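(* Let $X\subset\mathbb{G}_m^d$ be an irreducible variety over $\Bbbk$. Then the tropical variety $\mathscr{T}(X)$, and hence also the Bieri-Groves set $\mathscr{BG}(X)$ and the amoeba $\mathscr{A}(X)$, are connected subsets of $\mathbb{R}^d$.
   Context: $\Bbbk$ is a field that is complete with respect to a nontrivial non-archimedean norm $|\cdot|$; $v=-\log|\cdot|$ is the corresponding valuation. $\overline{\Bbbk}$ is a fixed algebraic closure, with the norm and $v$ extended (uniquely) to it. $\mathbb{G}_m^d=\operatorname{Spec}\Bbbk[x_1^{\pm1},\dots,x_d^{\pm1}]$; subvarieties are closed, $X=\operatorname{Spec}(\Bbbk[x_1^{\pm1},\dots,x_d^{\pm1}]/I)$ for an ideal $I$, and $\Bbbk[X]=\Bbbk[x_1^{\pm1},\dots,x_d^{\pm1}]/I$. Tropical variety and amoeba: define $\operatorname{val}$ and $\operatorname{Log}$ from $(\overline{\Bbbk}^\times)^d$ to $\mathbb{R}^d$ by $\operatorname{val}(a_1,\dots,a_d)=(v(a_1),\dots,v(a_d))$ and $\operatorname{Log}=-\operatorname{val}$. Then $\mathscr{T}(X)$ is the closure of $\operatorname{val}(X(\overline{\Bbbk}))$ in $\mathbb{R}^d$, and $\mathscr{A}(X)$ is the closure of $\operatorname{Log}(X(\overline{\Bbbk}))$ in $\mathbb{R}^d$. Bieri-Groves set: a ring valuation on a commutative ring $A$ with $1$ is a map $w\colon A\to\mathbb{R}\cup\{\infty\}$ with $w(ab)=w(a)+w(b)$, $w(a+b)\ge\min\{w(a),w(b)\}$, $w(0)=\infty$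 and $w(1)=0$ (nonzero elements may have value $\infty$). For $A=\Bbbk[X]$ let $\mathscr{W}(A)$ be the set of all ring valuations on $A$ extending $v$ on $\Bbbk$. Then $\mathscr{BG}(X)=\{(w(x_1),\dots,w(x_d)):w\in\mathscr{W}(A)\}\subset\mathbb{R}^d$. *)

theory Defs
  imports
    "HOL-Analysis.Analysis"
    "HOL-Library.Poly_Mapping"
    "HOL-Algebra.QuotRing"
    "HOL-Algebra.Algebraic_Closure_Type"
begin

unbundle no fps_syntax

definition nonarch_norm :: "('a::field \<Rightarrow> real) \<Rightarrow> bool" where
  "nonarch_norm N \<longleftrightarrow>
     (\<forall>x. 0 \<le> N x) \<and> (\<forall>x. N x = 0 \<longleftrightarrow> x = 0) \<and>
     (\<forall>x y. N (x * y) = N x * N y) \<and> (\<forall>x y. N (x + y) \<le> max (N x) (N y))"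

definition norm_val :: "('a::field \<Rightarrow> real) \<Rightarrow> 'a \<Rightarrow> ereal" where
  "norm_val N x = (if x = 0 then \<infinity> else ereal (- ln (N x)))"

(* The group algebra of the exponent lattice: multiplication of poly_mappings is convolution,
   so single m c is the Laurent monomial c * x^m. *)
type_synonym ('n, 'k) laurent = "(int ^ 'n) \<Rightarrow>\<^sub>0 'k"

definition laurent_eval ::
    "('k::field alg_closure) ^ ('n::finite) \<Rightarrow> ('n, 'k) laurent \<Rightarrow> 'k alg_closure" where
  "laurent_eval a f =
     (\<Sum>m\<in>Poly_Mapping.keys f. to_ac (Poly_Mapping.lookup f m) * (\<Prod>i\<in>UNIV. (a $ i) powi (m $ i)))"

definition coord_ring :: "('n::finite, 'k::field) laurent set \<Rightarrow> ('n, 'k) laurent set ring" where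
  "coord_ring I = ring_of_type_algebra Quot I"

definition coord_class ::
    "('n::finite, 'k::field) laurent set \<Rightarrow> ('n, 'k) laurent \<Rightarrow> ('n, 'k) laurent set" where
  "coord_class I f = I +>\<^bsub>ring_of_type_algebra\<^esub> f"

definition prime_spectrum :: "('a, 'b) ring_scheme \<Rightarrow> 'a set set" where
  "prime_spectrum A = {P. primeideal P A}"

definition vanishing_locus :: "('a, 'b) ring_scheme \<Rightarrow> 'a set \<Rightarrow> 'a set set" where
  "vanishing_locus A S = {P \<in> prime_spectrum A. S \<subseteq> P}"

definition zariski_topology :: "('a, 'b) ring_scheme \<Rightarrow> 'a set topology" where
  "zariski_topology A =
     topology (\<lambda>U. \<exists>S \<subseteq> carrier A. U = prime_spectrum A - vanishing_locus A S)"

lemma istopology_zariski: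
  fixes A :: "('a, 'b) ring_scheme"
  shows "istopology (\<lambda>U. \<exists>S \<subseteq> carrier A. U = prime_spectrum A - vanishing_locus A S)"
  unfolding istopology_def
proof (intro conjI allI impI)
  fix U V
  assume "\<exists>S \<subseteq> carrier A. U = prime_spectrum A - vanishing_locus A S"
    and "\<exists>S \<subseteq> carrier A. V = prime_spectrum A - vanishing_locus A S"
  then obtain S T where S: "S \<subseteq> carrier A" "U = prime_spectrum A - vanishing_locus A S"
    and T: "T \<subseteq> carrier A" "V = prime_spectrum A - vanishing_locus A T"
    by blast
  show "\<exists>S \<subseteq> carrier A. U \<inter> V = prime_spectrum A - vanishing_locus A S"
  proof (cases "prime_spectrum A = {}")
    case True
    then show ?thesis using S by auto
  next
    case False
    then obtain P0 where "primeideal P0 A" by (auto simp: prime_spectrum_def)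
    then interpret A: cring A by (simp add: primeideal_def)
    define R where "R = {s \<otimes>\<^bsub>A\<^esub> t |s t. s \<in> S \<and> t \<in> T}"
    have R: "R \<subseteq> carrier A" using S T by (auto simp: R_def)
    have "S \<subseteq> P \<or> T \<subseteq> P \<longleftrightarrow> R \<subseteq> P" if "primeideal P A" for P
    proof
      interpret P: primeideal P A by fact
      show "R \<subseteq> P" if "S \<subseteq> P \<or> T \<subseteq> P"
        using that S(1) T(1) P.I_l_closed P.I_r_closed unfolding R_def by blast
      show "S \<subseteq> P \<or> T \<subseteq> P" if "R \<subseteq> P"
        using that S(1) T(1) P.I_prime unfolding R_def by blast
    qed
    then have "U \<inter> V = prime_spectrum A - vanishing_locus A R"
      unfolding S T by (auto simp: vanishing_locus_def prime_spectrum_def)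
    with R show ?thesis by blast
  qed
next
  fix \<U>
  assume "\<forall>U\<in>\<U>. \<exists>S \<subseteq> carrier A. U = prime_spectrum A - vanishing_locus A S"
  then obtain S where S: "\<And>U. U \<in> \<U> \<Longrightarrow> S U \<subseteq> carrier A \<and> U = prime_spectrum A - vanishing_locus A (S U)"
    by metis
  have "\<Union>\<U> = (\<Union>U\<in>\<U>. prime_spectrum A - vanishing_locus A (S U))"
    using S by auto
  also have "\<dots> = prime_spectrum A - vanishing_locus A (\<Union>U\<in>\<U>. S U)"
    by (auto simp: vanishing_locus_def)
  finally show "\<exists>S \<subseteq> carrier A. \<Union>\<U> = prime_spectrum A - vanishing_locus A S"
    using S by (intro exI[of _ "\<Union>U\<in>\<U>. S U"]) auto
qed

lemma openin_zariski_topology: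
  "openin (zariski_topology A) U \<longleftrightarrow>
     (\<exists>S \<subseteq> carrier A. U = prime_spectrum A - vanishing_locus A S)"
  unfolding zariski_topology_def by (simp add: topology_inverse' istopology_zariski)

lemma topspace_zariski_topology: "topspace (zariski_topology A) = prime_spectrum A"
proof -
  have "vanishing_locus A (carrier A) = {}"
    by (auto simp: vanishing_locus_def prime_spectrum_def primeideal_def primeideal_axioms_def
        dest: ideal.Icarr)
  then have "openin (zariski_topology A) (prime_spectrum A)"
    by (auto simp: openin_zariski_topology)
  then show ?thesis
    by (auto simp: topspace_def openin_zariski_topology)
qed

definition irreducible_space :: "'a topology \<Rightarrow> bool" where
  "irreducible_space T \<longleftrightarrow> topspace T \<noteq> {} \<and>
     (\<forall>C D. closedin T C \<and> closedin T D \<and> C \<union> D = topspace T \<longrightarrow>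
        C = topspace T \<or> D = topspace T)"

(* Points with coordinates in the algebraic closure. *)
definition geometric_points ::
    "('n::finite, 'k::field) laurent set \<Rightarrow> (('k alg_closure) ^ 'n) set" where
  "geometric_points I = {a. (\<forall>i. a $ i \<noteq> 0) \<and> (\<forall>f\<in>I. laurent_eval a f = 0)}"

(* Only meant for vectors with nonzero coordinates, whose valuations are finite. *)
definition val_map :: "('a::field \<Rightarrow> real) \<Rightarrow> 'a ^ ('n::finite) \<Rightarrow> real ^ 'n" where
  "val_map N a = (\<chi> i. real_of_ereal (norm_val N (a $ i)))"

definition Log_map :: "('a::field \<Rightarrow> real) \<Rightarrow> 'a ^ ('n::finite) \<Rightarrow> real ^ 'n" where
  "Log_map N a = - val_map N a"

definition tropical_variety ::
    "('k::field alg_closure \<Rightarrow> real) \<Rightarrow> ('n::finite, 'k) laurent set \<Rightarrow> (real ^ 'n) set" where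
  "tropical_variety N I = closure (val_map N ` geometric_points I)"

definition amoeba ::
    "('k::field alg_closure \<Rightarrow> real) \<Rightarrow> ('n::finite, 'k) laurent set \<Rightarrow> (real ^ 'n) set" where
  "amoeba N I = closure (Log_map N ` geometric_points I)"

definition ring_valuation :: "('a, 'b) ring_scheme \<Rightarrow> ('a \<Rightarrow> ereal) \<Rightarrow> bool" where
  "ring_valuation A w \<longleftrightarrow>
     (\<forall>a\<in>carrier A. w a \<noteq> -\<infinity>) \<and>
     (\<forall>a\<in>carrier A. \<forall>b\<in>carrier A. w (a \<otimes>\<^bsub>A\<^esub> b) = w a + w b) \<and>
     (\<forall>a\<in>carrier A. \<forall>b\<in>carrier A. min (w a) (w b) \<le> w (a \<oplus>\<^bsub>A\<^esub> b)) \<and>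
     w \<zero>\<^bsub>A\<^esub> = \<infinity> \<and> w \<one>\<^bsub>A\<^esub> = 0"

(* axis i 1 is the exponent vector of the coordinate function x_i. *)
definition bieri_groves ::
    "('k::field \<Rightarrow> real) \<Rightarrow> ('n::finite, 'k) laurent set \<Rightarrow> (real ^ 'n) set" where
  "bieri_groves N I =
     {p. \<exists>w. ring_valuation (coord_ring I) w \<and>
            (\<forall>c. w (coord_class I (Poly_Mapping.single 0 c)) = norm_val N c) \<and>
            (\<forall>i. w (coord_class I (Poly_Mapping.single (axis i 1) 1)) = ereal (p $ i))}"

end

theory Submission imports Defs begin

text \<open>All norms live on one algebraically closed field that contains infinitely many elements algebraically
independent over the algebraic closure F0 of k. Subfields are subsets of it, a point of X is a ring map from
the Laurent polynomials to it that vanishes on I, and S is the set of all norms on it that extend the norm of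
k. As X is irreducible, the intersection of all primes of k[X] is prime, so that there is a generic point
\<xi>, whose kernel is this intersection (generic_point). Let B be the set of the vectors
(-ln w(\<xi>(i))) for w in S. Two facts give the theorem.

B is connected. Give S, for a subfield L, the topology of pointwise convergence on L. If L contains the
coordinates of \<xi>, the map from S onto B is continuous, so that it is enough that S is connected when L is
the algebraic closure of F0(J), J finite (finitely_generated_connected). Adjoining the elements of J one at
a time, this follows from two facts: restriction of norms is open, and its fibres are connected, that is, for
F algebraically closed the norms on the algebraic closure of F(t) that extend a given norm of F form a
connected space (extension_norms_connected). For F(t) itself this is the connectedness of a disc, whose
points are joined by intervals of radii. For a curve P(t,y) = 0 let C be open, closed and not everything.
Above each general c in F there is then a point (c,b) of the curve that C avoids (bad_root). Counting
coefficients gives a nonconstant function h whose only possible poles are such points, so that h is bounded on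
C. But C, if nonempty, restricts onto all norms on F(h), where h takes arbitrarily large values.

B \<subseteq> BG(X) \<subseteq> T(X) \<subseteq> closure B. The first inclusion is clear. A ring valuation on
k[X] comes from a norm in S evaluated at some point of X, and this point can be moved into F0 with an
arbitrarily small change of the absolute values of its coordinates (specialize_to_algebraic_point). Conversely
let a be a point over F0. It is a specialisation of \<xi>, and some u in S satisfies u(\<xi>(i)) =
|a(i)| exactly (exact_specialization): after a Noether normalisation there are norms under which the
polynomial variables are close to their values at a, roots lie close to roots, and since there are only
finitely many extensions of each of these norms one of them has the right value at all coordinates. Completeness
of k is used here: all norms in S agree on F0 (complete_unique_extension).

Every set between B and its closure is connected, and the amoeba is -T(X).\<close>

section \<open>Subrings, subfields and algebraic elements\<close>

hide_const (open) Polynomials.degree Polynomials.lead_coeff up_ring.coeff up_ring.monom module.smult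

definition is_ring :: "'a::comm_ring_1 set => bool" where
 "is_ring A \<longleftrightarrow> 1 : A & (ALL x:A. ALL y:A. x-y : A & x*y : A)"

definition is_field :: "'a::field set => bool" where
 "is_field K \<longleftrightarrow> is_ring K & (ALL x:K. inverse x : K)"

definition coeffs_in :: "'a::zero set => 'a poly => bool" where
 "coeffs_in A p \<longleftrightarrow> (ALL i. coeff p i : A)"

text \<open>The subfield generated by S.\<close>

definition fgen :: "'a::field set => 'a set" where
 "fgen S = \<Inter>{K. is_field K & S<=K}"

definition alg :: "'a::field set => 'a => bool" where
 "alg K x \<longleftrightarrow> (EX p. coeffs_in K p & p~=0 & poly p x = 0)"

text \<open>The relative algebraic closure of K.\<close>

definition acl :: "'a::field set => 'a set" where
 "acl K = {x. alg K x}"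

definition aclosed :: "'a::field set => bool" where
 "aclosed F \<longleftrightarrow> is_field F & (ALL x. alg F x --> x : F)"

definition is_minpoly :: "'a::field set => 'a => 'a poly => bool" where
 "is_minpoly K y q \<longleftrightarrow> coeffs_in K q & lead_coeff q = 1 & poly q y = 0 &
  (ALL p. coeffs_in K p & p~=0 & poly p y = 0 --> degree q<=degree p)"

lemma subring_one: "is_ring A ==> 1 : A"
 and subring_diff: "is_ring A ==> x : A ==> y : A ==> x-y : A"
 and subring_mult: "is_ring A ==> x : A ==> y : A ==> x*y : A" by (auto simp: is_ring_def)

lemma subring_zero: "is_ring A ==> 0 : A" using subring_diff[of A 1 1] subring_one[of A] by simp

lemma subring_uminus: "is_ring A ==> x : A ==> - x : A" using subring_diff[of A 0 x] subring_zero[of A] by simp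

lemma subring_add: "is_ring A ==> x : A ==> y : A ==> x+y : A" using subring_diff[of A x "- y"] subring_uminus[of A y] by simp

lemma subring_power: "is_ring A ==> x : A ==> x^n : A" by (induction n) (auto intro: subring_one subring_mult)

lemma subring_sum: "is_ring A ==> (!!i. i : I ==> f i : A) ==> sum f I : A" by (induction I rule: infinite_finite_induct) (auto intro: subring_zero subring_add)

lemma subring_prod: "is_ring A ==> (!!i. i : I ==> f i : A) ==> prod f I : A"
 by (induction I rule: infinite_finite_induct) (auto intro: subring_one subring_mult)

lemma subring_of_nat: "is_ring A ==> of_nat n : A" by (induction n) (auto intro: subring_one subring_zero subring_add)

lemmas subring_closed = subring_one subring_zero subring_diff subring_mult subring_uminus
 subring_add subring_power subring_sum subring_prod subring_of_nat

lemma field_ring: "is_field K ==> is_ring K" by (simp add: is_field_def)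

lemma subfield_inverse: "is_field K ==> x : K ==> inverse x : K" by (simp add: is_field_def)

lemma subfield_divide: "is_field K ==> x : K ==> y : K ==> x/y : K" by (simp add: subfield_inverse field_ring subring_mult divide_inverse)

lemma coeffs_inD: "coeffs_in A p ==> coeff p i : A" by (simp add: coeffs_in_def)

lemma coeffs_in_mono: "coeffs_in A p ==> A<=B ==> coeffs_in B p" by (auto simp: coeffs_in_def)

lemma coeffs_in_0: "is_ring A ==> coeffs_in A 0" by (simp add: coeffs_in_def subring_zero)

lemma coeffs_in_pCons_iff: "coeffs_in A (pCons a p) \<longleftrightarrow> a : A & coeffs_in A p"
 unfolding coeffs_in_def by (metis coeff_pCons_0 coeff_pCons_Suc not0_implies_Suc)

lemma coeffs_in_const: "is_ring A ==> a : A ==> coeffs_in A [:a:]" by (simp add: coeffs_in_pCons_iff coeffs_in_0)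

lemma coeffs_in_linear: "is_ring A ==> a : A ==> coeffs_in A [:-a, 1:]" by (simp add: coeffs_in_pCons_iff coeffs_in_0 subring_uminus subring_one)

lemma coeffs_in_X: "is_ring A ==> coeffs_in A [:0, 1:]" using coeffs_in_linear[of A 0] by (simp add: subring_zero)

lemma coeffs_in_1: "is_ring A ==> coeffs_in A 1" using coeffs_in_const[of A 1] by (simp add: subring_one one_pCons)

lemma coeffs_in_add: "is_ring A ==> coeffs_in A p ==> coeffs_in A q ==> coeffs_in A (p+q)" by (simp add: coeffs_in_def subring_add)

lemma coeffs_in_diff: "is_ring A ==> coeffs_in A p ==> coeffs_in A q ==> coeffs_in A (p-q)" by (simp add: coeffs_in_def subring_diff)

lemma coeffs_in_uminus: "is_ring A ==> coeffs_in A p ==> coeffs_in A (- p)" by (simp add: coeffs_in_def subring_uminus)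

lemma coeffs_in_smult: "is_ring A ==> c : A ==> coeffs_in A p ==> coeffs_in A (smult c p)" by (simp add: coeffs_in_def subring_mult)

lemma coeffs_in_mult: "is_ring A ==> coeffs_in A p ==> coeffs_in A q ==> coeffs_in A (p*q)" by (simp add: coeffs_in_def coeff_mult subring_sum subring_mult)

lemma coeffs_in_monom: "is_ring A ==> c : A ==> coeffs_in A (monom c n)" by (simp add: coeffs_in_def subring_zero)

lemma coeffs_in_power: "is_ring A ==> coeffs_in A p ==> coeffs_in A (p^n)" by (induction n) (auto intro: coeffs_in_1 coeffs_in_mult)

lemma coeffs_in_sum: "is_ring A ==> (!!i. i : I ==> coeffs_in A (f i)) ==> coeffs_in A (sum f I)"
 by (induction I rule: infinite_finite_induct) (auto intro: coeffs_in_0 coeffs_in_add)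

lemma coeffs_in_prod: "is_ring A ==> (!!i. i : I ==> coeffs_in A (f i)) ==> coeffs_in A (prod f I)"
 by (induction I rule: infinite_finite_induct) (auto intro: coeffs_in_1 coeffs_in_mult)

lemma coeffs_in_Collect_ring: "is_ring A ==> is_ring {g. coeffs_in A g}"
 unfolding is_ring_def[of "{g. coeffs_in A g}"] by (auto intro: coeffs_in_1 coeffs_in_diff coeffs_in_mult)

lemma coeffs_in_pderiv: "is_ring A ==> coeffs_in A p ==> coeffs_in A (pderiv p)"
 by (simp add: coeffs_in_def coeff_pderiv subring_mult subring_of_nat subring_add subring_one)

lemma subring_poly: "is_ring A ==> coeffs_in A p ==> x : A ==> poly p x : A" by (simp add: poly_altdef coeffs_in_def subring_closed)

lemma coeffs_in_pcompose: "is_ring A ==> coeffs_in A p ==> coeffs_in A q ==> coeffs_in A (pcompose p q)"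
 by (induction p) (auto simp: coeffs_in_pCons_iff pcompose_pCons intro!: coeffs_in_add coeffs_in_mult coeffs_in_0 coeffs_in_const)

lemmas coeffs_in_closed = coeffs_in_0 coeffs_in_1 coeffs_in_const coeffs_in_linear coeffs_in_add coeffs_in_diff coeffs_in_uminus coeffs_in_smult
 coeffs_in_mult coeffs_in_monom coeffs_in_power coeffs_in_sum coeffs_in_prod coeffs_in_pderiv

lemma coeff_sum_monom: "finite I ==> coeff (SUM i:I. monom (f i) i) j = (if j : I then f j else 0)" by (induction I rule: finite_induct) auto

text \<open>Multiplying by a power of the leading coefficient of g replaces division by it, so that no inverses in A are used.\<close>

lemma pseudo_division_over:
 fixes g p :: "'a::comm_ring_1 poly"
 assumes A: "is_ring A" and g: "coeffs_in A g" "g~=0" and p: "coeffs_in A p"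
 shows "EX N s r. coeffs_in A s & coeffs_in A r & smult (lead_coeff g^N) p = s*g+r &
     (r = 0 \<or> degree r < degree g)" using p
proof (induction "degree p" arbitrary: p rule: less_induct)
 case less
 show ?case
 proof (cases "p = 0 \<or> degree p < degree g")
  case True
  thus ?thesis using less.prems A by (intro exI[of _ 0] exI[of _ p]) (auto intro: coeffs_in_0)
 next
  case False
  define b where "b = lead_coeff g"
  define m where "m = monom (lead_coeff p) (degree p-degree g)"
  define p' where "p' = smult b p-m*g"
  have bA: "b : A" "coeffs_in A m" using g less.prems A by (auto simp: b_def m_def coeffs_in_def subring_zero)
  have p': "coeffs_in A p'" unfolding p'_def using bA less.prems A g by (intro coeffs_in_closed)
  have "degree (m*g)<=degree p" using degree_mult_le[of m g] False degree_monom_le[of "lead_coeff p" "degree p-degree g"] unfolding m_def by linarith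
  hence le: "degree p'<=degree p" unfolding p'_def by (intro degree_diff_le degree_smult_le)
  have "coeff (m*g) (degree p) = lead_coeff p*b" using False by (simp add: m_def coeff_monom_mult b_def)
  hence "coeff p' (degree p) = 0" by (simp add: p'_def mult.commute)
  hence "p' = 0 \<or> degree p' < degree p" using le by (rule eq_zero_or_degree_less[rotated])
  thus ?thesis
  proof
   assume "p' = 0"
   thus ?thesis using bA A by (intro exI[of _ 1] exI[of _ m] exI[of _ 0]) (auto simp: p'_def b_def coeffs_in_0)
  next
   assume "degree p' < degree p"
   from less.hyps[OF this p'] obtain N s r where *: "coeffs_in A s" "coeffs_in A r"
    "smult (lead_coeff g^N) p' = s*g+r" "r = 0 \<or> degree r < degree g" by blast
   have "smult (b^N) (smult b p) = smult (b^N) p'+smult (b^N) (m*g)" by (simp add: p'_def flip: smult_add_right)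
   hence "smult (lead_coeff g^Suc N) p = (s+smult (b^N) m)*g+r" using *(3) by (simp add: b_def algebra_simps)
   thus ?thesis using * bA A by (intro exI[of _ "Suc N"] exI[of _ "s+smult (b^N) m"] exI[of _ r])
     (auto intro!: coeffs_in_closed subring_closed)
  qed
 qed
qed

lemma monic_division_over:
 fixes g p :: "'a::comm_ring_1 poly"
 assumes A: "is_ring A" and g: "coeffs_in A g" "lead_coeff g = 1" and p: "coeffs_in A p"
 obtains s r where "coeffs_in A s" "coeffs_in A r" "p = s*g+r" "r = 0 \<or> degree r < degree g"
proof -
 have "g~=0" using g(2) by auto
 from pseudo_division_over[OF A g(1) this p] g(2) that show ?thesis by auto
qed

lemma division_over:
 fixes g p :: "'a::field poly"
 assumes K: "is_field K" and g: "coeffs_in K g" and p: "coeffs_in K p"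
 shows "coeffs_in K (p div g)" "coeffs_in K (p mod g)"
proof -
 have "coeffs_in K (p div g) & coeffs_in K (p mod g)"
 proof (cases "g = 0")
  case True thus ?thesis using K p by (auto intro: coeffs_in_0 field_ring)
 next
  case False
  note A = field_ring[OF K]
  from pseudo_division_over[OF A g False p] obtain N s r where *: "coeffs_in K s" "coeffs_in K r"
    "smult (lead_coeff g^N) p = s*g+r" "r = 0 \<or> degree r < degree g" by blast
  define c where "c = lead_coeff g^N"
  have c: "c : K" "c~=0" using g A False by (auto simp: c_def coeffs_in_def subring_closed)
  have "p = smult (inverse c) (smult c p)" using c by simp
  also have "smult c p = s*g+r" using * by (simp add: c_def)
  also have "smult (inverse c) (s*g+r) = smult (inverse c) s*g+smult (inverse c) r" by (simp add: smult_add_right)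
  finally have eq: "p = smult (inverse c) s*g+smult (inverse c) r" .
  have "smult (inverse c) r div g = 0" "smult (inverse c) r mod g = smult (inverse c) r" using *(4) c by (auto intro: div_poly_less mod_poly_less)
  moreover have "(a*g+b) div g = a & (a*g+b) mod g = b" if "b div g = 0" "b mod g = b" for a b using False that by simp
  ultimately have "p div g = smult (inverse c) s" "p mod g = smult (inverse c) r" unfolding eq by blast+
  thus ?thesis using * c A K by (simp add: coeffs_in_smult subfield_inverse)
 qed
 thus "coeffs_in K (p div g)" "coeffs_in K (p mod g)" by auto
qed

lemma subfield_fgen: "is_field (fgen S)" unfolding fgen_def is_field_def is_ring_def by auto

lemma fgen_superset: "S<=fgen S" unfolding fgen_def by auto

lemma fgen_least: "is_field K ==> S<=K ==> fgen S<=K" unfolding fgen_def by auto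

lemma fgen_mono: "S<=T ==> fgen S<=fgen T" using fgen_least[OF subfield_fgen[of T], of S] fgen_superset[of T] by auto

lemma fgen_eq: "is_field K ==> fgen K = K" using fgen_least[of K K] fgen_superset[of K] by auto

lemma fgen_fgen_Un: "fgen (fgen S Un T) = fgen (S Un T)"
proof
 show "fgen (fgen S Un T)<=fgen (S Un T)" using fgen_mono[of S "S Un T"] fgen_superset[of "S Un T"] by (intro fgen_least subfield_fgen) auto
 show "fgen (S Un T)<=fgen (fgen S Un T)" using fgen_superset[of S] by (intro fgen_mono) auto
qed

lemma fgen_Un: "is_field (fgen (A Un B))" "A<=fgen (A Un B)" "B<=fgen (A Un B)"
  "infinite A ==> infinite (fgen (A Un B))"
proof -
 show "is_field (fgen (A Un B))" by (rule subfield_fgen)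
 show "A<=fgen (A Un B)" "B<=fgen (A Un B)" using fgen_superset[of "A Un B"] by auto
 thus "infinite A ==> infinite (fgen (A Un B))" using infinite_super by blast
qed

lemma fgen_ins: "is_field (fgen (insert x A))" "A<=fgen (insert x A)" "x : fgen (insert x A)"
  "infinite A ==> infinite (fgen (insert x A))" using fgen_Un(2-4)[of A "{x}"] fgen_superset[of "insert x A"] by (simp_all add: subfield_fgen)

lemma fgen_quotient:
 fixes A :: "'a::field set"
 assumes A: "is_ring A" and x: "x : fgen A"
 shows "EX a:A. EX b:A. b~=0 & x = a/b"
proof -
 define Q where "Q = {a/b | a b. a : A & b : A & b~=0}"
 have I: "a/b : Q" if "a : A" "b : A" "b~=0" for a b using that by (auto simp: Q_def)
 note A1 = subring_one[OF A]
 have "is_field Q" unfolding is_field_def is_ring_def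
 proof (intro conjI ballI)
  show "1 : Q" using I[OF A1 A1] by simp
  fix x assume "x : Q"
  then obtain a b where ab: "a : A" "b : A" "b~=0" "x = a/b" by (auto simp: Q_def)
  show "inverse x : Q" using I[OF ab(2,1)] I[OF ab(1) A1] ab(4) by (cases "a = 0") simp_all
  fix y assume "y : Q"
  then obtain c d where cd: "c : A" "d : A" "d~=0" "y = c/d" by (auto simp: Q_def)
  have bd: "b*d : A" "b*d~=0" using ab cd subring_mult[OF A] by auto
  show "x-y : Q" using I[OF subring_diff[OF A subring_mult[OF A ab(1) cd(2)] subring_mult[OF A cd(1) ab(2)]] bd] ab cd by (simp add: diff_frac_eq)
  show "x*y : Q" using I[OF subring_mult[OF A ab(1) cd(1)] bd] ab(4) cd(4) by simp
 qed
 moreover have "A<=Q" using I[OF _ A1] by auto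
 ultimately have "fgen A<=Q" by (rule fgen_least)
 hence "x : Q" using x by blast
 thus ?thesis unfolding Q_def by blast
qed

lemma subring_poly_range:
 assumes "is_ring A"
 shows "is_ring {poly p x | p. coeffs_in A p}" "A<={poly p x | p. coeffs_in A p}" "x : {poly p x | p. coeffs_in A p}"
proof -
 have I: "z : {poly p x | p. coeffs_in A p}" if "coeffs_in A p" "z = poly p x" for p z using that by blast
 show "is_ring {poly p x | p. coeffs_in A p}" unfolding is_ring_def
 proof (intro conjI ballI)
  show "1 : {poly p x | p. coeffs_in A p}" by (rule I[OF coeffs_in_1[OF assms]]) simp
  fix y z assume "y : {poly p x | p. coeffs_in A p}" "z : {poly p x | p. coeffs_in A p}"
  then obtain p q where "coeffs_in A p" "y = poly p x" "coeffs_in A q" "z = poly q x" by blast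
  thus "y-z : {poly p x | p. coeffs_in A p}" "y*z : {poly p x | p. coeffs_in A p}"
   using I[of "p-q"] I[of "p*q"] coeffs_in_diff[OF assms] coeffs_in_mult[OF assms] by auto
 qed
 show "A<={poly p x | p. coeffs_in A p}" using I[OF coeffs_in_const[OF assms]] by fastforce
 show "x : {poly p x | p. coeffs_in A p}" by (rule I[OF coeffs_in_X[OF assms]]) simp
qed

lemma fgen_Un_insert: "fgen (A Un insert x B) = fgen (insert x (fgen (A Un B)))" using fgen_fgen_Un[of "A Un B" "{x}"] by (simp add: insert_commute)

lemma alg_mono: "alg K x ==> K<=L ==> alg L x" unfolding alg_def using coeffs_in_mono by blast

lemma algI_mem: "is_ring K ==> x : K ==> alg K x" unfolding alg_def by (intro exI[of _ "[:-x, 1:]"]) (auto intro: coeffs_in_linear)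

lemma minpoly_alg: "is_minpoly K x q ==> alg K x" unfolding alg_def is_minpoly_def by (metis leading_coeff_0_iff zero_neq_one)

lemma minpoly_exists:
 assumes K: "is_field K" and x: "alg K x"
 shows "EX q. is_minpoly K x q"
proof -
 define P where "P p \<longleftrightarrow> coeffs_in K p & p~=0 & poly p x = 0" for p
 obtain p where p: "P p" "!!p'. P p' ==> degree p<=degree p'" using x ex_has_least_nat[of P _ degree] unfolding alg_def P_def by blast
 define q where "q = smult (inverse (lead_coeff p)) p"
 have P: "coeffs_in K p" "p~=0" "poly p x = 0" using p(1) by (auto simp: P_def)
 have "coeffs_in K q" unfolding q_def by (intro coeffs_in_smult field_ring[OF K] subfield_inverse[OF K] coeffs_inD P)
 moreover have "lead_coeff q = 1" "poly q x = 0" "degree q = degree p" using P by (simp_all add: q_def)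
 ultimately have "coeffs_in K q" "lead_coeff q = 1" "poly q x = 0" "degree q = degree p" .
 thus ?thesis using p(2) by (intro exI[of _ q]) (simp add: is_minpoly_def P_def)
qed

lemma minpoly_dvd:
 assumes K: "is_field K" and q: "is_minpoly K x q" and p: "coeffs_in K p" "poly p x = 0"
 shows "q dvd p"
proof -
 have q0: "q~=0" using q by (auto simp: is_minpoly_def)
 have "coeffs_in K (p mod q)" using division_over(2)[OF K _ p(1)] q by (simp add: is_minpoly_def)
 moreover have "poly p x = poly (p div q) x*poly q x+poly (p mod q) x" by (metis div_mult_mod_eq poly_add poly_mult)
 hence "poly (p mod q) x = 0" using p(2) q by (simp add: is_minpoly_def)
 ultimately have "p mod q = 0" using q degree_mod_less[OF q0, of p] unfolding is_minpoly_def by (meson linorder_not_le)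
 thus ?thesis by auto
qed

lemma minpoly_degree_pos:
 assumes "is_minpoly K x q" shows "degree q > 0"
proof (rule ccontr)
 assume "~ degree q > 0"
 then obtain c where "q = [:c:]" by (auto elim: degree_eq_zeroE)
 thus False using assms by (auto simp: is_minpoly_def)
qed

text \<open>If b had a smaller minimal polynomial, it would divide q with a cofactor of positive degree, and one of the two would vanish at y.\<close>

lemma minpoly_conj:
 assumes K: "is_field K" and q: "is_minpoly K y q" and b: "poly q b = 0"
 shows "is_minpoly K b q"
proof -
 have "alg K b" using q b unfolding alg_def is_minpoly_def by (metis leading_coeff_0_iff zero_neq_one)
 then obtain q' where q': "is_minpoly K b q'" using minpoly_exists[OF K] by blast
 have "q' dvd q" using minpoly_dvd[OF K q'] q b by (simp add: is_minpoly_def)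
 hence s: "q = q'*(q div q')" by simp
 define s where "s = q div q'"
 have s': "coeffs_in K s" unfolding s_def using division_over(1)[OF K] q q' by (simp add: is_minpoly_def)
 have nz: "q~=0" "q'~=0" "s~=0" using q q' s by (auto simp: is_minpoly_def s_def)
 have deg: "degree q = degree q'+degree s" using s nz by (simp add: degree_mult_eq s_def[symmetric])
 have "poly q y = poly q' y*poly s y" using s by (metis poly_mult s_def)
 hence "poly q' y = 0 \<or> poly s y = 0" using q by (simp add: is_minpoly_def)
 hence "degree q<=degree q'"
 proof
  assume "poly q' y = 0" thus ?thesis using q q' nz by (simp add: is_minpoly_def)
 next
  assume "poly s y = 0"
  hence "degree q<=degree s" using q s' nz by (simp add: is_minpoly_def)
  thus ?thesis using deg minpoly_degree_pos[OF q'] by simp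
 qed
 thus ?thesis using q q' b deg unfolding is_minpoly_def by (metis le_trans)
qed

lemma minpoly_conj_zero_iff:
 assumes K: "is_field K" and q: "is_minpoly K y q" and b: "poly q b = 0" and g: "coeffs_in K g"
 shows "poly g b = 0 \<longleftrightarrow> poly g y = 0"
proof -
 have "poly g y = 0 \<longleftrightarrow> q dvd g" if "is_minpoly K y q" for y using that minpoly_dvd[OF K that g] by (auto simp: is_minpoly_def elim!: dvdE)
 thus ?thesis using q minpoly_conj[OF K q b] by simp
qed

section \<open>Products over the roots of a polynomial\<close>

lemma splits_monic:
 fixes q :: "'a::alg_closed_field poly"
 assumes "lead_coeff q = 1"
 obtains A where "size A = degree q" "q = (PROD x:#A. [:-x, 1:])"
proof -
 have "q~=0" using assms by auto
 from alg_closed_imp_factorization[OF this] that assms show ?thesis by auto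
qed

lemma poly_prod_linear: "poly (PROD x:#A. [:-x, 1:]) z = (PROD x:#A. z-(x::'a::idom))" by (induction A) (auto simp: algebra_simps)

lemma poly_prod_linear_eq_0_iff: "poly (PROD x:#A. [:-x, 1:]) z = 0 \<longleftrightarrow> (z::'a::idom) :# A" by (induction A) auto

lemma degree_prod_linear: "degree (PROD x:#A. [:-x, 1::'a::idom:]) = size A"
 and lead_coeff_prod_linear: "lead_coeff (PROD x:#A. [:-x, 1::'a::idom:]) = 1"
proof -
 have "degree (PROD x:#A. [:-x, 1::'a:]) = size A & lead_coeff (PROD x:#A. [:-x, 1::'a:]) = 1"
 proof (induction A)
  case (add x A)
  hence nz: "(PROD x:#A. [:-x, 1::'a:])~=0" by auto
  show ?case using add nz by (simp only: image_mset_add_mset prod_mset.add_mset lead_coeff_mult)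
    (auto simp: degree_mult_eq simp del: mult_pCons_left)
 qed auto
 thus "degree (PROD x:#A. [:-x, 1::'a:]) = size A" "lead_coeff (PROD x:#A. [:-x, 1::'a:]) = 1" by auto
qed

text \<open>The product of h over the roots of q is the resultant of q and h up to sign and powers of leading
coefficients. Replacing h by its remainder modulo q and exchanging the roles of q and h is a Euclidean descent that
stays in K.\<close>

lemma prod_over_roots_mem:
 fixes K :: "'a::alg_closed_field set"
 assumes K: "is_field K"
 shows "coeffs_in K (PROD x:#A. [:-x, 1:]) ==> coeffs_in K h ==> (PROD x:#A. poly h x) : K"
proof (induction "size A" arbitrary: A h rule: less_induct)
 case less
 note R = field_ring[OF K]
 define q where "q = (PROD x:#A. [:-x, 1:])"
 define r where "r = h mod q"
 have r: "coeffs_in K r" using division_over(2)[OF K less.prems] by (simp add: r_def q_def)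
 have q0: "q~=0" using lead_coeff_prod_linear[of A] by (auto simp: q_def)
 have "poly h x = poly r x" if "x :# A" for x
 proof -
  have "poly q x = 0" using that by (simp add: q_def poly_prod_linear_eq_0_iff)
  moreover have "poly h x = poly (h div q) x*poly q x+poly r x" unfolding r_def by (metis div_mult_mod_eq poly_add poly_mult)
  ultimately show ?thesis by simp
 qed
 hence hr: "(PROD x:#A. poly h x) = (PROD x:#A. poly r x)" by (intro arg_cong[of _ _ prod_mset] image_mset_cong) auto
 consider "A = {#}" | "A~={#}" "r = 0" | "A~={#}" "r~=0" by blast
 thus ?case
 proof cases
  case 1 thus ?thesis using R by (simp add: subring_one)
 next
  case 2
  hence "(PROD x:#A. poly r x) = 0" by (cases A) auto
  thus ?thesis using R hr subring_zero[of K] by metis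
 next
  case 3
  have deg: "degree r < size A" using degree_mod_less[OF q0, of h] 3 by (simp add: r_def q_def degree_prod_linear)
  define c where "c = lead_coeff r"
  have c: "c : K" "c~=0" using coeffs_inD[OF r, of "degree r"] 3 by (simp_all add: c_def)
  obtain B where B: "size B = degree r" "r = smult c (PROD x:#B. [:-x, 1:])" using alg_closed_imp_factorization[OF 3(2)] unfolding c_def by blast
  have "(PROD x:#B. [:-x, 1:]) = smult (inverse c) r" using c by (subst B(2)) simp
  hence Bin: "coeffs_in K (PROD x:#B. [:-x, 1:])" using r c K R by (simp add: coeffs_in_smult subfield_inverse)
  have IH: "(PROD y:#B. poly q y) : K" using less.hyps[OF _ Bin, of q] deg B less.prems by (simp add: q_def)
  define s :: 'a where "s = ((-1)^size B)^size A"
  define Q where "Q = (PROD x:#A. PROD y:#B. x-y)"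
  have inner: "(PROD y:#B. y-x) = (-1)^size B*(PROD y:#B. x-y)" for x by (induction B) (auto simp: algebra_simps)
  have "(PROD y:#B. poly q y) = (PROD y:#B. PROD x:#A. y-x)" by (simp add: q_def poly_prod_linear)
  also have "... = (PROD x:#A. PROD y:#B. y-x)" by (rule prod_mset.swap)
  also have "... = s*Q" unfolding inner prod_mset.distrib s_def Q_def by (simp add: prod_mset_constant)
  finally have "Q = s*(PROD y:#B. poly q y)" by (simp add: s_def flip: power_mult power_mult_distrib mult.assoc)
  hence "Q : K" using IH R by (simp add: s_def subring_closed)
  moreover have "poly r x = c*(PROD y:#B. x-y)" for x by (subst B(2)) (simp add: poly_prod_linear)
  hence "(PROD x:#A. poly r x) = (PROD x:#A. c*(PROD y:#B. x-y))" by (intro arg_cong[of _ _ prod_mset] image_mset_cong)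
  hence "(PROD x:#A. poly r x) = c^size A*Q" by (simp add: Q_def prod_mset.distrib prod_mset_constant)
  ultimately show ?thesis using hr c R by (simp add: subring_closed)
 qed
qed

text \<open>Newton interpolation at infinitely many nodes in K.\<close>

lemma coeffs_in_of_values:
 fixes K :: "'a::field set"
 assumes K: "is_field K"
 shows "S<=K ==> infinite S ==> (!!u. u : S ==> poly p u : K) ==> coeffs_in K p"
proof (induction "degree p" arbitrary: p S)
 case 0
 then obtain c where "p = [:c:]" by (metis degree_eq_zeroE)
 moreover obtain u where "u : S" using 0 by (metis finite.emptyI ex_in_conv)
 ultimately show ?case using 0 K by (auto intro!: coeffs_in_const field_ring)
next
 case (Suc n)
 note R = field_ring[OF K]
 obtain u0 where u0: "u0 : S" using Suc.prems by (metis finite.emptyI ex_in_conv)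
 define q where "q = synthetic_div p u0"
 have p: "p = [:- u0, 1:]*q+[:poly p u0:]" unfolding q_def by (rule synthetic_div_correct'[symmetric])
 have "coeffs_in K q"
 proof (rule Suc.hyps(1)[of q "S-{u0}"])
  show "n = degree q" using Suc.hyps(2) by (simp add: q_def degree_synthetic_div)
  show "S-{u0}<=K" "infinite (S-{u0})" using Suc.prems by auto
  fix u assume u: "u : S-{u0}"
  have "poly p u = (u-u0)*poly q u+poly p u0" by (subst p) (simp add: algebra_simps)
  hence "poly q u = (poly p u-poly p u0)/(u-u0)" using u by simp
  also have "... : K" using u u0 Suc.prems K R by (auto intro!: subfield_divide subring_diff)
  finally show "poly q u : K" .
 qed
 moreover have "coeffs_in K [:- u0, 1:]" "coeffs_in K [:poly p u0:]" using u0 Suc.prems R by (auto intro!: coeffs_in_linear coeffs_in_const)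
 ultimately show ?case using R by (subst p) (intro coeffs_in_add coeffs_in_mult)
qed

lemma coeffs_in_prod_over_roots:
 fixes K :: "'a::alg_closed_field set"
 assumes K: "is_field K" "infinite K" and A: "coeffs_in K (PROD x:#A. [:-x, 1:])"
  and f: "!!u. u : K ==> EX h. coeffs_in K h & (ALL x. poly (f x) u = poly h x)"
 shows "coeffs_in K (PROD x:#A. f x)"
proof (rule coeffs_in_of_values[OF K(1) order.refl K(2)])
 fix u assume "u : K"
 then obtain h where h: "coeffs_in K h" "!!x. poly (f x) u = poly h x" using f by blast
 have "poly (PROD x:#A. f x) u = (PROD x:#A. poly h x)" by (induction A) (auto simp: h)
 thus "poly (PROD x:#A. f x) u : K" using prod_over_roots_mem[OF K(1) A h(1)] by simp
qed

text \<open>The polynomial of the conjugates of g(x); its values at elements of K are products over roots.\<close>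

lemma coeffs_in_conj_poly:
 fixes K :: "'a::alg_closed_field set"
 assumes K: "is_field K" "infinite K" and A: "coeffs_in K (PROD x:#A. [:-x, 1:])"
  and g: "coeffs_in K g"
 shows "coeffs_in K (PROD x:#A. [:- poly g x, 1:])"
proof (rule coeffs_in_prod_over_roots[OF K A])
 fix u assume "u : K"
 thus "EX h. coeffs_in K h & (ALL x. poly [:- poly g x, 1:] u = poly h x)" using g field_ring[OF K(1)]
  by (intro exI[of _ "[:u:]-g"]) (auto intro!: coeffs_in_diff coeffs_in_const)
qed

text \<open>A bivariate polynomial is a polynomial in y whose coefficients are polynomials in t; this substitutes x for t.\<close>

definition ieval :: "'a::comm_ring_1 poly poly => 'a => 'a poly" where
 "ieval G x = map_poly (%g. poly g x) G"

lemma coeff_ieval [simp]: "coeff (ieval G x) i = poly (coeff G i) x" by (simp add: ieval_def coeff_map_poly)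

lemma poly_ieval: "poly (ieval G x) y = poly (poly G [:y:]) x" by (induction G) (auto simp: ieval_def map_poly_pCons)

lemma poly_ieval_sum: "poly (ieval G u) v = (SUM i<=degree G. poly (coeff G i) u * v^i)"
proof -
 have "degree (ieval G u)<=degree G" by (intro degree_le) (simp add: coeff_eq_0)
 hence "poly (ieval G u) v = (SUM i<=degree G. coeff (ieval G u) i * v^i)"
  unfolding poly_altdef by (intro sum.mono_neutral_left) (auto simp: coeff_eq_0 simp del: coeff_ieval)
 thus ?thesis by simp
qed

lemma ieval_add: "ieval (G+H) x = ieval G x+ieval H x" by (rule poly_eqI) simp

lemma ieval_mult: "ieval (G*H) x = ieval G x*ieval H x" by (rule poly_eqI) (simp add: coeff_mult poly_sum)

lemma ieval_diff: "ieval (G-H) x = ieval G x-ieval H x" by (rule poly_eqI) simp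

lemma ieval_pCons: "ieval (pCons g G) x = pCons (poly g x) (ieval G x)" by (rule poly_eqI) (simp add: coeff_pCons split: nat.split)

section \<open>Relative algebraic closure\<close>

text \<open>The polynomial of the conjugates of g(y) has coefficients in K and vanishes at g(y).\<close>

lemma alg_poly:
 fixes K :: "'a::alg_closed_field set"
 assumes K: "is_field K" "infinite K" and y: "alg K y" and g: "coeffs_in K g"
 shows "alg K (poly g y)"
proof -
 obtain q where q: "is_minpoly K y q" using minpoly_exists[OF K(1) y] by blast
 obtain A where A: "q = (PROD x:#A. [:-x, 1:])" using splits_monic q unfolding is_minpoly_def by metis
 define D where "D = (PROD x:#A. [:- poly g x, 1:])"
 have "coeffs_in K D" unfolding D_def using q A by (intro coeffs_in_conj_poly K g) (simp add: is_minpoly_def)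
 moreover have "D~=0" unfolding D_def by auto
 moreover have "y :# A" using q A by (simp add: is_minpoly_def poly_prod_linear_eq_0_iff)
 hence "poly D (poly g y) = 0" unfolding D_def by (induction A) auto
 ultimately show ?thesis unfolding alg_def by blast
qed

lemma alg_inverse_poly:
 fixes K :: "'a::field set"
 assumes K: "is_field K" and x: "alg K x"
 shows "EX g. coeffs_in K g & inverse x = poly g x"
proof (cases "x = 0")
 case True
 thus ?thesis using K by (intro exI[of _ 0]) (simp add: coeffs_in_0 field_ring)
next
 case False
 note R = field_ring[OF K]
 obtain q where q: "is_minpoly K x q" using minpoly_exists[OF K x] by blast
 then obtain c p where p: "q = pCons c p" by (metis pCons_cases)
 have cp: "c : K" "coeffs_in K p" using q p by (auto simp: is_minpoly_def coeffs_in_pCons_iff)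
 have p0: "p~=0" using p minpoly_degree_pos[OF q] by auto
 have "c~=0"
 proof
  assume "c = 0"
  hence "poly p x = 0" using q p False by (simp add: is_minpoly_def)
  hence "degree q<=degree p" using q cp p0 by (simp add: is_minpoly_def)
  thus False using p p0 by simp
 qed
 have "c+x*poly p x = 0" using q p by (simp add: is_minpoly_def)
 hence "inverse x = poly (smult (- inverse c) p) x" using False \<open>c~=0\<close> by (simp add: field_simps) (metis add_eq_0_iff2 mult.commute)
 thus ?thesis using cp R K by (intro exI[of _ "smult (- inverse c) p"])
   (simp add: coeffs_in_smult coeffs_in_uminus subfield_inverse)
qed

lemma fgen_insert:
 fixes K :: "'a::field set"
 assumes K: "is_field K"
 shows "fgen (insert y K) = {poly g y/poly h y | g h. coeffs_in K g & coeffs_in K h & poly h y~=0}" (is "_ = ?L")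
proof
 define A where "A = {poly g y | g. coeffs_in K g}"
 note A = subring_poly_range[OF field_ring[OF K], of y, folded A_def]
 have "fgen (insert y K)<=fgen A" using A by (intro fgen_mono) auto
 thus "fgen (insert y K) <= ?L" using fgen_quotient[OF A(1)] by (fastforce simp: A_def)
 have "poly g y : fgen (insert y K)" if "coeffs_in K g" for g
  using coeffs_in_mono[OF that fgen_ins(2)] fgen_ins(3) by (intro subring_poly[OF field_ring[OF subfield_fgen]])
 thus "?L<=fgen (insert y K)" using subfield_divide[OF subfield_fgen] by blast
qed

lemma fgen_insert_alg:
 fixes K :: "'a::alg_closed_field set"
 assumes K: "is_field K" "infinite K" and y: "alg K y"
 shows "fgen (insert y K) = {poly g y | g. coeffs_in K g}" unfolding fgen_insert[OF K(1)]
proof (intro equalityI subsetI)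
 note R = field_ring[OF K(1)]
 fix x assume "x : {poly g y/poly h y | g h. coeffs_in K g & coeffs_in K h & poly h y~=0}"
 then obtain g h where gh: "x = poly g y/poly h y" "coeffs_in K g" "coeffs_in K h" by blast
 obtain u where "coeffs_in K u" "inverse (poly h y) = poly u (poly h y)" using alg_inverse_poly[OF K(1) alg_poly[OF K y gh(3)]] by blast
 hence "x = poly (g*pcompose u h) y" "coeffs_in K (g*pcompose u h)"
  using gh R by (auto simp: divide_inverse poly_pcompose intro: coeffs_in_mult coeffs_in_pcompose)
 thus "x : {poly g y | g. coeffs_in K g}" by blast
next
 fix x assume "x : {poly g y | g. coeffs_in K g}"
 then obtain g where "x = poly g y/poly 1 y" "coeffs_in K g" by auto
 thus "x : {poly g y/poly h y | g h. coeffs_in K g & coeffs_in K h & poly h y~=0}"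
  using coeffs_in_1[OF field_ring[OF K(1)]] by (intro CollectI exI[of _ g] exI[of _ 1]) auto
qed

text \<open>Take the product, over all conjugates of c, of the polynomial of z written with coefficients in K[c].\<close>

lemma alg_trans_insert:
 fixes K :: "'a::alg_closed_field set"
 assumes K: "is_field K" "infinite K" and c: "alg K c" and z: "alg (fgen (insert c K)) z"
 shows "alg K z"
proof -
 obtain P where P: "coeffs_in (fgen (insert c K)) P" "P~=0" "poly P z = 0" using z unfolding alg_def by blast
 have "ALL i. EX g. coeffs_in K g & coeff P i = poly g c" using P(1) unfolding coeffs_in_def fgen_insert_alg[OF K c] by blast
 then obtain gg where gg: "!!i. coeffs_in K (gg i)" "!!i. coeff P i = poly (gg i) c" by metis
 define G where "G = (SUM i<=degree P. monom (gg i) i)"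
 have G: "coeff G i = (if i<=degree P then gg i else 0)" for i by (simp add: G_def coeff_sum_monom)
 have GP: "ieval G c = P" by (rule poly_eqI) (auto simp: G gg(2)[symmetric] coeff_eq_0)
 obtain q where q: "is_minpoly K c q" using minpoly_exists[OF K(1) c] by blast
 obtain A where A: "q = (PROD x:#A. [:-x, 1:])" using splits_monic q unfolding is_minpoly_def by metis
 have nz: "ieval G x~=0" if "x :# A" for x
 proof
  assume "ieval G x = 0"
  hence "poly (coeff G i) x = 0" for i by (metis coeff_ieval coeff_0)
  moreover have "poly q x = 0" using that A by (simp add: poly_prod_linear_eq_0_iff)
  moreover have "coeffs_in K (coeff G i)" for i using gg K by (auto simp: G coeffs_in_0 field_ring)
  ultimately have "poly (coeff G i) c = 0" for i using minpoly_conj_zero_iff[OF K(1) q] by metis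
  hence "ieval G c = 0" by (intro poly_eqI) simp
  thus False using GP P by simp
 qed
 define E where "E = (PROD x:#A. ieval G x)"
 have "coeffs_in K E" unfolding E_def
 proof (rule coeffs_in_prod_over_roots[OF K])
  show "coeffs_in K (PROD x:#A. [:-x, 1:])" using q A by (simp add: is_minpoly_def)
  fix u assume "u : K"
  have "coeffs_in K (poly G [:u:])" using gg \<open>u : K\<close> field_ring[OF K(1)] by (simp add: G_def poly_sum poly_monom coeffs_in_closed)
  thus "EX h. coeffs_in K h & (ALL x. poly (ieval G x) u = poly h x)" by (auto simp: poly_ieval)
 qed
 moreover have "E~=0" using nz unfolding E_def by (induction A) auto
 moreover have "c :# A" using q A by (simp add: is_minpoly_def poly_prod_linear_eq_0_iff)
 hence "poly E z = 0" unfolding E_def using P(3) GP by (induction A) auto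
 ultimately show ?thesis unfolding alg_def by blast
qed

lemma subset_acl: "is_ring K ==> K<=acl K" by (auto simp: acl_def algI_mem)

lemma acl_mono: "K<=L ==> acl K<=acl L" by (auto simp: acl_def intro: alg_mono)

lemma subfield_acl:
 fixes K :: "'a::alg_closed_field set"
 assumes K: "is_field K" "infinite K"
 shows "is_field (acl K)" unfolding is_field_def is_ring_def
proof (intro conjI ballI)
 note R = field_ring[OF K(1)]
 show "1 : acl K" using subset_acl[OF R] subring_one[OF R] by blast
next
 fix x y assume "x : acl K" "y : acl K"
 hence x: "alg K x" and y: "alg K y" by (auto simp: acl_def)
 define L where "L = fgen (insert x K)"
 note L = fgen_ins(1-3)[where x = x and A = K, folded L_def] and L' = fgen_ins(4)[OF K(2), of x, folded L_def]
 note RL = field_ring[OF L(1)]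
 have "alg L y" using y L alg_mono by blast
 from alg_poly[OF L(1) L' this, of "[:x, -1:]"] alg_poly[OF L(1) L' this, of "[:0, x:]"] RL L(3)
 have "alg L (x-y)" "alg L (y*x)" by (auto simp: coeffs_in_pCons_iff coeffs_in_0 subring_closed)
 thus "x-y : acl K" "x*y : acl K" using alg_trans_insert[OF K x] unfolding L_def acl_def by (auto simp: mult.commute)
next
 fix x assume "x : acl K"
 hence x: "alg K x" by (simp add: acl_def)
 thus "inverse x : acl K" using alg_inverse_poly[OF K(1) x] alg_poly[OF K x] by (auto simp: acl_def)
qed

lemma alg_trans_finite:
 fixes K :: "'a::alg_closed_field set"
 assumes K: "is_field K" "infinite K"
 shows "finite C ==> C<=acl K ==> alg (fgen (K Un C)) z ==> alg K z"
proof (induction C arbitrary: z rule: finite_induct)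
 case empty
 thus ?case using fgen_eq[OF K(1)] by simp
next
 case (insert c C)
 define L where "L = fgen (K Un C)"
 note L = fgen_Un(1,2)[of K C, folded L_def] and L' = fgen_Un(4)[OF K(2), of C, folded L_def]
 have c: "alg L c" using insert.prems L alg_mono by (auto simp: acl_def)
 have "fgen (K Un insert c C) = fgen (insert c L)" unfolding L_def by (rule fgen_Un_insert)
 hence "alg L z" using alg_trans_insert[OF L(1) L' c] insert.prems by simp
 thus ?case using insert by (simp add: L_def)
qed

lemma aclosed_acl:
 fixes K :: "'a::alg_closed_field set"
 assumes K: "is_field K" "infinite K"
 shows "aclosed (acl K)" unfolding aclosed_def
proof (intro conjI allI impI)
 show "is_field (acl K)" by (rule subfield_acl[OF K])
 fix x assume "alg (acl K) x"
 then obtain p where p: "coeffs_in (acl K) p" "p~=0" "poly p x = 0" unfolding alg_def by blast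
 define C where "C = coeff p ` {..degree p}"
 have C: "finite C" "C<=acl K" using p by (auto simp: C_def coeffs_in_def)
 have R: "is_ring (fgen (K Un C))" by (rule field_ring[OF subfield_fgen])
 have "coeff p i : fgen (K Un C)" for i using fgen_superset[of "K Un C"] subring_zero[OF R] by (cases "i<=degree p") (auto simp: C_def coeff_eq_0)
 hence "alg (fgen (K Un C)) x" using p unfolding alg_def coeffs_in_def by blast
 thus "x : acl K" using alg_trans_finite[OF K C] by (simp add: acl_def)
qed

lemma aclosed_subfield: "aclosed F ==> is_field F" and aclosed_subring: "aclosed F ==> is_ring F" by (simp_all add: aclosed_def field_ring)

lemma acl_fgen:
 fixes A :: "'a::alg_closed_field set"
 assumes "infinite A"
 shows "aclosed (acl (fgen (A Un B)))" "A<=acl (fgen (A Un B))" "B<=acl (fgen (A Un B))" "infinite (acl (fgen (A Un B)))"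
proof -
 have s: "fgen (A Un B)<=acl (fgen (A Un B))" by (rule subset_acl[OF field_ring[OF subfield_fgen]])
 show "aclosed (acl (fgen (A Un B)))" by (rule aclosed_acl[OF subfield_fgen fgen_Un(4)[OF assms]])
 show "A<=acl (fgen (A Un B))" "B<=acl (fgen (A Un B))" using fgen_Un(2,3) s by blast+
 thus "infinite (acl (fgen (A Un B)))" using assms infinite_super by blast
qed

lemma aclosed_acl_eq: "aclosed F ==> acl F = F" using subset_acl[of F] by (auto simp: aclosed_def acl_def field_ring)

lemma acl_least: "K<=F ==> aclosed F ==> acl K<=F" using acl_mono[of K F] aclosed_acl_eq[of F] by auto

lemma fgen_subset_acl:
 fixes K :: "'a::alg_closed_field set"
 assumes K: "is_field K" "infinite K" and S: "S<=acl K"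
 shows "fgen (K Un S)<=acl K" using fgen_least[OF subfield_acl[OF K], of "K Un S"] subset_acl[OF field_ring[OF K(1)]] S by auto

lemma aclosed_splits:
 fixes F :: "'a::alg_closed_field set"
 assumes F: "aclosed F" and p: "coeffs_in F p" "lead_coeff p = 1"
 obtains A where "size A = degree p" "p = (PROD x:#A. [:-x, 1:])" "set_mset A<=F"
proof -
 obtain A where A: "size A = degree p" "p = (PROD x:#A. [:-x, 1:])" using splits_monic[OF p(2)] by blast
 have "p~=0" using p by auto
 hence "x : F" if "x :# A" for x using F p that A poly_prod_linear_eq_0_iff[of A x] unfolding aclosed_def alg_def by blast
 thus ?thesis using A that by blast
qed

section \<open>Seminorms and Gauss norms\<close>

definition norm_on :: "'a::field set => ('a => real) => bool" where
 "norm_on K w \<longleftrightarrow> (ALL x:K. 0<=w x & (w x = 0 \<longleftrightarrow> x = 0)) &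
  (ALL x:K. ALL y:K. w (x*y) = w x*w y & w (x+y)<=max (w x) (w y))"

definition seminorm_on :: "'a::field set => ('a => real) => bool" where
 "seminorm_on K q \<longleftrightarrow> (ALL x:K. 0<=q x) & q 0 = 0 & q 1 = 1 &
  (ALL x:K. ALL y:K. q (x-y)<=max (q x) (q y) & q (x*y)<=q x*q y)"

lemma nonarch_norm_iff: "nonarch_norm w \<longleftrightarrow> norm_on UNIV w" by (auto simp: nonarch_norm_def norm_on_def)

lemma norm_on_nonneg: "norm_on K w ==> x : K ==> 0<=w x" unfolding norm_on_def by meson

lemma norm_on_eq_0: "norm_on K w ==> x : K ==> w x = 0 \<longleftrightarrow> x = 0" unfolding norm_on_def by blast

lemma norm_on_mult: "norm_on K w ==> x : K ==> y : K ==> w (x*y) = w x*w y" unfolding norm_on_def by meson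

lemma norm_on_add: "norm_on K w ==> x : K ==> y : K ==> w (x+y)<=max (w x) (w y)" unfolding norm_on_def by meson

lemma norm_onI:
 assumes "!!x. x : K ==> 0<=w x" "!!x. x : K ==> w x = 0 \<longleftrightarrow> x = 0"
  "!!x y. x : K ==> y : K ==> w (x*y) = w x*w y"
  "!!x y. x : K ==> y : K ==> w (x+y)<=max (w x) (w y)"
 shows "norm_on K w" unfolding norm_on_def by (intro ballI conjI assms)

lemma norm_on_subset: "norm_on K w ==> L<=K ==> norm_on L w" unfolding norm_on_def by (meson subsetD)

lemma norm_on_cong:
 assumes w: "norm_on K w" and K: "is_ring K" and eq: "!!x. x : K ==> v x = w x" shows "norm_on K v"
 by (rule norm_onI) (simp_all add: eq subring_mult[OF K] subring_add[OF K] norm_on_nonneg[OF w] norm_on_eq_0[OF w]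
   norm_on_mult[OF w] norm_on_add[OF w])

lemma seminorm_onI:
 assumes "!!x. x : K ==> 0<=q x" "q 0 = 0" "q 1 = 1"
  "!!x y. x : K ==> y : K ==> q (x-y)<=max (q x) (q y)"
  "!!x y. x : K ==> y : K ==> q (x*y)<=q x*q y"
 shows "seminorm_on K q" unfolding seminorm_on_def by (intro ballI conjI assms)

lemma norm_on_one:
 assumes "norm_on K w" "is_ring K" shows "w 1 = 1"
proof -
 have "w (1*1) = w 1*w 1" using assms by (intro norm_on_mult) (auto intro: subring_one)
 moreover have "w 1~=0" using norm_on_eq_0[OF assms(1) subring_one[OF assms(2)]] by simp
 ultimately show ?thesis by simp
qed

lemma norm_on_uminus:
 assumes "norm_on K w" "is_ring K" "x : K" shows "w (- x) = w x"
proof -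
 have m: "- 1 : K" "1 : K" using assms by (auto intro: subring_closed)
 have "w (-1)*w (-1) = 1" using norm_on_mult[OF assms(1) m(1) m(1)] norm_on_one[OF assms(1,2)] by simp
 hence "(w (-1))\<^sup>2 = 1" by (simp add: power2_eq_square)
 moreover have "w (-1) >= 0" using norm_on_nonneg[OF assms(1) m(1)] .
 ultimately have "w (-1) = 1" by (simp add: power2_eq_1_iff)
 moreover have "w (- 1*x) = w (-1)*w x" by (rule norm_on_mult[OF assms(1) m(1) assms(3)])
 ultimately show ?thesis by simp
qed

lemma norm_on_seminorm:
 assumes "norm_on K w" "is_ring K" shows "seminorm_on K w"
proof -
 have "w (x-y)<=max (w x) (w y)" if "x : K" "y : K" for x y
 proof -
  have "w (x + - y)<=max (w x) (w (- y))" by (rule norm_on_add[OF assms(1) that(1) subring_uminus[OF assms(2) that(2)]])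
  thus ?thesis using norm_on_uminus[OF assms that(2)] by simp
 qed
 thus ?thesis using norm_on_nonneg[OF assms(1)] norm_on_one[OF assms] norm_on_mult[OF assms(1)]
   norm_on_eq_0[OF assms(1) subring_zero[OF assms(2)]] by (intro seminorm_onI) auto
qed

lemma seminorm_nonneg: "seminorm_on K q ==> x : K ==> 0<=q x" unfolding seminorm_on_def by meson

lemma seminorm_zero: "seminorm_on K q ==> q 0 = 0" unfolding seminorm_on_def by meson

lemma seminorm_one: "seminorm_on K q ==> q 1 = 1" unfolding seminorm_on_def by meson

lemma seminorm_mult: "seminorm_on K q ==> x : K ==> y : K ==> q (x*y)<=q x*q y" unfolding seminorm_on_def by meson

lemma seminorm_diff: "seminorm_on K q ==> x : K ==> y : K ==> q (x-y)<=max (q x) (q y)" unfolding seminorm_on_def by meson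

lemma seminorm_uminus:
 assumes "seminorm_on K q" "is_ring K" "x : K" shows "q (- x) = q x"
proof -
 have "q (- y)<=q y" if "y : K" for y using seminorm_diff[OF assms(1) subring_zero[OF assms(2)] that] seminorm_nonneg[OF assms(1) that]
  by (simp add: seminorm_zero[OF assms(1)])
 from this[of x] this[of "-x"] show ?thesis using subring_uminus[OF assms(2,3)] assms(3) by simp
qed

lemma seminorm_add:
 assumes "seminorm_on K q" "is_ring K" "x : K" "y : K" shows "q (x+y)<=max (q x) (q y)"
proof -
 have "q (x-(- y))<=max (q x) (q (- y))" by (rule seminorm_diff[OF assms(1,3) subring_uminus[OF assms(2,4)]])
 thus ?thesis using seminorm_uminus[OF assms(1,2,4)] by simp
qed

lemma seminorm_sum_less:
 assumes q: "seminorm_on K q" "is_ring K" and B: "0 < B"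
 shows "(!!i. i : I ==> f i : K & q (f i) < B) ==> q (sum f I) < B"
proof (induction I rule: infinite_finite_induct)
 case (insert i I)
 have "q (f i+sum f I)<=max (q (f i)) (q (sum f I))" using insert q by (intro seminorm_add) (auto intro!: subring_sum)
 also have "... < B" using insert by simp
 finally show ?case using insert by simp
qed (use q B in \<open>auto simp: seminorm_zero\<close>)

lemma seminorm_sum_le:
 assumes q: "seminorm_on K q" "is_ring K" and B: "0<=B" and f: "!!i. i : I ==> f i : K & q (f i)<=B"
 shows "q (sum f I)<=B"
proof (rule field_le_epsilon)
 fix e :: real assume "0 < e"
 hence "q (sum f I) < B+e" using B f by (intro seminorm_sum_less[OF q]) force+
 thus "q (sum f I)<=B+e" by simp
qed

lemma seminorm_power_le:
 assumes q: "seminorm_on K q" "is_ring K" "x : K" shows "q (x^n)<=q x^n"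
proof (induction n)
 case (Suc n)
 have "q (x*x^n)<=q x*q (x^n)" using q by (intro seminorm_mult) (auto intro: subring_power)
 also have "... <= q x*q x^n" using Suc q by (intro mult_left_mono) (auto intro: seminorm_nonneg)
 finally show ?case by simp
qed (use q in \<open>simp add: seminorm_one\<close>)

lemma norm_on_dominant:
 assumes w: "norm_on K w" "is_ring K" and "x : K" "y : K" "w x < w y"
 shows "w (x+y) = w y"
proof (rule antisym)
 note s = norm_on_seminorm[OF w]
 show "w (x+y)<=w y" using seminorm_add[OF s w(2), of x y] assms by simp
 have "w (x+y-x)<=max (w (x+y)) (w x)" by (rule seminorm_diff[OF s subring_add[OF w(2) assms(3,4)] assms(3)])
 thus "w y<=w (x+y)" using assms by (auto simp: max_def split: if_splits)
qed

lemma norm_on_power: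
 assumes w: "norm_on K w" "is_ring K" "x : K" shows "w (x^n) = w x^n"
proof (induction n)
 case (Suc n)
 thus ?case using norm_on_mult[OF w(1) w(3) subring_power[OF w(2,3)]] by simp
qed (use w in \<open>simp add: norm_on_one\<close>)

text \<open>The Gauss norm of radius r.\<close>

definition gnorm :: "('a::zero => real) => real => 'a poly => real" where
 "gnorm q r p = Max ((%i. q (coeff p i)*r^i) ` {..degree p})"

lemma gnorm_le:
 assumes "0<=B" "!!i. q (coeff p i)*r^i<=B"
 shows "gnorm q r p<=B" using assms unfolding gnorm_def by (subst Max_le_iff) auto

lemma gnorm_nonneg:
 assumes q: "seminorm_on K q" and p: "coeffs_in K p" and r: "0<=r" shows "0<=gnorm q r p"
proof -
 have "0<=q (coeff p 0)*r^0" using q p by (auto intro: seminorm_nonneg coeffs_inD)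
 also have "... <= gnorm q r p" unfolding gnorm_def by (intro Max_ge) (auto intro!: image_eqI[of _ _ 0])
 finally show ?thesis .
qed

lemma le_gnorm:
 assumes q: "seminorm_on K q" and p: "coeffs_in K p" and r: "0<=r"
 shows "q (coeff p i)*r^i<=gnorm q r p"
proof (cases "i<=degree p")
 case True thus ?thesis unfolding gnorm_def by (intro Max_ge) auto
next
 case False thus ?thesis using gnorm_nonneg[OF assms] by (simp add: coeff_eq_0 seminorm_zero[OF q])
qed

lemma gnorm_attained:
 obtains i where "i<=degree p" "gnorm q r p = q (coeff p i)*r^i"
proof -
 have "gnorm q r p : (%i. q (coeff p i)*r^i) ` {..degree p}" unfolding gnorm_def by (rule Max_in) auto
 thus ?thesis using that by auto
qed

lemma gnorm_const: "seminorm_on K q ==> gnorm q r [:c:] = q c" by (simp add: gnorm_def)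

lemma gnorm_diff:
 assumes q: "seminorm_on K q" "is_ring K" and p: "coeffs_in K p" "coeffs_in K p'" and r: "0<=r"
 shows "gnorm q r (p-p')<=max (gnorm q r p) (gnorm q r p')"
proof (rule gnorm_le)
 show "0<=max (gnorm q r p) (gnorm q r p')" using gnorm_nonneg[OF q(1) p(1) r] by simp
 fix i
 have "q (coeff (p-p') i)<=max (q (coeff p i)) (q (coeff p' i))" using seminorm_diff[OF q(1) coeffs_inD[OF p(1)] coeffs_inD[OF p(2)]] by simp
 hence "q (coeff (p-p') i)*r^i<=max (q (coeff p i)) (q (coeff p' i))*r^i" using r by (intro mult_right_mono) auto
 also have "... = max (q (coeff p i)*r^i) (q (coeff p' i)*r^i)" using r by (simp add: max_mult_distrib_right)
 also have "... <= max (gnorm q r p) (gnorm q r p')" using le_gnorm[OF q(1) p(1) r, of i] le_gnorm[OF q(1) p(2) r, of i] by auto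
 finally show "q (coeff (p-p') i)*r^i<=max (gnorm q r p) (gnorm q r p')" .
qed

lemma gnorm_linear: "0 < r ==> q 1 = 1 ==> gnorm q r [:c :: 'a::field, 1:] = max r (q c)" by (simp add: gnorm_def atMost_Suc max.commute)

lemma gnorm_mult_le:
 assumes q: "seminorm_on K q" "is_ring K" and p: "coeffs_in K p" "coeffs_in K p'" and r: "0<=r"
 shows "gnorm q r (p*p')<=gnorm q r p*gnorm q r p'"
proof (rule gnorm_le)
 note nn = gnorm_nonneg[OF q(1) p(1) r] gnorm_nonneg[OF q(1) p(2) r]
 show "0<=gnorm q r p*gnorm q r p'" using nn by simp
 fix i
 show "q (coeff (p*p') i)*r^i<=gnorm q r p*gnorm q r p'"
 proof (cases "r = 0 & i > 0")
  case True thus ?thesis using nn by (simp add: zero_power)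
 next
  case False
  hence ri: "r^i > 0" using r by (cases "i = 0") auto
  have "q (coeff (p*p') i)<=gnorm q r p*gnorm q r p'/r^i" unfolding coeff_mult
  proof (rule seminorm_sum_le[OF q])
   show "0<=gnorm q r p*gnorm q r p'/r^i" using nn ri by simp
   fix j assume j: "j : {..i}"
   have m: "coeff p j : K" "coeff p' (i-j) : K" using p by (auto simp: coeffs_in_def)
   have "q (coeff p j*coeff p' (i-j))*r^i<=q (coeff p j)*q (coeff p' (i-j))*r^i" using seminorm_mult[OF q(1) m] ri by simp
   also have "... = (q (coeff p j)*r^j)*(q (coeff p' (i-j))*r^(i-j))" using j by (simp add: power_add[symmetric] algebra_simps)
   also have "... <= gnorm q r p*gnorm q r p'" using le_gnorm[OF q(1) p(1) r] le_gnorm[OF q(1) p(2) r] nn r seminorm_nonneg[OF q(1) m(2)]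
    by (intro mult_mono) auto
   finally show "coeff p j*coeff p' (i-j) : K &
     q (coeff p j*coeff p' (i-j))<=gnorm q r p*gnorm q r p'/r^i" using m q ri by (simp add: subring_mult field_simps)
  qed
  thus ?thesis using ri by (simp add: field_simps)
 qed
qed

lemma gnorm_power_le:
 assumes q: "seminorm_on K q" "is_ring K" and p: "coeffs_in K p" and r: "0<=r"
 shows "gnorm q r (p^n)<=gnorm q r p^n"
proof (induction n)
 case 0
 have "gnorm q r [:1:] = 1" using gnorm_const[OF q(1), of r 1] q by (simp add: seminorm_one)
 thus ?case by (simp add: one_pCons)
next
 case (Suc n)
 have "gnorm q r (p*p^n)<=gnorm q r p*gnorm q r (p^n)" using q p r by (intro gnorm_mult_le) (auto intro: coeffs_in_power)
 also have "... <= gnorm q r p*gnorm q r p^n" using Suc gnorm_nonneg[OF q(1) p r] by (intro mult_left_mono)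
 finally show ?case by simp
qed

lemma gnorm_pos:
 assumes w: "norm_on K w" "is_ring K" and p: "coeffs_in K p" "p~=0" and r: "0 < r"
 shows "0 < gnorm w r p"
proof -
 have "0 < w (lead_coeff p)*r^degree p" using norm_on_nonneg[OF w(1) coeffs_inD[OF p(1)], of "degree p"]
   norm_on_eq_0[OF w(1) coeffs_inD[OF p(1)], of "degree p"] p(2) r by simp
 also have "... <= gnorm w r p" using le_gnorm[OF norm_on_seminorm[OF w] p(1)] r by simp
 finally show ?thesis .
qed

text \<open>Among the terms of maximal value take the first one in each factor. In the corresponding coefficient of the
product every other term is strictly smaller.\<close>

lemma gnorm_mult:
 assumes w: "norm_on K w" "is_ring K" and p: "coeffs_in K p" "coeffs_in K p'" and r: "0 < r"
 shows "gnorm w r (p*p') = gnorm w r p*gnorm w r p'"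
proof (cases "p = 0 \<or> p' = 0")
 case True
 have "gnorm w r 0 = 0" using seminorm_zero[OF norm_on_seminorm[OF w]] by (simp add: gnorm_def)
 thus ?thesis using True by auto
next
 case False
 note s = norm_on_seminorm[OF w]
 have r': "0<=r" using r by simp
 define G where "G = gnorm w r p" define G' where "G' = gnorm w r p'"
 have pos: "G > 0" "G' > 0" using gnorm_pos[OF w] p False r by (auto simp: G_def G'_def)
 define i0 where "i0 = (LEAST i. w (coeff p i)*r^i = G)"
 define j0 where "j0 = (LEAST i. w (coeff p' i)*r^i = G')"
 have i0: "w (coeff p i0)*r^i0 = G" unfolding i0_def by (rule LeastI_ex) (metis G_def gnorm_attained)
 have j0: "w (coeff p' j0)*r^j0 = G'" unfolding j0_def by (rule LeastI_ex) (metis G'_def gnorm_attained)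
 have lt: "w (coeff p i)*r^i < G" if "i < i0" for i using not_less_Least[OF that[unfolded i0_def]] le_gnorm[OF s p(1) r', of i] unfolding G_def by simp
 have lt': "w (coeff p' i)*r^i < G'" if "i < j0" for i using not_less_Least[OF that[unfolded j0_def]] le_gnorm[OF s p(2) r', of i] unfolding G'_def by simp
 define n where "n = i0+j0"
 define f where "f j = coeff p j*coeff p' (n-j)" for j
 have mem: "coeff p i : K" "coeff p' i : K" for i using p by (auto simp: coeffs_in_def)
 have fK: "f j : K" for j using mem w by (simp add: f_def subring_mult)
 have wf: "w (f j)*r^n = (w (coeff p j)*r^j)*(w (coeff p' (n-j))*r^(n-j))" if "j<=n" for j
  using norm_on_mult[OF w(1) mem] that unfolding f_def by (simp add: power_add[symmetric] algebra_simps)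
 have top: "w (f i0) = G*G'/r^n"
 proof -
  have "w (f i0)*r^n = G*G'" using wf[of i0] by (simp add: n_def i0 j0)
  thus ?thesis using r by (simp add: field_simps)
 qed
 have small: "w (sum f ({..n}-{i0})) < G*G'/r^n"
 proof (rule seminorm_sum_less[OF s w(2)])
  show "0 < G*G'/r^n" using pos r by simp
  fix j assume j: "j : {..n}-{i0}"
  have nn: "0<=w (coeff p j)*r^j" "0<=w (coeff p' (n-j))*r^(n-j)" using norm_on_nonneg[OF w(1)] mem r by simp_all
  have le: "w (coeff p j)*r^j<=G" "w (coeff p' (n-j))*r^(n-j)<=G'" using le_gnorm[OF s p(1) r'] le_gnorm[OF s p(2) r'] by (auto simp: G_def G'_def)
  have "j < i0 \<or> n-j < j0" using j by (auto simp: n_def)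
  hence "(w (coeff p j)*r^j)*(w (coeff p' (n-j))*r^(n-j)) < G*G'"
  proof
   assume "j < i0"
   from lt[OF this] show ?thesis using nn le pos by (intro le_less_trans[OF mult_left_mono[OF le(2) nn(1)]] mult_strict_right_mono)
  next
   assume "n-j < j0"
   from lt'[OF this] show ?thesis using nn le pos by (intro le_less_trans[OF mult_right_mono[OF le(1) nn(2)]] mult_strict_left_mono)
  qed
  thus "f j : K & w (f j) < G*G'/r^n" using fK wf[of j] j r by (simp add: field_simps)
 qed
 have "coeff (p*p') n = sum f ({..n}-{i0})+f i0" unfolding coeff_mult f_def[symmetric] using sum.remove[of "{..n}" i0 f] by (simp add: n_def)
 hence "w (coeff (p*p') n) = w (f i0)" using norm_on_dominant[OF w _ fK[of i0]] small top w fK by (simp add: subring_sum)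
 hence "G*G' = w (coeff (p*p') n)*r^n" using top r by simp
 also have "... <= gnorm w r (p*p')" using p w r' by (intro le_gnorm[OF s] coeffs_in_mult)
 finally show ?thesis using gnorm_mult_le[OF s w(2) p r'] by (simp add: G_def G'_def)
qed

lemma seminorm_poly_le:
 assumes q: "seminorm_on K q" "is_ring K" and p: "coeffs_in K p" and x: "x : K"
  and D: "!!i. q (x^i)<=D * s^i" and s: "0<=s" and D0: "0<=D"
 shows "q (poly p x)<=D*gnorm q s p" unfolding poly_altdef
proof (rule seminorm_sum_le[OF q])
 show "0<=D*gnorm q s p" using gnorm_nonneg[OF q(1) p s] D0 by simp
 fix i
 have m: "coeff p i : K" "x^i : K" using p x q by (auto simp: coeffs_in_def subring_power)
 have "q (coeff p i*x^i)<=q (coeff p i)*q (x^i)" by (rule seminorm_mult[OF q(1) m])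
 also have "... <= q (coeff p i)*(D * s^i)" using D seminorm_nonneg[OF q(1) m(1)] by (intro mult_left_mono)
 also have "... = D*(q (coeff p i) * s^i)" by simp
 also have "... <= D*gnorm q s p" using le_gnorm[OF q(1) p s] D0 by (intro mult_left_mono)
 finally show "coeff p i*x^i : K & q (coeff p i*x^i)<=D*gnorm q s p" using m q by (simp add: subring_mult)
qed

section \<open>Multiplicative norms below a seminorm\<close>

lemma le_mult_Inf:
 fixes a c :: real
 assumes "B~={}" "0<=a" and c: "!!b. b : B ==> c<=a*b" shows "c<=a*Inf B"
proof (cases "a = 0")
 case False
 hence "c/a<=Inf B" using assms by (intro cInf_greatest) (auto simp: divide_le_eq mult.commute)
 thus ?thesis using False assms(2) by (simp add: divide_le_eq mult.commute)
qed (use assms in auto)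

text \<open>Both the quotient seminorm and the limits of decreasing families of seminorms are infima of this form.\<close>

lemma INF_seminorm:
 assumes ne: "!!x. x : K ==> V x~={}" and nn: "!!x v. v : V x ==> (0 :: real)<=v"
  and unit: "0 : V 0" "1 : V 1" "!!v. v : V 1 ==> 1<=v"
  and diff: "!!x y a b. x : K ==> y : K ==> a : V x ==> b : V y ==> EX c:V (x-y). c<=max a b"
  and mult: "!!x y a b. x : K ==> y : K ==> a : V x ==> b : V y ==> EX c:V (x*y). c<=a*b"
 shows "seminorm_on K (%x. Inf (V x))" "!!x v. v : V x ==> Inf (V x)<=v"
proof -
 have bdd: "bdd_below (V x)" for x using nn by (intro bdd_belowI)
 show lower: "Inf (V x)<=v" if "v : V x" for x v using bdd that by (intro cInf_lower)
 have pos: "0<=Inf (V x)" if "V x~={}" for x using that nn by (intro cInf_greatest)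
 show "seminorm_on K (%x. Inf (V x))"
 proof (rule seminorm_onI)
  show "0<=Inf (V x)" if "x : K" for x using pos ne that by simp
  show "Inf (V 0) = 0" using lower[OF unit(1)] pos[of 0] unit(1) by (intro antisym) auto
  show "Inf (V 1) = 1" using lower[OF unit(2)] unit(2,3) by (intro antisym cInf_greatest) auto
  fix x y assume xy: "x : K" "y : K"
  show "Inf (V (x-y))<=max (Inf (V x)) (Inf (V y))"
  proof (rule ccontr)
   assume "~ ?thesis"
   hence "Inf (V x) < Inf (V (x-y))" "Inf (V y) < Inf (V (x-y))" by auto
   then obtain a b where ab: "a : V x" "a < Inf (V (x-y))" "b : V y" "b < Inf (V (x-y))" using cInf_less_iff[OF ne bdd] xy by metis
   thus False using diff[OF xy ab(1,3)] lower[of _ "x-y"] by force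
  qed
  have "Inf (V (x*y))<=a*Inf (V y)" if a: "a : V x" for a
  proof (rule le_mult_Inf[OF ne[OF xy(2)] nn[OF a]])
   fix b assume "b : V y"
   thus "Inf (V (x*y))<=a*b" using mult[OF xy a] lower order.trans by blast
  qed
  hence "Inf (V (x*y))<=Inf (V y)*Inf (V x)" using pos ne xy by (intro le_mult_Inf) (auto simp: mult.commute)
  thus "Inf (V (x*y))<=Inf (V x)*Inf (V y)" by (simp add: mult.commute)
 qed
qed

text \<open>The largest seminorm for which y has value at most s is the quotient seminorm of the Gauss norm under
A \<mapsto> A(y). The only obstruction is that the value of 1 could drop below 1.\<close>

lemma quotient_seminorm:
 fixes K :: "'a::field set"
 assumes q: "seminorm_on K q" "is_ring K" and s: "0<=s"
  and L: "L<={poly A y | A. coeffs_in K A}"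
  and one: "!!A. coeffs_in K A ==> poly A y = 1 ==> 1<=gnorm q s A"
 shows "EX Q. seminorm_on L Q & (ALL x:K. Q x<=q x) & Q y<=s"
proof -
 define R where "R x = {A. coeffs_in K A & poly A y = x}" for x
 define V where "V x = gnorm q s ` R x" for x
 have const: "q x : V x" if "x : K" for x
  unfolding V_def by (rule image_eqI[of _ _ "[:x:]"]) (use that q in \<open>auto simp: R_def gnorm_const[OF q(1)] intro: coeffs_in_const\<close>)
 have V: "EX A. coeffs_in K A & poly A y = x & a = gnorm q s A" if "a : V x" for a x using that by (auto simp: V_def R_def)
 have VI: "EX c:V x. c<=B" if "coeffs_in K A" "poly A y = x" "gnorm q s A<=B" for A x B using that by (auto simp: V_def R_def)
 note INF = INF_seminorm[of L V]
 have 1: "V x~={}" if "x : L" for x using that L by (auto simp: V_def R_def)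
 have 2: "0<=v" if "v : V x" for v x using V[OF that] gnorm_nonneg[OF q(1) _ s] by auto
 have 3: "0 : V 0" "1 : V 1" using const[of 0] const[of 1] q by (simp_all add: subring_closed seminorm_zero seminorm_one)
 have 4: "1<=v" if "v : V 1" for v using V[OF that] one by auto
 have 5: "EX c:V (x-z). c<=max a b" "EX c:V (x*z). c<=a*b" if "x : L" "z : L" and ab: "a : V x" "b : V z" for x z a b
 proof -
  obtain A B where "coeffs_in K A" "poly A y = x" "a = gnorm q s A" "coeffs_in K B" "poly B y = z" "b = gnorm q s B" using V[OF ab(1)] V[OF ab(2)] by blast
  thus "EX c:V (x-z). c<=max a b" "EX c:V (x*z). c<=a*b" using gnorm_diff[OF q _ _ s, of A B] gnorm_mult_le[OF q _ _ s, of A B] q(2)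
    VI[of "A-B" "x-z" "max a b"] VI[of "A*B" "x*z" "a*b"] by (auto simp: coeffs_in_diff coeffs_in_mult)
 qed
 have "gnorm q s [:0, 1:]<=s" using s q by (simp add: gnorm_def atMost_Suc seminorm_zero seminorm_one)
 then obtain c where "c : V y" "c<=s" using VI[OF coeffs_in_X[OF q(2)], of y s] by auto
 hence "Inf (V y)<=s" using INF(2)[OF 1 2 3 4 5] by fastforce
 thus ?thesis using INF[OF 1 2 3 4 5] const by (intro exI[of _ "%x. Inf (V x)"]) simp
qed

text \<open>If q(f^m) < q(f)^m, a quotient seminorm makes f smaller. Once powers are preserved,
the limit of q(g f^n)/q(f)^n is a seminorm below q, so that it equals q, and this says q(g f) = q(g) q(f).\<close>

lemma minimal_seminorm_multiplicative:
 fixes K :: "'a::field set"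
 assumes K: "is_field K" and q: "seminorm_on K q"
  and minimal: "!!q'. seminorm_on K q' ==> (!!x. x : K ==> q' x<=q x) ==> (!!x. x : K ==> q' x = q x)"
 shows "norm_on K q"
proof -
 note R = field_ring[OF K]
 have pos: "0 < q f" if f: "f : K" "f~=0" for f
 proof -
  have "1<=q f*q (inverse f)" using seminorm_mult[OF q f(1) subfield_inverse[OF K f(1)]] f(2) seminorm_one[OF q] by simp
  thus ?thesis using seminorm_nonneg[OF q f(1)] by (cases "q f = 0") auto
 qed
 have pw: "q (f^m) = q f^m" if f: "f : K" "f~=0" for f m
 proof (rule ccontr)
  assume ne: "q (f^m)~=q f^m"
  hence m: "m > 0" using seminorm_one[OF q] by (cases m) auto
  have lt: "q (f^m) < q f^m" using seminorm_power_le[OF q R f(1), of m] ne by simp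
  define s where "s = root m (q (f^m))"
  have fm: "0 < q (f^m)" using pos[of "f^m"] f R by (simp add: subring_power)
  have s0: "0 < s" "s^m = q (f^m)" using m fm by (auto simp: s_def)
  have sf: "s < q f" using lt s0 pos[OF f] m by (metis less_eq_real_def linorder_not_less power_mono)
  define D where "D = (q f/s)^m"
  have bound: "q (f^i)<=D * s^i" for i
  proof -
   define j l where "j = i div m" and "l = i mod m"
   have i: "i = m*j+l" and l: "l < m" using m by (auto simp: j_def l_def)
   have "q (f^i) = q ((f^m)^j*f^l)" by (simp add: i power_add power_mult)
   also have "... <= q ((f^m)^j)*q (f^l)" using f R by (intro seminorm_mult[OF q] subring_power)
   also have "... <= q (f^m)^j*q f^l" using f R q fm pos[OF f] seminorm_nonneg[OF q subring_power[OF R f(1)]]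
    by (intro mult_mono seminorm_power_le subring_power) auto
   also have "... = s^(m*j) * s^l*(q f/s)^l" using s0 by (simp add: power_mult power_divide)
   also have "... <= s^(m*j) * s^l*D" unfolding D_def using s0 sf l by (intro mult_left_mono power_increasing) (auto simp: field_simps)
   also have "... = D * s^i" by (simp add: i power_add)
   finally show ?thesis .
  qed
  have D0: "0<=D" using s0 sf by (simp add: D_def)
  have "EX Q. seminorm_on K Q & (ALL x:K. Q x<=q x) & Q f<=s"
  proof (rule quotient_seminorm[OF q R])
   show "0<=s" using s0 by simp
   show "K<={poly A f |A. coeffs_in K A}"
   proof
    fix x assume "x : K"
    thus "x : {poly A f |A. coeffs_in K A}" using R by (auto intro!: exI[of _ "[:x:]"] coeffs_in_const)
   qed
   fix A assume A: "coeffs_in K A" "poly A f = 1"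
   show "1<=gnorm q s A"
   proof (rule ccontr)
    assume "~ ?thesis"
    hence lt1: "gnorm q s A < 1" by simp
    have g0: "0<=gnorm q s A" using gnorm_nonneg[OF q A(1)] s0 by simp
    have "1<=D*gnorm q s A^n" for n
    proof -
     have "q (poly (A^n) f)<=D*gnorm q s (A^n)" using A R f s0 D0 by (intro seminorm_poly_le[OF q R] bound) (auto intro: coeffs_in_power)
     also have "... <= D*gnorm q s A^n" using D0 s0 by (intro mult_left_mono gnorm_power_le[OF q R A(1)]) auto
     finally show ?thesis using A seminorm_one[OF q] by simp
    qed
    moreover have "(%n. D*gnorm q s A^n) \<longlonglongrightarrow> D*0" using lt1 g0 by (intro tendsto_mult tendsto_const LIMSEQ_power_zero) auto
    ultimately show False using LIMSEQ_le_const[of "%n. D*gnorm q s A^n" "D*0" 1] by auto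
   qed
  qed
  then obtain Q where Q: "seminorm_on K Q" "!!x. x : K ==> Q x<=q x" "Q f<=s" by blast
  show False using minimal[OF Q(1,2) f(1)] Q(3) sf by simp
 qed
 have mult: "q g*q f<=q (g*f)" if f: "f : K" "f~=0" and g: "g : K" for f g
 proof -
  define a where "a g n = q (g*f^n)/q f^n" for g n
  have fK: "g*f^n : K" if "g : K" for g n using that f R by (intro subring_mult subring_power)
  have a0: "0<=a g n" if "g : K" for g n using seminorm_nonneg[OF q fK[OF that]] pos[OF f] by (simp add: a_def)
  have dec: "a g (Suc n)<=a g n" if g: "g : K" for g n
  proof -
   have "q (g*f^n*f)<=q (g*f^n)*q f" by (rule seminorm_mult[OF q fK[OF g] f(1)])
   thus ?thesis using pos[OF f] by (simp add: a_def field_simps)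
  qed
  have mono: "a g n<=a g m" if "g : K" "m<=n" for g m n using lift_Suc_antimono_le[of "a g" m n] dec[OF that(1)] that(2) by simp
  define V where "V g = (if g : K then range (a g) else {})" for g
  have 1: "V x~={}" if "x : K" for x using that by (simp add: V_def)
  have 2: "0<=v" if "v : V x" for v x using that a0 by (auto simp: V_def split: if_splits)
  have "a 0 n = 0" "a 1 n = 1" for n using seminorm_zero[OF q] pw[OF f] pos[OF f] by (simp_all add: a_def)
  hence 3: "0 : V 0" "1 : V 1" and 4: "!!v. v : V 1 ==> 1<=v" using R by (auto simp: V_def subring_closed image_iff)
  have 5: "EX c:V (x-y). c<=max b c'" if xy: "x : K" "y : K" "b : V x" "c' : V y" for x y b c'
  proof -
   obtain n m where nm: "b = a x n" "c' = a y m" using xy by (auto simp: V_def)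
   define k where "k = max n m"
   have "q (x*f^k-y*f^k)<=max (q (x*f^k)) (q (y*f^k))" by (rule seminorm_diff[OF q fK[OF xy(1)] fK[OF xy(2)]])
   hence "a (x-y) k<=max (a x k) (a y k)" using pos[OF f] by (auto simp: a_def algebra_simps le_max_iff_disj divide_right_mono)
   also have "... <= max b c'" using mono[OF xy(1), of n k] mono[OF xy(2), of m k] by (auto simp: nm k_def intro: max.mono)
   finally show ?thesis using xy R by (auto simp: V_def subring_diff)
  qed
  have 6: "EX c:V (x*y). c<=b*c'" if xy: "x : K" "y : K" "b : V x" "c' : V y" for x y b c'
  proof -
   obtain n m where nm: "b = a x n" "c' = a y m" using xy by (auto simp: V_def)
   have "q (x*f^n*(y*f^m))<=q (x*f^n)*q (y*f^m)" by (rule seminorm_mult[OF q fK[OF xy(1)] fK[OF xy(2)]])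
   hence "a (x*y) (n+m)<=b*c'" unfolding nm using pos[OF f] by (simp add: a_def power_add algebra_simps divide_right_mono)
   thus ?thesis using xy R by (auto simp: V_def subring_mult)
  qed
  note INF = INF_seminorm[of K V, OF 1 2 3 4 5 6]
  have lower: "Inf (V g)<=a g n" if "g : K" for g n using that by (intro INF(2)) (auto simp: V_def)
  have le: "Inf (V g)<=q g" if "g : K" for g using lower[OF that, of 0] by (simp add: a_def)
  from minimal[OF INF(1) le g] have "q g<=a g 1" using lower[OF g, of 1] by simp
  thus ?thesis using pos[OF f] by (simp add: a_def field_simps)
 qed
 show ?thesis
 proof (rule norm_onI)
  fix x assume x: "x : K"
  show "0<=q x" by (rule seminorm_nonneg[OF q x])
  show "q x = 0 \<longleftrightarrow> x = 0" using pos[OF x] seminorm_zero[OF q] by (cases "x = 0") auto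
  fix y assume y: "y : K"
  show "q (x+y)<=max (q x) (q y)" by (rule seminorm_add[OF q R x y])
  show "q (x*y) = q x*q y"
  proof (cases "y = 0")
   case True thus ?thesis using seminorm_zero[OF q] by simp
  next
   case False
   show ?thesis using mult[OF y False x] seminorm_mult[OF q x y] by simp
  qed
 qed
qed

text \<open>Decreasing chains of seminorms have infima, and by Zorn there is a minimal one. Functions are set to 0 outside of K to make the order antisymmetric.\<close>

lemma multiplicative_below_seminorm:
 fixes K :: "'a::field set"
 assumes K: "is_field K" and p: "seminorm_on K p"
 shows "EX q. norm_on K q & (ALL x:K. q x<=p x)"
proof -
 note R = field_ring[OF K]
 define A where "A = {q. seminorm_on K q & (ALL x:K. q x<=p x) & (ALL x. x ~: K --> q x = 0)}"
 define P where "P = (%a b :: 'a => real. ALL x. b x<=a x)"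
 define r where "r q = (%x. if x : K then q x else (0::real))" for q
 have rA: "r q : A" if q: "seminorm_on K q" "!!x. x : K ==> q x<=p x" for q
 proof -
  have "seminorm_on K (r q)"
  proof (rule seminorm_onI)
   fix x y assume xy: "x : K" "y : K"
   show "r q (x-y)<=max (r q x) (r q y)" "r q (x*y)<=r q x*r q y"
    using xy seminorm_diff[OF q(1) xy] seminorm_mult[OF q(1) xy] R by (auto simp: r_def subring_closed)
  qed (use q R in \<open>auto simp: r_def subring_closed seminorm_nonneg seminorm_one seminorm_zero\<close>)
  thus ?thesis using q by (auto simp: A_def r_def)
 qed
 have "EX m:A. ALL a:A. P m a --> a = m"
 proof (rule predicate_Zorn)
  show "partial_order_on A (relation_of P A)" by (auto simp: partial_order_on_def preorder_on_def refl_on_def trans_def antisym_def relation_of_def P_def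
     intro: order.trans order.antisym) (meson order.trans order.antisym ext)+
  fix C assume C: "C : Chains (relation_of P A)"
  show "EX u:A. ALL a:C. P a u"
  proof (cases "C = {}")
   case True
   thus ?thesis using rA[OF p] by auto
  next
   case False
   have CA: "C<=A" using C by (auto simp: Chains_def relation_of_def)
   have lin: "P a b \<or> P b a" if "a : C" "b : C" for a b using C that by (auto simp: Chains_def relation_of_def)
   have sem: "seminorm_on K a" if "a : C" for a using that CA by (auto simp: A_def)
   define V where "V x = (%a. a x) ` C" for x
   define u where "u x = Inf (V x)" for x
   have nn: "0<=a x" if "a : C" for a x using that CA seminorm_nonneg[OF sem[OF that]] by (cases "x : K") (auto simp: A_def)
   have 1: "V x~={}" for x using False by (simp add: V_def)
   have 2: "0<=v" if "v : V x" for v x using that nn by (auto simp: V_def)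
   have 3: "0 : V 0" "1 : V 1" and 4: "!!v. v : V 1 ==> 1<=v" using False seminorm_zero[OF sem] seminorm_one[OF sem] by (force simp: V_def)+
   have 5: "EX c:V (x-y). c<=max a b" "EX c:V (x*y). c<=a*b" if xy: "x : K" "y : K" and ab: "a : V x" "b : V y" for x y a b
   proof -
    obtain a' b' where "a' : C" "a = a' x" "b' : C" "b = b' y" using ab by (auto simp: V_def)
    then obtain c where c: "c : C" "c x<=a" "c y<=b" using lin[of a' b'] unfolding P_def by (metis order.refl)
    have "c (x-y)<=max a b" using seminorm_diff[OF sem[OF c(1)] xy] c by simp
    moreover have "c (x*y)<=a*b" using seminorm_mult[OF sem[OF c(1)] xy] mult_mono[OF c(2,3)] nn[OF c(1)] c(2) by (meson order.trans)
    ultimately show "EX c:V (x-y). c<=max a b" "EX c:V (x*y). c<=a*b" using c(1) by (auto simp: V_def)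
   qed
   note INF = INF_seminorm[of K V, OF 1 2 3 4 5]
   have lower: "u x<=a x" if "a : C" for a x using that by (intro INF(2)[folded u_def]) (auto simp: V_def)
   have "seminorm_on K u" using INF(1) by (simp add: u_def[abs_def])
   moreover have "u x<=p x" if "x : K" for x
   proof -
    obtain a where a: "a : C" using False by auto
    hence "a x<=p x" using CA that by (auto simp: A_def)
    thus ?thesis using lower[OF a, of x] by simp
   qed
   ultimately have "r u : A" by (rule rA)
   moreover have "P a (r u)" if "a : C" for a using lower[OF that] nn[OF that] by (auto simp: P_def r_def)
   ultimately show ?thesis by blast
  qed
 qed
 then obtain m where m: "m : A" "!!a. a : A ==> P m a ==> a = m" by blast
 have ms: "seminorm_on K m" "!!x. x : K ==> m x<=p x" "!!x. x ~: K ==> m x = 0" using m(1) by (auto simp: A_def)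
 have "norm_on K m"
 proof (rule minimal_seminorm_multiplicative[OF K ms(1)])
  fix q x assume q: "seminorm_on K q" "!!x. x : K ==> q x<=m x" and x: "x : K"
  have "r q : A" using q(2) ms(2) by (intro rA[OF q(1)]) (meson order.trans)
  moreover have "P m (r q)" using q(2) ms(3) by (auto simp: P_def r_def)
  ultimately have "r q = m" by (rule m(2))
  thus "q x = m x" using x by (metis r_def)
 qed
 thus ?thesis using ms(2) by blast
qed

section \<open>Extension of norms\<close>

lemma subring_UNIV: "is_ring UNIV" by (simp add: is_ring_def)

lemma coeffs_in_UNIV: "coeffs_in UNIV p" by (simp add: coeffs_in_def)

context
 fixes w :: "'a::field => real"
 assumes w: "nonarch_norm w"
begin

lemma nan_norm_on: "norm_on K w" using w norm_on_subset[of UNIV w K] by (simp add: nonarch_norm_iff)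
lemma nan_seminorm: "seminorm_on UNIV w" by (rule norm_on_seminorm[OF nan_norm_on subring_UNIV])
lemma nan_nonneg: "0<=w x" using w by (simp add: nonarch_norm_def)
lemma nan_eq_0: "w x = 0 \<longleftrightarrow> x = 0" using w by (simp add: nonarch_norm_def)
lemma nan_zero: "w 0 = 0" by (simp add: nan_eq_0)
lemma nan_pos: "x~=0 ==> 0 < w x" using nan_nonneg[of x] nan_eq_0[of x] by simp
lemma nan_mult: "w (x*y) = w x*w y" using w by (simp add: nonarch_norm_def)
lemma nan_one: "w 1 = 1" by (rule seminorm_one[OF nan_seminorm])
lemma nan_minus: "w (- x) = w x" by (rule norm_on_uminus[OF nan_norm_on subring_UNIV UNIV_I])
lemma nan_add: "w (x+y)<=max (w x) (w y)" using w by (simp add: nonarch_norm_def)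
lemma nan_diff: "w (x-y)<=max (w x) (w y)" using nan_add[of x "- y"] nan_minus[of y] by simp
lemma nan_diff_commute: "w (x-y) = w (y-x)" using nan_minus[of "x-y"] by simp
lemma nan_power: "w (x^n) = w x^n" by (rule norm_on_power[OF nan_norm_on subring_UNIV UNIV_I])
lemma nan_inverse: "w (inverse x) = inverse (w x)"
proof (cases "x = 0")
 case False
 hence "w x*w (inverse x) = 1" using nan_mult[of x "inverse x"] nan_one by simp
 thus ?thesis by (simp add: inverse_unique)
qed (simp add: nan_zero)
lemma nan_divide: "w (x/y) = w x/w y" by (simp add: divide_inverse nan_mult nan_inverse)
lemma nan_dominant: "w x < w y ==> w (x+y) = w y" by (rule norm_on_dominant[OF nan_norm_on subring_UNIV]) auto
lemma nan_sum_le: "0<=B ==> (!!i. i : I ==> w (f i)<=B) ==> w (sum f I)<=B" by (rule seminorm_sum_le[OF nan_seminorm subring_UNIV]) auto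
lemma nan_sum_less: "0 < B ==> (!!i. i : I ==> w (f i) < B) ==> w (sum f I) < B" by (rule seminorm_sum_less[OF nan_seminorm subring_UNIV]) auto
lemma nan_prod: "w (prod f I) = (PROD i:I. w (f i))" by (induction I rule: infinite_finite_induct) (auto simp: nan_one nan_mult)
lemma nan_prod_mset: "w (PROD x:#A. f x) = (PROD x:#A. w (f x))" by (induction A) (auto simp: nan_one nan_mult)
lemma nan_poly_le: "w x<=r ==> 0<=r ==> w (poly p x)<=gnorm w r p" using seminorm_poly_le[OF nan_seminorm subring_UNIV coeffs_in_UNIV, of x 1 r p]
 by (simp add: nan_power power_mono nan_nonneg)

end

text \<open>Apply the inequality to x and to its inverse.\<close>

lemma norm_on_eq_of_le:
 assumes K: "is_field K" and w: "norm_on K w" and w': "norm_on K w'"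
  and le: "!!x. x : K ==> w' x<=w x" and x: "x : K"
 shows "w' x = w x"
proof (cases "x = 0")
 case True thus ?thesis using x norm_on_eq_0[OF w x] norm_on_eq_0[OF w' x] by simp
next
 case False
 have i: "inverse x : K" by (rule subfield_inverse[OF K x])
 note R = field_ring[OF K]
 have "w x*w (inverse x) = 1" "w' x*w' (inverse x) = 1"
  using norm_on_mult[OF w x i] norm_on_mult[OF w' x i] norm_on_one[OF w R] norm_on_one[OF w' R] False by auto
 moreover have "w' x*w' (inverse x)<=w' x*w (inverse x)" using le[OF i] norm_on_nonneg[OF w' x] by (rule mult_left_mono)
 moreover have "0 < w (inverse x)" using norm_on_nonneg[OF w i] norm_on_eq_0[OF w i] False by simp
 ultimately have "w x<=w' x" by (metis mult_le_cancel_right_pos)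
 thus ?thesis using le[OF x] by simp
qed

text \<open>The hypothesis on g says that the leading term dominates, so that subtracting multiples of g does not increase the Gauss norm.\<close>

lemma gnorm_division:
 fixes K :: "'a::field set"
 assumes q: "seminorm_on K w" "is_ring K" and g: "coeffs_in K g" "lead_coeff g = 1"
  and r: "0<=r" and gr: "gnorm w r g<=r^degree g"
 shows "coeffs_in K p ==> EX S R. coeffs_in K S & coeffs_in K R & p = S*g+R &
  (R = 0 \<or> degree R < degree g) & gnorm w r R<=gnorm w r p"
proof (induction "degree p" arbitrary: p rule: less_induct)
 case less
 show ?case
 proof (cases "p = 0 \<or> degree p < degree g")
  case True
  thus ?thesis using less.prems q by (intro exI[of _ 0] exI[of _ p]) (auto intro: coeffs_in_0)
 next
  case False
  define a where "a = lead_coeff p"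
  define d where "d = degree p-degree g"
  define m where "m = monom a d"
  define p' where "p' = p-m*g"
  have aK: "a : K" using less.prems by (simp add: a_def coeffs_inD)
  have mK: "coeffs_in K m" using aK q by (simp add: m_def coeffs_in_monom)
  have p'K: "coeffs_in K p'" unfolding p'_def using less.prems mK q g by (intro coeffs_in_diff coeffs_in_mult)
  have "degree (m*g)<=degree m+degree g" by (rule degree_mult_le)
  hence "degree (m*g)<=degree p" using False degree_monom_le[of a d] unfolding m_def d_def by linarith
  hence le: "degree p'<=degree p" unfolding p'_def by (intro degree_diff_le) auto
  have "coeff (m*g) (degree p) = a" using False g(2) by (simp add: m_def d_def coeff_monom_mult)
  hence "coeff p' (degree p) = 0" by (simp add: p'_def a_def)
  hence p'deg: "p' = 0 \<or> degree p' < degree p" using le by (rule eq_zero_or_degree_less[rotated])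
  have "gnorm w r (m*g)<=gnorm w r m*gnorm w r g" by (rule gnorm_mult_le[OF q mK g(1) r])
  also have "gnorm w r m<=w a*r^d"
   by (rule gnorm_le) (use q r aK in \<open>auto simp: m_def seminorm_zero intro!: mult_nonneg_nonneg seminorm_nonneg[OF q(1)]\<close>)
  hence "gnorm w r m*gnorm w r g<=(w a*r^d)*r^degree g" using gr gnorm_nonneg[OF q(1) mK r] gnorm_nonneg[OF q(1) g(1) r] by (intro mult_mono) auto
  also have "... = w a*r^degree p" using False by (simp add: d_def power_add[symmetric])
  also have "... <= gnorm w r p" unfolding a_def by (rule le_gnorm[OF q(1) less.prems r])
  finally have "gnorm w r (m*g)<=gnorm w r p" .
  hence gp': "gnorm w r p'<=gnorm w r p" unfolding p'_def using gnorm_diff[OF q less.prems coeffs_in_mult[OF q(2) mK g(1)] r] by simp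
  show ?thesis
  proof (cases "p' = 0")
   case True
   have "gnorm w r 0<=gnorm w r p" using gp' True by simp
   thus ?thesis using True mK q by (intro exI[of _ m] exI[of _ 0]) (auto simp: p'_def coeffs_in_0)
  next
   case False
   hence "degree p' < degree p" using p'deg by simp
   from less.hyps[OF this p'K] obtain S R where *: "coeffs_in K S" "coeffs_in K R" "p' = S*g+R"
    "R = 0 \<or> degree R < degree g" "gnorm w r R<=gnorm w r p'" by blast
   have "p = (S+m)*g+R" using *(3) by (simp add: p'_def algebra_simps)
   thus ?thesis using * gp' mK q by (intro exI[of _ "S+m"] exI[of _ R]) (auto intro: coeffs_in_add)
  qed
 qed
qed

text \<open>K(y) is the quotient of K[Y] by the minimal polynomial q. For r large the leading term of q dominates, and
by division the quotient of the Gauss norm of radius r is a nonzero seminorm; a multiplicative norm below it extends w.\<close>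

lemma norm_extend_alg:
 fixes K :: "'a::alg_closed_field set"
 assumes K: "is_field K" "infinite K" and w: "norm_on K w" and y: "alg K y"
 shows "EX w'. norm_on (fgen (insert y K)) w' & (ALL x:K. w' x = w x)"
proof -
 note R = field_ring[OF K(1)]
 note s = norm_on_seminorm[OF w R]
 obtain q where q: "is_minpoly K y q" using minpoly_exists[OF K(1) y] by blast
 have qK: "coeffs_in K q" and q1: "lead_coeff q = 1" and qy: "poly q y = 0" using q by (auto simp: is_minpoly_def)
 define n where "n = degree q"
 define r where "r = Max (insert 1 ((%i. w (coeff q i)) ` {..n}))"
 have r1: "1<=r" unfolding r_def by (intro Max_ge) auto
 have wr: "w (coeff q i)<=r" if "i<=n" for i using that unfolding r_def by (intro Max_ge) auto
 have gq: "gnorm w r q<=r^degree q"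
 proof (rule gnorm_le)
  fix i
  consider "i < n" | "i = n" | "i > n" by linarith
  thus "w (coeff q i)*r^i<=r^degree q"
  proof cases
   case 1
   have "w (coeff q i)*r^i<=r*r^i" using wr[of i] 1 r1 by (intro mult_right_mono) auto
   also have "... = r^Suc i" by simp
   also have "... <= r^degree q" using 1 r1 unfolding n_def by (intro power_increasing) auto
   finally show ?thesis .
  next
   case 2 thus ?thesis using q1 norm_on_one[OF w R] by (simp add: n_def)
  next
   case 3 thus ?thesis using r1 by (simp add: n_def coeff_eq_0 seminorm_zero[OF s])
  qed
 qed (use r1 in simp)
 define L where "L = fgen (insert y K)"
 have "EX Q. seminorm_on L Q & (ALL x:K. Q x<=w x) & Q y<=r"
 proof (rule quotient_seminorm[OF s R])
  show "0<=r" using r1 by simp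
  show "L<={poly A y |A. coeffs_in K A}" unfolding L_def fgen_insert_alg[OF K y] by blast
  fix A assume A: "coeffs_in K A" "poly A y = 1"
  have r0: "0<=r" using r1 by simp
  obtain S B where B: "coeffs_in K S" "coeffs_in K B" "A = S*q+B"
   "B = 0 \<or> degree B < degree q" "gnorm w r B<=gnorm w r A" using gnorm_division[OF s R qK q1 r0 gq A(1)] by blast
  have "poly B y = 1" using A(2) B(3) qy by simp
  hence "poly (B-1) y = 0" "coeffs_in K (B-1)" using B R by (auto intro: coeffs_in_diff coeffs_in_1)
  moreover have "B-1~=0 --> degree (B-1) < degree q" using B(4) minpoly_degree_pos[OF q] degree_diff_less[of B "degree q" 1] by auto
  ultimately have "B = 1" using q unfolding is_minpoly_def by (metis eq_iff_diff_eq_0 linorder_not_le)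
  hence "gnorm w r B = 1" using gnorm_const[OF s, of r 1] norm_on_one[OF w R] by (simp add: one_pCons)
  thus "1<=gnorm w r A" using B(5) by simp
 qed
 then obtain Q where Q: "seminorm_on L Q" "!!x. x : K ==> Q x<=w x" by blast
 have L: "is_field L" "K<=L" unfolding L_def using subfield_fgen fgen_superset[of "insert y K"] by auto
 obtain w' where w': "norm_on L w'" "!!x. x : L ==> w' x<=Q x" using multiplicative_below_seminorm[OF L(1) Q(1)] by blast
 have "w' x<=w x" if "x : K" for x using Q(2)[OF that] w'(2)[of x] L that by auto
 hence "w' x = w x" if "x : K" for x using norm_on_eq_of_le[OF K(1) w norm_on_subset[OF w'(1) L(2)]] that by blast
 thus ?thesis using w'(1) unfolding L_def by blast
qed

text \<open>A multiplicative function on a ring that is compatible with h passes to fractions of values of h.\<close>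

lemma norm_extend_image:
 fixes h :: "'l::comm_ring_1 => 'a::field" and mu :: "'l => real"
 assumes B: "is_ring B" and h: "h 1 = 1" "!!x y. x : B ==> y : B ==> h (x-y) = h x-h y & h (x*y) = h x*h y"
  and m: "!!x. x : B ==> 0<=mu x & (mu x = 0 \<longleftrightarrow> h x = 0)"
   "!!x y. x : B ==> y : B ==> mu (x*y) = mu x*mu y & mu (x-y)<=max (mu x) (mu y)"
 shows "EX w. norm_on (fgen (h ` B)) w & (ALL x:B. w (h x) = mu x)"
proof -
 note R = subring_mult[OF B] subring_diff[OF B] subring_add[OF B] subring_uminus[OF B] subring_one[OF B] subring_zero[OF B]
 have h0: "h 0 = 0" using h(2)[of 0 0] R by simp
 have hadd: "h (x+y) = h x+h y" and madd: "mu (x+y)<=max (mu x) (mu y)" if "x : B" "y : B" for x y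
 proof -
  have "mu 0 = 0" using m(1)[of 0] h0 R by simp
  hence "mu (- y)<=mu y" using m(2)[of 0 y] m(1)[of y] R that by simp
  moreover have "h (- y) = - h y" using h(2)[of 0 y] h0 R that by simp
  ultimately show "h (x+y) = h x+h y" "mu (x+y)<=max (mu x) (mu y)" using h(2)[of x "- y"] m(2)[of x "- y"] R(4) that by auto
 qed
 have pos: "0 < mu x" if "x : B" "h x~=0" for x using m(1)[OF that(1)] that(2) by auto
 have hB: "is_ring (h ` B)" unfolding is_ring_def
 proof (intro conjI ballI)
  show "1 : h ` B" using h(1) R(5) by (metis imageI)
  fix x y assume "x : h ` B" "y : h ` B"
  then obtain a b where "a : B" "x = h a" "b : B" "y = h b" by blast
  thus "x-y : h ` B" "x*y : h ` B" using h(2)[of a b] R(1,2)[of a b] by (auto intro: rev_image_eqI)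
 qed
 have "ALL x:fgen (h ` B). EX a b. a : B & b : B & h b~=0 & x = h a/h b" using fgen_quotient[OF hB] by blast
 then obtain a b where ab: "!!x. x : fgen (h ` B) ==> a x : B & b x : B & h (b x)~=0 & x = h (a x)/h (b x)" by metis
 define w where "w x = mu (a x)/mu (b x)" for x
 have eq: "mu x = mu y" if "x : B" "y : B" "h x = h y" for x y
 proof -
  have le: "mu x<=mu y" if "x : B" "y : B" "h x = h y" for x y
  proof -
   have "mu (x-y) = 0" using m(1)[of "x-y"] h(2)[of x y] R(2) that by simp
   thus ?thesis using madd[of "x-y" y] m(1)[of y] R(2) that by simp
  qed
  thus ?thesis using that by (simp add: antisym)
 qed
 have w: "w (h c/h d) = mu c/mu d" if cd: "c : B" "d : B" "h d~=0" for c d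
 proof -
  define q where "q = h c/h d"
  have "q : fgen (h ` B)" using cd fgen_superset[of "h ` B"] unfolding q_def by (intro subfield_divide[OF subfield_fgen]) auto
  note x = ab[OF this]
  have "h c/h d = h (a q)/h (b q)" using x q_def by metis
  hence "h (c*b q) = h (a q*d)" using frac_eq_eq[of "h d" "h (b q)" "h c" "h (a q)"] x cd h(2) by simp
  hence "mu c*mu (b q) = mu (a q)*mu d" using eq[of "c*b q" "a q*d"] m(2) x cd R(1) by simp
  thus ?thesis unfolding w_def q_def[symmetric] using frac_eq_eq[of "mu (b q)" "mu d"] pos[of "b q"] pos[of d] x cd by simp
 qed
 have "norm_on (fgen (h ` B)) w"
 proof (rule norm_onI)
  fix x assume "x : fgen (h ` B)"
  note x = ab[OF this]
  show "0<=w x" "w x = 0 \<longleftrightarrow> x = 0" unfolding w_def using x m(1)[of "a x"] pos[of "b x"] by auto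
  fix y assume "y : fgen (h ` B)"
  note y = ab[OF this]
  have 1: "mu (b x*b y) = mu (b x)*mu (b y)" "0 < mu (b x)" "0 < mu (b y)" "h (b x*b y) = h (b x)*h (b y)" using x y m(2) h(2) pos by auto
  have 2: "b x*b y : B" "a x*b y : B" "a y*b x : B" "a x*a y : B" "h (b x*b y)~=0" using x y R(1) 1(4) by auto
  have "x*y = h (a x*a y)/h (b x*b y)" using x y h(2) by (metis times_divide_times_eq)
  thus "w (x*y) = w x*w y" using w[OF 2(4,1,5)] x y m(2) 1(1) by (simp add: w_def)
  have "x+y = h (a x*b y+a y*b x)/h (b x*b y)" unfolding hadd[OF 2(2,3)] using x y h(2) add_frac_eq[of "h (b x)" "h (b y)" "h (a x)" "h (a y)"] by metis
  hence "w (x+y) = mu (a x*b y+a y*b x)/(mu (b x)*mu (b y))" using w[OF R(3)[OF 2(2,3)] 2(1,5)] 1(1) by simp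
  also have "... <= max (mu (a x)*mu (b y)) (mu (a y)*mu (b x))/(mu (b x)*mu (b y))" using madd[OF 2(2,3)] x y m(2) 1 by (intro divide_right_mono) auto
  also have "... = max (w x) (w y)" using 1 by (simp add: w_def max_def frac_le_eq divide_simps)
  finally show "w (x+y)<=max (w x) (w y)" .
 qed
 moreover have "w (h c) = mu c" if "c : B" for c using w[OF that R(5)] h(1) m(2)[OF R(5,5)] pos[OF R(5)] by simp
 ultimately show ?thesis by blast
qed

lemma norm_extend_transcendental:
 fixes K :: "'a::field set"
 assumes K: "is_field K" and w: "norm_on K w" and t: "~ alg K t" and b: "b : K" and r: "0 < r"
 shows "EX w'. norm_on (fgen (insert t K)) w' & (ALL g. coeffs_in K g --> w' (poly g (t-b)) = gnorm w r g) & (ALL x:K. w' x = w x)"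
proof -
 note R = field_ring[OF K]
 note s = norm_on_seminorm[OF w R]
 define B where "B = {g. coeffs_in K g}"
 have z: "poly g (t-b) = 0 \<longleftrightarrow> g = 0" if "coeffs_in K g" for g
 proof
  assume "poly g (t-b) = 0"
  hence "poly (pcompose g [:-b, 1:]) t = 0" by (simp add: poly_pcompose)
  hence "pcompose g [:-b, 1:] = 0" using t that R b unfolding alg_def by (metis coeffs_in_pcompose coeffs_in_linear)
  thus "g = 0" by (simp add: pcompose_eq_0_iff)
 qed simp
 have "EX w'. norm_on (fgen ((%g. poly g (t-b)) ` B)) w' & (ALL g:B. w' (poly g (t-b)) = gnorm w r g)"
 proof (rule norm_extend_image)
  show "is_ring B" unfolding B_def by (rule coeffs_in_Collect_ring[OF R])
  fix g assume g: "g : B"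
  have "gnorm w r 0 = 0" using gnorm_const[OF s, of r 0] seminorm_zero[OF s] by simp
  thus "0<=gnorm w r g & (gnorm w r g = 0 \<longleftrightarrow> poly g (t-b) = 0)"
   using g z[of g] gnorm_nonneg[OF s, of g r] gnorm_pos[OF w R, of g r] r by (auto simp: B_def)
  fix h assume "h : B"
  thus "gnorm w r (g*h) = gnorm w r g*gnorm w r h & gnorm w r (g-h)<=max (gnorm w r g) (gnorm w r h)"
   using gnorm_mult[OF w R _ _ r] gnorm_diff[OF s R] g r by (simp add: B_def)
 qed auto
 then obtain w' where w': "norm_on (fgen ((%g. poly g (t-b)) ` B)) w'" "!!g. coeffs_in K g ==> w' (poly g (t-b)) = gnorm w r g" by (auto simp: B_def)
 have "poly [:c:] (t-b) : (%g. poly g (t-b)) ` B" if "c : K" for c unfolding B_def using coeffs_in_const[OF R that] by blast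
 moreover have "poly [:b, 1:] (t-b) : (%g. poly g (t-b)) ` B" unfolding B_def
  using b R by (intro imageI CollectI) (simp add: coeffs_in_pCons_iff coeffs_in_0 subring_one)
 ultimately have "fgen (insert t K)<=fgen ((%g. poly g (t-b)) ` B)" by (intro fgen_mono) auto
 moreover have "w' x = w x" if "x : K" for x using w'(2)[OF coeffs_in_const[OF R that]] gnorm_const[OF s, of r x] by simp
 ultimately show ?thesis using w' norm_on_subset by blast
qed

text \<open>By Zorn there is a maximal extension, and a proper subfield can always be enlarged by one algebraic or transcendental element.\<close>

lemma norm_extend:
 fixes K :: "'a::alg_closed_field set"
 assumes K: "is_field K" "infinite K" and w: "norm_on K w"
 shows "EX w'. nonarch_norm w' & (ALL x:K. w' x = w x)"
proof -
 (* A norm on a subfield is encoded by a function that takes the value -1 outside of the subfield. *)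
 define D where "D v = {x. 0<=v x}" for v :: "'a => real"
 define good where "good v \<longleftrightarrow> is_field (D v) & norm_on (D v) v & (ALL x. x ~: D v --> v x = - 1) & (ALL x:K. v x = w x)" for v
 define P where "P a b \<longleftrightarrow> (ALL x:D a. b x = a x)" for a b :: "'a => real"
 have cut: "D (%x. if x : L then v x else - 1) = L" "good (%x. if x : L then v x else - 1)"
  if L: "is_field L" "norm_on L v" "K<=L" "!!x. x : K ==> v x = w x" for L v
 proof -
  show 1: "D (%x. if x : L then v x else - 1) = L" using norm_on_nonneg[OF L(2)] by (auto simp: D_def)
  have "norm_on L (%x. if x : L then v x else - 1)" by (rule norm_on_cong[OF L(2) field_ring[OF L(1)]]) simp
  thus "good (%x. if x : L then v x else - 1)" unfolding good_def 1 using L by auto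
 qed
 have "EX m:{v. good v}. ALL a:{v. good v}. P m a --> a = m"
 proof (rule predicate_Zorn)
  have anti: "a = b" if "good a" "good b" "P a b" "P b a" for a b
  proof
   fix x show "a x = b x" using that unfolding good_def P_def by (cases "x : D a"; cases "x : D b") (metis | simp)+
  qed
  have tr: "P a c" if "P a b" "P b c" for a b c using that by (auto simp: P_def D_def)
  show "partial_order_on {v. good v} (relation_of P {v. good v})"
   unfolding partial_order_on_def preorder_on_def refl_on_def trans_def antisym_def relation_of_def using anti tr by (auto simp: P_def[of x x for x])
  fix C assume "C : Chains (relation_of P {v. good v})"
  hence C: "!!a. a : C ==> good a" "!!a b. a : C ==> b : C ==> P a b \<or> P b a" by (auto simp: Chains_def relation_of_def)
  show "EX u:{v. good v}. ALL a:C. P a u"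
  proof (cases "C = {}")
   case True
   thus ?thesis using cut(2)[OF K(1) w] by auto
  next
   case False
   define u where "u x = (if EX a:C. x : D a then SOME r. EX a:C. x : D a & r = a x else - 1)" for x
   have u: "u x = a x" if a: "a : C" "x : D a" for a x
   proof -
    have "EX b:C. x : D b & u x = b x" using someI_ex[of "%r. EX a:C. x : D a & r = a x"] a by (auto simp: u_def)
    thus ?thesis using C(2) a unfolding P_def by metis
   qed
   have Du: "x : D u \<longleftrightarrow> (EX a:C. x : D a)" for x
   proof
    assume "x : D u"
    thus "EX a:C. x : D a" by (rule contrapos_pp) (simp add: D_def u_def)
   next
    assume "EX a:C. x : D a"
    thus "x : D u" using u by (metis D_def mem_Collect_eq)
   qed
   have two: "EX a:C. x : D a & y : D a" if xy: "x : D u" "y : D u" for x y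
   proof -
    obtain a b where "a : C" "x : D a" "b : C" "y : D b" using xy Du by blast
    thus ?thesis using C(2)[of a b] unfolding P_def D_def by (metis mem_Collect_eq)
   qed
   have g: "is_ring (D a)" "is_field (D a)" "norm_on (D a) a" if "a : C" for a using C(1)[OF that] field_ring by (auto simp: good_def)
   have sf: "is_field (D u)" unfolding is_field_def is_ring_def
   proof (intro conjI ballI)
    obtain a where a: "a : C" using False by auto
    thus "1 : D u" using subring_one[OF g(1)[OF a]] Du by blast
    fix x assume x: "x : D u"
    show "inverse x : D u" using Du[of x] x subfield_inverse[OF g(2)] Du by blast
    fix y assume "y : D u"
    then obtain a where a: "a : C" "x : D a" "y : D a" using two[OF x] by blast
    show "x-y : D u" "x*y : D u" using subring_diff[OF g(1)[OF a(1)] a(2,3)] subring_mult[OF g(1)[OF a(1)] a(2,3)] a(1) Du by blast+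
   qed
   moreover have "norm_on (D u) u"
   proof (rule norm_onI)
    fix x y assume "x : D u" "y : D u"
    then obtain a where a: "a : C" "x : D a" "y : D a" using two by blast
    note n = g(3)[OF a(1)] and v = u[OF a(1)]
    show "0<=u x" "u x = 0 \<longleftrightarrow> x = 0" using norm_on_nonneg[OF n a(2)] norm_on_eq_0[OF n a(2)] by (simp_all add: v[OF a(2)])
    show "u (x*y) = u x*u y" "u (x+y)<=max (u x) (u y)" using norm_on_mult[OF n a(2,3)] norm_on_add[OF n a(2,3)]
     by (simp_all add: v a(2,3) subring_mult[OF g(1)[OF a(1)]] subring_add[OF g(1)[OF a(1)]])
   qed
   moreover have "u x = - 1" if "x ~: D u" for x using that Du by (simp add: u_def)
   moreover have "u x = w x" if x: "x : K" for x
   proof -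
    obtain a where a: "a : C" using False by auto
    hence ax: "a x = w x" using C(1) x by (simp add: good_def)
    hence "x : D a" using norm_on_nonneg[OF w x] by (simp add: D_def)
    thus ?thesis using u[OF a] ax by simp
   qed
   ultimately have "good u" by (simp add: good_def)
   thus ?thesis using u by (auto simp: P_def)
  qed
 qed
 then obtain m where m: "good m" "!!a. good a ==> P m a ==> a = m" by blast
 define L where "L = D m"
 have L: "is_field L" "norm_on L m" and mK: "!!x. x : K ==> m x = w x" using m(1) by (auto simp: good_def L_def)
 have KL: "K<=L" using mK norm_on_nonneg[OF w] by (auto simp: L_def D_def)
 have "y : L" for y
 proof -
  have "EX v. norm_on (fgen (insert y L)) v & (ALL x:L. v x = m x)"
  proof (cases "alg L y")
   case True thus ?thesis by (rule norm_extend_alg[OF L(1) infinite_super[OF KL K(2)] L(2)])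
  next
   case False
   from norm_extend_transcendental[OF L False subring_zero[OF field_ring[OF L(1)]], of 1] show ?thesis by auto
  qed
  then obtain v where v: "norm_on (fgen (insert y L)) v" "!!x. x : L ==> v x = m x" by blast
  define a where "a x = (if x : fgen (insert y L) then v x else - 1)" for x
  have KL': "K<=fgen (insert y L)" "!!x. x : K ==> v x = w x" using KL fgen_ins(2)[of L y] v(2) mK by auto
  have "D a = fgen (insert y L)" "good a" unfolding a_def[abs_def] using cut[OF subfield_fgen v(1) KL'] by blast+
  moreover have "P m a" using v(2) fgen_ins(2)[of L y] by (auto simp: P_def a_def L_def[symmetric])
  ultimately have "fgen (insert y L) = L" using m(2)[of a] by (simp add: L_def)
  thus ?thesis using fgen_ins(3)[of y L] by simp
 qed
 hence "L = UNIV" by auto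
 hence "nonarch_norm m" using L(2) by (simp add: nonarch_norm_iff)
 thus ?thesis using mK by blast
qed

text \<open>The field isomorphism K(y) \<rightarrow> K(b) carries the norm over; the result is then extended to the whole field.\<close>

lemma norm_transport:
 fixes K :: "'a::alg_closed_field set"
 assumes K: "is_field K" "infinite K" and q: "is_minpoly K y q" "poly q b = 0" and w: "nonarch_norm w"
 shows "EX w'. nonarch_norm w' & (ALL g. coeffs_in K g --> w' (poly g y) = w (poly g b)) & (ALL x:K. w' x = w x)"
proof -
 note R = field_ring[OF K(1)]
 define B where "B = {g. coeffs_in K g}"
 have "EX w'. norm_on (fgen ((%g. poly g y) ` B)) w' & (ALL g:B. w' (poly g y) = w (poly g b))"
 proof (rule norm_extend_image)
  show "is_ring B" unfolding B_def by (rule coeffs_in_Collect_ring[OF R])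
  show "0<=w (poly g b) & (w (poly g b) = 0 \<longleftrightarrow> poly g y = 0)" if "g : B" for g
   using that minpoly_conj_zero_iff[OF K(1) q] nan_nonneg[OF w] nan_eq_0[OF w] by (simp add: B_def)
 qed (auto simp: nan_mult[OF w] nan_diff[OF w])
 then obtain w0 where w0: "norm_on (fgen ((%g. poly g y) ` B)) w0" "!!g. coeffs_in K g ==> w0 (poly g y) = w (poly g b)" by (auto simp: B_def)
 have mem: "poly g y : fgen ((%g. poly g y) ` B)" if "coeffs_in K g" for g by (rule subsetD[OF fgen_superset]) (use that in \<open>auto simp: B_def\<close>)
 have "K<=fgen ((%g. poly g y) ` B)" using mem[OF coeffs_in_const[OF R]] by auto
 from norm_extend[OF subfield_fgen infinite_super[OF this K(2)] w0(1)] obtain w' where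
  "nonarch_norm w'" "!!x. x : fgen ((%g. poly g y) ` B) ==> w' x = w0 x" by blast
 moreover from this have "w' (poly g y) = w (poly g b)" if "coeffs_in K g" for g using mem[OF that] w0(2)[OF that] by simp
 moreover from this have "w' x = w x" if "x : K" for x using coeffs_in_const[OF R that] by fastforce
 ultimately show ?thesis by blast
qed

lemma norm_extend_gauss:
 fixes K :: "'a::alg_closed_field set"
 assumes K: "is_field K" "infinite K" and t: "~ alg K t" and w: "nonarch_norm w" and b: "b : K" and r: "0 < r"
 shows "EX w'. nonarch_norm w' & (ALL x:K. w' x = w x) & (ALL g. coeffs_in K g --> w' (poly g (t-b)) = gnorm w r g)"
proof -
 obtain w0 where w0: "norm_on (fgen (insert t K)) w0" "!!g. coeffs_in K g ==> w0 (poly g (t-b)) = gnorm w r g" "!!x. x : K ==> w0 x = w x"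
  using norm_extend_transcendental[OF K(1) nan_norm_on[OF w] t b r] by blast
 from norm_extend[OF subfield_fgen fgen_ins(4)[OF K(2)] w0(1)] obtain w' where
  w': "nonarch_norm w'" "!!x. x : fgen (insert t K) ==> w' x = w0 x" by blast
 note S = field_ring[OF subfield_fgen[of "insert t K"]]
 have "t-b : fgen (insert t K)" using b fgen_ins(2,3) by (intro subring_diff[OF S]) auto
 hence "poly g (t-b) : fgen (insert t K)" if "coeffs_in K g" for g using coeffs_in_mono[OF that fgen_ins(2)] by (intro subring_poly[OF S])
 thus ?thesis using w' w0(2,3) fgen_ins(2)[of K t] by (intro exI[of _ w']) auto
qed

section \<open>Topologies on sets of norms\<close>

definition agree :: "'a set => ('a => real) => ('a => real) => bool" where
 "agree K u w \<longleftrightarrow> (ALL x:K. u x = w x)"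

definition close :: "'a set => real => ('a => real) => ('a => real) => bool" where
 "close Y e u w \<longleftrightarrow> (ALL y:Y. \<bar>u y-w y\<bar> < e)"

text \<open>w lies in the closure of A in the topology of pointwise convergence on K.\<close>

definition near :: "'a set => ('a => real) set => ('a => real) => bool" where
 "near K A w \<longleftrightarrow> (ALL Y e. finite Y & Y<=K & 0 < e --> (EX u:A. close Y e u w))"

text \<open>C is open in U for pointwise convergence on K. This topology does not separate norms that agree on K, and it is
described by subsets of one fixed U since several fields K are compared.\<close>

definition kopen :: "('a => real) set => 'a set => ('a => real) set => bool" where
 "kopen U K C \<longleftrightarrow> C<=U & (ALL w:C. ~ near K (U-C) w)"

definition ext_norms :: "'a::field set => ('a => real) => ('a => real) set" where
 "ext_norms k w0 = {w. nonarch_norm w & agree k w w0}"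

text \<open>The union of the fibres, under restriction to K, that meet C.\<close>

definition sat :: "('a => real) set => 'a set => ('a => real) set => ('a => real) set" where
 "sat U K C = {w:U. EX u:C. agree K u w}"

lemma agree_sym: "agree K u w ==> agree K w u" by (simp add: agree_def)
lemma agree_trans: "agree K u v ==> agree K v w ==> agree K u w" by (simp add: agree_def)
lemma agree_mono: "agree K u w ==> L<=K ==> agree L u w" by (auto simp: agree_def)

lemma ext_norms_nonarch: "w : ext_norms k w0 ==> nonarch_norm w" by (simp add: ext_norms_def)

lemma ext_norms_agree: "w : ext_norms k w0 ==> nonarch_norm u ==> agree K u w ==> k<=K ==> u : ext_norms k w0"
 unfolding ext_norms_def using agree_mono agree_trans by blast

lemma kopen_sub: "kopen U K C ==> C<=U" by (simp add: kopen_def)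

lemma kopenI: "C<=U ==> (!!w. w : C ==> ~ near K (U-C) w) ==> kopen U K C" by (simp add: kopen_def)

lemma kopen_not_near: "kopen U K C ==> w : C ==> ~ near K (U-C) w" by (simp add: kopen_def)

lemma not_near: "finite Y ==> Y<=K ==> 0 < e ==> (!!u. u : A ==> ~ close Y e u w) ==> ~ near K A w" unfolding near_def by blast

lemma kopenE:
 assumes "kopen U K C" "w : C"
 obtains Y e where "finite Y" "Y<=K" "0 < e" "!!u. u : U ==> close Y e u w ==> u : C"
proof -
 obtain Y e where "finite Y" "Y<=K" "0 < e" "!!u. u : U-C ==> ~ close Y e u w" using kopen_not_near[OF assms] unfolding near_def by meson
 thus ?thesis using that[of Y e] by blast
qed

lemma near_mono: "near K A w ==> L<=K ==> A<=B ==> near L B w" unfolding near_def by (meson order.trans subsetD)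

lemma kopen_agree:
 assumes "kopen U K C" "w : C" "u : U" "agree K u w" shows "u : C"
proof (rule kopenE[OF assms(1,2)])
 fix Y e assume Y: "finite Y" "Y<=K" "0 < e" "!!u. u : U ==> close Y e u w ==> u : C"
 have "close Y e u w" using Y(2,3) assms(4) by (auto simp: close_def agree_def subset_iff)
 thus "u : C" using Y(4) assms(3) by blast
qed

lemma kopen_mono: "kopen U K C ==> K<=L ==> kopen U L C" unfolding kopen_def using near_mono by blast

lemma kopen_restrict:
 assumes C: "kopen U K C" and V: "V<=U" shows "kopen V K (C Int V)"
proof (rule kopenI)
 fix w assume "w : C Int V"
 hence "~ near K (U-C) w" using kopen_not_near[OF C] by blast
 thus "~ near K (V-C Int V) w" by (rule contrapos_nn) (erule near_mono, use V in auto)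
qed auto

lemma kopen_local:
 assumes "C<=U" "!!w. w : C ==> EX D. kopen U K D & w : D & D<=C"
 shows "kopen U K C"
proof (rule kopenI[OF assms(1)])
 fix w assume "w : C"
 then obtain D where D: "kopen U K D" "w : D" "D<=C" using assms(2) by blast
 show "~ near K (U-C) w" using kopen_not_near[OF D(1,2)] near_mono[of K "U-C" w K "U-D"] D(3) by blast
qed

lemma close_mono: "close Y e u w ==> Z<=Y ==> e<=d ==> close Z d u w" unfolding close_def by fastforce

lemma kopen_Int:
 assumes "kopen U K C" "kopen U K D" shows "kopen U K (C Int D)"
proof (rule kopenI)
 fix w assume w: "w : C Int D"
 obtain Y e where Y: "finite Y" "Y<=K" "0 < e" "!!u. u : U ==> close Y e u w ==> u : C" using kopenE[OF assms(1) IntD1[OF w]] by metis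
 obtain Z d where Z: "finite Z" "Z<=K" "0 < d" "!!u. u : U ==> close Z d u w ==> u : D" using kopenE[OF assms(2) IntD2[OF w]] by metis
 have "u : C Int D" if "u : U" "close (Y Un Z) (min e d) u w" for u
  using Y(4)[OF that(1) close_mono[OF that(2)]] Z(4)[OF that(1) close_mono[OF that(2)]] by simp
 thus "~ near K (U-C Int D) w" using Y Z by (intro not_near[of "Y Un Z" K "min e d"]) auto
qed (use kopen_sub[OF assms(1)] in blast)

lemma kopen_less: assumes "x : K" shows "kopen U K {u:U. u x < (c::real)}"
proof (rule kopenI)
 fix w assume "w : {u:U. u x < c}"
 thus "~ near K (U-{u:U. u x < c}) w" using assms by (intro not_near[of "{x}" K "c-w x"]) (auto simp: close_def)
qed auto

lemma kopen_ball:
 assumes Y: "finite Y" "Y<=K"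
 shows "kopen U K {u:U. close Y e u w}"
proof (rule kopenI)
 fix v assume v: "v : {u:U. close Y e u w}"
 define d where "d = Min (insert 1 ((%y. e - \<bar>v y-w y\<bar>) ` Y))"
 have d: "0 < d" "!!y. y : Y ==> d<=e - \<bar>v y-w y\<bar>" unfolding d_def using Y v by (auto simp: close_def)
 have "close Y e u w" if "close Y d u v" for u unfolding close_def
 proof
  fix y assume y: "y : Y"
  have "\<bar>u y-v y\<bar> < d" using that y by (simp add: close_def)
  thus "\<bar>u y-w y\<bar> < e" using d(2)[OF y] by linarith
 qed
 thus "~ near K (U-{u:U. close Y e u w}) v" by (intro not_near[OF Y d(1)]) blast
qed auto

lemma sat_sub: "sat U K C<=U" by (auto simp: sat_def)

lemma sat_sat:
 assumes "K<=L" "C<=U" shows "sat U K (sat U L C) = sat U K C"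
proof (intro equalityI subsetI)
 fix w assume "w : sat U K (sat U L C)"
 then obtain v u where v: "w : U" "agree K v w" "u : C" "agree L u v" by (auto simp: sat_def)
 have "agree K u w" using agree_trans[OF agree_mono[OF v(4) assms(1)] v(2)] .
 thus "w : sat U K C" using v by (auto simp: sat_def)
next
 fix w assume "w : sat U K C"
 then obtain u where u: "w : U" "agree K u w" "u : C" by (auto simp: sat_def)
 hence "u : sat U L C" using assms by (auto simp: sat_def agree_def)
 thus "w : sat U K (sat U L C)" using u by (auto simp: sat_def)
qed

lemma sat_mono: "C<=D ==> sat U K C<=sat U K D" by (auto simp: sat_def)

section \<open>Norms and conjugate elements\<close>

lemma gnorm_prod_linear:
 assumes w: "nonarch_norm w" and r: "0 < r"
 shows "gnorm w r (PROD x:#A. [:-x, 1:]) = (PROD x:#A. max r (w x))"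
proof (induction A)
 case empty
 thus ?case using gnorm_const[OF nan_seminorm[OF w], of r 1] by (simp add: one_pCons nan_one[OF w])
next
 case (add x A)
 thus ?case using gnorm_mult[OF nan_norm_on[OF w] subring_UNIV coeffs_in_UNIV coeffs_in_UNIV r, of "[:-x, 1:]"] r
  by (simp add: gnorm_linear nan_one[OF w] nan_minus[OF w] del: mult_pCons_left)
qed

text \<open>The logarithm of the product is piecewise linear in the logarithm of r, with breaks at the values f(x).\<close>

lemma locally_monomial:
 fixes f :: "'b => real"
 assumes "0 < s" "!!x. x :# A ==> 0<=f x & f x~=s"
 shows "EX C m a b. 0 < C & 0 < a & a < s & s < b & (ALL r. a<=r & r<=b --> (PROD x:#A. max r (f x)) = C*r^m)" using assms(2)
proof (induction A)
 case empty
 thus ?case using assms(1) by (intro exI[of _ 1] exI[of _ 0] exI[of _ "s/2"] exI[of _ "s+1"]) auto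
next
 case (add x A)
 then obtain C m a b where *: "0 < C" "0 < a" "a < s" "s < b" "!!r. a<=r ==> r<=b ==> (PROD x:#A. max r (f x)) = C*r^m" by auto
 consider "f x < s" | "s < f x" using add.prems[of x] by fastforce
 thus ?case
 proof cases
  case 1
  thus ?thesis using * by (intro exI[of _ C] exI[of _ "Suc m"] exI[of _ "max a (f x)"] exI[of _ b]) (auto simp: max_def)
 next
  case 2
  thus ?thesis using * assms(1) by (intro exI[of _ "f x * C"] exI[of _ m] exI[of _ a] exI[of _ "min b (f x)"]) auto
 qed
qed

text \<open>Near s the Gauss norm of the product is a monomial C r^m in r. Every coefficient whose exponent is
not m lies strictly below C s^m, since otherwise it would exceed C r^m for r slightly smaller or slightly larger than s.\<close>

lemma dominant_coeff_prod_linear: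
 assumes w: "nonarch_norm w" and s: "0 < s" and A: "\<forall>b\<in>#A. w b~=s"
 shows "EX i0. ALL i. i~=i0 --> w (coeff (PROD x:#A. [:-x, 1:]) i) * s^i < w (coeff (PROD x:#A. [:-x, 1:]) i0) * s^i0"
proof -
 define D where "D = (PROD x:#A. [:-x, 1:])"
 obtain C m a b where m: "0 < C" "0 < a" "a < s" "s < b" "!!r. a<=r ==> r<=b ==> (PROD x:#A. max r (w x)) = C*r^m"
  using locally_monomial[OF s, of A w] A nan_nonneg[OF w] by metis
 have g: "gnorm w r D = C*r^m" if "a<=r" "r<=b" for r using m(2,5) that gnorm_prod_linear[OF w, of r A] by (simp add: D_def)
 have le: "w (coeff D i)*r^i<=C*r^m" if "a<=r" "r<=b" for r i using le_gnorm[OF nan_seminorm[OF w] coeffs_in_UNIV, of r D i] g[OF that] m(2) that by simp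
 have top: "i = m" if i: "w (coeff D i) * s^i = C * s^m" for i
 proof -
  have "(r/s)^i<=(r/s)^m" if r: "a<=r" "r<=b" for r
  proof -
   have "w (coeff D i)*r^i * s^i<=C*r^m * s^i" using le[OF r] s by (intro mult_right_mono) auto
   hence "C*(s^m*r^i)<=C*(r^m * s^i)" by (metis i mult.assoc mult.commute mult.left_commute)
   thus ?thesis using m(1) s by (simp add: power_divide field_simps)
  qed
  note le = this[of b] this[of a]
  have "i<=m" using le(1) m s by (simp add: power_increasing_iff)
  moreover have "m<=i" using le(2) m s by (simp add: power_decreasing_iff)
  ultimately show ?thesis by simp
 qed
 have sb: "a<=s" "s<=b" using m by auto
 obtain i0 where "gnorm w s D = w (coeff D i0) * s^i0" using gnorm_attained by metis
 hence i0: "w (coeff D i0) * s^i0 = C * s^m" using g[OF sb] by simp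
 have "w (coeff D i) * s^i < w (coeff D i0) * s^i0" if "i~=i0" for i using le[OF sb, of i] top[of i] top[OF i0] that unfolding i0 by fastforce
 thus ?thesis unfolding D_def by blast
qed

text \<open>If w'(x) is not the value of a root, one term of D dominates at this value with respect to w, hence
with respect to w', and D(x) cannot vanish.\<close>

lemma norm_in_conjugate_norms:
 fixes K :: "'a::alg_closed_field set"
 assumes w: "nonarch_norm w" "nonarch_norm w'" and D: "!!i. w' (coeff D i) = w (coeff D i)"
  and A: "D = (PROD x:#A. [:-x, 1:])" and x: "poly D x = 0"
 shows "\<exists>b\<in>#A. w b = w' x"
proof (cases "x = 0")
 case True
 have "coeff D 0 = 0" using x True by (simp add: poly_0_coeff_0)
 hence "0 :# A" using poly_prod_linear_eq_0_iff[of A 0] A by (simp add: poly_0_coeff_0)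
 thus ?thesis using True nan_zero[OF w(1)] nan_zero[OF w(2)] by metis
next
 case False
 define s where "s = w' x"
 have s: "0 < s" using False nan_pos[OF w(2)] by (simp add: s_def)
 show ?thesis
 proof (rule ccontr)
  assume "~ ?thesis"
  hence "\<forall>b\<in>#A. w b~=s" by (auto simp: s_def)
  from dominant_coeff_prod_linear[OF w(1) s this] obtain i0 where
   i0: "!!i. i~=i0 ==> w (coeff D i) * s^i < w (coeff D i0) * s^i0" unfolding A by blast
  define m where "m = w (coeff D i0) * s^i0"
  have "0<=w (coeff D (Suc i0)) * s^Suc i0" using nan_nonneg[OF w(1)] s by simp
  hence m0: "0 < m" using i0[of "Suc i0"] by (simp add: m_def)
  have t: "w' (coeff D i*x^i) = w (coeff D i) * s^i" for i by (simp add: nan_mult[OF w(2)] nan_power[OF w(2)] D s_def)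
  have "i0<=degree D" using m0 nan_zero[OF w(1)] by (intro le_degree) (auto simp: m_def)
  hence "poly D x = (SUM i:{..degree D}-{i0}. coeff D i*x^i)+coeff D i0*x^i0"
   unfolding poly_altdef using sum.remove[of "{..degree D}" i0 "%i. coeff D i*x^i"] by (simp add: add.commute)
  moreover have "w' (SUM i:{..degree D}-{i0}. coeff D i*x^i) < w' (coeff D i0*x^i0)" using m0 i0 by (intro nan_sum_less[OF w(2)]) (auto simp: t m_def)
  ultimately have "w' (poly D x) = w' (coeff D i0*x^i0)" using nan_dominant[OF w(2)] by simp
  thus False using x m0 by (simp add: t m_def[symmetric] nan_zero[OF w(2)])
 qed
qed

lemma finite_power_coincidences:
 fixes a b c d :: real
 assumes pos: "0 < a" "0 < b" "0 < c" "0 < d" and ne: "a~=b \<or> c~=d"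
 shows "finite {n::nat. a^n*c = b^n*d}"
proof (cases "a = b")
 case True
 hence "{n::nat. a^n*c = b^n*d} = {}" using ne pos by auto
 thus ?thesis by simp
next
 case False
 have "n = m" if n: "a^n*c = b^n*d" "a^m*c = b^m*d" for n m :: nat
 proof -
  have "(a/b)^n = d/c" "(a/b)^m = d/c" using n pos by (auto simp: power_divide field_simps)
  hence "ln ((a/b)^n) = ln ((a/b)^m)" by simp
  hence "real n*ln (a/b) = real m*ln (a/b)" using pos by (simp add: ln_realpow)
  moreover have "ln (a/b)~=0" using False pos by (simp add: ln_div)
  ultimately show ?thesis by simp
 qed
 hence "{n::nat. a^n*c = b^n*d}<={SOME n. a^n*c = b^n*d}" by (auto intro: someI2)
 thus ?thesis by (rule finite_subset) simp
qed

text \<open>Given x for the earlier pairs and x0 for the new one, x^n x0 works for all but finitely many n.\<close>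

lemma separating_element:
 fixes M :: "'m::comm_monoid_mult set" and P :: "(('m => real) \<times> ('m => real)) set"
 assumes M: "1 : M" "!!x y. x : M ==> y : M ==> x*y : M"
 shows "finite P ==> (!!u v. (u, v) : P ==> EX x:M. u x~=v x) ==>
  (!!u v x. (u, v) : P ==> x : M ==> 0 < u x & 0 < v x) ==>
  (!!u v x y. (u, v) : P ==> x : M ==> y : M ==> u (x*y) = u x*u y & v (x*y) = v x * v y) ==>
  EX x:M. ALL (u, v):P. u x~=v x"
proof (induction P rule: finite_induct)
 case empty
 thus ?case using M by auto
next
 case (insert p P)
 obtain u0 v0 where p: "p = (u0, v0)" by (cases p)
 have "EX x:M. ALL (u, v):P. u x~=v x" by (rule insert.IH) (use insert.prems in blast)+
 then obtain x where x: "x : M" "!!u v. (u, v) : P ==> u x~=v x" by auto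
 obtain x0 where x0: "x0 : M" "u0 x0~=v0 x0" using insert.prems(1)[of u0 v0] p by auto
 have pow: "x^n : M" for n by (induction n) (auto intro: M x)
 have powu: "u (x^n) = u x^n & v (x^n) = v x^n" if uv: "(u, v) : insert p P" for u v n
 proof (induction n)
  case 0
  have "u (1*1) = u 1*u 1 & v (1*1) = v 1 * v 1" "0 < u 1 & 0 < v 1" using insert.prems(3)[OF uv M(1) M(1)] insert.prems(2)[OF uv M(1)] by blast+
  thus ?case by simp
 next
  case (Suc n)
  thus ?case using insert.prems(3)[OF uv x(1) pow[of n]] by simp
 qed
 define bad where "bad = (%(u :: 'm => real, v :: 'm => real). {n::nat. u x^n*u x0 = v x^n * v x0})"
 have "finite (bad (u, v))" if uv: "(u, v) : insert p P" for u v
 proof -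
  have "u x~=v x \<or> u x0~=v x0" using uv x(2) x0 p by auto
  thus ?thesis using insert.prems(2)[OF uv x(1)] insert.prems(2)[OF uv x0(1)] unfolding bad_def by (auto intro!: finite_power_coincidences)
 qed
 hence "finite (UN z:insert p P. bad z)" using insert.hyps by (intro finite_UN_I) auto
 then obtain n where n: "n ~: (UN z:insert p P. bad z)" using ex_new_if_finite[OF infinite_UNIV_nat] by blast
 have "u (x^n*x0)~=v (x^n*x0)" if uv: "(u, v) : insert p P" for u v
 proof -
  have "n ~: bad (u, v)" using n uv by blast
  thus ?thesis using insert.prems(3)[OF uv pow[of n] x0(1)] powu[OF uv, of n] by (simp add: bad_def)
 qed
 thus ?case using M(2)[OF pow x0(1)] by (intro bexI[of _ "x^n*x0"]) auto
qed

text \<open>Two norms that agree on K differ on K(y) by a conjugation. Each single element g(y) has the same value as some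
conjugate g(b); if no b worked for all g, one g could be chosen that fails for all b at the same time.\<close>

lemma norms_conjugate:
 fixes K :: "'a::alg_closed_field set"
 assumes K: "is_field K" "infinite K" and q: "is_minpoly K y q"
  and w: "nonarch_norm w" "nonarch_norm w'" "agree K w' w"
 shows "EX b. poly q b = 0 & (ALL g. coeffs_in K g --> w' (poly g y) = w (poly g b))"
proof (rule ccontr)
 assume neg: "~ ?thesis"
 note R = field_ring[OF K(1)]
 have qK: "coeffs_in K q" and q1: "lead_coeff q = 1" and qy: "poly q y = 0" using q by (auto simp: is_minpoly_def)
 obtain A where A: "q = (PROD x:#A. [:-x, 1:])" using splits_monic[OF q1] by blast
 have rootA: "poly q b = 0 \<longleftrightarrow> b :# A" for b by (simp add: A poly_prod_linear_eq_0_iff)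
 have zero: "poly g b = 0 \<longleftrightarrow> poly g y = 0" if "b :# A" "coeffs_in K g" for g b
  using minpoly_conj_zero_iff[OF K(1) q _ that(2)] that(1) rootA by blast
 have hit: "\<exists>b\<in>#A. w (poly g b) = w' (poly g y)" if g: "coeffs_in K g" for g
 proof -
  define B where "B = image_mset (poly g) A"
  define D where "D = (PROD x:#B. [:-x, 1:])"
  have "coeffs_in K D" unfolding D_def B_def using coeffs_in_conj_poly[OF K _ g, of A] qK A by (simp add: image_mset.compositionality comp_def)
  hence "w' (coeff D i) = w (coeff D i)" for i using w(3) by (auto simp: coeffs_in_def agree_def)
  moreover have "poly D (poly g y) = 0" unfolding D_def poly_prod_linear_eq_0_iff B_def using rootA qy by auto
  ultimately show ?thesis using norm_in_conjugate_norms[OF w(1,2) _ D_def] by (auto simp: B_def)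
 qed
 define M where "M = {g. coeffs_in K g & poly g y~=0}"
 define P where "P = (%b. (%g. w' (poly g y), %g. w (poly g b))) ` set_mset A"
 have "EX g:M. ALL (u, v):P. u g~=v g"
 proof (rule separating_element)
  show "1 : M" using R by (auto simp: M_def coeffs_in_1)
  show "g*h : M" if "g : M" "h : M" for g h using that R by (auto simp: M_def intro: coeffs_in_mult)
  show "finite P" by (simp add: P_def)
 next
  fix u v assume "(u, v) : P"
  then obtain b where b: "b :# A" "u = (%g. w' (poly g y))" "v = (%g. w (poly g b))" by (auto simp: P_def)
  obtain g where g: "coeffs_in K g" "w' (poly g y)~=w (poly g b)" using neg b(1) rootA by blast
  have "poly g y~=0" using g zero[OF b(1) g(1)] nan_zero[OF w(1)] nan_zero[OF w(2)] by auto
  thus "EX x:M. u x~=v x" using g b by (auto simp: M_def)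
 next
  fix u v g assume "(u, v) : P" "g : M"
  then obtain b where b: "b :# A" "u = (%g. w' (poly g y))" "v = (%g. w (poly g b))" by (auto simp: P_def)
  show "0 < u g & 0 < v g" using \<open>g : M\<close> b zero[OF b(1), of g] nan_pos[OF w(1)] nan_pos[OF w(2)] by (auto simp: M_def)
 next
  fix u v g h assume "(u, v) : P"
  thus "u (g*h) = u g*u h & v (g*h) = v g * v h" by (auto simp: P_def nan_mult[OF w(1)] nan_mult[OF w(2)])
 qed
 then obtain g where "coeffs_in K g" "!!b. b :# A ==> w' (poly g y)~=w (poly g b)" by (auto simp: M_def P_def)
 thus False using hit by metis
qed

section \<open>Restriction of norms along algebraic extensions\<close>

lemma root_bound:
 assumes w: "nonarch_norm w" and p: "lead_coeff p = 1" "poly p x = 0"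
  and m: "1<=m" "!!i. i < degree p ==> w (coeff p i)<=m"
 shows "w x<=m"
proof (rule ccontr)
 assume "~ w x<=m"
 hence gt: "m < w x" by simp
 define n where "n = degree p"
 have n0: "n > 0"
 proof (rule ccontr)
  assume "~ n > 0"
  then obtain c where "p = [:c:]" unfolding n_def by (auto elim: degree_eq_zeroE)
  thus False using p by simp
 qed
 have "w (SUM i:{..<n}. coeff p i*x^i) < w (x^n)"
 proof (rule nan_sum_less[OF w])
  show pos: "0 < w (x^n)" using gt m by (simp add: nan_power[OF w])
  fix i assume i: "i : {..<n}"
  have "w (coeff p i*x^i) = w (coeff p i)*w x^i" by (simp add: nan_mult[OF w] nan_power[OF w])
  also have "... <= m*w x^i" using m(2)[of i] i gt m by (intro mult_right_mono) (auto simp: n_def)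
  also have "... <= m*w x^(n-1)" using i gt m by (intro mult_left_mono power_increasing) auto
  also have "... < w x*w x^(n-1)" using gt m by (intro mult_strict_right_mono) auto
  also have "... = w (x^n)" using n0 power_eq_if[of "w x" n] by (simp add: nan_power[OF w])
  finally show "w (coeff p i*x^i) < w (x^n)" .
 qed
 moreover have "poly p x = (SUM i:{..<n}. coeff p i*x^i)+x^n" using p(1) by (simp add: poly_altdef n_def flip: lessThan_Suc_atMost)
 ultimately have "w (poly p x) = w (x^n)" using nan_dominant[OF w] by simp
 thus False using p(2) gt m by (simp add: nan_zero[OF w] nan_power[OF w])
qed

lemma compact_PiE_UNIV:
 fixes S :: "'i => 'b::topological_space set"
 assumes "!!i. compact (S i)"
 shows "compact (PiE UNIV S)"
proof -
 have "compactin (product_topology (%i. euclidean) UNIV) (PiE UNIV S)" unfolding compactin_PiE using assms by (simp add: compactin_euclidean_iff)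
 thus ?thesis by (simp add: euclidean_product_topology compactin_euclidean_iff)
qed

lemma open_close_set: "finite Z ==> open {f :: 'a => real. close Z e f u}"
proof -
 assume Z: "finite Z"
 have "{f. close Z e f u} = (INT z:Z. (%f. f z) -` {u z-e<..<u z+e})" by (auto simp: close_def abs_diff_less_iff)
 moreover have "open ((%f :: 'a => real. f z) -` {u z-e<..<u z+e})" for z
  using continuous_on_product_coordinates[of z] open_vimage open_greaterThanLessThan by blast
 ultimately show ?thesis using Z by auto
qed

lemma near_sequence:
 assumes "near K A w" "finite Z" "Z<=K"
 shows "EX u. (ALL n. u n : A) & (ALL z:Z. (%n::nat. u n z) \<longlonglongrightarrow> w z)"
proof -
 have "EX u:A. close Z (inverse (real (Suc n))) u w" for n
 proof -
  have "finite Z & Z<=K & 0 < inverse (real (Suc n))" using assms by simp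
  thus ?thesis using assms(1) unfolding near_def by blast
 qed
 then obtain u where u: "!!n. u n : A" "!!n. close Z (inverse (real (Suc n))) (u n) w" by metis
 have "(%n. u n z) \<longlonglongrightarrow> w z" if z: "z : Z" for z
 proof (rule LIM_zero_cancel, rule Lim_null_comparison)
  show "\<forall>\<^sub>F n in sequentially. norm (u n z-w z)<=inverse (real (Suc n))"
   using u(2) z by (intro always_eventually) (auto simp: close_def less_imp_le)
  show "(%n. inverse (real (Suc n))) \<longlonglongrightarrow> 0" by (rule LIMSEQ_inverse_real_of_nat)
 qed
 thus ?thesis using u(1) by blast
qed

text \<open>A closure point on K lifts to a closure point on the algebraic closure of K. Norms near w on the coefficients of
the minimal polynomial of x are bounded at x, so that Tychonoff gives a cluster point.\<close>

lemma near_cluster: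
 fixes K :: "'a::alg_closed_field set"
 assumes K: "is_field K" "infinite K" and A: "!!u. u : A ==> nonarch_norm u"
  and w: "near K A w"
 shows "EX v. nonarch_norm v & agree K v w & near (acl K) A v"
proof -
 define L where "L = acl K"
 have L: "is_field L" "K<=L" using subfield_acl[OF K] subset_acl[OF field_ring[OF K(1)]] by (auto simp: L_def)
 have L': "infinite L" by (rule infinite_super[OF L(2) K(2)])
 define mp where "mp x = (SOME q. is_minpoly K x q)" for x
 have mp: "is_minpoly K x (mp x)" if "x : L" for x
  unfolding mp_def by (rule someI_ex, rule minpoly_exists[OF K(1)]) (use that in \<open>simp add: L_def acl_def\<close>)
 define cs where "cs x = coeff (mp x) ` {..degree (mp x)}" for x
 have cs: "finite (cs x)" "x : L ==> cs x<=K" for x using mp[of x] by (auto simp: cs_def is_minpoly_def coeffs_in_def)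
 define B where "B x = 1+(SUM c:cs x. \<bar>w c\<bar> + 1)" for x
 have B1: "1<=B x" for x unfolding B_def by (simp add: sum_nonneg)
 have bound: "u x<=B x" if "nonarch_norm u" "x : L" "close (cs x) 1 u w" for u x
 proof (rule root_bound[OF that(1) _ _ B1])
  show "lead_coeff (mp x) = 1" "poly (mp x) x = 0" using mp[OF that(2)] by (auto simp: is_minpoly_def)
  fix i assume "i < degree (mp x)"
  hence c: "coeff (mp x) i : cs x" by (auto simp: cs_def)
  hence "u (coeff (mp x) i)<=\<bar>w (coeff (mp x) i)\<bar> + 1" using that(3) by (auto simp: close_def abs_less_iff)
  also have "... <= (SUM c:cs x. \<bar>w c\<bar> + 1)" using c cs by (intro member_le_sum) auto
  finally show "u (coeff (mp x) i)<=B x" by (simp add: B_def)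
 qed
 define r where "r u = (%x. if x : L then min (u x) (B x) else 0)" for u :: "'a => real"
 define T where "T = (%(Y, e). closure (r ` {u:A. close Y e u w}))"
 define I where "I = {(Y :: 'a set, e :: real). finite Y & Y<=K & 0 < e}"
 define box where "box = PiE UNIV (%x. {0..B x})"
 have "box Int (INT i:I. T i)~={}"
 proof (rule compact_imp_fip_image)
  show "compact box" unfolding box_def by (rule compact_PiE_UNIV) simp
  show "closed (T i)" for i by (auto simp: T_def split: prod.split)
  fix J assume J: "finite J" "J<=I"
  define Y where "Y = (\<Union>(fst ` J))"
  define e where "e = Min (insert 1 (snd ` J))"
  have JI: "finite Z & Z<=K & 0 < d" if "(Z, d) : J" for Z d using subsetD[OF J(2) that] by (simp add: I_def)
  have "finite Y" unfolding Y_def using J(1) JI by (intro finite_Union) auto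
  moreover have "Y<=K" unfolding Y_def using JI by fastforce
  moreover have "0 < e" unfolding e_def using J(1) JI by (subst Min_gr_iff) auto
  ultimately obtain u where u: "u : A" "close Y e u w" using w unfolding near_def by meson
  have B0: "0<=B x" for x using B1[of x] by simp
  have "r u : box" using nan_nonneg[OF A[OF u(1)]] B0 by (auto simp: box_def r_def PiE_def)
  moreover have "r u : T i" if i: "i : J" for i
  proof -
   obtain Z d where Z: "i = (Z, d)" by (cases i)
   have "Z<=Y" using i Z by (force simp: Y_def)
   moreover have "e<=d" unfolding e_def using J(1) i Z by (intro Min_le) force+
   ultimately have "close Z d u w" using close_mono[OF u(2)] by simp
   thus ?thesis using u(1) Z by (auto simp: T_def intro!: subsetD[OF closure_subset])
  qed
  ultimately show "box Int (INT i:J. T i)~={}" by auto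
 qed
 then obtain v where v: "!!i. i : I ==> v : T i" by auto
 have approx: "EX u:A. close Z e u v & close Y e u w" if Z: "finite Z" "Z<=L" and Y: "finite Y" "Y<=K" and e: "0 < e" for Z Y e
 proof -
  define Y' where "Y' = Y Un (UN z:Z. cs z)"
  define d where "d = min e 1"
  have "Y'<=K" unfolding Y'_def using Y(2) cs(2) Z(2) by blast
  moreover have "finite Y'" "0 < d" using Z Y cs(1) e by (auto simp: Y'_def d_def)
  ultimately have "(Y', d) : I" by (simp add: I_def)
  from v[OF this] have "v : closure (r ` {u:A. close Y' d u w})" by (simp add: T_def)
  moreover have "v : {f. close Z e f v}" using e by (simp add: close_def)
  ultimately have "v : {f. close Z e f v} Int closure (r ` {u:A. close Y' d u w})" by (rule IntI[rotated])
  hence "{f. close Z e f v} Int closure (r ` {u:A. close Y' d u w})~={}" by (metis emptyE)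
  hence "{f. close Z e f v} Int r ` {u:A. close Y' d u w}~={}" unfolding open_Int_closure_eq_empty[OF open_close_set[OF Z(1)]] .
  then obtain u where u: "u : A" "close Y' d u w" "close Z e (r u) v" by auto
  have "r u z = u z" if z: "z : Z" for z
  proof -
   have "close (cs z) 1 u w" using close_mono[OF u(2), of "cs z" 1] z by (auto simp: Y'_def d_def)
   thus ?thesis using bound[OF A[OF u(1)], of z] z Z by (auto simp: r_def)
  qed
  hence "close Z e u v" using u(3) by (simp add: close_def)
  moreover have "close Y e u w" using close_mono[OF u(2), of Y e] by (simp add: Y'_def d_def)
  ultimately show ?thesis using u(1) by blast
 qed
 have nL: "near L A v" unfolding near_def using approx[of _ "{}"] by (metis empty_subsetI finite.emptyI)
 have agr: "v x = w x" if x: "x : K" for x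
 proof (rule ccontr)
  assume "v x~=w x"
  hence "0 < \<bar>v x-w x\<bar>/2" by simp
  from approx[of "{x}" "{x}", OF _ _ _ _ this] obtain u where
   "close {x} (\<bar>v x-w x\<bar>/2) u v" "close {x} (\<bar>v x-w x\<bar>/2) u w" using x L by auto
  thus False unfolding close_def by (simp add: abs_if split: if_splits)
 qed
 note RL = field_ring[OF L(1)]
 have lim: "0<=v x" "v 0 = 0" "v 1 = 1" "v (x*y) = v x * v y" "v (x+y)<=max (v x) (v y)" if xy: "x : L" "y : L" for x y
 proof -
  have "finite {0, 1, x, y, x*y, x+y}" "{0, 1, x, y, x*y, x+y}<=L" using xy RL by (auto simp: subring_closed)
  from near_sequence[OF nL this] obtain u where u: "!!n::nat. nonarch_norm (u n)" and
   l: "!!z. z : {0, 1, x, y, x*y, x+y} ==> (%n. u n z) \<longlonglongrightarrow> v z" using A by blast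
  have "(%n. 0 :: real) \<longlonglongrightarrow> v 0" "(%n. 1 :: real) \<longlonglongrightarrow> v 1" using l[of 0] l[of 1] by (simp_all add: nan_zero[OF u] nan_one[OF u])
  thus "v 0 = 0" "v 1 = 1" by (simp_all add: LIMSEQ_const_iff)
  show "0<=v x" using nan_nonneg[OF u] by (intro LIMSEQ_le_const[OF l[of x]]) auto
  have "(%n. u n (x*y)) \<longlonglongrightarrow> v x * v y" unfolding nan_mult[OF u] using l by (intro tendsto_mult) auto
  thus "v (x*y) = v x * v y" using LIMSEQ_unique l[of "x*y"] by auto
  have "(%n. max (u n x) (u n y)) \<longlonglongrightarrow> max (v x) (v y)" using l by (intro tendsto_max) auto
  thus "v (x+y)<=max (v x) (v y)" using l[of "x+y"] nan_add[OF u] by (intro LIMSEQ_le[of "%n. u n (x+y)"]) auto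
 qed
 have "norm_on L v"
 proof (rule norm_onI)
  show "v x = 0 \<longleftrightarrow> x = 0" if x: "x : L" for x using lim(2-4)[OF x subfield_inverse[OF L(1) x]] by (cases "x = 0") auto
 qed (use lim in auto)
 from norm_extend[OF L(1) L' this] obtain v' where v': "nonarch_norm v'" "!!x. x : L ==> v' x = v x" by blast
 have "near L A v'" unfolding near_def
 proof (intro allI impI)
  fix Y e assume Y: "finite Y & Y<=L & 0 < (e::real)"
  then obtain u where u: "u : A" "close Y e u v" using nL unfolding near_def by meson
  have "close Y e u v'" using u(2) Y v'(2) by (auto simp: close_def subset_iff)
  thus "EX u:A. close Y e u v'" using u(1) by blast
 qed
 moreover have "agree K v' w" using v'(2) agr L(2) by (auto simp: agree_def)
 ultimately show ?thesis using v'(1) unfolding L_def by blast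
qed

context
 fixes k :: "'a::alg_closed_field set" and w0 :: "'a => real" and U
 defines "U == ext_norms k w0"
begin

text \<open>Restriction of norms from K(y) to K is open. If w1 in C lies above w, and w is a limit of norms v', then a cluster
point of the v' agrees with w on K. Hence it is conjugate to w1, and transporting the v' along this conjugation
brings them close to w1.\<close>

lemma kopen_sat_insert:
 assumes K: "is_field K" "infinite K" "k<=K" and y: "alg K y"
  and C: "kopen U (fgen (insert y K)) C"
 shows "kopen U K (sat U K C)"
proof (rule kopenI)
 show "sat U K C<=U" by (rule sat_sub)
 fix w assume "w : sat U K C"
 then obtain w1 where w1: "w1 : C" "agree K w1 w" by (auto simp: sat_def)
 show "~ near K (U-sat U K C) w"
 proof
  assume n: "near K (U-sat U K C) w"
  obtain v where v: "nonarch_norm v" "agree K v w" "near (acl K) (U-sat U K C) v" using near_cluster[OF K(1,2) _ n] by (auto simp: U_def ext_norms_def)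
  have w1U: "w1 : U" "nonarch_norm w1" using w1(1) kopen_sub[OF C] by (auto simp: U_def ext_norms_def)
  obtain q where q: "is_minpoly K y q" using minpoly_exists[OF K(1) y] by blast
  obtain b where b: "poly q b = 0" "!!g. coeffs_in K g ==> w1 (poly g y) = v (poly g b)"
   using norms_conjugate[OF K(1,2) q v(1) w1U(2)] w1(2) v(2) agree_sym agree_trans by blast
  have bK: "alg K b" by (rule minpoly_alg[OF minpoly_conj[OF K(1) q b(1)]])
  obtain Y e where Y: "finite Y" "Y<=fgen (insert y K)" "0 < e" "!!u. u : U ==> close Y e u w1 ==> u : C" using kopenE[OF C w1(1)] by metis
  have "ALL z:Y. EX g. coeffs_in K g & z = poly g y" using Y(2) unfolding fgen_insert_alg[OF K(1,2) y] by blast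
  then obtain G where G: "!!z. z : Y ==> coeffs_in K (G z)" "!!z. z : Y ==> z = poly (G z) y" by metis
  define Z where "Z = (%z. poly (G z) b) ` Y"
  have "Z<=acl K" using alg_poly[OF K(1,2) bK] G by (auto simp: Z_def acl_def)
  then obtain u where u: "u : U-sat U K C" "close Z e u v" using v(3) Y(1,3) unfolding near_def Z_def by (meson finite_imageI)
  hence un: "nonarch_norm u" by (auto simp: U_def ext_norms_def)
  obtain u' where u': "nonarch_norm u'" "!!g. coeffs_in K g ==> u' (poly g y) = u (poly g b)" and ag: "agree K u' u"
   using norm_transport[OF K(1,2) q b(1) un] by (auto simp: agree_def)
  have u'U: "u' : U" using ext_norms_agree[of u k w0 u' K] u(1) u'(1) ag K(3) by (simp add: U_def)
  have "close Y e u' w1" unfolding close_def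
  proof
   fix z assume z: "z : Y"
   have "\<bar>u (poly (G z) b)-v (poly (G z) b)\<bar> < e" using u(2) z by (auto simp: close_def Z_def)
   thus "\<bar>u' z-w1 z\<bar> < e" using u'(2)[OF G(1)[OF z]] b(2)[OF G(1)[OF z]] G(2)[OF z] by simp
  qed
  hence "u' : C" using Y(4) u'U by blast
  hence "u : sat U K C" using u(1) ag by (auto simp: sat_def)
  thus False using u(1) by simp
 qed
qed

lemma kopen_sat_finite:
 assumes K: "is_field K" "infinite K" "k<=K"
 shows "finite S ==> S<=acl K ==> kopen U (fgen (K Un S)) C ==> kopen U K (sat U K C)"
proof (induction S arbitrary: C rule: finite_induct)
 case empty
 have "kopen U K C" using empty fgen_eq[OF K(1)] by simp
 hence "sat U K C = C" using kopen_agree[of U K C] kopen_sub[of U K C] by (auto simp: sat_def agree_def)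
 thus ?case using empty fgen_eq[OF K(1)] by simp
next
 case (insert s S)
 define L where "L = fgen (K Un S)"
 note L = fgen_Un(1,2)[of K S, folded L_def]
 have L': "infinite L" "k<=L" using infinite_super[OF L(2) K(2)] K(3) L(2) by auto
 have s: "alg L s" using insert.prems L alg_mono by (auto simp: acl_def)
 have "fgen (K Un insert s S) = fgen (insert s L)" unfolding L_def by (rule fgen_Un_insert)
 hence "kopen U L (sat U L C)" using kopen_sat_insert[OF L(1) L' s] insert.prems by simp
 hence "kopen U K (sat U K (sat U L C))" using insert by (simp add: L_def)
 thus ?case using sat_sat[OF L(2) kopen_sub[OF insert.prems(2)]] by simp
qed

lemma kopen_sat:
 assumes K: "is_field K" "infinite K" "k<=K" and C: "kopen U (acl K) C"
 shows "kopen U K (sat U K C)"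
proof (rule kopen_local)
 fix w assume "w : sat U K C"
 then obtain w1 where w1: "w : U" "w1 : C" "agree K w1 w" by (auto simp: sat_def)
 obtain Y e where Y: "finite Y" "Y<=acl K" "0 < e" "!!u. u : U ==> close Y e u w1 ==> u : C" using kopenE[OF C w1(2)] by metis
 define D where "D = {u:U. close Y e u w1}"
 have "kopen U (fgen (K Un Y)) D" unfolding D_def using Y(1) fgen_superset[of "K Un Y"] by (intro kopen_ball) auto
 hence "kopen U K (sat U K D)" using kopen_sat_finite[OF K Y(1,2)] by blast
 moreover have "w1 : D" using w1 kopen_sub[OF C] Y(3) by (auto simp: D_def close_def)
 hence "w : sat U K D" using w1 by (auto simp: sat_def)
 moreover have "sat U K D<=sat U K C" using Y(4) by (intro sat_mono) (auto simp: D_def)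
 ultimately show "EX D. kopen U K D & w : D & D<=sat U K C" by blast
qed (rule sat_sub)

text \<open>Restriction along algebraic extensions is closed, because closure points lift (near_cluster).\<close>

lemma kopen_Diff_sat:
 assumes K: "is_field K" "infinite K" "k<=K" and C: "kopen U (acl K) (U-C)" "C<=U"
 shows "kopen U K (U-sat U K C)"
proof (rule kopenI)
 fix w assume w: "w : U-sat U K C"
 show "~ near K (U-(U-sat U K C)) w"
 proof
  assume "near K (U-(U-sat U K C)) w"
  hence n: "near K (sat U K C) w" using sat_sub[of U K C] by (simp add: double_diff)
  have "near K C w" unfolding near_def
  proof (intro allI impI)
   fix Y e assume Y: "finite Y & Y<=K & 0 < (e::real)"
   then obtain u where u: "u : sat U K C" "close Y e u w" using n unfolding near_def by meson
   then obtain u' where "u' : C" "agree K u' u" by (auto simp: sat_def)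
   hence "close Y e u' w" using u Y by (auto simp: close_def agree_def subset_iff)
   thus "EX u:C. close Y e u w" using \<open>u' : C\<close> by blast
  qed
  then obtain v where v: "nonarch_norm v" "agree K v w" "near (acl K) C v" using near_cluster[OF K(1,2), of C w] C(2) by (auto simp: U_def ext_norms_def)
  have vU: "v : U" using ext_norms_agree[of w k w0 v K] w v(1,2) K(3) by (simp add: U_def)
  have "v : C"
  proof (rule ccontr)
   assume "v ~: C"
   hence "~ near (acl K) (U-(U-C)) v" using kopen_not_near[OF C(1)] vU by blast
   thus False using v(3) C(2) by (simp add: double_diff)
  qed
  hence "w : sat U K C" using w v(2) by (auto simp: sat_def)
  thus False using w by simp
 qed
qed auto

end

text \<open>Adjoining one element multiplies the number of extensions at most by the number of conjugates. The bound is independent of w.\<close>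

lemma finite_norm_restrictions:
 fixes K :: "'a::alg_closed_field set"
 assumes K: "is_field K" "infinite K"
 shows "finite S ==> S<=acl K ==> EX n. ALL w. nonarch_norm w --> (EX A. finite A & card A<=n & (ALL u:A. nonarch_norm u) &
  (ALL v. nonarch_norm v & agree K v w --> (EX u:A. agree (fgen (K Un S)) u v)))"
proof (induction S rule: finite_induct)
 case empty
 have "fgen (K Un {}) = K" using fgen_eq[OF K(1)] by simp
 thus ?case by (intro exI[of _ 1] allI impI) (rule_tac x = "{w}" in exI, auto intro: agree_sym)
next
 case (insert s S)
 define L where "L = fgen (K Un S)"
 note L = fgen_Un(1,2)[of K S, folded L_def] and L' = fgen_Un(4)[OF K(2), of S, folded L_def]
 have s: "alg L s" using insert.prems L alg_mono by (auto simp: acl_def)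
 have LS: "fgen (K Un insert s S) = fgen (insert s L)" unfolding L_def by (rule fgen_Un_insert)
 obtain q where q: "is_minpoly L s q" using minpoly_exists[OF L(1) s] by blast
 define R where "R = {b. poly q b = 0}"
 have R: "finite R" unfolding R_def using q by (intro poly_roots_finite) (auto simp: is_minpoly_def)
 obtain n where n: "!!w. nonarch_norm w ==> (EX A. finite A & card A<=n & (ALL u:A. nonarch_norm u) &
  (ALL v. nonarch_norm v & agree K v w --> (EX u:A. agree L u v)))" using insert unfolding L_def by auto
 define T where "T u b = (SOME w'. nonarch_norm w' & (ALL g. coeffs_in L g --> w' (poly g s) = u (poly g b)))" for u b
 have "EX w'. nonarch_norm w' & (ALL g. coeffs_in L g --> w' (poly g s) = u (poly g b))" if "nonarch_norm u" "b : R" for u b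
  using norm_transport[OF L(1) L' q, of b u] that unfolding R_def by blast
 from someI_ex[OF this] have T: "nonarch_norm (T u b)" "!!g. coeffs_in L g ==> T u b (poly g s) = u (poly g b)"
  if "nonarch_norm u" "b : R" for u b using that unfolding T_def by auto
 show ?case
 proof (intro exI[of _ "n*card R"] allI impI)
  fix w :: "'a => real" assume "nonarch_norm w"
  then obtain A where A: "finite A" "card A<=n" "!!u. u : A ==> nonarch_norm u"
   "!!v. nonarch_norm v ==> agree K v w ==> (EX u:A. agree L u v)" using n[of w] by blast
  define A' where "A' = (%(u, b). T u b) ` (A \<times> R)"
  have "finite A'" using A R by (simp add: A'_def)
  moreover have "card A'<=n*card R"
  proof -
   have "card A'<=card (A \<times> R)" unfolding A'_def using A R by (intro card_image_le) auto
   also have "... <= n*card R" using A by (simp add: card_cartesian_product)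
   finally show ?thesis .
  qed
  moreover have "ALL u:A'. nonarch_norm u" using A T by (auto simp: A'_def)
  moreover have "EX u:A'. agree (fgen (insert s L)) u v" if v: "nonarch_norm v" "agree K v w" for v
  proof -
   obtain u where u: "u : A" "agree L u v" using A(4)[OF v] by blast
   obtain b where b: "poly q b = 0" "!!g. coeffs_in L g ==> v (poly g s) = u (poly g b)"
    using norms_conjugate[OF L(1) L' q A(3)[OF u(1)] v(1) agree_sym[OF u(2)]] by blast
   have bR: "b : R" using b(1) by (simp add: R_def)
   have "agree (fgen (insert s L)) (T u b) v" unfolding agree_def fgen_insert_alg[OF L(1) L' s] using b(2) T(2)[OF A(3)[OF u(1)] bR] by auto
   moreover have "T u b : A'" using u(1) bR by (force simp: A'_def)
   ultimately show ?thesis by blast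
  qed
  ultimately show "EX A. finite A & card A<=n*card R & (ALL u:A. nonarch_norm u) &
    (ALL v. nonarch_norm v & agree K v w --> (EX u:A. agree (fgen (K Un insert s S)) u v))" unfolding LS by blast
 qed
qed

section \<open>Polynomial expressions and algebraic exchange\<close>

lemma clear_denominators:
 fixes K :: "'a::field set"
 assumes K: "is_field K" and p: "coeffs_in (fgen (insert t K)) p"
 shows "EX d G. coeffs_in K d & poly d t~=0 & (ALL i. coeffs_in K (coeff G i)) & ieval G t = smult (poly d t) p"
proof -
 note R = field_ring[OF K]
 have "ALL i. EX g h. coeffs_in K g & coeffs_in K h & poly h t~=0 & coeff p i = poly g t/poly h t"
  using p unfolding coeffs_in_def[of _ p] fgen_insert[OF K] by blast
 then obtain g h where gh: "!!i. coeffs_in K (g i)" "!!i. coeffs_in K (h i)" "!!i. poly (h i) t~=0"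
  "!!i. coeff p i = poly (g i) t/poly (h i) t" by metis
 define d where "d = (PROD i<=degree p. h i)"
 define G where "G = (SUM i<=degree p. monom (g i*(PROD j:{..degree p}-{i}. h j)) i)"
 have Gc: "coeff G i = (if i<=degree p then g i*(PROD j:{..degree p}-{i}. h j) else 0)" for i by (simp add: G_def coeff_sum_monom)
 have dt: "poly d t = poly (h i) t*poly (PROD j:{..degree p}-{i}. h j) t" if "i<=degree p" for i
  unfolding d_def using prod.remove[of "{..degree p}" i h] that by simp
 have "coeff (ieval G t) i = coeff (smult (poly d t) p) i" for i
 proof (cases "i<=degree p")
  case True
  thus ?thesis using gh(3)[of i] by (simp add: Gc dt[OF True] gh(4))
 qed (simp add: Gc coeff_eq_0)
 hence "ieval G t = smult (poly d t) p" by (rule poly_eqI)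
 moreover have "coeffs_in K d" unfolding d_def using gh R by (intro coeffs_in_prod)
 moreover have "poly d t~=0" unfolding d_def using gh by (simp add: poly_prod)
 moreover have "coeffs_in K (coeff G i)" for i unfolding Gc using gh R by (auto intro!: coeffs_in_mult coeffs_in_prod coeffs_in_0)
 ultimately show ?thesis by blast
qed

text \<open>A polynomial relation between t and h can be read in either variable.\<close>

lemma algebraic_exchange:
 fixes F :: "'a::alg_closed_field set"
 assumes F: "aclosed F" "infinite F" and h: "h : acl (fgen (insert t F))" "h ~: F"
 shows "t : acl (fgen (insert h F))"
proof (rule ccontr)
 assume t: "t ~: acl (fgen (insert h F))"
 have FF: "is_field F" using F by (simp add: aclosed_def)
 define E where "E = acl (fgen (insert h F))"
 have E: "aclosed E" "F<=E" "h : E" using acl_fgen(1-3)[OF F(2), of "{h}"] by (auto simp: E_def)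
 note RE = aclosed_subring[OF E(1)]
 obtain p where p: "coeffs_in (fgen (insert t F)) p" "p~=0" "poly p h = 0" using h(1) by (auto simp: acl_def alg_def)
 obtain d G where G: "poly d t~=0" "!!i. coeffs_in F (coeff G i)" "ieval G t = smult (poly d t) p" using clear_denominators[OF FF p(1)] by blast
 have "ieval G t~=0" using G p by simp
 hence "G~=0" by (auto simp: ieval_def)
 define q where "q = (SUM i<=degree G. smult (h^i) (coeff G i))"
 have "poly q t = poly (ieval G t) h" by (simp add: poly_ieval_sum q_def poly_sum mult.commute)
 hence "poly q t = 0" using G(3) p(3) by simp
 moreover have "coeffs_in E q" unfolding q_def
 proof (intro coeffs_in_sum[OF RE] coeffs_in_smult[OF RE] subring_power[OF RE])
  show "h : E" "coeffs_in E (coeff G i)" for i using E G(2)[of i] by (auto elim!: coeffs_in_mono)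
 qed
 ultimately have q0: "q = 0" using t E(1) unfolding E_def[symmetric] aclosed_def alg_def by blast
 have "coeff (coeff G i) j = 0" if "i<=degree G" for i j
 proof -
  define r where "r = (SUM i<=degree G. monom (coeff (coeff G i) j) i)"
  have rc: "coeff r i = (if i<=degree G then coeff (coeff G i) j else 0)" for i by (simp add: r_def coeff_sum_monom)
  have "poly r h = coeff q j" by (simp add: r_def q_def poly_sum poly_monom coeff_sum mult.commute)
  hence "poly r h = 0" using q0 by simp
  moreover have "coeffs_in F r" unfolding coeffs_in_def rc using G(2) subring_zero[OF field_ring[OF FF]] by (auto simp: coeffs_in_def)
  ultimately have "r = 0" using h(2) F(1) unfolding aclosed_def alg_def by blast
  thus ?thesis using rc[of i] that by simp
 qed
 hence "coeff G (degree G) = 0" by (intro poly_eqI) simp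
 thus False using \<open>G~=0\<close> by simp
qed

text \<open>In characteristic c an inseparable minimal polynomial is a polynomial in the c-th power of the variable.\<close>

lemma simple_root_of_power:
 fixes K :: "'a::alg_closed_field set"
 assumes K: "is_field K"
 shows "coeffs_in K p ==> p~=0 ==> poly p x = 0 ==>
  EX m q. 0 < m & coeffs_in K q & poly q (x^m) = 0 & poly (pderiv q) (x^m)~=0"
proof (induction "degree p" arbitrary: p x rule: less_induct)
 case less
 note R = field_ring[OF K]
 have "alg K x" using less.prems unfolding alg_def by blast
 then obtain q where q: "is_minpoly K x q" using minpoly_exists[OF K] by blast
 have qK: "coeffs_in K q" "poly q x = 0" "q~=0" using q by (auto simp: is_minpoly_def)
 have deg: "degree q<=degree p" using q less.prems by (simp add: is_minpoly_def)
 show ?case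
 proof (cases "pderiv q = 0")
  case False
  have "degree (pderiv q) < degree q"
  proof -
   have "degree (pderiv q)<=degree q-1" by (intro degree_le) (auto simp: coeff_pderiv coeff_eq_0)
   thus ?thesis using minpoly_degree_pos[OF q] by linarith
  qed
  moreover have "coeffs_in K (pderiv q)" using qK R by (intro coeffs_in_pderiv)
  ultimately have "poly (pderiv q) x~=0" using q False unfolding is_minpoly_def by (metis linorder_not_le)
  thus ?thesis using qK by (intro exI[of _ 1] exI[of _ q]) auto
 next
  case True
  define c where "c = CHAR('a)"
  have dvd: "c dvd i" if "coeff q i~=0" for i
  proof (cases i)
   case (Suc j)
   have "of_nat (Suc j)*coeff q (Suc j) = 0" using arg_cong[OF True, of "%p. coeff p j"] by (simp add: coeff_pderiv)
   hence "of_nat i = (0 :: 'a)" using that Suc by simp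
   thus ?thesis unfolding c_def by (simp add: of_nat_eq_0_iff_char_dvd)
  qed simp
  have cd: "c dvd degree q" using dvd[of "degree q"] qK(3) by simp
  have c0: "c > 0" using cd minpoly_degree_pos[OF q] by (cases "c = 0") auto
  have "c~=1"
  proof
   assume "c = 1"
   hence "(of_nat 1 :: 'a) = 0" using of_nat_CHAR[where 'a='a] by (metis c_def)
   thus False by simp
  qed
  hence c1: "c > 1" using c0 by simp
  define r where "r = (SUM j<=degree q div c. monom (coeff q (c*j)) j)"
  have rc: "coeff r j = (if j<=degree q div c then coeff q (c*j) else 0)" for j by (simp add: r_def coeff_sum_monom)
  have rK: "coeffs_in K r" unfolding coeffs_in_def rc using qK(1) subring_zero[OF R] by (auto simp: coeffs_in_def)
  have "poly r (x^c) = poly q x"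
  proof -
   have "poly q x = (SUM i<=degree q. coeff q i*x^i)" by (rule poly_altdef)
   also have "... = (SUM i:(%j. c*j) ` {..degree q div c}. coeff q i*x^i)"
   proof (rule sum.mono_neutral_right)
    show "(%j. c*j) ` {..degree q div c}<={..degree q}" using c0 by (auto simp: less_eq_div_iff_mult_less_eq mult.commute)
    show "ALL i:{..degree q}-(%j. c*j) ` {..degree q div c}. coeff q i*x^i = 0"
    proof
     fix i assume i: "i : {..degree q}-(%j. c*j) ` {..degree q div c}"
     show "coeff q i*x^i = 0"
     proof (rule ccontr)
      assume "coeff q i*x^i~=0"
      hence "c dvd i" using dvd by auto
      then obtain j where "i = c*j" by auto
      moreover from this have "j<=degree q div c" using i c0 by (auto simp: less_eq_div_iff_mult_less_eq mult.commute)
      ultimately show False using i by auto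
     qed
    qed
   qed simp
   also have "... = (SUM j<=degree q div c. coeff q (c*j)*x^(c*j))" using c0 by (subst sum.reindex) (auto simp: inj_on_def)
   also have "... = poly r (x^c)" by (simp add: r_def poly_sum poly_monom power_mult)
   finally show ?thesis by simp
  qed
  hence r0: "poly r (x^c) = 0" using qK by simp
  have "coeff r (degree q div c) = lead_coeff q" using cd by (simp add: rc)
  hence rn: "r~=0" using qK(3) by auto
  have "degree r<=degree q div c" unfolding r_def by (intro degree_sum_le) (auto intro: order.trans[OF degree_monom_le])
  also have "... < degree q" using c1 minpoly_degree_pos[OF q] by simp
  finally have "degree r < degree p" using deg by simp
  from less.hyps[OF this rK rn r0] obtain m q' where "0 < m" "coeffs_in K q'" "poly q' ((x^c)^m) = 0"
   "poly (pderiv q') ((x^c)^m)~=0" by blast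
  thus ?thesis using c0 by (intro exI[of _ "c*m"] exI[of _ q']) (simp add: power_mult)
 qed
qed

text \<open>The polynomial functions of a family of variables indexed by Y, with coefficients in A; a point is a function b on Y.\<close>

inductive_set polyfun :: "'a::comm_ring_1 set => 'b set => (('b => 'a) => 'a) set" for A Y where
 const: "c : A ==> (%_. c) : polyfun A Y"
| proj: "y : Y ==> (%b. b y) : polyfun A Y"
| add: "f : polyfun A Y ==> g : polyfun A Y ==> (%b. f b+g b) : polyfun A Y"
| mult: "f : polyfun A Y ==> g : polyfun A Y ==> (%b. f b*g b) : polyfun A Y"

lemma polyfun_mem:
 assumes "is_ring A" "!!y. y : Y ==> b y : A" shows "f : polyfun A Y ==> f b : A"
 by (induction rule: polyfun.induct) (auto intro: assms subring_add subring_mult)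

lemma polyfun_mono: "f : polyfun A Y ==> A<=B ==> f : polyfun B Y" by (induction rule: polyfun.induct) (auto intro: polyfun.intros)

lemma polyfun_comp: "f : polyfun A Y ==> (%b. f (%y. b (s y))) : polyfun A (s ` Y)" by (induction rule: polyfun.induct) (auto intro: polyfun.intros)

lemma polyfun_poly:
 assumes A: "is_ring A" and f: "f : polyfun A Y" shows "coeffs_in A g ==> (%b. poly g (f b)) : polyfun A Y"
proof (induction g)
 case 0
 thus ?case using polyfun.const[OF subring_zero[OF A]] by simp
next
 case (pCons a g)
 thus ?case using polyfun.add[OF polyfun.const polyfun.mult[OF f]] by (simp add: coeffs_in_pCons_iff)
qed

lemma polyfun_ieval:
 assumes A: "is_ring A" and xy: "x : Y" "y : Y"
 shows "(!!i. coeffs_in A (coeff G i)) ==> (%b. poly (ieval G (b x)) (b y)) : polyfun A Y"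
proof (induction G)
 case 0
 thus ?case using polyfun.const[OF subring_zero[OF A]] by (simp add: ieval_def)
next
 case (pCons g G)
 have "coeffs_in A g" "!!i. coeffs_in A (coeff G i)" using pCons.prems[of 0] pCons.prems[of "Suc i" for i] by simp_all
 thus ?case using pCons.IH polyfun_poly[OF A polyfun.proj[OF xy(1)]] polyfun.proj[OF xy(2)] by (auto simp: ieval_pCons intro!: polyfun.add polyfun.mult)
qed

definition near_on :: "('a::ab_group_add => real) => 'b set => real => real => ('b => 'a) => ('b => 'a) => bool" where
 "near_on w Y B d a b \<longleftrightarrow> 0<=d & (ALL y:Y. w (a y)<=B & w (b y)<=B & w (a y-b y)<=d)"

definition lip_bound :: "('a::ab_group_add => real) set => 'b set => real => (('b => 'a) => 'a) => real => bool" where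
 "lip_bound U Y B f M \<longleftrightarrow> 1<=M & (ALL w:U. ALL a b d. near_on w Y B d a b --> w (f a)<=M & w (f b)<=M & w (f a-f b)<=M*d)"

lemma lip_boundD:
 assumes "lip_bound U Y B f M"
 shows "1<=M" "w : U ==> near_on w Y B d a b ==> w (f a)<=M" "w : U ==> near_on w Y B d a b ==> w (f b)<=M"
  "w : U ==> near_on w Y B d a b ==> w (f a-f b)<=M*d" using assms unfolding lip_bound_def by blast+

lemma polyfun_continuous:
 assumes f: "f : polyfun A Y" and B: "1<=B" and U: "!!w. w : U ==> nonarch_norm w & (ALL c:A. w c = w0 c)"
 shows "EX M. lip_bound U Y B f M" using f
proof (induction rule: polyfun.induct)
 case (const c)
 thus ?case using U unfolding lip_bound_def by (intro exI[of _ "max 1 (w0 c)"]) (auto simp: nan_zero near_on_def)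
next
 case (proj y)
 have "d<=B*d" if "0<=d" for d using mult_right_mono[OF B that] by simp
 thus ?case using proj B unfolding lip_bound_def by (intro exI[of _ B]) (fastforce simp: near_on_def)
next
 case (add f g)
 obtain M1 M2 where M: "lip_bound U Y B f M1" "lip_bound U Y B g M2" using add.IH by blast
 have M1: "1<=M1" "1<=M2" using lip_boundD(1) M by blast+
 have "w (f a+g a)<=M1+M2 & w (f b+g b)<=M1+M2 & w (f a+g a-(f b+g b))<=(M1+M2)*d" if w: "w : U" "near_on w Y B d a b" for w a b d
 proof -
  have nw: "nonarch_norm w" using U w by blast
  note 1 = lip_boundD(2-4)[OF M(1) w] and 2 = lip_boundD(2-4)[OF M(2) w]
  have "0<=M1*d" "0<=M2*d" using M1 w(2) by (auto simp: near_on_def)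
  hence "w ((f a-f b)+(g a-g b))<=M1*d+M2*d" using nan_add[OF nw, of "f a-f b" "g a-g b"] 1 2 by linarith
  thus ?thesis using nan_add[OF nw, of "f a" "g a"] nan_add[OF nw, of "f b" "g b"] 1 2 M1 by (auto simp: algebra_simps)
 qed
 thus ?case using M1 unfolding lip_bound_def by (intro exI[of _ "M1+M2"]) simp
next
 case (mult f g)
 obtain M1 M2 where M: "lip_bound U Y B f M1" "lip_bound U Y B g M2" using mult.IH by blast
 have M1: "1<=M1" "1<=M2" using lip_boundD(1) M by blast+
 have "w (f a*g a)<=M1*M2 & w (f b*g b)<=M1*M2 & w (f a*g a-f b*g b)<=M1*M2*d" if w: "w : U" "near_on w Y B d a b" for w a b d
 proof -
  have nw: "nonarch_norm w" using U w by blast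
  note 1 = lip_boundD(2-4)[OF M(1) w] and 2 = lip_boundD(2-4)[OF M(2) w]
  have "w (f a*(g a-g b))<=M1*(M2*d)" "w (g b*(f a-f b))<=M2*(M1*d)" "w (f a*g a)<=M1*M2" "w (f b*g b)<=M1*M2"
   unfolding nan_mult[OF nw] using 1 2 nan_nonneg[OF nw] M1 by (auto intro!: mult_mono)
  moreover have "f a*g a-f b*g b = f a*(g a-g b)+g b*(f a-f b)" by (simp add: algebra_simps)
  ultimately show ?thesis using nan_add[OF nw, of "f a*(g a-g b)" "g b*(f a-f b)"] by (simp add: mult_ac)
 qed
 moreover have "1<=M1*M2" using mult_mono[OF M1] M1 by simp
 ultimately show ?case unfolding lip_bound_def by (intro exI[of _ "M1*M2"]) simp
qed

section \<open>Norms on the line\<close>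

text \<open>U is the fibre of the restriction to F. Its topology over Ft = F(t) is that of the analytic affine line.\<close>

locale line_ext =
 fixes F :: "'a::alg_closed_field set" and w0 :: "'a => real" and t :: 'a
 assumes F: "aclosed F" "infinite F" and w0: "nonarch_norm w0" and t: "t ~: F"
begin

definition "U = ext_norms F w0"
definition "Ft = fgen (insert t F)"

lemma F_field: "is_field F" using F by (simp add: aclosed_def)
lemma F_ring: "is_ring F" by (rule field_ring[OF F_field])
lemma Ft_field: "is_field Ft" by (simp add: Ft_def subfield_fgen)
lemma Ft_ring: "is_ring Ft" by (rule field_ring[OF Ft_field])
lemma F_Ft: "F<=Ft" and t_Ft: "t : Ft" using fgen_superset[of "insert t F"] by (auto simp: Ft_def)
lemma Ft_inf: "infinite Ft" by (rule infinite_super[OF F_Ft F(2)])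
lemma transc: "coeffs_in F p ==> poly p t = 0 ==> p = 0" using t F(1) unfolding aclosed_def alg_def by blast
lemma not_alg_t: "~ alg F t" using t F(1) by (auto simp: aclosed_def)
lemma U_nonarch: "w : U ==> nonarch_norm w" by (simp add: U_def ext_norms_def)
lemma U_F: "w : U ==> x : F ==> w x = w0 x" by (simp add: U_def ext_norms_def agree_def)
lemma U_agree: "w : U ==> nonarch_norm u ==> agree Ft u w ==> u : U" unfolding U_def using ext_norms_agree F_Ft by blast
lemma w0_U: "w0 : U" using w0 by (simp add: U_def ext_norms_def agree_def)

text \<open>F is algebraically closed, so that rational functions split into linear factors and a norm on F(t) is known from its values at all t - x.\<close>

lemma Ft_factor:
 assumes y: "y : Ft"
 shows "EX c A B. c : F & set_mset A<=F & set_mset B<=F &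
  (ALL w:U. w y = w0 c*(PROD x:#A. w (t-x))/(PROD x:#B. w (t-x)))"
proof (cases "y = 0")
 case True
 thus ?thesis by (intro exI[of _ 0] exI[of _ "{#}"]) (simp add: nan_zero U_nonarch w0 subring_zero[OF F_ring])
next
 case False
 have fac: "EX A. set_mset A<=F & poly g t = lead_coeff g*(PROD x:#A. t-x)" if g: "coeffs_in F g" "g~=0" for g
 proof -
  define g1 where "g1 = smult (inverse (lead_coeff g)) g"
  have "coeffs_in F g1" unfolding g1_def using g F_field by (intro coeffs_in_smult F_ring subfield_inverse coeffs_inD)
  moreover have "lead_coeff g1 = 1" using g by (simp add: g1_def)
  ultimately obtain A where A: "g1 = (PROD x:#A. [:-x, 1:])" "set_mset A<=F" using aclosed_splits[OF F(1)] by metis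
  have "g = smult (lead_coeff g) g1" using g by (simp add: g1_def)
  hence "poly g t = lead_coeff g*poly g1 t" by (metis poly_smult)
  thus ?thesis using A by (auto simp: poly_prod_linear)
 qed
 obtain g h where gh: "coeffs_in F g" "coeffs_in F h" "poly h t~=0" "y = poly g t/poly h t" using y unfolding Ft_def fgen_insert[OF F_field] by blast
 have nz: "g~=0" "h~=0" using gh False by auto
 obtain A where A: "set_mset A<=F" "poly g t = lead_coeff g*(PROD x:#A. t-x)" using fac[OF gh(1) nz(1)] by blast
 obtain B where B: "set_mset B<=F" "poly h t = lead_coeff h*(PROD x:#B. t-x)" using fac[OF gh(2) nz(2)] by blast
 define c where "c = lead_coeff g/lead_coeff h"
 have c: "c : F" unfolding c_def using gh by (intro subfield_divide[OF F_field] coeffs_inD)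
 have "y = c*(PROD x:#A. t-x)/(PROD x:#B. t-x)" unfolding gh(4) A(2) B(2) c_def by simp
 hence "w y = w0 c*(PROD x:#A. w (t-x))/(PROD x:#B. w (t-x))" if "w : U" for w
  using that by (simp add: nan_divide[OF U_nonarch] nan_mult[OF U_nonarch] nan_prod_mset[OF U_nonarch] U_F[OF _ c])
 thus ?thesis using c A(1) B(1) by blast
qed

lemma Ft_determined:
 assumes "y : Ft"
 shows "EX E. finite E & E<=F & (ALL u:U. ALL v:U. (ALL x:E. u (t-x) = v (t-x)) --> u y = v y)"
proof -
 obtain c A B where *: "set_mset A<=F" "set_mset B<=F"
  "!!w. w : U ==> w y = w0 c*(PROD x:#A. w (t-x))/(PROD x:#B. w (t-x))" using Ft_factor[OF assms] by blast
 have "u y = v y" if uv: "u : U" "v : U" "ALL x:set_mset A Un set_mset B. u (t-x) = v (t-x)" for u v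
 proof -
  have "image_mset (%x. u (t-x)) A = image_mset (%x. v (t-x)) A" "image_mset (%x. u (t-x)) B = image_mset (%x. v (t-x)) B"
   using uv(3) by (auto intro!: image_mset_cong)
  thus ?thesis using *(3)[OF uv(1)] *(3)[OF uv(2)] by simp
 qed
 thus ?thesis using *(1,2) by (intro exI[of _ "set_mset A Un set_mset B"]) auto
qed

text \<open>The norms that restrict to the Gauss norm of the disc with centre b and radius r; they form one fibre over F(t).\<close>

definition "disc_norms b r = {w:U. ALL e:F. w (t-e) = max r (w0 (b-e))}"

lemma disc_norms_U: "w : disc_norms b r ==> w : U" by (simp add: disc_norms_def)

lemma disc_norms_gauss:
 assumes b: "b : F" and r: "0 < r"
 shows "disc_norms b r~={}"
proof -
 obtain w where w: "nonarch_norm w" "!!x. x : F ==> w x = w0 x"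
  "!!g. coeffs_in F g ==> w (poly g (t-b)) = gnorm w0 r g" using norm_extend_gauss[OF F_field F(2) not_alg_t w0 b r] by blast
 have "w (t-e) = max r (w0 (b-e))" if e: "e : F" for e
  using w(3)[of "[:b-e, 1:]"] b e F_ring by (simp add: gnorm_linear r nan_one[OF w0] coeffs_in_pCons_iff coeffs_in_0 subring_closed)
 hence "w : disc_norms b r" using w by (simp add: disc_norms_def U_def ext_norms_def agree_def)
 thus ?thesis by blast
qed

lemma disc_norms_center:
 assumes "w : disc_norms b r" "b : F" "0 < r" shows "w (t-b) = r" using assms nan_zero[OF w0] by (auto simp: disc_norms_def)

lemma disc_norms_agree:
 assumes "w : disc_norms b r" "u : disc_norms b r" shows "agree Ft w u" unfolding agree_def
proof
 fix y assume "y : Ft"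
 then obtain E where E: "E<=F" "ALL u:U. ALL v:U. (ALL x:E. u (t-x) = v (t-x)) --> u y = v y" using Ft_determined by metis
 have "ALL x:E. w (t-x) = u (t-x)" using E(1) assms by (simp add: disc_norms_def subset_iff)
 thus "w y = u y" using E(2) assms by (simp add: disc_norms_U)
qed

lemma disc_norms_in_kopen:
 assumes C: "kopen U Ft C" and w: "w : disc_norms b r" "w : C"
 shows "disc_norms b r<=C"
proof
 fix u assume "u : disc_norms b r"
 thus "u : C" using kopen_agree[OF C w(2)] disc_norms_agree[OF _ w(1)] by (auto simp: disc_norms_def)
qed

text \<open>Finitely many conditions w(t - x) = max s |b - x|, with s near r, suffice to stay in a neighbourhood of the disc norm.\<close>

lemma disc_neighbourhood:
 assumes C: "kopen U Ft C" and b: "b : F" and r: "0 < r" "disc_norms b r<=C"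
 shows "EX E d. finite E & E<=F & 0 < d &
  (ALL s u. 0 < s --> \<bar>s-r\<bar> < d --> u : U --> (ALL x:E. u (t-x) = max s (w0 (b-x))) --> u : C)"
proof -
 obtain w where w: "w : disc_norms b r" using disc_norms_gauss[OF b r(1)] by blast
 hence wC: "w : C" using r by blast
 obtain Y e where Y: "finite Y" "Y<=Ft" "0 < e" "!!u. u : U ==> close Y e u w ==> u : C" using kopenE[OF C wC] by metis
 have cont: "EX E d. finite E & E<=F & 0 < d &
  (ALL s u. 0 < s --> \<bar>s-r\<bar> < d --> u : U --> (ALL x:E. u (t-x) = max s (w0 (b-x))) --> \<bar>u y-w y\<bar> < e)" if y: "y : Y" for y
 proof -
  obtain c A B where *: "set_mset A<=F" "set_mset B<=F"
   "ALL w:U. w y = w0 c*(PROD x:#A. w (t-x))/(PROD x:#B. w (t-x))" using Ft_factor[of y] y Y(2) by blast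
  define f where "f s = w0 c*(PROD x:#A. max s (w0 (b-x)))/(PROD x:#B. max s (w0 (b-x)))" for s
  have fu: "u y = f s" if u: "u : U" "ALL x:set_mset A Un set_mset B. u (t-x) = max s (w0 (b-x))" for u s
  proof -
   have "image_mset (%x. u (t-x)) A = image_mset (%x. max s (w0 (b-x))) A"
    "image_mset (%x. u (t-x)) B = image_mset (%x. max s (w0 (b-x))) B" using u(2) by (auto intro!: image_mset_cong)
   thus ?thesis using bspec[OF *(3) u(1)] by (simp add: f_def)
  qed
  have pm: "isCont (%s. PROD x:#A. max s (w0 (b-x))) r" for A by (induction A) (auto intro!: continuous_intros)
  have pos: "0 < (PROD x:#A. max r (w0 (b-x)))" for A using r(1) by (induction A) auto
  have "isCont f r" unfolding f_def by (intro continuous_intros pm) (rule less_imp_neq[OF pos, THEN not_sym])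
  then obtain d where d: "0 < d" "!!s. dist s r < d ==> dist (f s) (f r) < e" using Y(3) unfolding continuous_at_eps_delta by blast
  have wr: "w y = f r" using w *(1,2) by (intro fu) (auto simp: disc_norms_def)
  show ?thesis
  proof (intro exI[of _ "set_mset A Un set_mset B"] exI[of _ d] conjI allI impI d(1))
   fix s u assume "\<bar>s-r\<bar> < d" "u : U" "ALL x:set_mset A Un set_mset B. u (t-x) = max s (w0 (b-x))"
   thus "\<bar>u y-w y\<bar> < e" using d(2)[of s] fu[of u s] wr by (simp add: dist_real_def)
  qed (use *(1,2) in auto)
 qed
 then obtain E d where d: "!!y. y : Y ==> finite (E y) & E y<=F & 0 < d y"
  "!!y s u. y : Y ==> 0 < s ==> \<bar>s-r\<bar> < d y ==> u : U ==> ALL x:E y. u (t-x) = max s (w0 (b-x)) ==> \<bar>u y-w y\<bar> < e" by metis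
 define m where "m = Min (insert 1 (d ` Y))"
 have m: "0 < m" "!!y. y : Y ==> m<=d y" unfolding m_def using Y(1) d(1) by auto
 show ?thesis
 proof (intro exI[of _ "\<Union>(E ` Y)"] exI[of _ m] conjI allI impI m(1))
  fix s u assume s: "0 < s" "\<bar>s-r\<bar> < m" and u: "u : U" "ALL x:\<Union>(E ` Y). u (t-x) = max s (w0 (b-x))"
  have "\<bar>u y-w y\<bar> < e" if y: "y : Y" for y using d(2)[OF y s(1) _ u(1)] s(2) m(2)[OF y] u(2) y by auto
  thus "u : C" using Y(4) u(1) by (simp add: close_def)
 qed (use d(1) Y(1) in auto)
qed

lemma kopen_disc_radius:
 assumes C: "kopen U Ft C" and b: "b : F"
 shows "open {r. 0 < r & disc_norms b r<=C}"
proof (subst open_dist, intro ballI)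
 fix r assume "r : {r. 0 < r & disc_norms b r<=C}"
 hence r: "0 < r" "disc_norms b r<=C" by auto
 obtain E d where d: "E<=F" "0 < d" "!!s u. 0 < s ==> \<bar>s-r\<bar> < d ==> u : U ==>
  ALL x:E. u (t-x) = max s (w0 (b-x)) ==> u : C" using disc_neighbourhood[OF C b r] by blast
 show "EX e>0. ALL s. dist s r < e --> s : {r. 0 < r & disc_norms b r<=C}"
 proof (intro exI[of _ "min r d"] conjI allI impI)
  fix s assume s: "dist s r < min r d"
  hence "0 < s" "\<bar>s-r\<bar> < d" by (auto simp: dist_real_def abs_if split: if_splits)
  thus "s : {r. 0 < r & disc_norms b r<=C}" using d(1) d(3)[of s] by (auto simp: disc_norms_def subset_iff)
 qed (use r d in auto)
qed

text \<open>An open set only sees finitely many values w(t - x). If x = b minimises this value among them, the disc with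
centre b and radius w(t - b) has the same values.\<close>

lemma kopen_contains_disc:
 assumes C: "kopen U Ft C" and w: "w : C" and c: "c : F"
 shows "EX b r. b : F & 0 < r & disc_norms b r<=C & r<=w (t-c) & w0 (b-c)<=w (t-c)"
proof -
 have wU: "w : U" using w kopen_sub[OF C] by blast
 note nw = U_nonarch[OF wU]
 obtain Y e where Y: "finite Y" "Y<=Ft" "0 < e" "!!u. u : U ==> close Y e u w ==> u : C" using kopenE[OF C w] by metis
 have "ALL y:Y. EX E. finite E & E<=F & (ALL u:U. ALL v:U. (ALL x:E. u (t-x) = v (t-x)) --> u y = v y)" using Ft_determined Y(2) by blast
 then obtain E where E: "!!y. y : Y ==> finite (E y) & E y<=F"
  "!!y u. y : Y ==> u : U ==> (!!x. x : E y ==> u (t-x) = w (t-x)) ==> u y = w y" using wU by metis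
 define S where "S = insert c (UN y:Y. E y)"
 have S: "finite S" "S<=F" "S~={}" using E Y(1) c by (auto simp: S_def)
 obtain b where b: "b : S" "!!e. e : S ==> w (t-b)<=w (t-e)" using ex_min_if_finite[of "(%e. w (t-e)) ` S"] S by (auto simp: not_less)
 define r where "r = w (t-b)"
 have bF: "b : F" using b S by blast
 hence r: "0 < r" unfolding r_def using t nan_pos[OF nw, of "t-b"] by auto
 have eq: "w (t-e) = max r (w0 (b-e))" if e: "e : S" for e
 proof (rule antisym)
  have we: "w (b-e) = w0 (b-e)" using U_F[OF wU] bF e S by (simp add: F_ring subring_diff subset_iff)
  have "w ((t-b)+(b-e))<=max (w (t-b)) (w (b-e))" by (rule nan_add[OF nw])
  thus "w (t-e)<=max r (w0 (b-e))" by (simp add: r_def we)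
  have "w ((t-e)-(t-b))<=max (w (t-e)) (w (t-b))" by (rule nan_diff[OF nw])
  hence "w0 (b-e)<=w (t-e)" using b(2)[OF e] we by simp
  thus "max r (w0 (b-e))<=w (t-e)" using b(2)[OF e] by (simp add: r_def)
 qed
 have "disc_norms b r<=C"
 proof
  fix u assume u: "u : disc_norms b r"
  hence uU: "u : U" by (simp add: disc_norms_def)
  have ue: "u (t-e) = w (t-e)" if "e : S" for e using u that S(2) eq[OF that] by (auto simp: disc_norms_def)
  have "u y = w y" if y: "y : Y" for y by (rule E(2)[OF y uU]) (use ue y in \<open>auto simp: S_def\<close>)
  hence "close Y e u w" using Y(3) by (simp add: close_def)
  thus "u : C" using Y(4) uU by blast
 qed
 moreover have "max r (w0 (b-c)) = w (t-c)" using eq[of c] by (simp add: S_def)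
 hence "r<=w (t-c)" "w0 (b-c)<=w (t-c)" by auto
 ultimately show ?thesis using bF r by blast
qed

text \<open>Concentric discs are joined by the interval of their radii, and two discs are contained in a third
one, where their centres are interchangeable.\<close>

lemma disc_connected:
 assumes C: "kopen U Ft C" "kopen U Ft C'" and c: "c : F"
  and disj: "!!w. w : U ==> w (t-c) < d ==> w : C ==> w ~: C'"
  and cover: "!!w. w : U ==> w (t-c) < d ==> w : C \<or> w : C'"
  and w: "w : C" "w (t-c) < d" and w': "w' : C'" "w' (t-c) < d"
 shows False
proof -
 have inside: "disc_norms b r<={w:U. w (t-c) < d}" if "b : F" "w0 (b-c) < d" "r < d" for b r using that c by (auto simp: disc_norms_def)
 have all: "disc_norms b s<=C" if D: "kopen U Ft C" "kopen U Ft C'"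
   "!!w. w : U ==> w (t-c) < d ==> w : C ==> w ~: C'" "!!w. w : U ==> w (t-c) < d ==> w : C \<or> w : C'"
  and b: "b : F" "w0 (b-c) < d" and r: "0 < r" "r < d" "disc_norms b r<=C" and s: "0 < s" "s < d" for C C' b r s
 proof -
  define S where "S = {r. 0 < r & disc_norms b r<=C}"
  define S' where "S' = {r. 0 < r & disc_norms b r<=C'}"
  have dich: "disc_norms b x<=C \<or> disc_norms b x<=C'" if x: "0 < x" "x < d" for x
  proof -
   obtain u where u: "u : disc_norms b x" using disc_norms_gauss[OF b(1) x(1)] by blast
   hence "u : C \<or> u : C'" using inside[OF b x(2)] D(4) by auto
   thus ?thesis using disc_norms_in_kopen[OF D(1) u] disc_norms_in_kopen[OF D(2) u] by blast
  qed
  have notboth: "~ (x : S & x : S')" if x: "0 < x" "x < d" for x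
  proof
   assume "x : S & x : S'"
   moreover obtain u where u: "u : disc_norms b x" using disc_norms_gauss[OF b(1) x(1)] by blast
   ultimately show False using inside[OF b x(2)] D(3)[of u] by (auto simp: S_def S'_def)
  qed
  have "connected {0<..<d}" by (rule connected_Ioo)
  moreover have "open S" "open S'" unfolding S_def S'_def by (rule kopen_disc_radius[OF D(1) b(1)] kopen_disc_radius[OF D(2) b(1)])+
  moreover have "S Int S' Int {0<..<d} = {}" using notboth by auto
  moreover have "{0<..<d}<=S Un S'"
  proof
   fix x assume "x : {0<..<d}"
   hence "0 < x" "x < d" by auto
   thus "x : S Un S'" using dich[of x] by (simp add: S_def S'_def)
  qed
  ultimately have "S Int {0<..<d} = {} \<or> S' Int {0<..<d} = {}" by (rule connectedD)
  moreover have "r : S Int {0<..<d}" using r by (auto simp: S_def)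
  ultimately have "S' Int {0<..<d} = {}" by blast
  hence "s ~: S'" using s by auto
  thus ?thesis using dich[OF s] s by (auto simp: S'_def)
 qed
 obtain b r where b: "b : F" "0 < r" "disc_norms b r<=C" "r < d" "w0 (b-c) < d" using kopen_contains_disc[OF C(1) w(1) c] w(2) by (meson le_less_trans)
 obtain b' r' where b': "b' : F" "0 < r'" "disc_norms b' r'<=C'" "r' < d" "w0 (b'-c) < d"
  using kopen_contains_disc[OF C(2) w'(1) c] w'(2) by (meson le_less_trans)
 define s where "s = max r (w0 (b-b'))"
 have "w0 ((b-c)-(b'-c))<=max (w0 (b-c)) (w0 (b'-c))" by (rule nan_diff[OF w0])
 hence s: "0 < s" "s < d" using b b' by (auto simp: s_def)
 have 1: "disc_norms b s<=C" by (rule all[OF C disj cover b(1,5,2,4,3) s])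
 have 2: "disc_norms b' s<=C'" by (rule all[OF C(2,1) _ _ b'(1,5,2,4,3) s]) (use disj cover in blast)+
 have "max s (w0 (b-e)) = max s (w0 (b'-e))" for e
 proof -
  have "w0 ((b-b')+(b'-e))<=max (w0 (b-b')) (w0 (b'-e))" "w0 ((b'-b)+(b-e))<=max (w0 (b'-b)) (w0 (b-e))" by (rule nan_add[OF w0])+
  thus ?thesis using nan_diff_commute[OF w0, of b b'] by (auto simp: s_def)
 qed
 hence "disc_norms b s = disc_norms b' s" by (simp add: disc_norms_def)
 moreover obtain u where "u : disc_norms b s" using disc_norms_gauss[OF b(1) s(1)] by blast
 ultimately have "u : C" "u : C'" "u : U" "u (t-c) < d" using 1 2 inside[OF b(1,5) s(2)] by auto
 thus False using disj by blast
qed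

lemma line_connected:
 assumes C: "kopen U Ft C" "kopen U Ft (U-C)" "C~={}"
 shows "C = U"
proof (rule ccontr)
 assume "C~=U"
 then obtain w w' where w: "w : C" "w' : U-C" using C kopen_sub[OF C(1)] by blast
 have z: "0 : F" by (rule subring_zero[OF F_ring])
 define d where "d = max (w t) (w' t)+1"
 show False by (rule disc_connected[OF C(1,2) z, of d w w']) (use w in \<open>auto simp: d_def\<close>)
qed

end

text \<open>The field is algebraic over F(h), so that the image of C in the line with coordinate h is open and closed,
and the line is connected.\<close>

lemma (in line_ext) clopen_surjective:
 assumes C: "kopen U (acl Ft) C" "kopen U (acl Ft) (U-C)" "C~={}" and h: "h : acl Ft" "h ~: F" and w: "w : U"
 shows "EX u:C. agree (fgen (insert h F)) u w"
proof -
 interpret h: line_ext F w0 h by unfold_locales (use F w0 h in auto)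
 have "t : acl h.Ft" using algebraic_exchange[OF F h(1)[unfolded Ft_def] h(2)] by (simp add: h.Ft_def)
 moreover have ah: "aclosed (acl h.Ft)" by (rule aclosed_acl[OF h.Ft_field h.Ft_inf])
 moreover have "F<=acl h.Ft" using h.F_Ft subset_acl[OF h.Ft_ring] by blast
 ultimately have "Ft<=acl h.Ft" unfolding Ft_def using ah by (intro fgen_least) (auto simp: aclosed_def)
 hence sub: "acl Ft<=acl h.Ft" using ah by (rule acl_least)
 have C': "kopen U (acl h.Ft) C" "kopen U (acl h.Ft) (U-C)" using C kopen_mono sub by blast+
 have "kopen U h.Ft (sat U h.Ft C)" unfolding U_def by (rule kopen_sat[OF h.Ft_field h.Ft_inf h.F_Ft C'(1)[unfolded U_def]])
 moreover have "kopen U h.Ft (U-sat U h.Ft C)"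
  unfolding U_def by (rule kopen_Diff_sat[OF h.Ft_field h.Ft_inf h.F_Ft C'(2)[unfolded U_def] kopen_sub[OF C(1), unfolded U_def]])
 moreover have "sat U h.Ft C~={}" using C(3) kopen_sub[OF C(1)] by (auto simp: sat_def agree_def)
 ultimately have "sat U h.Ft C = U" by (rule h.line_connected)
 thus ?thesis using w by (auto simp: sat_def h.Ft_def)
qed

section \<open>Plane curves over an algebraically closed field\<close>

lemma coeffs_in_synthetic_div:
 assumes "is_ring A" "c : A" shows "coeffs_in A p ==> coeffs_in A (synthetic_div p c)"
 using assms by (induction p) (auto simp: coeffs_in_pCons_iff coeffs_in_0 synthetic_div_pCons intro!: subring_poly)

lemma ieval_pderiv: "ieval (pderiv G) x = pderiv (ieval G x)" by (rule poly_eqI) (simp add: coeff_pderiv poly_of_nat)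

lemma simple_root_minpoly:
 assumes K: "is_field K" and q: "is_minpoly K y q" and p: "coeffs_in K p" "poly p y = 0" "poly (pderiv p) y~=0"
 shows "poly (pderiv q) y~=0"
proof
 assume a: "poly (pderiv q) y = 0"
 obtain s where s: "p = q * s" using minpoly_dvd[OF K q p(1,2)] by (elim dvdE)
 have "poly (pderiv p) y = poly q y*poly (pderiv s) y+poly s y*poly (pderiv q) y" unfolding s by (simp add: pderiv_mult)
 thus False using a q p(3) by (simp add: is_minpoly_def)
qed

context line_ext
begin

text \<open>A norm c' outside of C has a neighbourhood that depends on a finite extension of F(t) only, on which there
are finitely many norms above that of c'. One element y0 separates c' from those of them that come from C, a
power y of y0 is separable over F(t), and saturating C with respect to F(t,y) still misses c'.\<close>

lemma reduce_to_simple: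
 assumes C: "kopen U (acl Ft) C" "kopen U (acl Ft) (U-C)" "C~={}" "C~=U"
 shows "EX y D q. y : acl Ft & kopen U (fgen (insert y Ft)) D & kopen U (fgen (insert y Ft)) (U-D) & D~={} & D~=U &
  coeffs_in Ft q & poly q y = 0 & poly (pderiv q) y~=0"
proof -
 have CU: "C<=U" by (rule kopen_sub[OF C(1)])
 then obtain c' where c': "c' : U-C" using C(4) by blast
 have nc': "nonarch_norm c'" using c' U_nonarch by simp
 obtain Y e where Y: "finite Y" "Y<=acl Ft" "0 < e" "!!u. u : U ==> close Y e u c' ==> u : U-C" using kopenE[OF C(2) c'] by metis
 obtain n where n: "!!w. nonarch_norm w ==> EX A. finite A & card A<=n & (ALL u:A. nonarch_norm u) &
  (ALL v. nonarch_norm v & agree Ft v w --> (EX u:A. agree (fgen (Ft Un Y)) u v))" using finite_norm_restrictions[OF Ft_field Ft_inf Y(1,2)] by blast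
 obtain A where A: "finite A" "!!u. u : A ==> nonarch_norm u"
  "!!v. nonarch_norm v ==> agree Ft v c' ==> EX u:A. agree (fgen (Ft Un Y)) u v" using n[OF nc'] by blast
 define L where "L = fgen (Ft Un Y)"
 note L = fgen_Un(1-3)[where A = Ft and B = Y, folded L_def] fgen_subset_acl[OF Ft_field Ft_inf Y(2), folded L_def]
 define M where "M = L-{0}"
 define Pr where "Pr = (%u. (u, c')) ` {u:A. EX x:M. u x~=c' x}"
 have "EX x:M. ALL (u, v):Pr. u x~=v x"
 proof (rule separating_element)
  note R = field_ring[OF L(1)]
  show "1 : M" using R by (auto simp: M_def subring_one)
  show "x*y : M" if "x : M" "y : M" for x y using that R by (auto simp: M_def subring_mult)
  show "finite Pr" using A(1) by (simp add: Pr_def)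
 next
  fix u v assume "(u, v) : Pr" thus "EX x:M. u x~=v x" by (auto simp: Pr_def)
 next
  fix u v x assume "(u, v) : Pr" "x : M"
  hence "nonarch_norm u" "nonarch_norm v" "x~=0" using A(2) nc' by (auto simp: Pr_def M_def)
  thus "0 < u x & 0 < v x" using nan_pos by blast
 next
  fix u v x y assume "(u, v) : Pr"
  hence "nonarch_norm u" "nonarch_norm v" using A(2) nc' by (auto simp: Pr_def)
  thus "u (x*y) = u x*u y & v (x*y) = v x * v y" using nan_mult by blast
 qed
 then obtain y0 where y0: "y0 : M" "!!u v. (u, v) : Pr ==> u y0~=v y0" by blast
 have y0L: "y0 : acl Ft" using y0(1) L(4) by (auto simp: M_def)
 have sep: "v y0~=c' y0" if v: "v : C" "agree Ft v c'" for v
 proof -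
  have nv: "nonarch_norm v" using v(1) CU U_nonarch by blast
  obtain u where u: "u : A" "agree L u v" using A(3)[OF nv v(2)] by (auto simp: L_def)
  have "~ close Y e v c'" using Y(4)[of v] v(1) CU by blast
  then obtain z where z: "z : Y" "v z~=c' z" using Y(3) by (auto simp: close_def)
  have uz: "u z~=c' z" using z L(3) u(2) by (auto simp: agree_def)
  have "z~=0" using z(2) nan_zero[OF nv] nan_zero[OF nc'] by auto
  hence "z : M" using z(1) L(3) by (auto simp: M_def)
  hence "(u, c') : Pr" using u(1) uz by (auto simp: Pr_def)
  from y0(2)[OF this] show ?thesis using u(2) y0(1) by (simp add: agree_def M_def)
 qed
 obtain p where p: "coeffs_in Ft p" "p~=0" "poly p y0 = 0" using y0L by (auto simp: acl_def alg_def)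
 obtain m q where q: "0 < m" "coeffs_in Ft q" "poly q (y0^m) = 0" "poly (pderiv q) (y0^m)~=0" using simple_root_of_power[OF Ft_field p] by blast
 define y where "y = y0^m"
 define K where "K = fgen (insert y Ft)"
 note K = fgen_ins(1-3)[where x = y and A = Ft, folded K_def] and Kinf = fgen_ins(4)[OF Ft_inf, of y, folded K_def]
 have FK: "F<=K" using F_Ft K(2) by blast
 have C': "kopen U (acl K) C" "kopen U (acl K) (U-C)" using C(1,2) kopen_mono acl_mono[OF K(2)] by blast+
 define D where "D = sat U K C"
 have D1: "kopen U K D" unfolding D_def U_def by (rule kopen_sat[OF K(1) Kinf FK C'(1)[unfolded U_def]])
 have D2: "kopen U K (U-D)" unfolding D_def U_def by (rule kopen_Diff_sat[OF K(1) Kinf FK C'(2)[unfolded U_def] CU[unfolded U_def]])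
 have CD: "C<=D" using CU by (auto simp: D_def sat_def agree_def)
 have c'D: "c' ~: D"
 proof
  assume "c' : D"
  then obtain v where v: "v : C" "agree K v c'" by (auto simp: D_def sat_def)
  have nv: "nonarch_norm v" using v(1) CU U_nonarch by blast
  have "v y = c' y" using v(2) K(3) by (simp add: agree_def)
  hence "v y0^m = c' y0^m" by (simp add: y_def nan_power[OF nv] nan_power[OF nc'])
  hence "v y0 = c' y0" using q(1) nan_nonneg[OF nv] nan_nonneg[OF nc'] by (metis power_eq_imp_eq_base)
  thus False using sep[OF v(1) agree_mono[OF v(2) K(2)]] by simp
 qed
 have yy: "y : acl Ft" unfolding y_def using y0L by (intro subring_power field_ring subfield_acl Ft_field Ft_inf)
 have "D~={}" using CD C(3) by blast
 moreover have "D~=U" using c'D c' by blast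
 ultimately have "y : acl Ft & kopen U K D & kopen U K (U-D) & D~={} & D~=U &
  coeffs_in Ft q & poly q y = 0 & poly (pderiv q) y~=0" using yy D1 D2 q(2-4) by (simp only: y_def simp_thms)
 thus ?thesis unfolding K_def by metis
qed

lemma ieval_Ft: "(!!i. coeffs_in F (coeff G i)) ==> coeffs_in Ft (ieval G t)"
 using subring_poly[OF Ft_ring coeffs_in_mono[OF _ F_Ft] t_Ft] by (simp add: coeffs_in_def[of Ft])

lemma ieval_F: "(!!i. coeffs_in F (coeff G i)) ==> c : F ==> coeffs_in F (ieval G c)"
 using subring_poly[OF F_ring] by (simp add: coeffs_in_def[of F "ieval G c"])

text \<open>Clearing denominators with D and replacing y by D y makes the equation monic over F[t].\<close>

lemma integral_generator:
 assumes y: "y : acl Ft" and q0: "coeffs_in Ft q0" "poly q0 y = 0" "poly (pderiv q0) y~=0"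
 shows "EX z P. fgen (insert z Ft) = fgen (insert y Ft) & (ALL i. coeffs_in F (coeff P i)) & lead_coeff P = 1 &
  is_minpoly Ft z (ieval P t) & degree (ieval P t) = degree P & poly (pderiv (ieval P t)) z~=0"
proof -
 obtain q where q: "is_minpoly Ft y q" using minpoly_exists[OF Ft_field] y by (auto simp: acl_def)
 have qK: "coeffs_in Ft q" "lead_coeff q = 1" "poly q y = 0" using q by (auto simp: is_minpoly_def)
 obtain d G where G: "coeffs_in F d" "poly d t~=0" "!!i. coeffs_in F (coeff G i)" "ieval G t = smult (poly d t) q"
  using clear_denominators[OF F_field qK(1)[unfolded Ft_def]] by blast
 define D where "D = poly d t"
 define n where "n = degree q"
 define P where "P = (SUM i<=n. monom (if i = n then 1 else d^(n-1-i)*coeff G i) i)"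
 have Pc: "coeff P i = (if i < n then d^(n-1-i)*coeff G i else if i = n then 1 else 0)" for i by (auto simp: P_def coeff_sum_monom)
 have PF: "coeffs_in F (coeff P i)" for i unfolding Pc using G F_ring by (auto intro!: coeffs_in_mult coeffs_in_power coeffs_in_1 coeffs_in_0)
 have degP: "degree P = n" by (rule antisym) (auto intro!: degree_le le_degree simp: Pc)
 define q1 where "q1 = ieval P t"
 have GD: "poly (coeff G i) t = D*coeff q i" for i using arg_cong[OF G(4), of "%p. coeff p i"] by (simp add: D_def)
 have q1c: "coeff q1 i = (if i<=n then D^(n-i)*coeff q i else 0)" for i
 proof -
  have "D^(n-Suc i)*(D*coeff q i) = D^(n-i)*coeff q i" if "i < n" using that power_Suc2[of D "n-Suc i"] by (simp add: Suc_diff_Suc mult.assoc[symmetric])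
  thus ?thesis using qK(2) by (auto simp: q1_def Pc GD n_def D_def[symmetric])
 qed
 have deg1: "degree q1 = n" using qK(2) by (intro antisym degree_le le_degree) (auto simp: q1c n_def)
 have lead1: "lead_coeff q1 = 1" using deg1 qK(2) by (simp add: q1c n_def)
 have D0: "D~=0" and DFt: "D : Ft" using G(2) subring_poly[OF Ft_ring coeffs_in_mono[OF G(1) F_Ft] t_Ft] by (auto simp: D_def)
 define z where "z = D*y"
 have "poly q1 z = (SUM i<=n. coeff q1 i*z^i)" by (simp add: poly_altdef deg1)
 also have "... = (SUM i<=n. D^n*(coeff q i*y^i))" by (intro sum.cong) (auto simp: q1c z_def power_mult_distrib power_add[symmetric] algebra_simps)
 also have "... = D^n*poly q y" by (simp add: poly_altdef n_def sum_distrib_left)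
 finally have q1z: "poly q1 z = 0" using qK by simp
 have q1K: "coeffs_in Ft q1" unfolding q1_def by (rule ieval_Ft[OF PF])
 have lin: "coeffs_in Ft [:0, D:]" "coeffs_in Ft [:0, inverse D:]"
  using DFt Ft_ring subfield_inverse[OF Ft_field DFt] by (auto simp: coeffs_in_pCons_iff coeffs_in_0 subring_zero)
 have min: "is_minpoly Ft z q1" unfolding is_minpoly_def
 proof (intro conjI allI impI q1K lead1 q1z)
  fix p assume p: "coeffs_in Ft p & p~=0 & poly p z = 0"
  have "coeffs_in Ft (pcompose p [:0, D:])" using p lin Ft_ring by (intro coeffs_in_pcompose) auto
  moreover have "poly (pcompose p [:0, D:]) y = 0" using p by (simp add: poly_pcompose z_def mult.commute)
  moreover have "degree (pcompose p [:0, D:]) = degree p" using D0 by (simp add: degree_pcompose)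
  moreover have "pcompose p [:0, D:]~=0" using p D0 by (simp add: pcompose_eq_0_iff)
  ultimately show "degree q1<=degree p" using q deg1 unfolding is_minpoly_def n_def by metis
 qed
 have "poly (pderiv q1) z~=0"
 proof (rule simple_root_minpoly[OF Ft_field min])
  define r where "r = pcompose q0 [:0, inverse D:]"
  show "coeffs_in Ft r" unfolding r_def using q0 lin Ft_ring by (intro coeffs_in_pcompose)
  have zD: "z*inverse D = y" "inverse D*z = y" using D0 by (simp_all add: z_def)
  show "poly r z = 0" using q0(2) zD by (simp add: r_def poly_pcompose)
  show "poly (pderiv r) z~=0" using q0(3) D0 zD by (simp add: r_def pderiv_pcompose poly_pcompose pderiv_pCons)
 qed
 moreover have "fgen (insert z Ft) = fgen (insert y Ft)"
 proof
  have "insert z Ft<=fgen (insert y Ft)" unfolding z_def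
   using fgen_ins(2)[of Ft y] fgen_ins(3)[of y Ft] DFt by (auto intro!: subring_mult field_ring subfield_fgen)
  thus "fgen (insert z Ft)<=fgen (insert y Ft)" by (intro fgen_least subfield_fgen)
  have "z/D : fgen (insert z Ft)" using fgen_ins(2)[of Ft z] fgen_ins(3)[of z Ft] DFt by (intro subfield_divide subfield_fgen) auto
  hence "insert y Ft<=fgen (insert z Ft)" using D0 fgen_ins(2)[of Ft z] by (simp add: z_def)
  thus "fgen (insert y Ft)<=fgen (insert z Ft)" by (intro fgen_least subfield_fgen)
 qed
 ultimately show ?thesis using PF degP min deg1 unfolding q1_def by (intro exI[of _ z] exI[of _ P]) (auto simp: Pc)
qed

lemma gnorm_U:
 assumes "w : U" "coeffs_in F g" shows "gnorm w r g = gnorm w0 r g" unfolding gnorm_def using U_F[OF assms(1)] coeffs_inD[OF assms(2)] by simp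

lemma close_values:
 assumes G: "!!i. coeffs_in F (coeff G i)" and c: "c : F" and B: "1<=B"
 shows "EX M>0. ALL w:U. ALL v. w t<=B --> w v<=B -->
  w (poly (ieval G t) v-poly (ieval G c) v)<=M*w (t-c)"
proof -
 define B' where "B' = max B (w0 c)"
 have "1<=B'" using B by (simp add: B'_def)
 have "EX M. lip_bound U {0, 1 :: nat} B' (%b. poly (ieval G (b 0)) (b 1)) M"
  by (rule polyfun_continuous[OF polyfun_ieval[OF F_ring _ _ G] \<open>1<=B'\<close>]) (use U_nonarch U_F in auto)
 then obtain M where "lip_bound U {0, 1 :: nat} B' (%b. poly (ieval G (b 0)) (b 1)) M" ..
 note M = lip_boundD[OF this]
 have "w (poly (ieval G t) v-poly (ieval G c) v)<=M*w (t-c)" if w: "w : U" "w t<=B" "w v<=B" for w v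
 proof -
  have "near_on w {0, 1 :: nat} B' (w (t-c)) (%i. if i = 0 then t else v) (%i. if i = 0 then c else v)"
   using w U_F[OF w(1) c] nan_nonneg[OF U_nonarch[OF w(1)]] by (auto simp: near_on_def B'_def nan_zero[OF U_nonarch[OF w(1)]])
  from M(4)[OF w(1) this] show ?thesis by simp
 qed
 thus ?thesis using M(1) by (intro exI[of _ M]) auto
qed

end

text \<open>The curve P(t,y) = 0, monic and irreducible in y. Its points above c in F are the pairs (c,b) with P(c,b) = 0, and a
norm is near such a point if w(t - c) and w(y - b) are small.\<close>

locale plane_curve = line_ext F w0 t for F :: "'a::alg_closed_field set" and w0 t +
 fixes y :: 'a and P :: "'a poly poly"
 assumes PF: "coeffs_in F (coeff P i)" and P_monic: "lead_coeff P = 1"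
  and P_min: "is_minpoly Ft y (ieval P t)" and deg_P: "degree (ieval P t) = degree P"
  and P_simple: "poly (pderiv (ieval P t)) y~=0"
begin

definition "K = fgen (insert y Ft)"

lemma P_root: "poly (ieval P t) y = 0" using P_min by (simp add: is_minpoly_def)
lemma alg_y: "alg Ft y" by (rule minpoly_alg[OF P_min])
lemma K_field: "is_field K" by (simp add: K_def subfield_fgen)
lemma Ft_K: "Ft<=K" and y_K: "y : K" by (simp_all add: K_def fgen_ins)
lemma K_eq: "K = {poly g y | g. coeffs_in Ft g}" unfolding K_def by (rule fgen_insert_alg[OF Ft_field Ft_inf alg_y])
lemma K_acl: "K<=acl Ft" unfolding K_def using alg_y subfield_acl[OF Ft_field Ft_inf] subset_acl[OF Ft_ring] by (intro fgen_least) (auto simp: acl_def)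

lemma low_degree_zero:
 assumes G: "!!i. coeffs_in F (coeff G i)" "degree G < degree P" "poly (ieval G t) y = 0"
 shows "G = 0"
proof -
 have "degree (ieval G t)<=degree G" by (intro degree_le) (simp add: coeff_eq_0)
 moreover have "coeffs_in Ft (ieval G t)" by (rule ieval_Ft[OF G(1)])
 ultimately have "ieval G t = 0" using P_min G(2,3) deg_P unfolding is_minpoly_def by (metis le_less_trans linorder_not_le)
 hence "poly (coeff G i) t = 0" for i by (metis coeff_ieval coeff_0)
 hence "coeff G i = 0" for i using transc[OF G(1)] by blast
 thus ?thesis by (intro poly_eqI) simp
qed

text \<open>The inverse of dP/dy lies in F(t)[y], and its denominator d can vanish only below a multiple root.\<close>

lemma discriminant:
 "EX d. coeffs_in F d & d~=0 & (ALL c b. poly (ieval P c) b = 0 & poly d c~=0 --> poly (pderiv (ieval P c)) b~=0)"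
proof -
 define v where "v = poly (pderiv (ieval P t)) y"
 have "coeffs_in Ft (pderiv (ieval P t))" using P_min Ft_ring by (intro coeffs_in_pderiv) (auto simp: is_minpoly_def)
 hence "v : K" unfolding v_def K_eq by blast
 hence "inverse v : K" by (rule subfield_inverse[OF K_field])
 then obtain g where g: "coeffs_in Ft g" "inverse v = poly g y" unfolding K_eq by blast
 obtain d B where B: "coeffs_in F d" "poly d t~=0" "!!i. coeffs_in F (coeff B i)" "ieval B t = smult (poly d t) g"
  using clear_denominators[OF F_field g(1)[unfolded Ft_def]] by blast
 define H where "H = B*pderiv P-[:d:]"
 note RF = coeffs_in_Collect_ring[OF F_ring]
 have HF: "coeffs_in {g. coeffs_in F g} H" unfolding H_def
  using B PF by (intro coeffs_in_diff[OF RF] coeffs_in_mult[OF RF] coeffs_in_pderiv[OF RF] coeffs_in_const[OF RF]) (auto simp: coeffs_in_def)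
 have PF': "coeffs_in {g. coeffs_in F g} P" using PF by (simp add: coeffs_in_def)
 obtain s r where sr: "coeffs_in {g. coeffs_in F g} r" "H = s*P+r" "r = 0 \<or> degree r < degree P" using monic_division_over[OF RF PF' P_monic HF] by metis
 have v0: "v~=0" using P_simple by (simp add: v_def)
 have "poly (ieval H t) y = poly d t*poly g y * v-poly d t" by (simp add: H_def ieval_diff ieval_mult B(4) ieval_pderiv v_def ieval_pCons) (simp add: ieval_def)
 also have "... = 0" using g(2) v0 by (simp flip: g(2))
 finally have "poly (ieval H t) y = 0" .
 hence "poly (ieval r t) y = 0" using sr(2) P_root by (simp add: ieval_add ieval_mult)
 hence "r = 0" using sr(1,3) low_degree_zero[of r] by (auto simp: coeffs_in_def[of "{g. coeffs_in F g}"])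
 have "poly (pderiv (ieval P c)) b~=0" if "poly (ieval P c) b = 0" "poly d c~=0" for c b
 proof
  assume a: "poly (pderiv (ieval P c)) b = 0"
  have "poly (ieval H c) b = 0" using sr(2) \<open>r = 0\<close> that(1) by (simp add: ieval_mult)
  moreover have "poly (ieval H c) b = - poly d c" by (simp add: H_def ieval_diff ieval_mult ieval_pderiv a ieval_pCons) (simp add: ieval_def)
  ultimately show False using that(2) by simp
 qed
 moreover have "d~=0" using B(2) by auto
 ultimately show ?thesis using B(1) by blast
qed

lemma degree_bound: "EX e>=1. ALL i. degree (coeff P i)<=e"
proof -
 define e where "e = Max (insert 1 ((%i. degree (coeff P i)) ` {..degree P}))"
 have "degree (coeff P i)<=e" for i
 proof (cases "i<=degree P")
  case True thus ?thesis unfolding e_def by (intro Max_ge) auto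
 qed (simp add: coeff_eq_0)
 moreover have "1<=e" unfolding e_def by (rule Max_ge) auto
 ultimately show ?thesis by blast
qed

lemma poly_growth:
 assumes g: "coeffs_in F g" "degree g<=e" and w: "w : U"
 shows "w (poly g t)<=gnorm w0 1 g*max 1 (w t)^e"
proof -
 note nw = U_nonarch[OF w]
 define s where "s = max 1 (w t)"
 have s: "1<=s" by (simp add: s_def)
 have f0: "0<=gnorm w0 1 g" by (rule gnorm_nonneg[OF nan_seminorm[OF w0] coeffs_in_UNIV]) simp
 have "w (poly g t)<=gnorm w0 1 g * s^e" unfolding poly_altdef
 proof (rule nan_sum_le[OF nw])
  show "0<=gnorm w0 1 g * s^e" using f0 s by simp
  fix j assume j: "j : {..degree g}"
  have "w (coeff g j) = w0 (coeff g j)" using U_F[OF w] g by (simp add: coeffs_in_def)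
  also have "... <= gnorm w0 1 g" using le_gnorm[OF nan_seminorm[OF w0] coeffs_in_UNIV, of 1 g j] by simp
  finally have 1: "w (coeff g j)<=gnorm w0 1 g" .
  have "w t^j<=s^j" using nan_nonneg[OF nw] by (intro power_mono) (auto simp: s_def)
  also have "... <= s^e" using j g(2) s by (intro power_increasing) auto
  finally show "w (coeff g j*t^j)<=gnorm w0 1 g * s^e" unfolding nan_mult[OF nw] nan_power[OF nw] using 1 f0 nan_nonneg[OF nw] by (intro mult_mono) auto
 qed
 thus ?thesis by (simp add: s_def)
qed

lemma root_growth:
 assumes e: "!!i. degree (coeff P i)<=e"
 shows "EX M>=1. ALL w:U. ALL z. poly (ieval P t) z = 0 --> w z<=M*max 1 (w t)^e"
proof -
 define f where "f i = gnorm w0 1 (coeff P i)" for i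
 have f0: "0<=f i" for i using gnorm_nonneg[OF nan_seminorm[OF w0] coeffs_in_UNIV, of 1] by (simp add: f_def)
 define M where "M = 1+(SUM i<=degree P. f i)"
 have M1: "1<=M" unfolding M_def using sum_nonneg[of "{..degree P}" f] f0 by simp
 have "w z<=M*max 1 (w t)^e" if w: "w : U" and z: "poly (ieval P t) z = 0" for w z
 proof -
  have pe: "1<=max 1 (w t)^e" by simp
  show ?thesis
  proof (rule root_bound[OF U_nonarch[OF w] _ z])
   show "lead_coeff (ieval P t) = 1" using P_min by (simp add: is_minpoly_def)
   show "1<=M*max 1 (w t)^e" using M1 pe by (metis mult_1 mult_mono' zero_le_one)
   fix i assume i: "i < degree (ieval P t)"
   have "w (poly (coeff P i) t)<=f i*max 1 (w t)^e" unfolding f_def by (rule poly_growth[OF PF e w])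
   also have "f i<=M" unfolding M_def using member_le_sum[of i "{..degree P}" f] f0 i deg_P by simp
   hence "f i*max 1 (w t)^e<=M*max 1 (w t)^e" using pe by (intro mult_right_mono) auto
   finally show "w (coeff (ieval P t) i)<=M*max 1 (w t)^e" by simp
  qed
 qed
 thus ?thesis using M1 by blast
qed

end

section \<open>Points of the curve above a neighbourhood of c\<close>

section \<open>Functions with prescribed poles\<close>

text \<open>More unknowns than equations: eliminate one unknown.\<close>

lemma homogeneous_system:
 fixes K :: "'a::field set" and a :: "'e => 'v => 'a"
 assumes K: "is_field K"
 shows "finite E ==> finite V ==> card E < card V ==> (!!e v. a e v : K) ==>
  EX x. (ALL v. x v : K) & (EX v:V. x v~=0) & (ALL e:E. (SUM v:V. a e v * x v) = 0)"
proof (induction E arbitrary: V a rule: finite_induct)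
 case empty
 hence "V~={}" by auto
 thus ?case using subring_one[OF field_ring[OF K]] by (intro exI[of _ "%_. 1"]) auto
next
 case (insert e E)
 note R = field_ring[OF K]
 show ?case
 proof (cases "ALL v:V. a e v = 0")
  case True
  have "card E < card V" using insert by simp
  with insert.IH[of V a] insert.prems obtain x where
   "(ALL v. x v : K) & (EX v:V. x v~=0) & (ALL e:E. (SUM v:V. a e v * x v) = 0)" by blast
  thus ?thesis using True by (intro exI[of _ x]) simp
 next
  case False
  then obtain u where u: "u : V" "a e u~=0" by blast
  define W where "W = V-{u}"
  have W: "finite W" "card E < card W" using insert u by (auto simp: W_def)
  define a' where "a' f v = a f v-a f u*a e v/a e u" for f v
  have a': "a' f v : K" for f v unfolding a'_def by (intro subring_diff[OF R] subfield_divide[OF K] subring_mult[OF R] insert.prems(3))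
  from insert.IH[of W a', OF W a'] obtain x where
   x: "!!v. x v : K" "EX v:W. x v~=0" "!!f. f : E ==> (SUM v:W. a' f v * x v) = 0" by auto
  define z where "z = - (SUM v:W. a e v * x v)/a e u"
  define x' where "x' = x(u := z)"
  have zK: "z : K" unfolding z_def by (intro subfield_divide[OF K] subring_uminus[OF R] subring_sum[OF R] subring_mult[OF R] x(1) insert.prems(3))
  have sum: "(SUM v:V. a f v * x' v) = a f u*z+(SUM v:W. a f v * x v)" for f
  proof -
   have "(SUM v:V. a f v * x' v) = a f u*x' u+(SUM v:W. a f v * x' v)" unfolding W_def by (rule sum.remove[OF insert.prems(1) u(1)])
   also have "(SUM v:W. a f v * x' v) = (SUM v:W. a f v * x v)" by (rule sum.cong) (auto simp: W_def x'_def)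
   finally show ?thesis by (simp add: x'_def)
  qed
  have "(SUM v:V. a f v * x' v) = 0" if f: "f : insert e E" for f
  proof (cases "f = e")
   case True
   thus ?thesis using u(2) by (simp add: sum z_def)
  next
   case False
   hence "f : E" using f by simp
   from x(3)[OF this] have "(SUM v:W. a f v * x v) = (SUM v:W. a f u*a e v/a e u*x v)" by (simp add: a'_def left_diff_distrib sum_subtractf)
   also have "... = a f u/a e u*(SUM v:W. a e v * x v)" unfolding sum_distrib_left by (rule sum.cong) simp_all
   finally show ?thesis by (simp add: sum z_def)
  qed
  moreover have "EX v:V. x' v~=0" using x(2) by (auto simp: W_def x'_def)
  moreover have "x' v : K" for v using x(1) zK by (simp add: x'_def)
  ultimately show ?thesis by blast
 qed
qed

lemma prod_mset_less_imp:
 fixes f :: "'b => real"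
 assumes "0 < d" "(PROD x:#A. f x) < d^size A"
 shows "\<exists>x\<in>#A. f x < d"
proof (rule ccontr)
 assume "~ ?thesis"
 hence "d^size A<=(PROD x:#A. f x)" using assms(1)
 proof (induction A)
  case (add x A)
  thus ?case by (simp add: mult_mono)
 qed simp
 thus False using assms(2) by simp
qed

text \<open>The value at v is the product of the distances to the roots.\<close>

lemma root_near:
 fixes p :: "'a::alg_closed_field poly"
 assumes w: "nonarch_norm w" and p: "lead_coeff p = 1" and d: "0 < d" and less: "w (poly p v) < d^degree p"
 shows "EX x. poly p x = 0 & w (v-x) < d"
proof -
 obtain A where A: "size A = degree p" "p = (PROD x:#A. [:-x, 1:])" using splits_monic[OF p] by blast
 have "(PROD x:#A. w (v-x)) < d^size A" using less unfolding A(1)[symmetric] by (subst (asm) A(2)) (simp only: poly_prod_linear nan_prod_mset[OF w])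
 from prod_mset_less_imp[OF d this] show ?thesis using A(2) poly_prod_linear_eq_0_iff by metis
qed

lemma prod_mset_le_power:
 fixes f :: "'b => real"
 assumes "!!x. x :# A ==> 0<=f x & f x<=B" "0<=B"
 shows "(PROD x:#A. f x)<=B^size A & 0<=(PROD x:#A. f x)" using assms by (induction A) (auto intro!: mult_mono)

context plane_curve
begin

lemma bounded_roots:
 "EX B>=1. R<=B & (ALL w:U. w t<=R --> (ALL z. poly (ieval P t) z = 0 --> w z<=B))"
proof -
 obtain e where e: "!!i. degree (coeff P i)<=e" using degree_bound by blast
 obtain M where M: "1<=M" "!!w z. w : U ==> poly (ieval P t) z = 0 ==> w z<=M*max 1 (w t)^e" using root_growth[OF e] by blast
 define r where "r = max 1 R"
 define B where "B = M*r^e+r"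
 have r1: "1<=r" by (simp add: r_def)
 have B: "r<=B" "M*r^e<=B" using M(1) r1 by (auto simp: B_def)
 have "w z<=B" if w: "w : U" "w t<=R" "poly (ieval P t) z = 0" for w z
 proof -
  have "max 1 (w t)^e<=r^e" using w(2) by (intro power_mono) (auto simp: r_def)
  hence "M*max 1 (w t)^e<=M*r^e" using M(1) by (intro mult_left_mono) auto
  thus ?thesis using M(2)[OF w(1,3)] B by (meson order.trans)
 qed
 moreover have "R<=B" using B(1) by (simp add: r_def)
 ultimately show ?thesis using B r1 by (intro exI[of _ B]) auto
qed

lemma bounded_near:
 assumes c: "c : F"
 shows "EX B>=1. ALL w:U. w (t-c)<=1 --> w t<=B & (ALL z. poly (ieval P t) z = 0 --> w z<=B)"
proof -
 obtain B where B: "1<=B" "max 1 (w0 c)<=B"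
  "!!w z. w : U ==> w t<=max 1 (w0 c) ==> poly (ieval P t) z = 0 ==> w z<=B" using bounded_roots[of "max 1 (w0 c)"] by blast
 have tr: "w t<=max 1 (w0 c)" if w: "w : U" "w (t-c)<=1" for w using nan_add[OF U_nonarch[OF w(1)], of "t-c" c] w U_F[OF w(1) c] by auto
 show ?thesis
 proof (intro exI[of _ B] conjI ballI impI allI B(1))
  fix w assume w: "w : U" "w (t-c)<=1"
  show "w t<=B" using tr[OF w] B(2) by linarith
  show "w z<=B" if "poly (ieval P t) z = 0" for z using B(3)[OF w(1) tr[OF w] that] .
 qed
qed

lemma P_c_monic: "lead_coeff (ieval P c) = 1" and P_c_degree: "degree (ieval P c) = degree P"
proof -
 have 1: "coeff (ieval P c) (degree P) = 1" using P_monic by simp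
 have "degree (ieval P c)<=degree P" by (intro degree_le) (simp add: coeff_eq_0)
 moreover have "degree P<=degree (ieval P c)" by (rule le_degree) (simp only: 1, simp)
 ultimately show "degree (ieval P c) = degree P" by simp
 thus "lead_coeff (ieval P c) = 1" using 1 by simp
qed

lemma P_c_coeffs: "c : F ==> coeffs_in F (ieval P c)" by (rule ieval_F[OF PF])

lemma P_c_root_F: "c : F ==> poly (ieval P c) b = 0 ==> b : F"
 using P_c_coeffs P_c_monic[of c] F(1) unfolding aclosed_def alg_def by (metis leading_coeff_0_iff zero_neq_one)

text \<open>If t is close to c, then P(c,y) is close to P(t,y) = 0.\<close>

lemma exists_near_root:
 assumes c: "c : F" and d: "0 < d"
 shows "EX e>0. ALL w:U. w (t-c) < e --> (EX b. poly (ieval P c) b = 0 & w (y-b) < d)"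
proof -
 obtain B where B: "1<=B" "!!w. w : U ==> w (t-c)<=1 ==> w t<=B & (ALL z. poly (ieval P t) z = 0 --> w z<=B)" using bounded_near[OF c] by blast
 obtain M where M: "0 < M" "!!w v. w : U ==> w t<=B ==> w v<=B ==>
  w (poly (ieval P t) v-poly (ieval P c) v)<=M*w (t-c)" using close_values[OF PF c B(1)] by blast
 define e where "e = min 1 (d^degree P/M)"
 have e: "0 < e" using d M by (simp add: e_def)
 have "EX b. poly (ieval P c) b = 0 & w (y-b) < d" if w: "w : U" "w (t-c) < e" for w
 proof (rule root_near[OF U_nonarch[OF w(1)] P_c_monic d])
  note nw = U_nonarch[OF w(1)]
  have "w t<=B" "w y<=B" using B(2)[OF w(1)] P_root w(2) by (auto simp: e_def)
  hence "w (poly (ieval P c) y)<=M*w (t-c)" using M(2)[OF w(1), of y] by (simp add: P_root nan_minus[OF nw])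
  also have "... < M*(d^degree P/M)" using w(2) M(1) by (intro mult_strict_left_mono) (simp_all add: e_def)
  finally show "w (poly (ieval P c) y) < d^degree (ieval P c)" using M(1) P_c_degree[of c] by simp
 qed
 thus ?thesis using e by blast
qed

text \<open>Conversely P(t,b) is close to P(c,b) = 0, so that b is close to a conjugate x of y, and the norm is transported from x to y.\<close>

lemma exists_norm_near_root:
 assumes c: "c : F" and b: "poly (ieval P c) b = 0" and d: "0 < d"
 shows "EX e>0. ALL w:U. w (t-c) < e --> (EX u:U. agree Ft u w & u (y-b) < d)"
proof -
 have bF: "b : F" by (rule P_c_root_F[OF c b])
 obtain B1 where B1: "1<=B1" "!!w. w : U ==> w (t-c)<=1 ==> w t<=B1" using bounded_near[OF c] by blast
 define B where "B = max B1 (w0 b)"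
 have B: "1<=B" using B1(1) by (simp add: B_def)
 obtain M where M: "0 < M" "!!w v. w : U ==> w t<=B ==> w v<=B ==>
  w (poly (ieval P t) v-poly (ieval P c) v)<=M*w (t-c)" using close_values[OF PF c B] by blast
 define e where "e = min 1 (d^degree P/M)"
 have e: "0 < e" using d M by (simp add: e_def)
 have "EX u:U. agree Ft u w & u (y-b) < d" if w: "w : U" "w (t-c) < e" for w
 proof -
  note nw = U_nonarch[OF w(1)]
  have "w t<=B" "w b<=B" using B1(2)[OF w(1)] U_F[OF w(1) bF] w(2) by (auto simp: B_def e_def)
  hence "w (poly (ieval P t) b)<=M*w (t-c)" using M(2)[OF w(1), of b] by (simp add: b)
  also have "... < M*(d^degree P/M)" using w(2) M(1) by (intro mult_strict_left_mono) (simp_all add: e_def)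
  finally have "w (poly (ieval P t) b) < d^degree (ieval P t)" using M(1) P_c_degree[of t] by simp
  from root_near[OF nw P_c_monic d this] obtain x where x: "poly (ieval P t) x = 0" "w (b-x) < d" by blast
  from norm_transport[OF Ft_field Ft_inf P_min x(1) nw] obtain u where
   u: "nonarch_norm u" "!!g. coeffs_in Ft g ==> u (poly g y) = w (poly g x)" and ag: "agree Ft u w" by (auto simp: agree_def)
  have bFt: "b : Ft" using bF F_Ft by blast
  have "u (y-b) = w (x-b)" using u(2)[OF coeffs_in_linear[OF Ft_ring bFt]] by (simp add: algebra_simps)
  hence "u (y-b) < d" using x(2) nan_diff_commute[OF nw, of b x] by simp
  thus ?thesis using ag U_agree[OF w(1) u(1) ag] by blast
 qed
 thus ?thesis using e by blast
qed

text \<open>Two such norms differ by a conjugation y \<mapsto> x with x close to y. If x and y were different, dP/dy would be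
small at y, but it is close to its nonzero value at (c,b).\<close>

lemma local_uniqueness:
 assumes c: "c : F" and b: "poly (ieval P c) b = 0" "poly (pderiv (ieval P c)) b~=0"
 shows "EX d>0. ALL w:U. ALL u:U. w (t-c) < d --> w (y-b) < d --> u (y-b) < d --> agree Ft u w --> agree K u w"
proof -
 have bF: "b : F" by (rule P_c_root_F[OF c b(1)])
 obtain B where B: "1<=B" "!!w. w : U ==> w (t-c)<=1 ==> w t<=B & (ALL z. poly (ieval P t) z = 0 --> w z<=B)" using bounded_near[OF c] by blast
 have P'F: "coeffs_in F (coeff (pderiv P) i)" for i
 proof -
  have "coeff (pderiv P) i = smult (of_nat (Suc i)) (coeff P (Suc i))" by (simp add: coeff_pderiv of_nat_poly)
  thus ?thesis using coeffs_in_smult[OF F_ring subring_of_nat[OF F_ring, of "Suc i"] PF, of "Suc i"] by metis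
 qed
 obtain M where M: "0 < M" "!!w v. w : U ==> w t<=B ==> w v<=B ==>
  w (poly (ieval (pderiv P) t) v-poly (ieval (pderiv P) c) v)<=M*w (t-c)" using close_values[OF P'F c B(1)] by blast
 define Q where "Q = synthetic_div (pderiv (ieval P c)) b"
 define D where "D = poly (pderiv (ieval P c)) b"
 have Q: "poly (pderiv (ieval P c)) v-D = (v-b)*poly Q v" for v
 proof -
  have "poly ([:- b, 1:]*Q+[:D:]) v = poly (pderiv (ieval P c)) v" unfolding Q_def D_def synthetic_div_correct' ..
  thus ?thesis by (simp add: algebra_simps)
 qed
 have QF: "coeffs_in F Q" unfolding Q_def by (intro coeffs_in_synthetic_div[OF F_ring bF] coeffs_in_pderiv[OF F_ring] P_c_coeffs c)
 have B0: "0<=B" using B(1) by simp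
 define M' where "M' = 1+gnorm w0 B Q"
 have M': "0 < M'" unfolding M'_def using gnorm_nonneg[OF nan_seminorm[OF w0] coeffs_in_UNIV B0, of Q] by simp
 have D: "D : F" "D~=0" unfolding D_def using b(2) by (auto intro!: subring_poly[OF F_ring] coeffs_in_pderiv[OF F_ring] P_c_coeffs c bF)
 have D0: "0 < w0 D" by (rule nan_pos[OF w0 D(2)])
 define n where "n = degree P"
 define d where "d = min 1 (min (w0 D/M) (min (w0 D/M') (w0 D/B^n)))"
 have d: "0 < d" using D0 M M' B by (simp add: d_def)
 have "agree K u w" if w: "w : U" and u: "u : U" and wt: "w (t-c) < d" and wy: "w (y-b) < d"
  and uy: "u (y-b) < d" and ag: "agree Ft u w" for w u
 proof -
  note nw = U_nonarch[OF w] and nu = U_nonarch[OF u]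
  obtain x where x: "poly (ieval P t) x = 0" "!!g. coeffs_in Ft g ==> u (poly g y) = w (poly g x)"
   using norms_conjugate[OF Ft_field Ft_inf P_min nw nu ag] by blast
  have bFt: "b : Ft" using bF F_Ft by blast
  have "u (y-b) = w (x-b)" using x(2)[OF coeffs_in_linear[OF Ft_ring bFt]] by (simp add: algebra_simps)
  hence wx: "w (x-b) < d" using uy by simp
  have wyx: "w (y-x) < d" using nan_diff[OF nw, of "y-b" "x-b"] wy wx by simp
  have "w (t-c)<=1" using wt by (simp add: d_def)
  hence bd: "w t<=B" "!!z. poly (ieval P t) z = 0 ==> w z<=B" using B(2)[OF w] by auto
  have yx: "y = x"
  proof (rule ccontr)
   assume ne: "y~=x"
   obtain A where A: "size A = n" "ieval P t = (PROD x:#A. [:-x, 1:])" using splits_monic[OF P_c_monic[of t]] P_c_degree[of t] unfolding n_def by metis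
   have rA: "z :# A \<longleftrightarrow> poly (ieval P t) z = 0" for z using A(2) poly_prod_linear_eq_0_iff by metis
   have "y :# A" "x :# A" using rA P_root x(1) by auto
   then obtain A' where A': "A = add_mset y (add_mset x A')" using ne by (metis insert_noteq_member mset_add)
   define p where "p = (PROD x:#add_mset x A'. [:-x, 1:])"
   have eq: "ieval P t = [:-y, 1:]*p" unfolding A(2) A' p_def by simp
   have "poly (pderiv (ieval P t)) y = poly p y" unfolding eq pderiv_mult by (simp add: pderiv_pCons)
   also have "... = (y-x)*(PROD z:#A'. y-z)" unfolding p_def poly_prod_linear by simp
   finally have 1: "w (poly (pderiv (ieval P t)) y) = w (y-x)*(PROD z:#A'. w (y-z))" by (simp add: nan_mult[OF nw] nan_prod_mset[OF nw])
   have "(PROD z:#A'. w (y-z))<=B^size A' & 0<=(PROD z:#A'. w (y-z))"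
   proof (rule prod_mset_le_power[OF _ B0])
    fix z assume "z :# A'"
    hence "z :# A" using A' by simp
    hence "poly (ieval P t) z = 0" using rA by blast
    hence "w z<=B" "w y<=B" using bd(2) P_root by auto
    thus "0<=w (y-z) & w (y-z)<=B" using nan_diff[OF nw, of y z] nan_nonneg[OF nw] by auto
   qed
   moreover have "B^size A'<=B^n" using B(1) A(1) A' by (intro power_increasing) auto
   ultimately have "w (poly (pderiv (ieval P t)) y)<=w (y-x)*B^n" unfolding 1 using nan_nonneg[OF nw] by (intro mult_left_mono) auto
   also have "... < d*B^n" using wyx B(1) by (intro mult_strict_right_mono) auto
   also have "... <= w0 D/B^n*B^n" using B(1) by (intro mult_right_mono) (auto simp: d_def)
   also have "... = w0 D" using B(1) by simp
   finally have small: "w (poly (pderiv (ieval P t)) y) < w0 D" .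
   have y: "w y<=B" using bd(2) P_root by simp
   have "w (poly (pderiv (ieval P t)) y-poly (pderiv (ieval P c)) y)<=M*w (t-c)" using M(2)[OF w bd(1) y] by (simp add: ieval_pderiv)
   also have "... < M*(w0 D/M)" using wt M(1) by (intro mult_strict_left_mono) (auto simp: d_def)
   finally have 2: "w (poly (pderiv (ieval P t)) y-poly (pderiv (ieval P c)) y) < w0 D" using M(1) by simp
   have "w (poly Q y)<=M'" using nan_poly_le[OF nw y B0, of Q] gnorm_U[OF w QF] by (simp add: M'_def)
   hence "w (poly (pderiv (ieval P c)) y-D)<=w (y-b)*M'" unfolding Q nan_mult[OF nw] using nan_nonneg[OF nw] by (intro mult_left_mono)
   also have "... < w0 D/M'*M'" using wy M' by (intro mult_strict_right_mono) (auto simp: d_def)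
   finally have 3: "w (poly (pderiv (ieval P c)) y-D) < w0 D" using M' by simp
   have "w (poly (pderiv (ieval P t)) y-D) < w0 D" using nan_add[OF nw, of "poly (pderiv (ieval P t)) y-poly (pderiv (ieval P c)) y"
     "poly (pderiv (ieval P c)) y-D"] 2 3 by simp
   hence "w (poly (pderiv (ieval P t)) y-D) < w D" using U_F[OF w D(1)] by simp
   from nan_dominant[OF nw this] have "w (poly (pderiv (ieval P t)) y) = w D" by simp
   thus False using small U_F[OF w D(1)] by simp
  qed
  show ?thesis unfolding agree_def K_eq using x(2) yx by auto
 qed
 thus ?thesis using d by blast
qed

end

section \<open>Functions with prescribed poles\<close>

context plane_curve
begin

text \<open>The complement of C surjects onto the line, so that it has norms arbitrarily close to some (c,b). Near this point the
curve is isomorphic to a disc by local uniqueness, and discs are connected. Thus C has no norms near (c,b).\<close>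

lemma bad_root:
 assumes C: "kopen U K C" "kopen U K (U-C)" "C~=U" and c: "c : F"
  and simple: "!!b. poly (ieval P c) b = 0 ==> poly (pderiv (ieval P c)) b~=0"
 shows "EX b d. poly (ieval P c) b = 0 & 0 < d & (ALL w:C. w (t-c) < d --> d<=w (y-b))"
proof -
 have CU: "C<=U" by (rule kopen_sub[OF C(1)])
 define C2 where "C2 = U-C"
 have UC2: "U-C2 = C" using CU by (auto simp: C2_def)
 have a: "kopen U (acl Ft) C2" "kopen U (acl Ft) (U-C2)" using C(1,2) kopen_mono[OF _ K_acl] unfolding UC2 by (auto simp: C2_def)
 have C2: "C2~={}" using C(3) CU by (auto simp: C2_def)
 have t_acl: "t : acl Ft" using subset_acl[OF Ft_ring] t_Ft by blast
 have tc: "t-c : Ft" using t_Ft c F_Ft by (auto intro: subring_diff[OF Ft_ring])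
 have surj: "EX u:C2. u (t-c) = r" if r: "0 < r" for r
 proof -
  obtain w where w: "w : disc_norms c r" using disc_norms_gauss[OF c r] by blast
  obtain u where "u : C2" "agree Ft u w" using clopen_surjective[OF a C2 t_acl t disc_norms_U[OF w]] unfolding Ft_def by blast
  thus ?thesis using disc_norms_center[OF w c r] tc by (auto simp: agree_def)
 qed
 define R where "R = {b. poly (ieval P c) b = 0}"
 have "ieval P c~=0" using P_c_monic[of c] by (metis leading_coeff_0_iff zero_neq_one)
 hence R: "finite R" unfolding R_def by (rule poly_roots_finite)
 have "EX b:R. ALL d>0. EX u:C2. u (t-c) < d & u (y-b) < d"
 proof (rule ccontr)
  assume "~ ?thesis"
  then obtain d where d: "!!b. b : R ==> 0 < d b" "!!b u. b : R ==> u : C2 ==> ~ (u (t-c) < d b & u (y-b) < d b)" by metis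
  define m where "m = Min (insert 1 (d ` R))"
  have m: "0 < m" "!!b. b : R ==> m<=d b" unfolding m_def using R d(1) by auto
  obtain e where e: "0 < e" "!!w. w : U ==> w (t-c) < e ==> EX b. poly (ieval P c) b = 0 & w (y-b) < m" using exists_near_root[OF c m(1)] by blast
  obtain u where u: "u : C2" "u (t-c) = min m e/2" using surj[of "min m e/2"] m(1) e(1) by auto
  hence "u (t-c) < e" "u (t-c) < m" using m(1) e(1) by auto
  then obtain b where "b : R" "u (y-b) < m" using e(2)[of u] u(1) by (auto simp: C2_def R_def)
  thus False using d(2)[of b u] m(2)[of b] u(1) \<open>u (t-c) < m\<close> by linarith
 qed
 then obtain b where b: "b : R" "!!d. 0 < d ==> EX u:C2. u (t-c) < d & u (y-b) < d" by blast
 have root: "poly (ieval P c) b = 0" using b(1) by (simp add: R_def)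
 obtain d0 where d0: "0 < d0" "!!w u. w : U ==> u : U ==> w (t-c) < d0 ==> w (y-b) < d0 ==> u (y-b) < d0 ==>
  agree Ft u w ==> agree K u w" using local_uniqueness[OF c root simple[OF root]] by blast
 obtain e where e: "0 < e" "!!w. w : U ==> w (t-c) < e ==> EX u:U. agree Ft u w & u (y-b) < d0" using exists_norm_near_root[OF c root d0(1)] by blast
 define d where "d = min d0 e"
 have d: "0 < d" "d<=d0" "d<=e" using d0(1) e(1) by (auto simp: d_def)
 define N where "N = {w:U. w (y-b) < d0}"
 have bK: "b : K" using P_c_root_F[OF c root] F_Ft Ft_K by blast
 have "kopen U K N" unfolding N_def by (rule kopen_less) (use y_K bK in \<open>auto intro: subring_diff[OF field_ring[OF K_field]]\<close>)
 hence D: "kopen U K (C Int N)" "kopen U K (C2 Int N)" using C kopen_Int by (auto simp: C2_def)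
 have S: "kopen U Ft (sat U Ft (C Int N))" "kopen U Ft (sat U Ft (C2 Int N))"
  unfolding U_def using D[THEN kopen_mono, OF K_acl, unfolded U_def] by (auto intro!: kopen_sat[OF Ft_field Ft_inf F_Ft])
 have "False" if w: "w : C" "w (t-c) < d" "w (y-b) < d" for w
 proof -
  obtain w' where w': "w' : C2" "w' (t-c) < d" "w' (y-b) < d" using b(2)[OF d(1)] by blast
  show False
  proof (rule disc_connected[OF S c])
   show "w : sat U Ft (C Int N)" using w CU d(2) by (auto simp: sat_def agree_def N_def)
   show "w' : sat U Ft (C2 Int N)" using w' d(2) by (auto simp: sat_def agree_def N_def C2_def)
   show "w (t-c) < d" "w' (t-c) < d" by fact+
   show "v : sat U Ft (C Int N) \<or> v : sat U Ft (C2 Int N)" if v: "v : U" "v (t-c) < d" for v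
   proof -
    obtain u where "u : U" "agree Ft u v" "u (y-b) < d0" using e(2)[of v] v d(3) by auto
    thus ?thesis using v(1) by (auto simp: sat_def N_def C2_def)
   qed
   show "v ~: sat U Ft (C2 Int N)" if v: "v : U" "v (t-c) < d" "v : sat U Ft (C Int N)" for v
   proof
    assume "v : sat U Ft (C2 Int N)"
    then obtain u' where u': "u' : C2" "u' : U" "u' (y-b) < d0" "agree Ft u' v" by (auto simp: sat_def N_def)
    obtain u where u: "u : C" "u : U" "u (y-b) < d0" "agree Ft u v" using v(3) by (auto simp: sat_def N_def)
    have "u (t-c) < d0" using u(4) tc v(2) d(2) by (auto simp: agree_def)
    hence "agree K u' u" using d0(2)[OF u(2) u'(2) _ u(3) u'(3)] agree_trans[OF u'(4) agree_sym[OF u(4)]] by blast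
    hence "u' : C" by (rule kopen_agree[OF C(1) u(1) u'(2)])
    thus False using u'(1) by (simp add: C2_def)
   qed
  qed
 qed
 thus ?thesis using root d(1) by (intro exI[of _ b] exI[of _ d]) (auto simp: not_less[symmetric])
qed

text \<open>The unknowns are the coefficients of G and the mu(c). There are (m+1)n + N of them for N n equations,
where n = deg P, m = e n^2 and N = m + e n, so that a nonzero solution exists. Above c,
G then vanishes at the points of the curve other than (c, b c).\<close>

lemma vanishing_curve:
 assumes S: "finite S" "S<=F" and b: "!!c. c : S ==> poly (ieval P c) (b c) = 0"
  and card: "card S = e*degree P^2+e*degree P"
 shows "EX G mu. G~=0 & (ALL i. coeffs_in F (coeff G i)) & degree G < degree P & (ALL i. degree (coeff G i)<=e*degree P^2) &
  (ALL c:S. mu c : F & ieval G c = smult (mu c) (synthetic_div (ieval P c) (b c)))"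
proof -
 define n where "n = degree P"
 define m where "m = e*n^2"
 have n: "0 < n" using minpoly_degree_pos[OF P_min] deg_P by (simp add: n_def)
 define E where "E c = synthetic_div (ieval P c) (b c)" for c
 have degE: "degree (E c) < n" for c unfolding E_def degree_synthetic_div using n P_c_degree[of c] by (simp add: n_def)
 have E0: "E c~=0" if c: "c : S" for c
 proof
  assume "E c = 0"
  hence "ieval P c = 0" using synthetic_div_correct'[of "b c" "ieval P c"] b[OF c] by (simp add: E_def)
  thus False using P_c_monic[of c] by (metis leading_coeff_0_iff zero_neq_one)
 qed
 have EF: "coeffs_in F (E c)" if c: "c : S" for c
  unfolding E_def using c S(2) b[OF c] P_c_root_F by (intro coeffs_in_synthetic_div[OF F_ring] P_c_coeffs) blast+
 define V where "V = ({..m} \<times> {..<n}) <+> S"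
 define a :: "'a \<times> nat => (nat \<times> nat) + 'a => 'a" where
  "a = (%(c, l) v. if c : S then (case v of Inl (i, l') => if l' = l then c^i else 0
   | Inr c' => if c' = c then - coeff (E c) l else 0) else 0)"
 have aF: "a p v : F" for p v using S(2) EF F_ring
  by (cases p; cases v) (auto simp: a_def subring_zero coeffs_in_def intro!: subring_power[OF F_ring] subring_uminus[OF F_ring])
 have "card (S \<times> {..<n}) < card V"
 proof -
  have "card V = (m+1)*n+card S" unfolding V_def using S(1) by (simp add: card_Plus card_cartesian_product)
  moreover have "card (S \<times> {..<n}) = card S*n" by (simp add: card_cartesian_product)
  moreover have "card S = m+e*n" using card by (simp add: m_def n_def)
  ultimately show ?thesis using n by (simp add: m_def power2_eq_square algebra_simps)
 qed
 moreover have "finite (S \<times> {..<n})" "finite V" using S(1) by (auto simp: V_def)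
 ultimately obtain x where x: "!!v. x v : F" "EX v:V. x v~=0" "!!p. p : S \<times> {..<n} ==> (SUM v:V. a p v * x v) = 0"
  using homogeneous_system[OF F_field, of "S \<times> {..<n}" V a] aF by blast
 define la where "la i l = x (Inl (i, l))" for i l
 define mu where "mu c = x (Inr c)" for c
 define G where "G = (SUM l<n. monom (SUM i<=m. monom (la i l) i) l)"
 have Gl: "coeff G l = (if l < n then (SUM i<=m. monom (la i l) i) else 0)" for l by (simp add: G_def coeff_sum_monom)
 have Gli: "coeff (coeff G l) i = (if l < n & i<=m then la i l else 0)" for l i by (simp add: Gl coeff_sum_monom)
 have GF: "coeffs_in F (coeff G l)" for l unfolding coeffs_in_def Gli using x(1) subring_zero[OF F_ring] by (auto simp: la_def)
 have degG: "degree (coeff G l)<=m" for l by (intro degree_le) (auto simp: Gli)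
 have "degree G<=n-1" by (intro degree_le) (auto simp: Gl)
 hence dG: "degree G < n" using n by linarith
 have Gc: "ieval G c = smult (mu c) (E c)" if c: "c : S" for c
 proof (rule poly_eqI)
  fix l
  show "coeff (ieval G c) l = coeff (smult (mu c) (E c)) l"
  proof (cases "l < n")
   case True
   have "0 = (SUM v:V. a (c, l) v * x v)" using x(3)[of "(c, l)"] c True by simp
   also have "... = (SUM p:{..m} \<times> {..<n}. a (c, l) (Inl p)*x (Inl p))+(SUM c':S. a (c, l) (Inr c')*x (Inr c'))"
    unfolding V_def using S(1) by (subst sum.Plus) (auto simp: comp_def)
   also have "(SUM p:{..m} \<times> {..<n}. a (c, l) (Inl p)*x (Inl p)) = (SUM i<=m. SUM l'<n. if l = l' then c^i*la i l' else 0)"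
    unfolding sum.cartesian_product using c by (intro sum.cong) (auto simp: a_def la_def)
   also have "... = (SUM i<=m. c^i*la i l)" using True by (intro sum.cong refl) (subst sum.delta', auto)
   also have "(SUM c':S. a (c, l) (Inr c')*x (Inr c')) = (SUM c':S. if c = c' then - coeff (E c) l*mu c' else 0)"
    using c by (intro sum.cong) (auto simp: a_def mu_def)
   also have "... = - coeff (E c) l*mu c" using c S(1) by (subst sum.delta') auto
   finally have "(SUM i<=m. c^i*la i l) = mu c*coeff (E c) l" by simp
   moreover have "coeff (ieval G c) l = (SUM i<=m. c^i*la i l)" using True by (simp add: Gl poly_sum poly_monom mult.commute)
   ultimately show ?thesis by simp
  next
   case False
   thus ?thesis using degE[of c] by (simp add: Gl coeff_eq_0)
  qed
 qed
 have "G~=0"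
 proof
  assume G0: "G = 0"
  from x(2) obtain v where v: "v : V" "x v~=0" by blast
  show False
  proof (cases v)
   case (Inl p)
   obtain i l where p: "p = (i, l)" by (cases p)
   have "la i l~=0" "i<=m" "l < n" using v Inl p by (auto simp: V_def la_def)
   thus False using Gli[of l i] G0 by simp
  next
   case (Inr c)
   hence "c : S" "mu c~=0" using v by (auto simp: V_def mu_def)
   thus False using Gc[of c] E0[of c] G0 by (simp add: ieval_def)
  qed
 qed
 moreover have "mu c : F" for c by (simp add: mu_def x(1))
 ultimately show ?thesis using GF dG degG Gc unfolding n_def[symmetric] m_def[symmetric] E_def by (intro exI[of _ G] exI[of _ mu]) auto
qed

lemma function_growth:
 assumes G: "!!i. coeffs_in F (coeff G i)" "!!i. degree (coeff G i)<=m" "degree G<=n" and e: "!!i. degree (coeff P i)<=e"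
 shows "EX M>0. ALL w:U. w (poly (ieval G t) y)<=M*max 1 (w t)^(m+e*n)"
proof -
 obtain M0 where M0: "1<=M0" "!!w. w : U ==> w y<=M0*max 1 (w t)^e" using root_growth[OF e] P_root by blast
 define f where "f i = gnorm w0 1 (coeff G i)" for i
 have f0: "0<=f i" for i using gnorm_nonneg[OF nan_seminorm[OF w0] coeffs_in_UNIV, of 1] by (simp add: f_def)
 define L where "L = 1+(SUM i<=degree G. f i)"
 have L: "0 < L" unfolding L_def using sum_nonneg[of "{..degree G}" f] f0 by (simp add: add_pos_nonneg)
 have fL: "f i<=L" if "i<=degree G" for i unfolding L_def using member_le_sum[of i "{..degree G}" f] f0 that by simp
 have "w (poly (ieval G t) y)<=L*M0^n*max 1 (w t)^(m+e*n)" if w: "w : U" for w unfolding poly_ieval_sum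
 proof (rule nan_sum_le[OF U_nonarch[OF w]])
  note nw = U_nonarch[OF w]
  define s where "s = max 1 (w t)"
  have s: "1<=s" by (simp add: s_def)
  show "0<=L*M0^n*max 1 (w t)^(m+e*n)" using L M0(1) by simp
  fix i assume i: "i : {..degree G}"
  have "w (poly (coeff G i) t)<=f i * s^m" unfolding f_def s_def by (rule poly_growth[OF G(1,2) w])
  also have "... <= L * s^m" using fL i s by (intro mult_right_mono) auto
  finally have 1: "w (poly (coeff G i) t)<=L * s^m" .
  have ge: "1<=M0 * s^e" using M0(1) s by (metis mult_1 mult_mono' one_le_power zero_le_one)
  have "w y^i<=(M0 * s^e)^i" using M0(2)[OF w] nan_nonneg[OF nw] by (intro power_mono) (auto simp: s_def)
  also have "... <= (M0 * s^e)^n" using i G(3) ge by (intro power_increasing) auto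
  finally have "w y^i<=M0^n * s^(e*n)" by (simp add: power_mult_distrib power_mult)
  hence "w (poly (coeff G i) t*y^i)<=(L * s^m)*(M0^n * s^(e*n))"
   unfolding nan_mult[OF nw] nan_power[OF nw] using 1 L s nan_nonneg[OF nw] by (intro mult_mono) auto
  thus "w (poly (coeff G i) t*y^i)<=L*M0^n*max 1 (w t)^(m+e*n)" by (simp add: s_def power_add mult_ac)
 qed
 moreover have "0 < L*M0^n" using L M0(1) by simp
 ultimately show ?thesis by blast
qed

text \<open>P(c,y) is small and the factor y - b is bounded away from 0, so that the cofactor of y - b is small.\<close>

lemma vanishing_near_other_roots:
 assumes G: "!!i. coeffs_in F (coeff G i)" and c: "c : F" and b: "poly (ieval P c) b = 0" and d: "0 < d"
  and Gc: "ieval G c = smult mu (synthetic_div (ieval P c) b)" and mu: "mu : F"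
 shows "EX M>0. ALL w:U. w t<=R --> d<=w (y-b) --> w (poly (ieval G t) y)<=M*w (t-c)"
proof -
 obtain B where B: "1<=B" "R<=B" "!!w z. w : U ==> w t<=R ==> poly (ieval P t) z = 0 ==> w z<=B" using bounded_roots by blast
 obtain M1 where M1: "0 < M1" "!!w v. w : U ==> w t<=B ==> w v<=B ==>
  w (poly (ieval G t) v-poly (ieval G c) v)<=M1*w (t-c)" using close_values[OF G c B(1)] by blast
 obtain M2 where M2: "0 < M2" "!!w v. w : U ==> w t<=B ==> w v<=B ==>
  w (poly (ieval P t) v-poly (ieval P c) v)<=M2*w (t-c)" using close_values[OF PF c B(1)] by blast
 define M where "M = M1+w0 mu*M2/d"
 have pos: "0<=w0 mu*M2/d" using nan_nonneg[OF w0] M2(1) d by simp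
 have "w (poly (ieval G t) y)<=M*w (t-c)" if w: "w : U" "w t<=R" "d<=w (y-b)" for w
 proof -
  note nw = U_nonarch[OF w(1)]
  have bd: "w t<=B" "w y<=B" using w(2) B(2) B(3)[OF w(1,2) P_root] by auto
  have tc: "0<=w (t-c)" by (rule nan_nonneg[OF nw])
  have "[:- b, 1:] * synthetic_div (ieval P c) b = ieval P c" using synthetic_div_correct'[of b "ieval P c"] b by simp
  hence "poly ([:- b, 1:] * synthetic_div (ieval P c) b) y = poly (ieval P c) y" by simp
  hence "(y-b)*poly (ieval G c) y = mu*poly (ieval P c) y" unfolding Gc by (simp add: algebra_simps)
  hence "w (y-b)*w (poly (ieval G c) y) = w0 mu*w (poly (ieval P c) y)" using U_F[OF w(1) mu] by (metis nan_mult[OF nw])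
  also have "... <= w0 mu*(M2*w (t-c))" using M2(2)[OF w(1) bd] nan_nonneg[OF w0] by (intro mult_left_mono) (auto simp: P_root nan_minus[OF nw])
  finally have "d*w (poly (ieval G c) y)<=w0 mu*(M2*w (t-c))" using w(3) nan_nonneg[OF nw, of "poly (ieval G c) y"] mult_right_mono[of d "w (y-b)"] by fastforce
  hence 1: "w (poly (ieval G c) y)<=w0 mu*M2/d*w (t-c)" using d by (simp add: field_simps)
  have "w (poly (ieval G t) y)<=max (M1*w (t-c)) (w0 mu*M2/d*w (t-c))" using nan_add[OF nw, of "poly (ieval G t) y-poly (ieval G c) y" "poly (ieval G c) y"]
    1 M1(2)[OF w(1) bd] by auto
  also have "... <= M*w (t-c)" using tc M1(1) pos unfolding M_def by (intro max.boundedI mult_right_mono) auto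
  finally show ?thesis .
 qed
 moreover have "0 < M" using M1(1) pos by (simp add: M_def)
 ultimately show ?thesis by blast
qed

end

context plane_curve
begin

section \<open>Connectedness of the fibres\<close>

text \<open>The function G(t,y) / prod (t - c) over c in S, where card S = N. At infinity it is bounded since the
degrees match. Near c it could only be unbounded at (c, b c), which C avoids. If it were constant, G would be a
constant multiple of the product, whose degree N exceeds the degree bound m.\<close>

lemma bounded_nonconstant_function:
 assumes C: "kopen U K C" "kopen U K (U-C)" "C~=U"
 shows "EX h:acl Ft. h ~: F & (EX M. ALL w:C. w h<=M)"
proof -
 obtain d where d: "d~=0" "!!c b. poly (ieval P c) b = 0 ==> poly d c~=0 ==> poly (pderiv (ieval P c)) b~=0" using discriminant by blast
 obtain e where e: "1<=e" "!!i. degree (coeff P i)<=e" using degree_bound by blast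
 define n where "n = degree P"
 define m where "m = e*n^2"
 define N where "N = m+e*n"
 have n: "0 < n" using minpoly_degree_pos[OF P_min] deg_P by (simp add: n_def)
 have mN: "m < N" using n e(1) by (simp add: N_def)
 have "infinite (F-{x. poly d x = 0})" using F(2) poly_roots_finite[OF d(1)] by simp
 then obtain S where S: "S<=F-{x. poly d x = 0}" "finite S" "card S = N" using infinite_arbitrarily_large by blast
 have SF: "S<=F" using S(1) by blast
 have "EX b r. poly (ieval P c) b = 0 & 0 < r & (ALL w:C. w (t-c) < r --> r<=w (y-b))" if "c : S" for c using bad_root[OF C, of c] d(2)[of c] that S(1) by auto
 then obtain b r where br: "!!c. c : S ==> poly (ieval P c) (b c) = 0" "!!c. c : S ==> 0 < r c"
  "!!c w. c : S ==> w : C ==> w (t-c) < r c ==> r c<=w (y-b c)" by metis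
 obtain G mu where G: "G~=0" "!!i. coeffs_in F (coeff G i)" "degree G < n" "!!i. degree (coeff G i)<=m"
  and Gmu: "!!c. c : S ==> mu c : F & ieval G c = smult (mu c) (synthetic_div (ieval P c) (b c))"
  using vanishing_curve[OF S(2) SF br(1), of e] S(3) unfolding N_def m_def n_def by blast
 define D where "D = (PROD c:S. t-c)"
 define g where "g = poly (ieval G t) y"
 define h where "h = g/D"
 have D0: "D~=0" unfolding D_def using S(2) SF t by auto
 define R where "R = Max (insert 1 (w0 ` S))"
 have R: "1<=R" "!!c. c : S ==> w0 c<=R" unfolding R_def using S(2) by auto
 define q where "q = Min (insert 1 (r ` S Un (%(c, c'). w0 (c-c')) ` {(c, c') : S \<times> S. c~=c'}))"
 have fin: "finite {(c, c') : S \<times> S. c~=c'}" using S(2) by (intro finite_subset[OF _ finite_cartesian_product]) auto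
 have q: "0 < q" "q<=1" "!!c. c : S ==> q<=r c" "!!c c'. c : S ==> c' : S ==> c~=c' ==> q<=w0 (c-c')"
 proof -
  show "0 < q" unfolding q_def using S(2) fin br(2) nan_pos[OF w0] by (subst Min_gr_iff) auto
  show "q<=1" "!!c. c : S ==> q<=r c" unfolding q_def using S(2) fin by (auto intro!: Min_le)
  show "q<=w0 (c-c')" if "c : S" "c' : S" "c~=c'" for c c' unfolding q_def using S(2) fin that by (intro Min_le) (auto intro!: image_eqI[of _ _ "(c, c')"])
 qed
 obtain M where M: "0 < M" "!!w. w : U ==> w g<=M*max 1 (w t)^N" using function_growth[OF G(2) G(4) less_imp_le[OF G(3)] e(2)] unfolding g_def N_def by blast
 have "ALL c:S. EX Mc>0. ALL w:U. w t<=R --> r c<=w (y-b c) --> w g<=Mc*w (t-c)"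
  unfolding g_def using vanishing_near_other_roots[OF G(2) _ br(1,2)] Gmu SF by blast
 then obtain Mc where Mc: "!!c. c : S ==> 0 < Mc c"
  "!!c w. c : S ==> w : U ==> w t<=R ==> r c<=w (y-b c) ==> w g<=Mc c*w (t-c)" by metis
 define B where "B = max M (max (M * R^N/q^N) (sum Mc S/q^(N-1)))"
 have CU: "C<=U" by (rule kopen_sub[OF C(1)])
 have "w h<=B" if w: "w : C" for w
 proof -
  have wU: "w : U" using w CU by blast
  note nw = U_nonarch[OF wU]
  have wD: "w D = (PROD c:S. w (t-c))" unfolding D_def by (rule nan_prod[OF nw])
  have wD0: "0 < w D" by (rule nan_pos[OF nw D0])
  have wc: "w c = w0 c" if "c : F" for c using U_F[OF wU that] .
  have wh: "w h = w g/w D" by (simp add: h_def nan_divide[OF nw])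
  show ?thesis
  proof (cases "w t<=R")
   case False
   have "w (t-c) = w t" if "c : S" for c using nan_dominant[OF nw, of "- c" t] R(2)[OF that] wc that SF False by (auto simp: nan_minus[OF nw])
   hence "w D = w t^N" unfolding wD using S(3) by simp
   moreover have "w g<=M*w t^N" using M(2)[OF wU] False R(1) by (simp add: max_def split: if_splits)
   ultimately have "w h<=M" unfolding wh using wD0 by (simp add: divide_le_eq)
   thus ?thesis by (simp add: B_def)
  next
   case True
   show ?thesis
   proof (cases "ALL c:S. q<=w (t-c)")
    case far: True
    have "q^N = (PROD c:S. q)" using S(3) by simp
    also have "... <= w D" unfolding wD using far q(1) by (intro prod_mono) auto
    finally have "q^N<=w D" .
    moreover have "w g<=M * R^N"
    proof -
     have "max 1 (w t)^N<=R^N" using True R(1) by (intro power_mono) auto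
     from mult_left_mono[OF this, of M] have "M*max 1 (w t)^N<=M * R^N" using M(1) by simp
     thus ?thesis using M(2)[OF wU] by linarith
    qed
    ultimately have "w h<=M * R^N/q^N" unfolding wh using q(1) M(1) R(1) by (intro frac_le) auto
    thus ?thesis by (simp add: B_def)
   next
    case False
    then obtain c where c: "c : S" "w (t-c) < q" by (auto simp: not_le)
    have other: "q<=w (t-c')" if c': "c' : S-{c}" for c'
    proof (rule ccontr)
     assume "~ ?thesis"
     hence "w ((t-c')-(t-c)) < q" using nan_diff[OF nw, of "t-c'" "t-c"] c(2) by simp
     moreover have "c-c' : F" using c(1) c' SF by (intro subring_diff[OF F_ring]) auto
     ultimately have "w0 (c-c') < q" using wc by simp
     thus False using q(4)[of c c'] c c' by auto
    qed
    have "w D = w (t-c)*(PROD c':S-{c}. w (t-c'))" unfolding wD by (rule prod.remove[OF S(2) c(1)])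
    moreover have "q^(N-1) = (PROD c':S-{c}. q)" using S c by simp
    moreover have "... <= (PROD c':S-{c}. w (t-c'))" using other q(1) by (intro prod_mono) auto
    ultimately have lb: "w (t-c)*q^(N-1)<=w D" using nan_nonneg[OF nw] by (simp add: mult_left_mono)
    have "r c<=w (y-b c)" using br(3)[OF c(1) w] c(2) q(3)[OF c(1)] by linarith
    hence "w g<=Mc c*w (t-c)" using Mc(2)[OF c(1) wU True] by blast
    moreover have "Mc c<=sum Mc S" using S(2) c(1) Mc(1) by (intro member_le_sum) (auto intro: less_imp_le)
    ultimately have "w g<=sum Mc S*w (t-c)" using nan_nonneg[OF nw] by (meson mult_right_mono order.trans)
    also have "... = sum Mc S/q^(N-1)*(w (t-c)*q^(N-1))" using q(1) by simp
    also have "... <= sum Mc S/q^(N-1)*w D" using lb q(1) Mc(1) by (intro mult_left_mono divide_nonneg_nonneg sum_nonneg) (auto intro: less_imp_le)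
    finally have "w h<=sum Mc S/q^(N-1)" unfolding wh using wD0 by (simp add: divide_le_eq)
    thus ?thesis by (simp add: B_def)
   qed
  qed
 qed
 moreover have "h : acl Ft"
 proof -
  have sf: "is_field (acl Ft)" by (rule subfield_acl[OF Ft_field Ft_inf])
  have yt: "y : acl Ft" "t : acl Ft" using K_acl y_K subset_acl[OF Ft_ring] t_Ft by auto
  have "coeffs_in (acl Ft) (ieval G t)" by (rule coeffs_in_mono[OF ieval_Ft[OF G(2)] subset_acl[OF Ft_ring]])
  hence "g : acl Ft" unfolding g_def by (rule subring_poly[OF field_ring[OF sf] _ yt(1)])
  moreover have "D : acl Ft" unfolding D_def using SF F_Ft subset_acl[OF Ft_ring] yt(2)
   by (intro subring_prod[OF field_ring[OF sf]] subring_diff[OF field_ring[OF sf]]) auto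
  ultimately show ?thesis unfolding h_def by (rule subfield_divide[OF sf])
 qed
 moreover have "h ~: F"
 proof
  assume hF: "h : F"
  define Z where "Z = smult h (PROD c:S. [:-c, 1:])"
  have ZF: "coeffs_in F Z" unfolding Z_def using hF SF by (intro coeffs_in_smult[OF F_ring] coeffs_in_prod[OF F_ring] coeffs_in_linear[OF F_ring]) auto
  have "coeffs_in F (coeff (G-[:Z:]) i)" for i using coeffs_in_diff[OF F_ring G(2) ZF, of 0] G(2)[of i] by (cases i) (simp_all add: coeff_pCons)
  moreover have "degree (G-[:Z:]) < degree P"
  proof -
   have "degree (G-[:Z:])<=degree G" by (intro degree_le) (auto simp: coeff_pCons coeff_eq_0 split: nat.split)
   thus ?thesis using G(3) by (simp add: n_def)
  qed
  moreover have "poly (ieval (G-[:Z:]) t) y = 0"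
  proof -
   have "poly (ieval (G-[:Z:]) t) y = g-poly Z t" by (simp add: ieval_diff ieval_pCons g_def) (simp add: ieval_def)
   also have "poly Z t = h*D" by (simp add: Z_def poly_prod D_def)
   also have "... = g" using D0 by (simp add: h_def)
   finally show ?thesis by simp
  qed
  ultimately have "G-[:Z:] = 0" by (rule low_degree_zero)
  hence GZ: "G = [:Z:]" by simp
  hence "degree Z<=m" using G(4)[of 0] by simp
  moreover have "degree (PROD c:S. [:-c, 1:]) = N" using S(3) by (simp add: degree_prod_sum_eq)
  ultimately have "h = 0" using mN by (auto simp: Z_def split: if_splits)
  thus False using GZ G(1) by (simp add: Z_def)
 qed
 ultimately show ?thesis by blast
qed

end

context line_ext
begin

text \<open>C contains a norm above the disc of centre 0 and any given radius on the line with coordinate h.\<close>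

lemma no_bounded_function:
 assumes C: "kopen U (acl Ft) C" "kopen U (acl Ft) (U-C)" "C~={}" and h: "h : acl Ft" "h ~: F"
 shows "EX w:C. M < w h"
proof -
 interpret h: line_ext F w0 h by unfold_locales (use F w0 h in auto)
 define r where "r = max 1 (M+1)"
 have zF: "0 : F" by (rule subring_zero[OF F_ring])
 have r: "0 < r" by (simp add: r_def)
 obtain w where w: "w : h.disc_norms 0 r" using h.disc_norms_gauss[OF zF r] by blast
 have "w : U" using h.disc_norms_U[OF w] by (simp add: U_def h.U_def)
 from clopen_surjective[OF C h this] obtain u where u: "u : C" "agree (fgen (insert h F)) u w" by blast
 have "u h = w h" using u(2) fgen_superset[of "insert h F"] by (auto simp: agree_def)
 also have "... = r" using h.disc_norms_center[OF w zF r] by simp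
 finally show ?thesis using u(1) by (intro bexI[of _ u]) (auto simp: r_def)
qed

theorem extension_norms_connected:
 assumes C: "kopen U (acl Ft) C" "kopen U (acl Ft) (U-C)" "C~={}"
 shows "C = U"
proof (rule ccontr)
 assume "C~=U"
 from reduce_to_simple[OF C this] obtain y D q where
  D: "y : acl Ft" "kopen U (fgen (insert y Ft)) D" "kopen U (fgen (insert y Ft)) (U-D)" "D~={}" "D~=U"
  and q: "coeffs_in Ft q" "poly q y = 0" "poly (pderiv q) y~=0" by blast
 from integral_generator[OF D(1) q] obtain z P where zP: "fgen (insert z Ft) = fgen (insert y Ft)"
  "ALL i. coeffs_in F (coeff P i)" "lead_coeff P = 1" "is_minpoly Ft z (ieval P t)"
  "degree (ieval P t) = degree P" "poly (pderiv (ieval P t)) z~=0" by blast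
 interpret plane_curve F w0 t z P by unfold_locales (use zP in auto)
 have K: "K = fgen (insert y Ft)" unfolding K_def by (rule zP(1))
 obtain h M where h: "h : acl Ft" "h ~: F" "!!w. w : D ==> w h<=M" using bounded_nonconstant_function[of D] D unfolding K by blast
 have D': "kopen U (acl Ft) D" "kopen U (acl Ft) (U-D)" using D(2,3) kopen_mono[OF _ K_acl] unfolding K by blast+
 obtain w where "w : D" "M < w h" using no_bounded_function[OF D' D(4) h(1,2)] by blast
 thus False using h(3)[of w] by simp
qed

end

section \<open>Connectedness of the space of norms\<close>

lemma tendsto_gnorm_one:
 assumes "!!z. z : range (coeff g) ==> (%n. u n z) \<longlonglongrightarrow> w z"
 shows "(%n. gnorm (u n) 1 g) \<longlonglongrightarrow> gnorm w 1 g"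
proof -
 have "(%n. Max ((%i. u n (coeff g i)) ` {..d})) \<longlonglongrightarrow> Max ((%i. w (coeff g i)) ` {..d})" for d
 proof (induction d)
  case (Suc d)
  thus ?case using assms by (simp add: atMost_Suc tendsto_max)
 qed (use assms in simp)
 thus ?thesis by (simp add: gnorm_def)
qed

text \<open>Assigning to a norm w on F the Gauss norm of radius 1 is a continuous section of the restriction from F(t) to F.\<close>

lemma kopen_transcendental_step:
 fixes F :: "'a::alg_closed_field set"
 assumes F: "aclosed F" "infinite F" and t: "t ~: F" and k: "k<=F" and U: "U = ext_norms k w0"
  and C: "kopen U (fgen (insert t F)) C" and sat: "!!w u. w : C ==> u : U ==> agree F u w ==> u : C"
 shows "kopen U F C"
proof (rule kopenI)
 show CU: "C<=U" by (rule kopen_sub[OF C])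
 have FF: "is_field F" using F by (simp add: aclosed_def)
 note FR = field_ring[OF FF]
 have nt: "~ alg F t" using t F by (auto simp: aclosed_def)
 have gauss: "EX v:U. agree F v w & (ALL g. coeffs_in F g --> v (poly g t) = gnorm w 1 g)" if w: "w : U" for w
 proof -
  obtain v where v: "nonarch_norm v" "ALL x:F. v x = w x" "ALL g. coeffs_in F g --> v (poly g (t-0)) = gnorm w 1 g"
   using norm_extend_gauss[OF FF F(2) nt ext_norms_nonarch[of w k w0] subring_zero[OF FR], of 1] w U by auto
  thus ?thesis using ext_norms_agree[of w k w0 v F] w k U by (auto simp: agree_def)
 qed
 fix w assume w: "w : C"
 show "~ near F (U-C) w"
 proof
  assume near: "near F (U-C) w"
  obtain v where v: "v : U" "agree F v w" "!!g. coeffs_in F g ==> v (poly g t) = gnorm w 1 g" using gauss[of w] w CU by blast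
  have "v : C" by (rule sat[OF w v(1,2)])
  then obtain Y e where Y: "finite Y" "Y<=fgen (insert t F)" "0 < e" "!!u. u : U ==> close Y e u v ==> u : C" using kopenE[OF C] by metis
  have "ALL y:Y. EX g h. coeffs_in F g & coeffs_in F h & poly h t~=0 & y = poly g t/poly h t" using Y(2) unfolding fgen_insert[OF FF] by blast
  then obtain g h where gh: "!!y. y : Y ==> coeffs_in F (g y) & coeffs_in F (h y) & poly (h y) t~=0 & y = poly (g y) t/poly (h y) t" by metis
  define Z where "Z = (UN y:Y. range (coeff (g y)) Un range (coeff (h y)))"
  have fin: "finite (range (coeff p))" for p :: "'a poly"
  proof -
   have "range (coeff p)<=insert 0 (coeff p ` {..degree p})" by (auto simp: image_iff not_le intro!: coeff_eq_0)
   thus ?thesis by (rule finite_subset) simp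
  qed
  have Z: "finite Z" "Z<=F" unfolding Z_def using Y(1) fin gh by (auto simp: coeffs_in_def)
  obtain u where u: "!!n::nat. u n : U-C" "!!z. z : Z ==> (%n. u n z) \<longlonglongrightarrow> w z" using near_sequence[OF near Z] by blast
  have "ALL n. EX v:U. agree F v (u n) & (ALL g. coeffs_in F g --> v (poly g t) = gnorm (u n) 1 g)" using gauss u(1) by blast
  then obtain s where s: "!!n. s n : U" "!!n. agree F (s n) (u n)" "!!n g. coeffs_in F g ==> s n (poly g t) = gnorm (u n) 1 g" by metis
  have lim: "(%n. s n y) \<longlonglongrightarrow> v y" if y: "y : Y" for y
  proof -
   have nU: "nonarch_norm a" if "a : U" for a using that U ext_norms_nonarch by blast
   have sy: "s n y = gnorm (u n) 1 (g y)/gnorm (u n) 1 (h y)" for n using gh[OF y] s(3) nan_divide[OF nU[OF s(1)]] by metis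
   have vy: "v y = gnorm w 1 (g y)/gnorm w 1 (h y)" using gh[OF y] v(3) nan_divide[OF nU[OF v(1)]] by metis
   have "gnorm w 1 (h y)~=0" using gh[OF y] v(3)[of "h y"] nan_pos[OF nU[OF v(1)], of "poly (h y) t"] by auto
   moreover have "range (coeff (g y))<=Z" "range (coeff (h y))<=Z" using y by (auto simp: Z_def)
   ultimately show ?thesis unfolding sy vy using u(2) by (intro tendsto_divide tendsto_gnorm_one) (auto simp: subset_iff)
  qed
  have "eventually (%n. \<bar>s n y-v y\<bar> < e) sequentially" if "y : Y" for y using tendstoD[OF lim[OF that] Y(3)] by (simp add: dist_real_def)
  hence "eventually (%n. ALL y:Y. \<bar>s n y-v y\<bar> < e) sequentially" using Y(1) by (simp add: eventually_ball_finite)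
  then obtain n where "close Y e (s n) v" unfolding close_def eventually_sequentially by blast
  hence "s n : C" using Y(4) s(1) by blast
  hence "u n : C" using sat[of "s n" "u n"] u(1) s(2) agree_sym by blast
  thus False using u(1) by blast
 qed
qed

text \<open>Let C be open and closed for the larger field. The fibres over F are connected, hence C is a union of
fibres; by openness of the restriction maps it is open and closed for F, and the induction hypothesis applies.\<close>

theorem finitely_generated_connected:
 fixes F0 :: "'a::alg_closed_field set"
 assumes F0: "aclosed F0" "infinite F0" and U: "U = ext_norms F0 w0" and J: "finite J"
 shows "kopen U (acl (fgen (F0 Un J))) C ==> kopen U (acl (fgen (F0 Un J))) (U-C) ==> C~={} ==> C = U" using J
proof (induction J arbitrary: C rule: finite_induct)
 case empty
 have "acl (fgen (F0 Un {})) = F0" using F0 by (simp add: fgen_eq aclosed_def aclosed_acl_eq)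
 hence C: "kopen U F0 C" using empty by simp
 obtain w where w: "w : C" using empty by blast
 have "u : C" if u: "u : U" for u
 proof (rule kopen_agree[OF C w u])
  show "agree F0 u w" using u w kopen_sub[OF C] by (auto simp: U ext_norms_def agree_def)
 qed
 thus ?case using kopen_sub[OF C] by blast
next
 case (insert t J)
 define F where "F = acl (fgen (F0 Un J))"
 have F: "aclosed F" and F0F: "F0<=F" "J<=F" and Finf: "infinite F" using acl_fgen[OF F0(2), of J] by (simp_all add: F_def)
 show ?case
 proof (cases "t : F")
  case True
  hence "acl (fgen (F0 Un insert t J))<=F" using F F0F by (intro acl_least fgen_least) (auto simp: aclosed_subfield)
  thus ?thesis using insert.IH[of C] insert.prems kopen_mono unfolding F_def[symmetric] by blast
 next
  case False
  define L where "L = acl (fgen (insert t F))"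
  have sub: "acl (fgen (F0 Un insert t J))<=L" unfolding L_def using F0F by (intro acl_mono fgen_mono) auto
  have step: "kopen U F C" if C: "kopen U L C" "kopen U L (U-C)" for C
  proof -
   have CU: "C<=U" by (rule kopen_sub[OF C(1)])
   have sat: "u : C" if w: "w : C" and u: "u : U" and a: "agree F u w" for w u
   proof -
    have nw: "nonarch_norm w" using w CU U ext_norms_nonarch by blast
    interpret l: line_ext F w t by unfold_locales (fact F Finf nw False)+
    have V: "l.U<=U" unfolding l.U_def U using w CU F0F(1) by (auto simp: ext_norms_def U agree_def subset_iff)
    have "(U-C) Int l.U = l.U-C Int l.U" using V by blast
    hence "kopen l.U (acl l.Ft) (C Int l.U)" "kopen l.U (acl l.Ft) (l.U-C Int l.U)" using kopen_restrict[OF C(1) V] kopen_restrict[OF C(2) V] V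
     unfolding L_def l.Ft_def by simp_all
    moreover have "C Int l.U~={}" using w nw by (auto simp: l.U_def ext_norms_def agree_def)
    ultimately have "C Int l.U = l.U" by (rule l.extension_norms_connected)
    moreover have "u : l.U" using u a by (auto simp: l.U_def U ext_norms_def)
    ultimately show ?thesis by blast
   qed
   note K = subfield_fgen[of "insert t F"] fgen_ins(2)[of F t]
   have "kopen U (fgen (insert t F)) (sat U (fgen (insert t F)) C)"
    unfolding U by (rule kopen_sat[OF K(1) infinite_super[OF K(2) Finf]]) (use F0F K(2) C(1) in \<open>auto simp: L_def U\<close>)
   moreover have "sat U (fgen (insert t F)) C = C"
   proof
    show "sat U (fgen (insert t F)) C<=C" using sat agree_mono[OF _ K(2)] agree_sym by (fastforce simp: sat_def)
    show "C<=sat U (fgen (insert t F)) C" using CU by (auto simp: sat_def agree_def)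
   qed
   ultimately have "kopen U (fgen (insert t F)) C" by simp
   thus ?thesis by (rule kopen_transcendental_step[OF F Finf False F0F(1) U]) (rule sat)
  qed
  have C: "kopen U L C" "kopen U L (U-C)" using insert.prems(1,2) kopen_mono[OF _ sub] by blast+
  have "U-(U-C) = C" using kopen_sub[OF C(1)] by blast
  hence "kopen U F C" "kopen U F (U-C)" using step[of C] step[of "U-C"] C by auto
  thus ?thesis using insert.IH[of C] insert.prems(3) unfolding F_def[symmetric] by blast
 qed
qed

text \<open>The values of F contain a divisible nontrivial subgroup of the positive reals.\<close>

lemma dense_values:
 fixes F :: "'a::alg_closed_field set"
 assumes F: "aclosed F" and w: "nonarch_norm w" and nt: "x : F" "x~=0" "w x~=1"
  and r: "0 < r" and d: "0 < d" and Z: "finite Z"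
 shows "EX z:F. z~=0 & w z ~: Z & \<bar>w z-r\<bar> < d"
proof -
 have FF: "is_field F" using F by (simp add: aclosed_def)
 note FR = field_ring[OF FF]
 obtain x where x: "x : F" "1 < w x"
 proof (cases "1 < w x")
  case False
  hence "w x < 1" "0 < w x" using nt nan_pos[OF w] by auto
  hence "1 < w (inverse x)" by (simp add: nan_inverse[OF w] one_less_inverse)
  thus ?thesis using that subfield_inverse[OF FF nt(1)] by blast
 qed (use nt that in blast)
 define L where "L = ln (w x)"
 have L: "0 < L" "w x = exp L" using x by (simp_all add: L_def)
 (* The values of roots of powers of x are the exp (q * L) with q rational. *)
 define Q where "Q = {s. \<bar>exp (s*L)-r\<bar> < d}-(%z. ln z/L) ` Z"
 have "open {s. \<bar>exp (s*L)-r\<bar> < d}" by (intro open_Collect_less continuous_intros)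
 hence op: "open Q" unfolding Q_def using Z by (intro open_Diff finite_imp_closed) auto
 have "{ln r/L<..<ln (r+d)/L}<={s. \<bar>exp (s*L)-r\<bar> < d}"
 proof
  fix s assume "s : {ln r/L<..<ln (r+d)/L}"
  hence "exp (ln r) < exp (s*L)" "exp (s*L) < exp (ln (r+d))" using L(1) by (simp_all add: divide_less_eq less_divide_eq)
  hence "r < exp (s*L)" "exp (s*L) < r+d" using r d by simp_all
  thus "s : {s. \<bar>exp (s*L)-r\<bar> < d}" by simp
 qed
 moreover have "infinite {ln r/L<..<ln (r+d)/L}" using r d L(1) by (simp add: infinite_Ioo divide_strict_right_mono)
 ultimately have "infinite {s. \<bar>exp (s*L)-r\<bar> < d}" by (rule infinite_super)
 hence "infinite Q" unfolding Q_def using Z by (intro Diff_infinite_finite) auto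
 then obtain s where "s : Q" by (metis ex_in_conv finite.emptyI)
 then obtain e where e: "0 < e" "!!s'. \<bar>s'-s\<bar> < e ==> s' : Q" using op unfolding open_dist dist_real_def by blast
 obtain q where q: "q : \<rat>" "s < q" "q < s+e" using Rats_dense_in_real[of s "s+e"] e(1) by auto
 hence qQ: "q : Q" using e(2)[of q] by simp
 obtain a b where ab: "0 < b" "q = of_int a/of_int b" using Rats_cases'[OF q(1)] by metis
 define m where "m = nat b"
 have m: "0 < m" "q = of_int a/real m" using ab by (simp_all add: m_def)
 obtain y where y: "y^m = x" using nth_root_exists[of m x] m(1) by blast
 have "alg F y" unfolding alg_def using x m y FR
  by (intro exI[of _ "monom 1 m-[:x:]"]) (auto intro!: coeffs_in_diff coeffs_in_monom coeffs_in_const subring_one simp: poly_monom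
   dest!: arg_cong[of _ _ degree] simp: degree_monom_eq)
 hence yF: "y : F" using F by (simp add: aclosed_def)
 have "w y^m = exp (L/m)^m" using y nan_power[OF w] L(2) m(1) by (metis exp_of_nat_mult mult.commute nonzero_divide_eq_eq of_nat_0_less_iff order_less_irrefl)
 hence wy: "w y = exp (L/m)" using m(1) nan_nonneg[OF w] by (metis exp_ge_zero power_eq_imp_eq_base)
 define z where "z = y powi a"
 have "w z = w y powi a" unfolding z_def power_int_def by (simp add: nan_power[OF w] nan_inverse[OF w])
 hence wz: "w z = exp (q*L)" by (simp add: wy m(2) powr_real_of_int'[symmetric] powr_def)
 have "z : F" unfolding z_def power_int_def using yF FF FR by (auto intro: subring_power subfield_inverse)
 moreover have "\<bar>w z-r\<bar> < d" "w z ~: Z" using qQ L(1) unfolding wz Q_def by (auto simp: image_iff)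
 moreover have "z~=0" using wz nan_zero[OF w] by (metis exp_not_eq_zero)
 ultimately show ?thesis by blast
qed

section \<open>Specialisation to algebraic points\<close>

lemma nan_diff_bound: "nonarch_norm w ==> \<bar>w x-w y\<bar><=w (x-y)"
 using nan_add[of w "x-y" y] nan_add[of w "y-x" x] nan_diff_commute[of w x y] nan_nonneg[of w x] nan_nonneg[of w y] nan_nonneg[of w "x-y"]
 by (auto simp: max_def split: if_splits)

context line_ext
begin

text \<open>An open set of the line contains a disc norm, and by the density of the values also one whose disc has a
general c in F on its boundary; the smaller discs around c then belong to the open set.\<close>

lemma norms_at_point:
 assumes nt: "x0 : F" "x0~=0" "w0 x0~=1" and D: "kopen U Ft D" "D~={}" and bad: "finite bad"
 shows "EX c r. c : F & c ~: bad & 0 < r & (ALL s. 0 < s --> s < r --> (EX w:D. w (t-c) = s))"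
proof -
 obtain v where v: "v : D" using D(2) by blast
 obtain b r where b: "b : F" "0 < r" "disc_norms b r<=D" using kopen_contains_disc[OF D(1) v subring_zero[OF F_ring]] by blast
 obtain E d where E: "finite E" "E<=F" "0 < d" "!!s u. 0 < s ==> \<bar>s-r\<bar> < d ==> u : U ==>
  ALL x:E. u (t-x) = max s (w0 (b-x)) ==> u : D" using disc_neighbourhood[OF D(1) b(1-3)] by blast
 obtain z where z: "z : F" "z~=0" "w0 z ~: (%x. w0 (b-x)) ` (E Un bad)" "\<bar>w0 z-r\<bar> < d"
  using dense_values[OF F(1) w0 nt b(2) E(3), of "(%x. w0 (b-x)) ` (E Un bad)"] E(1) bad by blast
 have z0: "0 < w0 z" by (rule nan_pos[OF w0 z(2)])
 define c where "c = b+z"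
 have cF: "c : F" unfolding c_def using b z by (intro subring_add[OF F_ring])
 have "c ~: bad"
 proof
  assume "c : bad"
  hence "w0 (b-c)~=w0 z" using z(3) by force
  thus False by (simp add: c_def nan_minus[OF w0])
 qed
 moreover have "EX w:D. w (t-c) = s" if s: "0 < s" "s < w0 z" for s
 proof -
  obtain w where w: "w : disc_norms c s" using disc_norms_gauss[OF cF s(1)] by blast
  have "w (t-x) = max (w0 z) (w0 (b-x))" if x: "x : E" for x
  proof -
   have ne: "w0 z~=w0 (b-x)" using z(3) x by blast
   hence "w0 (z+(b-x)) = max (w0 z) (w0 (b-x))"
    using nan_dominant[OF w0, of z "b-x"] nan_dominant[OF w0, of "b-x" z] by (cases "w0 z < w0 (b-x)") (auto simp: add.commute)
   moreover have "z+(b-x) = c-x" by (simp add: c_def)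
   ultimately have "w0 (c-x) = max (w0 z) (w0 (b-x))" by simp
   thus ?thesis using w x E(2) s(2) by (auto simp: disc_norms_def)
  qed
  hence "w : D" using E(4)[OF z0 z(4) disc_norms_U[OF w]] by blast
  thus ?thesis using disc_norms_center[OF w cF s(1)] by blast
 qed
 ultimately show ?thesis using cF z0 by blast
qed

text \<open>The norms close to w0 on Y restrict to an open set of the line, which contains norms close to a point c in F. There the
elements of Y are close to roots of polynomials over F, finitely many in number, and one choice of roots occurs for
norms arbitrarily close to c.\<close>

lemma specialize:
 assumes nt: "x0 : F" "x0~=0" "w0 x0~=1" and Y: "finite Y" "Y<=acl Ft" and e: "0 < e"
 shows "EX b. (ALL y:Y. b y : F) & (ALL d>0. EX w:U. close Y e w w0 & (ALL y:Y. w (y-b y) < d))"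
proof -
 define C where "C = {w:U. close Y e w w0}"
 have C: "kopen U (acl Ft) C" unfolding C_def by (rule kopen_ball[OF Y])
 have CU: "C<=U" by (auto simp: C_def)
 have "w0 : C" using w0_U e by (simp add: C_def close_def)
 hence D: "sat U Ft C~={}" "kopen U Ft (sat U Ft C)" using w0_U kopen_sat[OF Ft_field Ft_inf F_Ft C[unfolded U_def]] by (auto simp: sat_def agree_def U_def)
 have "EX G. (ALL i. coeffs_in F (coeff G i)) & G~=0 & poly (ieval G t) y = 0" if y: "y : Y" for y
 proof -
  obtain p where p: "coeffs_in Ft p" "p~=0" "poly p y = 0" using y Y(2) by (auto simp: acl_def alg_def)
  obtain d G where G: "poly d t~=0" "!!i. coeffs_in F (coeff G i)" "ieval G t = smult (poly d t) p"
   using clear_denominators[OF F_field p(1)[unfolded Ft_def]] by blast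
  have "ieval G t~=0" using G p by simp
  hence "G~=0" by (auto simp: ieval_def)
  thus ?thesis using G p by (intro exI[of _ G]) simp
 qed
 then obtain G where G: "!!y i. y : Y ==> coeffs_in F (coeff (G y) i)" "!!y. y : Y ==> G y~=0"
  "!!y. y : Y ==> poly (ieval (G y) t) y = 0" by metis
 have fin: "finite (UN y:Y. {x. poly (lead_coeff (G y)) x = 0})" using Y(1) G(2) by (auto intro!: poly_roots_finite)
 obtain c r where c: "c : F" "c ~: (UN y:Y. {x. poly (lead_coeff (G y)) x = 0})" and r: "0 < r"
  "!!s. 0 < s ==> s < r ==> EX w:sat U Ft C. w (t-c) = s" using norms_at_point[OF nt D(2,1) fin] by blast
 have tc: "t-c : Ft" using c t_Ft F_Ft by (intro subring_diff[OF Ft_ring]) auto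
 have near_c: "EX v:C. v (t-c) = s" if s: "0 < s" "s < r" for s using r(2)[OF s] tc by (auto simp: sat_def agree_def)
 have "EX A. finite A & A<=F & (ALL d>0. EX s>0. ALL v:C. v (t-c) < s --> (EX b:A. v (y-b) < d))" if y: "y : Y" for y
 proof -
  define l where "l = poly (lead_coeff (G y)) c"
  have l: "l~=0" "l : F" using c y G(1)[OF y] by (auto simp: l_def intro: subring_poly[OF F_ring])
  define q where "q = smult (inverse l) (ieval (G y) c)"
  note GcF = ieval_F[OF G(1)[OF y] c(1)]
  have qF: "coeffs_in F q" unfolding q_def using l by (intro coeffs_in_smult[OF F_ring] subfield_inverse[OF F_field] GcF)
  have deg: "degree (ieval (G y) c) = degree (G y)" using l by (intro antisym degree_le le_degree) (auto simp: coeff_eq_0 l_def)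
  have q1: "lead_coeff q = 1" unfolding q_def using l deg by (simp add: l_def)
  define B where "B = max 1 (max (max 1 (w0 c)) (w0 y+e))"
  have B1: "1<=B" by (simp add: B_def)
  obtain M where M: "0 < M" "!!w v. w : U ==> w t<=B ==> w v<=B ==>
   w (poly (ieval (G y) t) v-poly (ieval (G y) c) v)<=M*w (t-c)" using close_values[OF G(1)[OF y] c(1) B1] by blast
  have "EX s>0. ALL v:C. v (t-c) < s --> (EX b. poly q b = 0 & v (y-b) < d)" if d: "0 < d" for d
  proof (intro exI[of _ "min 1 (w0 l*d^degree q/M)"] conjI ballI impI)
   show "0 < min 1 (w0 l*d^degree q/M)" using nan_pos[OF w0 l(1)] d M(1) by simp
   fix v assume v: "v : C" "v (t-c) < min 1 (w0 l*d^degree q/M)"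
   have vU: "v : U" using v CU by blast
   note nv = U_nonarch[OF vU]
   have "v t<=B" using nan_add[OF nv, of "t-c" c] v(2) U_F[OF vU c(1)] by (simp add: B_def) linarith
   moreover have "v y<=B" using v(1) y by (auto simp: C_def close_def B_def)
   ultimately have "v (poly (ieval (G y) c) y)<=M * v (t-c)" using M(2)[OF vU, of y] G(3)[OF y] by (simp add: nan_minus[OF nv])
   also have "... < M*(w0 l*d^degree q/M)" using v(2) M(1) by (intro mult_strict_left_mono) simp_all
   also have "... = w0 l*d^degree q" using M(1) by simp
   finally have "v (poly (ieval (G y) c) y)/w0 l < d^degree q" using nan_pos[OF w0 l(1)] by (simp add: divide_less_eq mult.commute)
   moreover have "poly q y = poly (ieval (G y) c) y/l" by (simp add: q_def divide_inverse)
   ultimately have "v (poly q y) < d^degree q" using U_F[OF vU l(2)] by (simp only: nan_divide[OF nv])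
   thus "EX b. poly q b = 0 & v (y-b) < d" by (rule root_near[OF nv q1 d])
  qed
  moreover have "finite {b. poly q b = 0}" using q1 by (intro poly_roots_finite) auto
  moreover have "{b. poly q b = 0}<=F" using qF q1 F(1) unfolding aclosed_def alg_def by (metis (mono_tags) leading_coeff_0_iff mem_Collect_eq subsetI zero_neq_one)
  ultimately show ?thesis by (intro exI[of _ "{b. poly q b = 0}"]) simp
 qed
 then obtain A where A: "!!y. y : Y ==> finite (A y) & A y<=F"
  "!!y d. y : Y ==> 0 < d ==> EX s>0. ALL v:C. v (t-c) < s --> (EX b:A y. v (y-b) < d)" by metis
 define T where "T = PiE Y A"
 have T: "finite T" unfolding T_def by (rule finite_PiE[OF Y(1)]) (simp add: A(1))
 have "EX b:T. EX v:C. ALL y:Y. v (y-b y) < 1/real (Suc n)" for n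
 proof -
  have "ALL y:Y. EX s>0. ALL v:C. v (t-c) < s --> (EX b:A y. v (y-b) < 1/real (Suc n))" using A(2)[of _ "1/real (Suc n)"] by simp
  then obtain s where s: "!!y. y : Y ==> 0 < s y"
   "!!y v. y : Y ==> v : C ==> v (t-c) < s y ==> EX b:A y. v (y-b) < 1/real (Suc n)" by metis
  define m where "m = Min (insert r (s ` Y))"
  have m: "0 < m" "m<=r" "!!y. y : Y ==> m<=s y" unfolding m_def using Y(1) r(1) s(1) by auto
  obtain v where v: "v : C" "v (t-c) = m/2" using near_c[of "m/2"] m by auto
  hence "ALL y:Y. EX b:A y. v (y-b) < 1/real (Suc n)" using s(2)[OF _ v(1)] m by fastforce
  then obtain b where "!!y. y : Y ==> b y : A y & v (y-b y) < 1/real (Suc n)" by metis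
  thus ?thesis using v(1) by (intro bexI[of _ "restrict b Y"] bexI[of _ v]) (auto simp: T_def)
 qed
 then obtain b where b: "!!n. b n : T" "!!n. EX v:C. ALL y:Y. v (y-b n y) < 1/real (Suc n)" by metis
 obtain n0 where n0: "infinite {n. b n = b n0}" using pigeonhole_infinite[of "UNIV :: nat set" b] T b(1) finite_subset[of "range b" T] by auto
 have "EX w:U. close Y e w w0 & (ALL y:Y. w (y-b n0 y) < d)" if d: "0 < d" for d
 proof -
  obtain N where N: "1/real (Suc N) < d" using d reals_Archimedean[of d] by (auto simp: inverse_eq_divide)
  obtain n where n: "N<=n" "b n = b n0" using n0 unfolding infinite_nat_iff_unbounded_le by blast
  have "1/real (Suc n)<=1/real (Suc N)" using n(1) by (intro divide_left_mono) auto
  thus ?thesis using b(2)[of n] n(2) N by (fastforce simp: C_def)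
 qed
 moreover have "b n0 y : F" if "y : Y" for y using b(1)[of n0] A(1)[OF that] that by (auto simp: T_def)
 ultimately show ?thesis by blast
qed

end

definition specializes :: "('a::comm_ring_1 => real) => 'a set => 'a set => real => ('a => 'a) => bool" where
 "specializes w F Y e b \<longleftrightarrow> (ALL y:Y. b y : F & \<bar>w (b y)-w y\<bar> < e) &
  (ALL f:polyfun F Y. f (%y. y) = 0 --> f b = 0)"

lemma specializesD:
 assumes "specializes w F Y e b"
 shows "y : Y ==> b y : F" "y : Y ==> \<bar>w (b y)-w y\<bar> < e" "f : polyfun F Y ==> f (%y. y) = 0 ==> f b = 0"
 using assms by (simp_all add: specializes_def)

lemma specializes_trans:
 assumes b: "specializes w F Y d b" and a: "specializes w F0 (b ` Y) e a" and F0: "F0<=F"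
 shows "specializes w F0 Y (d+e) (%y. a (b y))" unfolding specializes_def
proof (intro conjI ballI impI)
 fix y assume "y : Y"
 thus "a (b y) : F0" "\<bar>w (a (b y))-w y\<bar> < d+e" using specializesD(1,2)[OF a, of "b y"] specializesD(2)[OF b, of y] by auto
next
 fix f assume f: "f : polyfun F0 Y" "f (%y. y) = 0"
 have "f b = 0" by (rule specializesD(3)[OF b polyfun_mono[OF f(1) F0] f(2)])
 thus "f (%y. a (b y)) = 0" using specializesD(3)[OF a polyfun_comp[OF f(1)]] by simp
qed

text \<open>A relation f that holds for Y holds for b up to any small error, and f(b) lies in F, where all the norms agree.\<close>

lemma (in line_ext) specialize_point:
 assumes nt: "x0 : F" "x0~=0" "w0 x0~=1" and Y: "finite Y" "Y<=acl Ft" and e: "0 < e"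
 shows "EX b. specializes w0 F Y e b"
proof -
 have e2: "0 < e/2" using e by simp
 obtain b where b: "!!y. y : Y ==> b y : F"
  "!!d. 0 < d ==> EX w:U. close Y (e/2) w w0 & (ALL y:Y. w (y-b y) < d)" using specialize[OF nt Y e2] by blast
 have "\<bar>w0 (b y)-w0 y\<bar> < e" if y: "y : Y" for y
 proof -
  obtain w where w: "w : U" "close Y (e/2) w w0" "ALL y:Y. w (y-b y) < e/2" using b(2)[OF e2] by blast
  have "\<bar>w y-w (b y)\<bar> < e/2" using nan_diff_bound[OF U_nonarch[OF w(1)], of y "b y"] w(3) y by fastforce
  moreover have "\<bar>w y-w0 y\<bar> < e/2" using w(2) y by (simp add: close_def)
  ultimately show ?thesis using U_F[OF w(1) b(1)[OF y]] by linarith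
 qed
 moreover have "f b = 0" if f: "f : polyfun F Y" "f (%y. y) = 0" for f
 proof (rule ccontr)
  assume ne: "f b~=0"
  have fF: "f b : F" by (rule polyfun_mem[OF F_ring b(1) f(1)])
  define B where "B = max 1 (Max (insert 1 (w0 ` Y))+e)"
  have B: "1<=B" "!!y. y : Y ==> w0 y+e<=B" using Y(1) e by (auto simp: B_def le_max_iff_disj)
  obtain M where "lip_bound U Y B f M" using polyfun_continuous[OF f(1) B(1)] U_nonarch U_F by blast
  note M = lip_boundD[OF this]
  define d where "d = min 1 (w0 (f b)/(2*M))"
  have d: "0 < d" using nan_pos[OF w0 ne] M(1) by (simp add: d_def)
  obtain w where w: "w : U" "close Y (e/2) w w0" "ALL y:Y. w (y-b y) < d" using b(2)[OF d] by blast
  note nw = U_nonarch[OF w(1)]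
  have "w y<=B & w (b y)<=B & w (y-b y)<=d" if y: "y : Y" for y
  proof -
   have "\<bar>w y-w0 y\<bar> < e/2" using w(2) y by (simp add: close_def)
   hence wy: "w y<=B" using B(2)[OF y] e by linarith
   have "w (y-b y)<=d" "d<=1" using w(3) y by (auto simp: d_def intro: less_imp_le)
   thus ?thesis using wy B(1) nan_diff[OF nw, of y "y-b y"] by auto
  qed
  hence "near_on w Y B d (%y. y) b" using d by (simp add: near_on_def)
  from M(4)[OF w(1) this] have "w (f b)<=M*d" using d f(2) by (simp add: nan_minus[OF nw])
  also have "... <= M*(w0 (f b)/(2*M))" using M(1) by (intro mult_left_mono) (auto simp: d_def)
  finally have "w0 (f b)<=w0 (f b)/2" using U_F[OF w(1) fF] M(1) by simp
  thus False using nan_pos[OF w0 ne] by simp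
 qed
 ultimately show ?thesis using b(1) unfolding specializes_def by (intro exI[of _ b]) simp
qed

theorem specialize_to_algebraic_point:
 fixes F0 :: "'a::alg_closed_field set"
 assumes F0: "aclosed F0" "infinite F0" and w: "nonarch_norm w" and nt: "x0 : F0" "x0~=0" "w x0~=1" and J: "finite J"
 shows "finite Y ==> Y<=acl (fgen (F0 Un J)) ==> 0 < e ==>
  EX b. specializes w F0 Y e b" using J
proof (induction J arbitrary: Y e rule: finite_induct)
 case empty
 have "acl (fgen (F0 Un {})) = F0" using F0 by (simp add: fgen_eq aclosed_def aclosed_acl_eq)
 thus ?case using empty by (intro exI[of _ "%y. y"]) (auto simp: specializes_def)
next
 case (insert t J)
 define F where "F = acl (fgen (F0 Un J))"
 have F: "aclosed F" and F0F: "F0<=F" "J<=F" and Finf: "infinite F" using acl_fgen[OF F0(2), of J] by (simp_all add: F_def)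
 show ?case
 proof (cases "t : F")
  case True
  hence "acl (fgen (F0 Un insert t J))<=F" using F F0F by (intro acl_least fgen_least) (auto simp: aclosed_subfield)
  thus ?thesis using insert.IH[of Y e] insert.prems unfolding F_def[symmetric] by blast
 next
  case False
  interpret l: line_ext F w t by unfold_locales (fact F Finf w False)+
  have "acl (fgen (F0 Un insert t J))<=acl l.Ft" unfolding l.Ft_def using F0F by (intro acl_mono fgen_mono) auto
  hence Y: "Y<=acl l.Ft" using insert.prems(2) by blast
  have e2: "0 < e/2" using insert.prems(3) by simp
  have xF: "x0 : F" using nt(1) F0F by blast
  obtain b where b: "specializes w F Y (e/2) b" using l.specialize_point[OF xF nt(2,3) insert.prems(1) Y e2] by blast
  have "finite (b ` Y)" "b ` Y<=acl (fgen (F0 Un J))" using insert.prems(1) specializesD(1)[OF b] by (auto simp: F_def)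
  from insert.IH[OF this e2] obtain a where a: "specializes w F0 (b ` Y) (e/2) a" by blast
  show ?thesis using specializes_trans[OF b a F0F(1)] by (intro exI) simp
 qed
qed

section \<open>Uniqueness of the extended norm over a complete field\<close>

lemma le_of_power_le:
 fixes a b C :: real
 assumes "0<=a" "0<=b" and le: "!!m. a^m<=C*b^m"
 shows "a<=b"
proof (rule ccontr)
 assume "~ a<=b"
 hence ab: "b < a" by simp
 show False
 proof (cases "b = 0")
  case True
  thus False using le[of 1] ab by simp
 next
  case False
  hence "1 < a/b" using ab assms(2) by simp
  then obtain m where "C < (a/b)^m" using real_arch_pow by blast
  thus False using le[of m] False assms(2) by (simp add: power_divide pos_less_divide_eq)
 qed
qed

lemma poly_bound_sum:
 assumes u: "nonarch_norm u" and g: "!!i. j<=i ==> coeff g i = 0"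
 shows "u (poly g x)<=(SUM i<j. u (coeff g i)*u x^i)"
proof -
 have "poly g x = (SUM i<j. coeff g i*x^i)"
 proof -
  have "poly g x = (SUM i<=degree g+j. coeff g i*x^i)" unfolding poly_altdef by (rule sum.mono_neutral_left) (auto simp: coeff_eq_0)
  also have "... = (SUM i<j. coeff g i*x^i)" by (rule sum.mono_neutral_right) (auto simp: g)
  finally show ?thesis .
 qed
 moreover have "u (SUM i<j. coeff g i*x^i)<=(SUM i<j. u (coeff g i)*u x^i)"
 proof (rule nan_sum_le[OF u])
  have nn: "0<=u (coeff g i)*u x^i" for i using nan_nonneg[OF u] by simp
  thus "0<=(SUM i<j. u (coeff g i)*u x^i)" by (rule sum_nonneg)
  fix i assume "i : {..<j}"
  thus "u (coeff g i*x^i)<=(SUM i<j. u (coeff g i)*u x^i)"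
   using member_le_sum[of i "{..<j}" "%i. u (coeff g i)*u x^i"] nn by (simp add: nan_mult[OF u] nan_power[OF u])
 qed
 ultimately show ?thesis by simp
qed

text \<open>Equivalence of norms on a finite-dimensional space. If x^j could be approximated by polynomials h of lower
degree, their coefficients would be Cauchy, and the limit would be a relation of degree j for x.\<close>

lemma coefficient_bound:
 fixes k :: "'a::field set"
 assumes k: "is_field k" and u: "nonarch_norm u"
  and complete: "!!s :: nat => 'a. (!!n. s n : k) ==> (!!e. 0 < e ==> EX N. ALL m>=N. ALL n>=N. u (s m-s n) < e) ==>
   EX l:k. (%n. u (s n-l)) \<longlonglongrightarrow> 0"
  and q: "is_minpoly k x q"
 shows "j<=degree q ==> EX c>0. ALL g. coeffs_in k g --> (ALL i>=j. coeff g i = 0) --> (ALL i. u (coeff g i)<=c*u (poly g x))"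
proof (induction j)
 case 0
 thus ?case by (intro exI[of _ 1]) (auto simp: nan_zero[OF u] nan_nonneg[OF u])
next
 case (Suc j)
 note R = field_ring[OF k]
 obtain c where c: "0 < c" "!!g i. coeffs_in k g ==> ALL i>=j. coeff g i = 0 ==> u (coeff g i)<=c*u (poly g x)" using Suc by (metis Suc_leD)
 have "EX d>0. ALL h. coeffs_in k h --> (ALL i>=j. coeff h i = 0) --> d<=u (x^j-poly h x)"
 proof (rule ccontr)
  assume neg: "~ ?thesis"
  have "EX h. coeffs_in k h & (ALL i>=j. coeff h i = 0) & u (x^j-poly h x) < 1/real (Suc m)" for m
   using neg[unfolded not_ex, rule_format, of "1/real (Suc m)"] by (auto simp: not_le)
  then obtain h where h: "!!m. coeffs_in k (h m)" "!!m. ALL i>=j. coeff (h m) i = 0"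
   "!!m. u (x^j-poly (h m) x) < 1/real (Suc m)" by metis
  have cau: "u (coeff (h m) i-coeff (h n) i)<=c*(1/real (Suc N))" if mn: "N<=m" "N<=n" for m n N i
  proof -
   have le: "u (x^j-poly (h m) x)<=1/real (Suc N)" if "N<=m" for m
   proof -
    have "1/real (Suc m)<=1/real (Suc N)" using that by (intro divide_left_mono) auto
    thus ?thesis using h(3)[of m] by linarith
   qed
   have "u (coeff (h m-h n) i)<=c*u (poly (h m-h n) x)" using h(1,2) by (intro c(2) coeffs_in_diff[OF R]) auto
   also have "poly (h m-h n) x = (x^j-poly (h n) x)-(x^j-poly (h m) x)" by simp
   also have "u ... <= 1/real (Suc N)" using nan_diff[OF u, of "x^j-poly (h n) x" "x^j-poly (h m) x"] le mn by (smt (verit))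
   finally show ?thesis using c(1) by simp
  qed
  have "EX l:k. (%n. u (coeff (h n) i-l)) \<longlonglongrightarrow> 0" for i
  proof (rule complete)
   show "coeff (h n) i : k" for n using h(1) by (rule coeffs_inD)
   fix e :: real assume e: "0 < e"
   obtain N where "1/real (Suc N) < e/c" using e c(1) reals_Archimedean[of "e/c"] by (auto simp: inverse_eq_divide)
   hence "c*(1/real (Suc N)) < e" using c(1) by (simp add: field_simps)
   thus "EX N. ALL m>=N. ALL n>=N. u (coeff (h m) i-coeff (h n) i) < e" using cau[of N] by (meson le_less_trans)
  qed
  then obtain l where l: "!!i. l i : k" "!!i. (%n. u (coeff (h n) i-l i)) \<longlonglongrightarrow> 0" by metis
  define H where "H = (SUM i<j. monom (l i) i)"
  have Hc: "coeff H i = (if i < j then l i else 0)" for i by (simp add: H_def coeff_sum_monom)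
  have Hk: "coeffs_in k H" unfolding coeffs_in_def Hc using l(1) subring_zero[OF R] by simp
  have "(%n. (SUM i<j. u (coeff (h n-H) i)*u x^i)) \<longlonglongrightarrow> (SUM i<j. 0*u x^i)"
   by (intro tendsto_sum tendsto_mult_right) (use l(2) in \<open>simp add: Hc\<close>)
  hence lim: "(%n. 1/real (Suc n)+(SUM i<j. u (coeff (h n-H) i)*u x^i)) \<longlonglongrightarrow> 0+0"
   using lim_1_over_n[where 'a=real, THEN filterlim_compose, OF filterlim_Suc] by (intro tendsto_add) auto
  have "u (x^j-poly H x)<=0+0"
  proof (rule LIMSEQ_le_const[OF lim], intro exI[of _ 0] allI impI)
   fix n
   have "x^j-poly H x = (x^j-poly (h n) x)+poly (h n-H) x" by simp
   hence "u (x^j-poly H x)<=max (u (x^j-poly (h n) x)) (u (poly (h n-H) x))" using nan_add[OF u] by metis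
   also have "... <= 1/real (Suc n)+(SUM i<j. u (coeff (h n-H) i)*u x^i)"
   proof -
    have "u (poly (h n-H) x)<=(SUM i<j. u (coeff (h n-H) i)*u x^i)" by (rule poly_bound_sum[OF u]) (simp add: Hc h(2))
    moreover have "0<=u (poly (h n-H) x)" by (rule nan_nonneg[OF u])
    moreover have "0<=1/real (Suc n)" by simp
    ultimately show ?thesis using h(3)[of n] by linarith
   qed
   finally show "u (x^j-poly H x)<=1/real (Suc n)+(SUM i<j. u (coeff (h n-H) i)*u x^i)" .
  qed
  hence "u (x^j-poly H x) = 0" using nan_nonneg[OF u, of "x^j-poly H x"] by linarith
  hence "poly (monom 1 j-H) x = 0" using nan_eq_0[OF u] by (simp add: poly_monom)
  moreover have "coeffs_in k (monom 1 j-H)" using Hk R by (intro coeffs_in_diff coeffs_in_monom subring_one)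
  moreover have "coeff (monom 1 j-H) j = 1" by (simp add: Hc)
  hence "monom 1 j-H~=0" by (metis coeff_0 zero_neq_one)
  moreover have "degree (monom 1 j-H)<=j" by (intro degree_le) (simp add: Hc)
  ultimately show False using q Suc.prems unfolding is_minpoly_def by (metis le_trans not_less_eq_eq)
 qed
 then obtain d where d: "0 < d" "!!h. coeffs_in k h ==> ALL i>=j. coeff h i = 0 ==> d<=u (x^j-poly h x)" by blast
 define C where "C = 1/d+c*(1+u x^j/d)"
 have C: "0 < C" "1/d<=C" "c*(1+u x^j/d)<=C" using d(1) c(1) nan_nonneg[OF u, of x] by (auto simp: C_def add_pos_nonneg)
 have "u (coeff g i)<=C*u (poly g x)" if g: "coeffs_in k g" "ALL i>=Suc j. coeff g i = 0" for g i
 proof -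
  define a where "a = coeff g j"
  define h where "h = g-monom a j"
  have a: "a : k" using g(1) by (simp add: a_def coeffs_in_def)
  have hk: "coeffs_in k h" unfolding h_def using g(1) a R by (intro coeffs_in_diff coeffs_in_monom)
  have hj: "ALL i>=j. coeff h i = 0"
  proof (intro allI impI)
   fix i assume "j<=i"
   thus "coeff h i = 0" using g(2) by (cases "i = j") (auto simp: h_def a_def)
  qed
  have ghx: "poly g x = poly h x+a*x^j" by (simp add: h_def poly_monom)
  have gn: "0<=u (poly g x)" by (rule nan_nonneg[OF u])
  have ua: "u a<=1/d*u (poly g x)"
  proof (cases "a = 0")
   case False
   define h' where "h' = smult (- inverse a) h"
   have "d<=u (x^j-poly h' x)" unfolding h'_def using hk hj a k R by (intro d(2) coeffs_in_smult subring_uminus subfield_inverse) auto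
   hence "u a*d<=u a*u (x^j-poly h' x)" using nan_nonneg[OF u] by (intro mult_left_mono)
   also have "... = u (a*(x^j-poly h' x))" by (simp add: nan_mult[OF u])
   also have "a*(x^j-poly h' x) = poly g x" using False by (simp add: h'_def ghx algebra_simps)
   finally show ?thesis using d(1) by (simp add: field_simps)
  qed (use gn d(1) nan_zero[OF u] in simp)
  have "u (poly h x)<=max (u (poly g x)) (u (a*x^j))" using nan_diff[OF u, of "poly g x" "a*x^j"] by (simp add: ghx)
  also have "u (a*x^j)<=1/d*u (poly g x)*u x^j" unfolding nan_mult[OF u] nan_power[OF u] using ua nan_nonneg[OF u] by (intro mult_right_mono) auto
  finally have "u (poly h x)<=max (u (poly g x)) (1/d*u (poly g x)*u x^j)" by simp
  moreover have "0<=1/d*u (poly g x)*u x^j" using d(1) gn nan_nonneg[OF u, of x] by simp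
  moreover have "(1+u x^j/d)*u (poly g x) = u (poly g x)+1/d*u (poly g x)*u x^j" by (simp add: algebra_simps)
  ultimately have uh: "u (poly h x)<=(1+u x^j/d)*u (poly g x)" using gn by linarith
  show ?thesis
  proof (cases "i = j")
   case True
   have "u (coeff g i)<=1/d*u (poly g x)" using ua True by (simp add: a_def)
   also have "... <= C*u (poly g x)" using C(2) gn by (intro mult_right_mono)
   finally show ?thesis .
  next
   case False
   hence "u (coeff g i) = u (coeff h i)" by (simp add: h_def)
   also have "... <= c*u (poly h x)" by (rule c(2)[OF hk hj])
   also have "... <= c*((1+u x^j/d)*u (poly g x))" using uh c(1) by (intro mult_left_mono) auto
   also have "... <= C*u (poly g x)" using mult_right_mono[OF C(3) gn] by (simp add: mult.assoc)
   finally show ?thesis .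
  qed
 qed
 thus ?case using C(1) by blast
qed

text \<open>The coefficients of x^m on the basis 1, x, ... are bounded by c u(x)^m, hence u'(x)^m is at most a constant times u(x)^m.\<close>

theorem complete_unique_extension:
 fixes k :: "'a::field set"
 assumes k: "is_field k" and w: "nonarch_norm w" "nonarch_norm w'" and ag: "agree k w' w"
  and complete: "!!s :: nat => 'a. (!!n. s n : k) ==> (!!e. 0 < e ==> EX N. ALL m>=N. ALL n>=N. w (s m-s n) < e) ==>
   EX l:k. (%n. w (s n-l)) \<longlonglongrightarrow> 0"
  and x: "alg k x"
 shows "w' x = w x"
proof -
 note R = field_ring[OF k]
 obtain q where q: "is_minpoly k x q" using minpoly_exists[OF k x] by blast
 have le: "u' x<=u x" if u: "nonarch_norm u" "nonarch_norm u'" and a: "agree k u w" "agree k u' w" for u u'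
 proof -
  have comp: "EX l:k. (%n. u (s n-l)) \<longlonglongrightarrow> 0"
   if s: "!!n. s n : k" "!!e. 0 < e ==> EX N. ALL m>=N. ALL n>=N. u (s m-s n) < e" for s :: "nat => 'a"
  proof -
   have "u (s m-y) = w (s m-y)" if "y : k" for m y using a(1) s(1) that subring_diff[OF R] by (auto simp: agree_def)
   hence eq: "y : k ==> (%m. u (s m-y)) = (%m. w (s m-y))" for y by (intro ext)
   have "EX l:k. (%n. w (s n-l)) \<longlonglongrightarrow> 0"
   proof (rule complete[OF s(1)])
    fix e :: real assume "0 < e"
    from s(2)[OF this] show "EX N. ALL m>=N. ALL n>=N. w (s m-s n) < e" using fun_cong[OF eq[OF s(1)]] by simp
   qed
   thus ?thesis using eq by auto
  qed
  obtain c where c: "0 < c" "!!g i. coeffs_in k g ==> ALL i>=degree q. coeff g i = 0 ==> u (coeff g i)<=c*u (poly g x)"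
   using coefficient_bound[OF k u(1) comp q order.refl] by blast
  show ?thesis
  proof (rule le_of_power_le)
   fix m
   define g where "g = monom 1 m mod q"
   have "coeffs_in k g" unfolding g_def using q R by (intro division_over[OF k] coeffs_in_monom subring_one) (auto simp: is_minpoly_def)
   moreover have "degree g < degree q \<or> g = 0" unfolding g_def using degree_mod_less[of q "monom 1 m"] minpoly_degree_pos[OF q] by (metis degree_0 less_not_refl)
   hence g0: "ALL i>=degree q. coeff g i = 0" by (auto simp: coeff_eq_0)
   ultimately have b: "u (coeff g i)<=c*u (poly g x)" "u' (coeff g i) = u (coeff g i)" for i using c(2)[of g i] a coeffs_inD[of k g i] by (auto simp: agree_def)
   have "poly (monom 1 m) x = poly (monom 1 m div q*q+g) x" by (simp add: g_def)
   hence gx: "poly g x = x^m" using q by (simp add: is_minpoly_def poly_monom)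
   have "u' x^m = u' (poly g x)" by (simp add: gx nan_power[OF u(2)])
   also have "... <= (SUM i<degree q. u' (coeff g i)*u' x^i)" by (rule poly_bound_sum[OF u(2)]) (use g0 in blast)
   also have "... <= (SUM i<degree q. c*u x^m*u' x^i)" using b nan_nonneg[OF u(2)] by (intro sum_mono mult_right_mono) (auto simp: gx nan_power[OF u(1)])
   also have "... = (SUM i<degree q. c*u' x^i)*u x^m" unfolding sum_distrib_right by (rule sum.cong) simp_all
   finally show "u' x^m<=(SUM i<degree q. c*u' x^i)*u x^m" .
  qed (use nan_nonneg u in auto)
 qed
 have ww: "agree k w w" by (simp add: agree_def)
 show ?thesis using le[OF w ww ag] le[OF w(2,1) ag ww] by (rule antisym)
qed

section \<open>Noether normalisation by means of norms\<close>

text \<open>The subring generated by A and T.\<close>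

definition pring :: "'a::comm_ring_1 set => 'a set => 'a set" where
 "pring A T = {f (%y. y) | f. f : polyfun A T}"

lemma pringI: "f : polyfun A T ==> x = f (%y. y) ==> x : pring A T" unfolding pring_def by (rule CollectI, rule exI[of _ f]) simp

lemma pring_base: "A<=pring A T" by (auto intro!: pringI polyfun.const)

lemma pring_gens: "T<=pring A T" by (auto intro!: pringI polyfun.proj)

lemma pring_least:
 assumes C: "is_ring C" "A<=C" "T<=C" shows "pring A T<=C"
proof
 fix x assume "x : pring A T"
 then obtain f where f: "f : polyfun A T" "x = f (%y. y)" by (auto simp: pring_def)
 show "x : C" unfolding f(2) by (rule polyfun_mem[OF C(1) _ polyfun_mono[OF f(1) C(2)]]) (use C(3) in blast)
qed

lemma subring_pring:
 assumes A: "is_ring A" shows "is_ring (pring A T)" unfolding is_ring_def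
proof (intro conjI ballI)
 show "1 : pring A T" using pring_base[of A T] subring_one[OF A] by blast
 fix x y assume "x : pring A T" "y : pring A T"
 then obtain f g where f: "f : polyfun A T" "x = f (%y. y)" and g: "g : polyfun A T" "y = g (%y. y)" by (auto simp: pring_def)
 show "x*y : pring A T" by (rule pringI[OF polyfun.mult[OF f(1) g(1)]]) (simp add: f(2) g(2))
 have "(%b. - 1*g b) : polyfun A T" by (intro polyfun.mult polyfun.const g subring_uminus A subring_one)
 from polyfun.add[OF f(1) this] show "x-y : pring A T" by (rule pringI) (simp add: f(2) g(2))
qed

lemma pring_insert:
 assumes A: "is_ring A" and x: "x : pring A (insert t T)"
 shows "EX p. coeffs_in (pring A T) p & x = poly p t"
proof -
 note C = subring_poly_range[OF subring_pring[OF A, of T], of t]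
 have "pring A (insert t T)<={poly p t | p. coeffs_in (pring A T) p}" using C(2,3) pring_base[of A T] pring_gens[of T A] by (intro pring_least C(1)) blast+
 thus ?thesis using x by blast
qed

lemma coeffs_in_quotient:
 fixes A :: "'a::field set"
 assumes A: "is_ring A" and p: "coeffs_in (fgen A) p"
 shows "EX d:A. d~=0 & coeffs_in A (smult d p)" using p
proof (induction p)
 case 0
 thus ?case using A by (intro bexI[of _ 1]) (auto simp: coeffs_in_0 subring_one)
next
 case (pCons c p)
 hence pc: "c : fgen A" "coeffs_in (fgen A) p" by (auto simp: coeffs_in_pCons_iff)
 obtain a b where ab: "a : A" "b : A" "b~=0" "c = a/b" using fgen_quotient[OF A pc(1)] by blast
 obtain d where d: "d : A" "d~=0" "coeffs_in A (smult d p)" using pCons.IH[OF pc(2)] by blast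
 have "coeffs_in A (smult b (smult d p))" by (rule coeffs_in_smult[OF A ab(2) d(3)])
 moreover have "b*d*c = a*d" using ab(3,4) by simp
 hence "b*d*c : A" using subring_mult[OF A ab(1) d(1)] by metis
 ultimately have "coeffs_in A (smult (b*d) (pCons c p))" by (simp only: smult_pCons coeffs_in_pCons_iff smult_smult simp_thms)
 thus ?case using subring_mult[OF A ab(2) d(1)] ab(3) d(2) by (intro bexI[of _ "b*d"]) auto
qed

lemma fgen_pring:
 assumes "is_ring k" shows "fgen (pring k T) = fgen (k Un T)"
proof
 show "fgen (pring k T)<=fgen (k Un T)" using fgen_superset[of "k Un T"] by (intro fgen_least subfield_fgen pring_least field_ring) auto
 show "fgen (k Un T)<=fgen (pring k T)" using pring_base[of k T] pring_gens[of T k] by (intro fgen_mono) blast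
qed

definition monomial_sum :: "'a::comm_ring_1 set => 'a set => ('a => nat) set => (('a => nat) => 'a) => 'a => bool" where
 "monomial_sum A T M c x \<longleftrightarrow> finite M & (ALL m:M. c m : A & c m~=0 & (ALL t. t ~: T --> m t = 0)) &
  x = (SUM m:M. c m*(PROD t:T. t^m t))"

lemma monomial_sum_poly:
 assumes T: "finite T" "t ~: T" and p: "!!i. EX M c. monomial_sum A T M c (coeff p i)"
 shows "EX M c. monomial_sum A (insert t T) M c (poly p t) & (p~=0 --> M~={})"
proof -
 obtain M c where Mc: "!!i. monomial_sum A T (M i) (c i) (coeff p i)" using p by metis
 define L where "L i = (%m. m(t := i)) ` M i" for i
 define d where "d m = c (m t) (m(t := 0))" for m
 have mt: "m t = 0" if "m : M i" for m i using Mc[of i] that T(2) by (auto simp: monomial_sum_def)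
 have up: "(m(t := i))(t := 0) = m" if "m : M i" for m i using mt[OF that] by (auto simp: fun_eq_iff)
 have inj: "inj_on (%m. m(t := i)) (M i)" for i
 proof (rule inj_onI)
  fix m m' assume m: "m : M i" "m' : M i" and e: "m(t := i) = m'(t := i)"
  have "(m(t := i))(t := 0) = (m'(t := i))(t := 0)" by (simp only: e)
  thus "m = m'" by (simp only: up[OF m(1)] up[OF m(2)])
 qed
 have fin: "finite (L i)" for i using Mc[of i] by (simp add: L_def monomial_sum_def)
 have dis: "m t = i" if "m : L i" for m i using that by (auto simp: L_def)
 define N where "N = (UN i<=degree p. L i)"
 have "(SUM m:N. d m*(PROD s:insert t T. s^m s)) = (SUM i<=degree p. SUM m:L i. d m*(PROD s:insert t T. s^m s))" unfolding N_def
 proof (rule sum.UNION_disjoint)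
  show "ALL i:{..degree p}. ALL j:{..degree p}. i~=j --> L i Int L j = {}"
  proof (intro ballI impI)
   fix i j :: nat assume ij: "i~=j"
   show "L i Int L j = {}"
   proof (rule equals0I)
    fix m assume "m : L i Int L j"
    hence "m t = i" "m t = j" by (auto intro: dis)
    thus False using ij by simp
   qed
  qed
 qed (use fin in simp_all)
 also have "... = (SUM i<=degree p. coeff p i*t^i)"
 proof (rule sum.cong[OF refl])
  fix i
  have "(SUM m:L i. d m*(PROD s:insert t T. s^m s)) = (SUM m:M i. c i m*(PROD s:T. s^m s)*t^i)" unfolding L_def sum.reindex[OF inj] comp_def
  proof (rule sum.cong[OF refl])
   fix m assume m: "m : M i"
   have "(PROD s:T. s^(m(t := i)) s) = (PROD s:T. s^m s)" using T(2) by (intro prod.cong) auto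
   thus "d (m(t := i))*(PROD s:insert t T. s^(m(t := i)) s) = c i m*(PROD s:T. s^m s)*t^i" using T m up[OF m] by (simp add: d_def)
  qed
  also have "... = coeff p i*t^i" using Mc[of i] by (simp add: monomial_sum_def sum_distrib_right)
  finally show "(SUM m:L i. d m*(PROD s:insert t T. s^m s)) = coeff p i*t^i" .
 qed
 also have "... = poly p t" by (simp add: poly_altdef)
 finally have sum: "poly p t = (SUM m:N. d m*(PROD s:insert t T. s^m s))" by simp
 have "d m : A & d m~=0 & (ALL s. s ~: insert t T --> m s = 0)" if "m : N" for m
 proof -
  obtain i m' where m: "m' : M i" "m = m'(t := i)" using \<open>m : N\<close> by (auto simp: N_def L_def)
  thus ?thesis using Mc[of i] up[OF m(1)] by (auto simp: d_def monomial_sum_def)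
 qed
 hence "monomial_sum A (insert t T) N d (poly p t)" using fin sum by (auto simp: monomial_sum_def N_def)
 moreover have "N~={}" if "p~=0"
 proof -
  have "M (degree p)~={}" using Mc[of "degree p"] that by (auto simp: monomial_sum_def)
  thus ?thesis by (auto simp: N_def L_def)
 qed
 ultimately show ?thesis by blast
qed

lemma pring_monomial_sum:
 assumes A: "is_ring A"
 shows "finite T ==> x : pring A T ==> EX M c. monomial_sum A T M c x"
proof (induction T arbitrary: x rule: finite_induct)
 case empty
 have "x : A" using pring_least[OF A order.refl, of "{}"] empty by auto
 thus ?case by (intro exI[of _ "if x = 0 then {} else {%_. 0}"] exI[of _ "%_. x"]) (auto simp: monomial_sum_def)
next
 case (insert t T)
 obtain p where p: "coeffs_in (pring A T) p" "x = poly p t" using pring_insert[OF A insert.prems] by blast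
 hence "EX M c. monomial_sum A T M c (coeff p i)" for i using insert.IH by (simp add: coeffs_in_def)
 from monomial_sum_poly[OF insert.hyps this] show ?case using p(2) by blast
qed

lemma algebraic_relation:
 fixes k :: "'a::field set"
 assumes k: "is_ring k" and T: "finite T" "t ~: T" and alg: "t : acl (fgen (k Un T))"
 shows "EX M c. M~={} & monomial_sum k (insert t T) M c 0"
proof -
 obtain p where p: "coeffs_in (fgen (k Un T)) p" "p~=0" "poly p t = 0" using alg by (auto simp: acl_def alg_def)
 note R = subring_pring[OF k, of T]
 obtain d where d: "d~=0" "coeffs_in (pring k T) (smult d p)" using coeffs_in_quotient[OF R, of p] p(1) unfolding fgen_pring[OF k] by blast
 have "EX M c. monomial_sum k T M c (coeff (smult d p) i)" for i using pring_monomial_sum[OF k T(1)] d(2) unfolding coeffs_in_def by blast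
 from monomial_sum_poly[OF T this] show ?thesis using d(1) p(2,3) by auto
qed

text \<open>Nagata weights: successive weights are larger than all sums of the previous ones, so that different monomials have different weights.\<close>

lemma weights_exist:
 fixes M :: "('b => nat) set"
 assumes M: "finite M"
 shows "finite T ==> x ~: T ==> EX e. e x = 1 & (ALL t:T. 1<=e t) &
  (ALL m:M. ALL m':M. (SUM t:insert x T. m t*e t) = (SUM t:insert x T. m' t*e t) --> (ALL t:insert x T. m t = m' t))"
proof (induction T rule: finite_induct)
 case empty
 thus ?case by (intro exI[of _ "%_. 1"]) auto
next
 case (insert s T)
 then obtain e where e: "e x = 1" "!!t. t : T ==> 1<=e t"
  "!!m m'. m : M ==> m' : M ==> (SUM t:insert x T. m t*e t) = (SUM t:insert x T. m' t*e t) ==> ALL t:insert x T. m t = m' t" by auto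
 define W where "W m = (SUM t:insert x T. m t*e t)" for m
 define K where "K = Suc (Max (insert 0 (W ` M)))"
 have WK: "W m < K" if "m : M" for m unfolding K_def using M that by (simp add: less_Suc_eq_le)
 define e' where "e' = e(s := K)"
 have s: "s ~: insert x T" "x~=s" using insert by auto
 have W': "(SUM t:insert x (insert s T). m t*e' t) = m s*K+W m" for m
 proof -
  have "(SUM t:insert s (insert x T). m t*e' t) = m s*e' s+(SUM t:insert x T. m t*e' t)" using insert.hyps(1) s(1) by (intro sum.insert) auto
  also have "(SUM t:insert x T. m t*e' t) = W m" unfolding W_def using s(1) by (intro sum.cong) (auto simp: e'_def)
  finally show ?thesis by (simp add: insert_commute e'_def)
 qed
 have "ALL t:insert x (insert s T). m t = m' t"
  if m: "m : M" "m' : M" "(SUM t:insert x (insert s T). m t*e' t) = (SUM t:insert x (insert s T). m' t*e' t)" for m m'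
 proof -
  have eq: "m s*K+W m = m' s*K+W m'" using m(3) W' by simp
  have "(m s*K+W m) div K = m s" "(m' s*K+W m') div K = m' s" using WK[OF m(1)] WK[OF m(2)] by auto
  hence 1: "m s = m' s" using eq by simp
  hence "W m = W m'" using eq by simp
  thus ?thesis using e(3)[OF m(1,2)] 1 by (auto simp: W_def)
 qed
 moreover have "e' x = 1" "ALL t:insert s T. 1<=e' t" using e(1,2) s by (auto simp: e'_def K_def)
 ultimately show ?case by (intro exI[of _ e']) blast
qed

locale norm_family =
 fixes k :: "'a::alg_closed_field set" and w0 :: "'a => real"
 assumes k: "is_field k" "infinite k" and w0: "nonarch_norm w0"
  and unique: "!!w x. nonarch_norm w ==> agree k w w0 ==> x : acl k ==> w x = w0 x"
  and nontrivial: "EX x:k. 1 < w0 x"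
begin

definition "S = ext_norms k w0"

lemma k_ring: "is_ring k" by (rule field_ring[OF k(1)])
lemma S_nonarch: "w : S ==> nonarch_norm w" by (simp add: S_def ext_norms_def)
lemma S_acl: "w : S ==> x : acl k ==> w x = w0 x" using unique by (simp add: S_def ext_norms_def)
lemma S_k: "w : S ==> x : k ==> w x = w0 x" using S_acl subset_acl[OF k_ring] by blast
lemma S_agree: "w : S ==> nonarch_norm u ==> agree K u w ==> k<=K ==> u : S" unfolding S_def by (rule ext_norms_agree)
lemma w0_S: "w0 : S" using w0 by (simp add: S_def ext_norms_def agree_def)

text \<open>At least 2, so that its powers exceed any given constant.\<close>

definition "size_on T w = Max (insert 2 (w ` T))" for w :: "'a => real"

text \<open>Bounded by a power of the values at T, uniformly in S. This is the counterpart of integrality over k[T].\<close>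

definition "poly_bounded T x \<longleftrightarrow> (EX D. ALL w:S. w x<=size_on T w^D)"

lemma poly_boundedI: "(!!w. w : S ==> w x<=size_on T w^D) ==> poly_bounded T x" unfolding poly_bounded_def by blast

lemma size_on_ge: "finite T ==> 2<=size_on T w" "finite T ==> t : T ==> w t<=size_on T w" by (simp_all add: size_on_def)

lemma size_on_ge_1: "finite T ==> 1<=size_on T w" using size_on_ge(1)[of T w] by simp

lemma size_on_le: "finite T ==> 2<=B ==> (!!t. t : T ==> w t<=B) ==> size_on T w<=B" by (auto simp: size_on_def)

lemma size_on_insert: "finite T ==> size_on (insert t T) w = max (w t) (size_on T w)"
 unfolding size_on_def image_insert insert_commute[of 2] by (rule Max_insert) auto

lemma size_on_cong: "(!!t. t : T ==> u t = w t) ==> size_on T u = size_on T w" using image_cong[of T T u w] by (simp add: size_on_def)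

lemma constant_le_size:
 assumes "finite T" shows "EX m. ALL w. C<=size_on T w^m"
proof -
 obtain m where "C < 2^m" using real_arch_pow[of 2 C] by auto
 moreover have "2^m<=size_on T w^m" for w using size_on_ge(1)[OF assms] by (intro power_mono) auto
 ultimately show ?thesis by (intro exI[of _ m]) (meson less_le_trans less_imp_le)
qed

lemma poly_bounded_ring:
 assumes T: "finite T" shows "is_ring {x. poly_bounded T x}" unfolding is_ring_def
proof (intro conjI ballI)
 show "1 : {x. poly_bounded T x}" by (intro CollectI poly_boundedI[of _ _ 0]) (simp add: nan_one S_nonarch)
 fix x y assume "x : {x. poly_bounded T x}" "y : {x. poly_bounded T x}"
 then obtain D E where D: "!!w. w : S ==> w x<=size_on T w^D" "!!w. w : S ==> w y<=size_on T w^E" by (auto simp: poly_bounded_def)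
 have "w (x*y)<=size_on T w^(D+E)" if w: "w : S" for w unfolding nan_mult[OF S_nonarch[OF w]] power_add
  using D[OF w] nan_nonneg[OF S_nonarch[OF w]] size_on_ge_1[OF T, of w] by (intro mult_mono) auto
 thus "x*y : {x. poly_bounded T x}" by (intro CollectI poly_boundedI)
 have "w (x-y)<=size_on T w^(D+E)" if w: "w : S" for w using nan_diff[OF S_nonarch[OF w], of x y] D[OF w] power_increasing[of D "D+E" "size_on T w"]
   power_increasing[of E "D+E" "size_on T w"] size_on_ge_1[OF T, of w] by simp
 thus "x-y : {x. poly_bounded T x}" by (intro CollectI poly_boundedI)
qed

lemma poly_bounded_k: "finite T ==> x : k ==> poly_bounded T x" using constant_le_size[of T "w0 x"] by (auto simp: S_k poly_bounded_def)

lemma poly_bounded_gen: "finite T ==> t : T ==> poly_bounded T t" by (rule poly_boundedI[of _ _ 1]) (simp add: size_on_ge)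

lemma poly_bounded_trans:
 assumes T: "finite T" "finite T'" and t: "!!t. t : T ==> poly_bounded T' t" and x: "poly_bounded T x"
 shows "poly_bounded T' x"
proof -
 obtain D where D: "!!t w. t : T ==> w : S ==> w t<=size_on T' w^D t" using t unfolding poly_bounded_def by metis
 obtain D0 where D0: "!!w. w : S ==> w x<=size_on T w^D0" using x by (auto simp: poly_bounded_def)
 define D1 where "D1 = Max (insert 1 (D ` T))"
 have D1: "1<=D1" "!!t. t : T ==> D t<=D1" unfolding D1_def using T(1) by auto
 have "w x<=size_on T' w^(D1*D0)" if w: "w : S" for w
 proof -
  note s = size_on_ge_1[OF T(2), of w]
  have "size_on T w<=size_on T' w^D1"
  proof (rule size_on_le[OF T(1)])
   show "2<=size_on T' w^D1" using size_on_ge(1)[OF T(2), of w] self_le_power[OF s, of D1] D1(1) by simp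
   show "w t<=size_on T' w^D1" if "t : T" for t using D[OF that w] power_increasing[OF D1(2)[OF that] s] by linarith
  qed
  hence "size_on T w^D0<=(size_on T' w^D1)^D0" using size_on_ge_1[OF T(1), of w] by (intro power_mono) auto
  thus ?thesis using D0[OF w] by (simp add: power_mult)
 qed
 thus ?thesis by (rule poly_boundedI)
qed

text \<open>Nagata's substitution y = t - x^(e t). If w(x) were large compared with all w(y), then w(t) = w(x)^(e t), and
the relation would have a single dominant monomial, the one of largest weight.\<close>

lemma reduce_generators:
 assumes T: "finite T" "x ~: T" and M: "M~={}" "monomial_sum k (insert x T) M c 0"
  and B: "is_ring B" "insert x T<=B"
 shows "EX T'. finite T' & T'<=B & card T'<=card T & (ALL t:insert x T. poly_bounded T' t)"
proof -
 have Mf: "finite M" "!!m. m : M ==> c m : k & c m~=0 & (ALL t. t ~: insert x T --> m t = 0)"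
  "(SUM m:M. c m*(PROD t:insert x T. t^m t)) = 0" using M(2) by (auto simp: monomial_sum_def)
 obtain e where e: "e x = 1" "!!t. t : T ==> 1<=e t"
  "!!m m'. m : M ==> m' : M ==> (SUM t:insert x T. m t*e t) = (SUM t:insert x T. m' t*e t) ==> ALL t:insert x T. m t = m' t"
  using weights_exist[OF Mf(1) T] by blast
 define W where "W m = (SUM t:insert x T. m t*e t)" for m
 have injW: "inj_on W M"
 proof (rule inj_onI)
  fix m m' assume m: "m : M" "m' : M" "W m = W m'"
  have "m t = m' t" for t using e(3)[OF m(1,2)] m(3) Mf(2)[OF m(1)] Mf(2)[OF m(2)] by (cases "t : insert x T") (auto simp: W_def)
  thus "m = m'" by blast
 qed
 obtain m0 where m0: "m0 : M" "!!m. m : M ==> W m<=W m0"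
 proof -
  have "Max (W ` M) : W ` M" using Mf(1) M(1) by (intro Max_in) auto
  then obtain m0 where m0: "m0 : M" "Max (W ` M) = W m0" by blast
  have "W m<=W m0" if "m : M" for m unfolding m0(2)[symmetric] using Mf(1) that by (intro Max_ge) auto
  thus thesis using that m0(1) by blast
 qed
 have less: "W m < W m0" if "m : M" "m~=m0" for m using m0(2)[OF that(1)] injW that m0(1) by (metis inj_onD le_neq_implies_less)
 define y where "y t = t-x^e t" for t
 define T' where "T' = y ` T"
 have T': "finite T'" "T'<=B" "card T'<=card T" unfolding T'_def y_def using T(1) B by (auto intro!: card_image_le subring_diff[OF B(1)] subring_power[OF B(1)])
 define R where "R = Max (insert 1 ((%m. w0 (c m)/w0 (c m0)) ` M))"
 have R: "1<=R" "!!m. m : M ==> w0 (c m)/w0 (c m0)<=R" unfolding R_def using Mf(1) by (auto intro!: Max_ge)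
 have c0: "0 < w0 (c m0)" using nan_pos[OF w0] Mf(2)[OF m0(1)] by blast
 have x: "w x<=R * size_on T' w" if w: "w : S" for w
 proof (rule ccontr)
  note nw = S_nonarch[OF w]
  assume "~ ?thesis"
  hence gt: "R * size_on T' w < w x" by simp
  have s: "1<=size_on T' w" by (rule size_on_ge_1[OF T'(1)])
  have "R*1<=R * size_on T' w" "1 * size_on T' w<=R * size_on T' w" using s R(1) by (intro mult_mono; simp)+
  hence xR: "R < w x" "size_on T' w < w x" using gt by auto
  hence x1: "1 < w x" using R(1) by linarith
  have wt: "w t = w x^e t" if t: "t : insert x T" for t
  proof (cases "t = x")
   case False
   hence tT: "t : T" using t by simp
   have "w (y t) < w x" using size_on_ge(2)[OF T'(1), of "y t" w] xR(2) tT by (simp add: T'_def)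
   also have "w x<=w x^e t" using x1 e(2)[OF tT] by (simp add: self_le_power)
   finally have "w (y t) < w (x^e t)" by (simp add: nan_power[OF nw])
   from nan_dominant[OF nw this] show ?thesis by (simp add: y_def nan_power[OF nw])
  qed (simp add: e(1))
  have trm: "w (c m*(PROD t:insert x T. t^m t)) = w0 (c m)*w x^W m" if m: "m : M" for m
  proof -
   have "w (PROD t:insert x T. t^m t) = (PROD t:insert x T. w x^(m t*e t))" unfolding nan_prod[OF nw]
   proof (rule prod.cong[OF refl])
    fix t assume t: "t : insert x T"
    have "w (t^m t) = (w x^e t)^m t" by (simp only: nan_power[OF nw] wt[OF t])
    thus "w (t^m t) = w x^(m t*e t)" by (simp only: power_mult[symmetric] mult.commute)
   qed
   thus ?thesis using S_k[OF w] Mf(2)[OF m] by (simp add: nan_mult[OF nw] W_def power_sum)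
  qed
  have pos: "0 < w0 (c m0)*w x^W m0" using c0 x1 by simp
  have "w (SUM m:M-{m0}. c m*(PROD t:insert x T. t^m t)) < w0 (c m0)*w x^W m0"
  proof (rule nan_sum_less[OF nw pos])
   fix m assume m: "m : M-{m0}"
   have "w0 (c m)<=R*w0 (c m0)" using R(2)[of m] m c0 by (simp add: divide_le_eq)
   also have "... < w x*w0 (c m0)" using xR(1) c0 by simp
   finally have "w0 (c m)*w x^W m < w x*w0 (c m0)*w x^W m" using x1 by (intro mult_strict_right_mono) auto
   also have "... = w0 (c m0)*w x^Suc (W m)" by simp
   also have "... <= w0 (c m0)*w x^W m0" using less[of m] m x1 c0 by (intro mult_left_mono power_increasing) auto
   finally show "w (c m*(PROD t:insert x T. t^m t)) < w0 (c m0)*w x^W m0" using trm m by simp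
  qed
  hence "w (SUM m:M-{m0}. c m*(PROD t:insert x T. t^m t)) < w (c m0*(PROD t:insert x T. t^m0 t))" by (simp only: trm[OF m0(1)])
  from nan_dominant[OF nw this] have "w (SUM m:M. c m*(PROD t:insert x T. t^m t)) = w0 (c m0)*w x^W m0"
   using sum.remove[OF Mf(1) m0(1), of "%m. c m*(PROD t:insert x T. t^m t)"] trm[OF m0(1)] by (simp add: add.commute)
  thus False using pos unfolding Mf(3) nan_zero[OF nw] by linarith
 qed
 obtain m where m: "!!w. R<=size_on T' w^m" using constant_le_size[OF T'(1)] by blast
 have "w x<=size_on T' w^Suc m" if "w : S" for w using order.trans[OF x[OF that] mult_right_mono[OF m]] size_on_ge_1[OF T'(1), of w] by (simp add: mult.commute)
 hence xb: "poly_bounded T' x" by (rule poly_boundedI)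
 note PR = poly_bounded_ring[OF T'(1)]
 have "poly_bounded T' t" if "t : T" for t
 proof -
  have "y t : {x. poly_bounded T' x}" using poly_bounded_gen[OF T'(1)] that by (simp add: T'_def)
  hence "y t+x^e t : {x. poly_bounded T' x}" using xb by (intro subring_add[OF PR] subring_power[OF PR]) auto
  thus ?thesis by (simp add: y_def)
 qed
 thus ?thesis using T' xb by (intro exI[of _ T']) auto
qed

definition "alg_indep T \<longleftrightarrow> (ALL t:T. t ~: acl (fgen (k Un (T-{t}))))"

lemma alg_indep_subset: "alg_indep T ==> T'<=T ==> alg_indep T'"
 unfolding alg_indep_def using acl_mono[OF fgen_mono] by (metis (no_types, lifting) Diff_mono Un_mono order.refl subset_iff)

text \<open>Take T of minimal cardinality; an algebraic relation would make it smaller.\<close>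

theorem noether_normalization:
 assumes Y: "finite Y" "Y<=B" and B: "is_ring B"
 shows "EX T. finite T & T<=B & alg_indep T & (ALL y:Y. poly_bounded T y)"
proof -
 define good where "good T \<longleftrightarrow> finite T & T<=B & (ALL y:Y. poly_bounded T y)" for T
 have "good Y" using Y poly_bounded_gen by (simp add: good_def)
 then obtain T where T: "good T" "!!T'. good T' ==> card T<=card T'" using ex_has_least_nat[of good Y card] by auto
 have "alg_indep T" unfolding alg_indep_def
 proof (intro ballI notI)
  fix x assume x: "x : T" "x : acl (fgen (k Un (T-{x})))"
  have fin: "finite (T-{x})" "x ~: T-{x}" "insert x (T-{x}) = T" using T(1) x(1) by (auto simp: good_def)
  obtain M c where M: "M~={}" "monomial_sum k (insert x (T-{x})) M c 0" using algebraic_relation[OF k_ring fin(1,2) x(2)] by blast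
  obtain T' where T': "finite T'" "T'<=B" "card T'<=card (T-{x})" "ALL t:T. poly_bounded T' t"
   using reduce_generators[OF fin(1,2) M B] T(1) unfolding fin(3) good_def by blast
  have "good T'" unfolding good_def using T' poly_bounded_trans[of T T'] T(1) by (auto simp: good_def)
  hence "card T<=card T'" by (rule T(2))
  moreover have "card (T-{x}) < card T" using T(1) x(1) by (intro card_Diff1_less) (auto simp: good_def)
  ultimately show False using T'(3) by linarith
 qed
 thus ?thesis using T(1) unfolding good_def by blast
qed

end

section \<open>Normality of polynomial rings\<close>

context norm_family
begin

lemma aclosed_closure:
 assumes "k<=K" "is_field K"
 shows "aclosed (acl K)" "is_ring (acl K)" "K<=acl K" "k<=acl K"
 using aclosed_acl[OF assms(2) infinite_super[OF assms(1) k(2)]] aclosed_subring subset_acl[OF field_ring[OF assms(2)]] assms(1) by auto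

lemma gauss_extension:
 assumes E: "aclosed E" "k<=E" and t: "t ~: E" and w: "w : S" and b: "b : E" and r: "0 < r"
 shows "EX u:S. agree E u w & (ALL p. coeffs_in E p --> u (poly p (t-b)) = gnorm w r p) & u (t-b) = r"
proof -
 have EF: "is_field E" and "~ alg E t" using E t by (auto simp: aclosed_def)
 then obtain u where u: "nonarch_norm u" "!!x. x : E ==> u x = w x" "!!p. coeffs_in E p ==> u (poly p (t-b)) = gnorm w r p"
  using norm_extend_gauss[OF EF infinite_super[OF E(2) k(2)] _ S_nonarch[OF w] b r] by metis
 have "u (t-b) = r" using u(3)[OF coeffs_in_X[OF field_ring[OF EF]]] r nan_one[OF S_nonarch[OF w]] nan_zero[OF S_nonarch[OF w]] by (simp add: gnorm_linear)
 have ag: "agree E u w" using u(2) by (simp add: agree_def)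
 have uS: "u : S" by (rule S_agree[OF w u(1) ag E(2)])
 show ?thesis using u(3) ag \<open>u (t-b) = r\<close> uS by blast
qed

text \<open>Write x = g/h with h of minimal degree. At a root b of h the numerator does not vanish, and norms with
w(t - b) \<rightarrow> 0 make x arbitrarily large while T stays bounded.\<close>

lemma bounded_rational_is_polynomial:
 assumes K: "is_field K" "k<=K" and t: "t ~: acl K" and T: "finite T" "T<=K"
  and x: "x : fgen (insert t K)" "poly_bounded (insert t T) x"
 shows "EX p. coeffs_in K p & x = poly p t"
proof -
 define E where "E = acl K"
 have E: "aclosed E" "K<=E" "k<=E" and ER: "is_ring E" using aclosed_closure[OF K(2,1)] by (auto simp: E_def)
 note R = field_ring[OF K(1)]
 define Q where "Q n \<longleftrightarrow> (EX g h. coeffs_in K g & coeffs_in K h & poly h t~=0 & x = poly g t/poly h t & degree h = n)" for n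
 have "EX n. Q n" using x(1) unfolding fgen_insert[OF K(1)] Q_def by blast
 hence "Q (LEAST n. Q n)" and minimal: "!!n. Q n ==> (LEAST n. Q n)<=n" by (auto intro: LeastI_ex Least_le)
 then obtain g h where gh: "coeffs_in K g" "coeffs_in K h" "poly h t~=0" "x = poly g t/poly h t" "degree h = (LEAST n. Q n)" unfolding Q_def by blast
 have "degree h = 0"
 proof (rule ccontr)
  assume "degree h~=0"
  then obtain b where b: "poly h b = 0" using alg_closed_imp_poly_has_root[of h] by auto
  have h0: "h~=0" using gh(3) by auto
  have ab: "alg K b" unfolding alg_def using gh(2) h0 b by blast
  hence bE: "b : E" by (simp add: E_def acl_def)
  have gb: "poly g b~=0"
  proof
   assume z: "poly g b = 0"
   obtain q where q: "is_minpoly K b q" using minpoly_exists[OF K(1) ab] by blast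
   have qK: "coeffs_in K q" using q by (simp add: is_minpoly_def)
   have eq: "q*(g div q) = g" "q*(h div q) = h" using minpoly_dvd[OF K(1) q gh(1) z] minpoly_dvd[OF K(1) q gh(2) b] by simp_all
   have "poly q t*poly (g div q) t = poly g t" "poly q t*poly (h div q) t = poly h t"
    using arg_cong[OF eq(1), of "%p. poly p t"] arg_cong[OF eq(2), of "%p. poly p t"] by simp_all
   hence nz: "poly q t~=0" "poly (h div q) t~=0"
    and "x = (poly q t*poly (g div q) t)/(poly q t*poly (h div q) t)" using gh(3,4) by auto
   hence "x = poly (g div q) t/poly (h div q) t" by simp
   hence "Q (degree (h div q))" unfolding Q_def using division_over[OF K(1) qK] gh(1,2) nz(2) by blast
   hence "degree h<=degree (h div q)" using minimal gh(5) by metis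
   moreover have "degree h = degree q+degree (h div q)" using eq(2) h0 degree_mult_eq[of q "h div q"] by fastforce
   ultimately show False using minpoly_degree_pos[OF q] by simp
  qed
  define G where "G = w0 (poly g b)"
  have G: "0 < G" unfolding G_def by (rule nan_pos[OF w0 gb])
  obtain D where D: "!!w. w : S ==> w x<=size_on (insert t T) w^D" using x(2) by (auto simp: poly_bounded_def)
  define R where "R = max 1 (w0 b)"
  define B where "B = max R (size_on T w0)"
  have B: "2<=B" unfolding B_def using size_on_ge(1)[OF T(1), of w0] by simp
  define g2 where "g2 = synthetic_div g b"
  define h2 where "h2 = synthetic_div h b"
  have dec: "poly p t = poly p b+(t-b)*poly (synthetic_div p b) t" for p
   using arg_cong[OF synthetic_div_correct'[of b p], of "%p. poly p t"] by (simp add: algebra_simps)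
  define Mg where "Mg = gnorm w0 R g2"
  define Mh where "Mh = gnorm w0 R h2*B^D"
  have M0: "0<=Mg" "0<=Mh" unfolding Mg_def Mh_def using gnorm_nonneg[OF nan_seminorm[OF w0] coeffs_in_UNIV, of R] B by (auto simp: R_def)
  define r where "r = min 1 (min (G/(2*(1+Mg))) (G/(2*(1+Mh))))"
  have r: "0 < r" "r<=1" using G M0 by (auto simp: r_def)
  have rM: "r*M < G" if "M = Mg \<or> M = Mh" for M
  proof -
   have "0<=M" "r<=G/(2*(1+M))" using that M0 by (auto simp: r_def)
   hence "r*M<=G/(2*(1+M))*M" by (intro mult_right_mono)
   also have "... < G" using G \<open>0<=M\<close> by (simp add: divide_simps)
   finally show ?thesis .
  qed
  obtain w where w: "w : S" "agree E w w0" "w (t-b) = r" using gauss_extension[OF E(1,3) _ w0_S bE r(1)] t by (auto simp: E_def)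
  note nw = S_nonarch[OF w(1)]
  have wE: "w y = w0 y" if "y : E" for y using w(2) that by (simp add: agree_def)
  have wt: "w t<=R" using nan_add[OF nw, of "t-b" b] w(3) r(2) wE[OF bE] by (simp add: R_def)
  have pb: "w (poly p t)<=gnorm w0 R p" if "coeffs_in E p" for p
  proof -
   have "gnorm w R p = gnorm w0 R p" unfolding gnorm_def using wE that by (simp add: coeffs_in_def)
   thus ?thesis using nan_poly_le[OF nw wt, of p] by (simp add: R_def)
  qed
  have E2: "coeffs_in E g2" "coeffs_in E h2" "coeffs_in E g" unfolding g2_def h2_def
   using gh(1,2) E(2) bE ER by (auto intro!: coeffs_in_synthetic_div elim!: coeffs_in_mono)
  have "w ((t-b)*poly g2 t)<=r*Mg" unfolding nan_mult[OF nw] w(3) Mg_def using pb[OF E2(1)] r(1) by (intro mult_left_mono) auto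
  also have "... < G" using rM by blast
  also have "G = w (poly g b)" unfolding G_def using wE subring_poly[OF ER E2(3) bE] by simp
  finally have "w (poly g t) = w (poly g b)" using nan_dominant[OF nw, of "(t-b)*poly g2 t" "poly g b"] dec[of g] by (simp add: g2_def add.commute)
  hence wg: "w (poly g t) = G" using wE subring_poly[OF ER E2(3) bE] by (simp add: G_def)
  have wh: "w (poly h t)<=r*gnorm w0 R h2" using dec[of h] b pb[OF E2(2)] r(1) by (simp add: nan_mult[OF nw] w(3) h2_def mult_left_mono)
  have wh0: "0 < w (poly h t)" by (rule nan_pos[OF nw gh(3)])
  have "size_on (insert t T) w<=B"
  proof (rule size_on_le)
   fix s assume s: "s : insert t T"
   show "w s<=B"
   proof (cases "s = t")
    case False
    hence "s : T" using s by simp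
    thus ?thesis using size_on_ge(2)[OF T(1), of s w0] wE[of s] T(2) E(2) by (auto simp: B_def le_max_iff_disj)
   qed (use wt in \<open>simp add: B_def\<close>)
  qed (use T(1) B in auto)
  hence "size_on (insert t T) w^D<=B^D" using size_on_ge_1[of "insert t T" w] T(1) by (intro power_mono) auto
  hence "w x<=B^D" using D[OF w(1)] by linarith
  hence "G<=B^D*w (poly h t)" unfolding gh(4) nan_divide[OF nw] wg using wh0 by (simp add: divide_le_eq)
  also have "... <= B^D*(r*gnorm w0 R h2)" using wh B by (intro mult_left_mono) auto
  also have "... = r*Mh" by (simp add: Mh_def mult_ac)
  also have "... < G" using rM by blast
  finally show False by simp
 qed
 then obtain c where c: "h = [:c:]" by (rule degree_eq_zeroE)
 have "c : K" using gh(2) c by (simp add: coeffs_in_pCons_iff)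
 hence "coeffs_in K (smult (inverse c) g)" using gh(1) by (intro coeffs_in_smult[OF R] subfield_inverse[OF K(1)])
 moreover have "x = poly (smult (inverse c) g) t" using gh(4) c by (simp add: divide_inverse)
 ultimately show ?thesis by blast
qed

text \<open>With the Gauss norm of radius 1 every coefficient is at most x itself, so that the coefficients are bounded too.\<close>

lemma bounded_rational_in_pring:
 "finite T ==> alg_indep T ==> x : fgen (k Un T) ==> poly_bounded T x ==> x : pring k T"
proof (induction T arbitrary: x rule: finite_induct)
 case empty
 thus ?case using pring_base[of k "{}"] fgen_eq[OF k(1)] by auto
next
 case (insert t T)
 define K where "K = fgen (k Un T)"
 note K = fgen_Un[where A = k and B = T, folded K_def]
 have t: "t ~: acl K" using insert.prems(1) insert.hyps(2) by (auto simp: alg_indep_def K_def)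
 obtain p where p: "coeffs_in K p" "x = poly p t" using bounded_rational_is_polynomial[OF K(1,2) t insert.hyps(1) K(3) _ insert.prems(3)] insert.prems(2)
  unfolding fgen_Un_insert K_def by blast
 obtain D where D: "!!w. w : S ==> w x<=size_on (insert t T) w^D" using insert.prems(3) by (auto simp: poly_bounded_def)
 define E where "E = acl K"
 have E: "aclosed E" "K<=E" "k<=E" and ER: "is_ring E" using aclosed_closure[OF K(2,1)] by (auto simp: E_def)
 have pE: "coeffs_in E p" by (rule coeffs_in_mono[OF p(1) E(2)])
 have "coeff p i : pring k T" for i
 proof (rule insert.IH)
  show "alg_indep T" using insert.prems(1) by (rule alg_indep_subset) auto
  show "coeff p i : fgen (k Un T)" using p(1) by (simp add: coeffs_in_def K_def)
  show "poly_bounded T (coeff p i)"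
  proof (rule poly_boundedI)
   fix w assume w: "w : S"
   obtain u where u: "u : S" "agree E u w" "!!p. coeffs_in E p ==> u (poly p (t-0)) = gnorm w 1 p" "u (t-0) = 1"
    using gauss_extension[OF E(1,3) t[folded E_def] w subring_zero[OF ER], of 1] by auto
   have "w (coeff p i)<=gnorm w 1 p" using le_gnorm[OF nan_seminorm[OF S_nonarch[OF w]] coeffs_in_UNIV, of 1 p i] by simp
   also have "... = u x" using u(3)[OF pE] p(2) by simp
   also have "... <= size_on (insert t T) u^D" by (rule D[OF u(1)])
   also have "u t<=size_on T u" using u(4) size_on_ge_1[OF insert.hyps(1), of u] by simp
   hence "size_on (insert t T) u = size_on T u" using insert.hyps(1) by (simp add: size_on_insert)
   also have "size_on T u = size_on T w" using u(2) K(3) E(2) by (intro size_on_cong) (auto simp: agree_def)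
   finally show "w (coeff p i)<=size_on T w^D" .
  qed
 qed
 moreover have "pring k T<=pring k (insert t T)" by (rule pring_least[OF subring_pring[OF k_ring] pring_base]) (use pring_gens[of "insert t T" k] in blast)
 ultimately have pc: "coeff p i : pring k (insert t T)" for i by blast
 show ?case unfolding p(2) by (rule subring_poly[OF subring_pring[OF k_ring]]) (use pc pring_gens[of "insert t T" k] in \<open>auto simp: coeffs_in_def\<close>)
qed

lemma coeffs_in_prod_linear:
 assumes "is_ring A" "set_mset M<=A" shows "coeffs_in A (PROD x:#M. [:-x, 1:])"
 using assms(2) by (induction M) (auto intro!: coeffs_in_mult coeffs_in_linear coeffs_in_1 assms(1) simp del: mult_pCons_left)

text \<open>A transcendental y can be given any value.\<close>

lemma poly_bounded_algebraic:
 assumes T: "finite T" and y: "poly_bounded T y"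
 shows "y : acl (fgen (k Un T))"
proof (rule ccontr)
 define K where "K = fgen (k Un T)"
 assume n: "y ~: acl (fgen (k Un T))"
 note K = fgen_Un[where A = k and B = T, folded K_def]
 note E = aclosed_closure[OF K(2,1)]
 have z: "0 : acl K" using E(3) subring_zero[OF field_ring[OF K(1)]] by blast
 obtain D where D: "!!w. w : S ==> w y<=size_on T w^D" using y by (auto simp: poly_bounded_def)
 define r where "r = size_on T w0^D+1"
 have r: "0 < r" unfolding r_def using size_on_ge_1[OF T, of w0] by (intro add_nonneg_pos) auto
 obtain w where w: "w : S" "agree (acl K) w w0" "w (y-0) = r" using gauss_extension[OF E(1,4) n[folded K_def] w0_S z r] by blast
 have "size_on T w = size_on T w0" using w(2) K(3) E(3) by (intro size_on_cong) (auto simp: agree_def)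
 thus False using D[OF w(1)] w(3) by (simp add: r_def)
qed

text \<open>The conjugates of y satisfy the same bounds by transport, hence so do the coefficients of the minimal polynomial.\<close>

theorem bounded_minpoly:
 assumes T: "finite T" "alg_indep T" and y: "poly_bounded T y"
 shows "EX P. is_minpoly (fgen (k Un T)) y P & coeffs_in (pring k T) P"
proof -
 define K where "K = fgen (k Un T)"
 note K = fgen_Un[where A = k and B = T, folded K_def]
 have Kinf: "infinite K" by (rule K(4)[OF k(2)])
 obtain P where P: "is_minpoly K y P" using minpoly_exists[OF K(1)] poly_bounded_algebraic[OF T(1) y] by (auto simp: K_def acl_def)
 obtain M where M: "P = (PROD x:#M. [:-x, 1:])" using splits_monic[of P] P by (metis is_minpoly_def)
 obtain D where D: "!!w. w : S ==> w y<=size_on T w^D" using y by (auto simp: poly_bounded_def)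
 have "poly_bounded T x" if x: "x :# M" for x
 proof (rule poly_boundedI)
  fix w assume w: "w : S"
  have "poly P x = 0" unfolding M poly_prod_linear_eq_0_iff by (rule x)
  then obtain u where u: "nonarch_norm u" "!!g. coeffs_in K g ==> u (poly g y) = w (poly g x)" "ALL x:K. u x = w x"
   using norm_transport[OF K(1) Kinf P _ S_nonarch[OF w]] by blast
  have ag: "agree K u w" using u(3) by (simp add: agree_def)
  have uS: "u : S" by (rule S_agree[OF w u(1) ag K(2)])
  have "w x = u y" using u(2)[OF coeffs_in_X[OF field_ring[OF K(1)]]] by simp
  also have "... <= size_on T u^D" by (rule D[OF uS])
  also have "size_on T u = size_on T w" using ag K(3) by (intro size_on_cong) (auto simp: agree_def)
  finally show "w x<=size_on T w^D" .
 qed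
 hence "coeffs_in {x. poly_bounded T x} P" unfolding M by (intro coeffs_in_prod_linear poly_bounded_ring[OF T(1)]) auto
 moreover have "coeffs_in K P" using P by (simp add: is_minpoly_def)
 ultimately have "coeffs_in (pring k T) P" unfolding coeffs_in_def using bounded_rational_in_pring[OF T] by (auto simp: K_def)
 thus ?thesis using P by (auto simp: K_def)
qed

lemma norm_near_point:
 "finite T ==> alg_indep T ==> (!!t. t : T ==> c t : acl k) ==> 0 < r ==> EX w:S. ALL t:T. w (t-c t) = r"
proof (induction T rule: finite_induct)
 case empty
 thus ?case using w0_S by auto
next
 case (insert t T)
 define K where "K = fgen (k Un T)"
 note K = fgen_Un[where A = k and B = T, folded K_def]
 note E = aclosed_closure[OF K(2,1)]
 have kK: "acl k<=acl K" by (rule acl_mono[OF K(2)])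
 have t: "t ~: acl K" using insert.prems(1) insert.hyps(2) by (auto simp: alg_indep_def K_def)
 have "alg_indep T" using insert.prems(1) by (rule alg_indep_subset) auto
 then obtain w where w: "w : S" "ALL t:T. w (t-c t) = r" using insert.IH insert.prems by auto
 have ct: "c t : acl K" using insert.prems(2)[of t] kK by auto
 obtain u where u: "u : S" "agree (acl K) u w" "u (t-c t) = r" using gauss_extension[OF E(1,4) t w(1) ct insert.prems(3)] by blast
 have "u (s-c s) = r" if s: "s : T" for s
 proof -
  have "s-c s : acl K" using s insert.prems(2)[of s] kK K(3) E(3) by (intro subring_diff[OF E(2)]) auto
  thus ?thesis using u(2) w(2) s by (simp add: agree_def)
 qed
 thus ?case using u(1,3) by auto
qed

end

section \<open>Norms with the values of a given specialisation\<close>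

text \<open>The sum is a polynomial in j.\<close>

lemma vanishing_exponential_sums:
 fixes c :: "nat => real"
 assumes G: "finite G" "N < card G" and z: "!!j. j : G ==> (SUM i<N. c i*real j^i) = 0" and i: "i < N"
 shows "c i = 0"
proof (rule ccontr)
 assume n: "c i~=0"
 define q where "q = (SUM i<N. monom (c i) i)"
 have qc: "coeff q m = (if m < N then c m else 0)" for m by (simp add: q_def coeff_sum_monom)
 have q: "q~=0" using qc[of i] n i by auto
 have "poly q (real j) = 0" if "j : G" for j using z[OF that] by (simp add: q_def poly_sum poly_monom)
 hence "card (real ` G)<=card {x. poly q x = 0}" using poly_roots_finite[OF q] by (intro card_mono) auto
 also have "... <= degree q" by (rule card_poly_roots_bound[OF q])
 also have "... <= N" by (rule degree_le) (simp add: qc)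
 finally show False using G(2) by (simp add: card_image)
qed

lemma pigeonhole_fiber:
 assumes A: "finite A" "card A<=n" and f: "!!x. x : H ==> f x : A" and H: "n*N < card H"
 shows "EX v:A. N < card {x:H. f x = v}"
proof (rule ccontr)
 assume "~ ?thesis"
 hence le: "card {x:H. f x = v}<=N" if "v : A" for v using that by force
 have "H = (UN v:A. {x:H. f x = v})" using f by auto
 hence "card H<=(SUM v:A. card {x:H. f x = v})" using card_UN_le[OF A(1), of "%v. {x:H. f x = v}"] by simp
 also have "... <= (SUM v:A. N)" using le by (intro sum_mono)
 also have "... <= n*N" using A(2) by simp
 finally show False using H by simp
qed

locale point_specialization = norm_family k w0 for k :: "'a::alg_closed_field set" and w0 +
 fixes Y :: "'a set" and phi :: "'a => 'a"
 assumes Y: "finite Y"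
  and phi_add: "x : pring k Y ==> y : pring k Y ==> phi (x+y) = phi x+phi y"
  and phi_mult: "x : pring k Y ==> y : pring k Y ==> phi (x*y) = phi x*phi y"
  and phi_k: "c : k ==> phi c = c"
  and phi_acl: "x : pring k Y ==> phi x : acl k"
begin

definition "B = pring k Y"

lemma B_ring: "is_ring B" by (simp add: B_def subring_pring k_ring)
lemma k_B: "k<=B" and Y_B: "Y<=B" by (auto simp: B_def pring_base pring_gens subset_iff[symmetric])
lemma phi_0: "phi 0 = 0" and phi_1: "phi 1 = 1" using phi_k subring_zero[OF k_ring] subring_one[OF k_ring] by auto
lemma phi_power: "x : B ==> phi (x^n) = phi x^n" by (induction n) (auto simp: phi_1 phi_mult B_def subring_power[OF B_ring[unfolded B_def]])
lemma phi_sum: "(!!i. i : I ==> f i : B) ==> phi (sum f I) = (SUM i:I. phi (f i))"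
 by (induction I rule: infinite_finite_induct) (auto simp: phi_0 phi_add B_def subring_sum[OF B_ring[unfolded B_def]])
lemma phi_prod: "(!!i. i : I ==> f i : B) ==> prod f I : B & phi (prod f I) = (PROD i:I. phi (f i))"
 by (induction I rule: infinite_finite_induct) (auto simp: phi_1 phi_mult[folded B_def] subring_one[OF B_ring] subring_mult[OF B_ring])

lemma phi_polyfun:
 assumes "T<=B" shows "f : polyfun k T ==> f (%y. y) : B & phi (f (%y. y)) = f phi" by (induction rule: polyfun.induct)
  (use assms k_B in \<open>auto simp: phi_k phi_add[folded B_def] phi_mult[folded B_def] intro: subring_add[OF B_ring] subring_mult[OF B_ring]\<close>)

lemma acl_k_norm: "w : S ==> x : B ==> w (phi x) = w0 (phi x)" using S_acl phi_acl by (simp add: B_def)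

definition "nearby T r = {w:S. ALL t:T. w (t-phi t)<=r}"

lemma nearby_finite:
 "finite I ==> (!!i. i : I ==> EX r>0. ALL w:nearby T r. Q i w) ==> EX r>0. ALL w:nearby T r. ALL i:I. Q i w"
proof (induction I rule: finite_induct)
 case (insert i I)
 obtain r s where rs: "0 < r" "ALL w:nearby T r. ALL i:I. Q i w" "0 < s" "ALL w:nearby T s. Q i w" using insert.IH insert.prems by (metis insertCI)
 have "nearby T (min r s)<=nearby T r Int nearby T s" by (auto simp: nearby_def)
 thus ?case using rs by (intro exI[of _ "min r s"]) auto
qed (auto intro: exI[of _ 1])

lemma phi_continuous:
 assumes T: "finite T" "T<=B" and f: "f : pring k T" and e: "0 < e"
 shows "EX r>0. ALL w:nearby T r. w (f-phi f) < e"
proof -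
 obtain F where F: "F : polyfun k T" "f = F (%y. y)" using f by (auto simp: pring_def)
 have pf: "phi f = F phi" using phi_polyfun[OF T(2) F(1)] F(2) by simp
 define R where "R = Max (insert 1 ((%t. w0 (phi t)) ` T))"
 have R: "1<=R" "!!t. t : T ==> w0 (phi t)<=R" unfolding R_def using T(1) by auto
 have "EX M. lip_bound S T R F M" by (rule polyfun_continuous[OF F(1) R(1), of S w0]) (use S_nonarch S_k in blast)
 then obtain M where "lip_bound S T R F M" ..
 note M = lip_boundD[OF this]
 define r where "r = min 1 (e/(2*M))"
 have r: "0 < r" "r<=1" using e M(1) by (auto simp: r_def)
 have "M*r<=M*(e/(2*M))" using M(1) by (intro mult_left_mono) (auto simp: r_def)
 hence Mr: "M*r < e" using M(1) e by simp
 have "w (f-phi f) < e" if "w : nearby T r" for w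
 proof -
  have w: "w : S" "!!t. t : T ==> w (t-phi t)<=r" using that by (auto simp: nearby_def)
  have "w t<=R & w (phi t)<=R" if t: "t : T" for t
  proof -
   have "w (phi t) = w0 (phi t)" by (rule acl_k_norm) (use w t T in auto)
   thus ?thesis using nan_add[OF S_nonarch[OF w(1)], of "t-phi t" "phi t"] R(1) R(2)[OF t] w(2)[OF t] r(2) by auto
  qed
  hence "near_on w T R r (%y. y) phi" using w(2) r(1) by (simp add: near_on_def)
  from M(4)[OF w(1) this] show ?thesis using Mr unfolding F(2)[symmetric] pf[symmetric] by linarith
 qed
 thus ?thesis using r(1) by blast
qed

text \<open>Near the specialisation the minimal polynomial P of y over k(T) almost vanishes at phi y. Hence it has a root at distance less
than |phi y|, whose value is therefore |phi y|; transport the norm to y.\<close>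

lemma lift_value:
 assumes T: "finite T" "T<=B" "alg_indep T" and y: "y : B" "poly_bounded T y" "phi y~=0"
 shows "EX r>0. ALL w:nearby T r. EX u:S. agree (fgen (k Un T)) u w & u y = w0 (phi y)"
proof -
 define K where "K = fgen (k Un T)"
 note K = fgen_Un[where A = k and B = T, folded K_def]
 have Kinf: "infinite K" by (rule K(4)[OF k(2)])
 obtain P where P: "is_minpoly K y P" "coeffs_in (pring k T) P" using bounded_minpoly[OF T(1,3) y(2)] by (auto simp: K_def)
 have Pm: "lead_coeff P = 1" "poly P y = 0" using P(1) by (auto simp: is_minpoly_def)
 have PB: "coeff P i : B" for i using P(2) pring_least[OF B_ring k_B T(2)] by (auto simp: coeffs_in_def)
 define z where "z = phi y"
 define d where "d = w0 z"
 have d: "0 < d" unfolding d_def z_def by (rule nan_pos[OF w0 y(3)])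
 define e where "e = d^degree P/max 1 d^degree P"
 have e: "0 < e" using d by (simp add: e_def)
 have ed: "e*d^i<=d^degree P" if "i<=degree P" for i
 proof -
  have "d^i<=max 1 d^i" using d by (intro power_mono) auto
  also have "... <= max 1 d^degree P" using that by (intro power_increasing) auto
  finally have "e*d^i<=e*max 1 d^degree P" using e by (intro mult_left_mono) auto
  thus ?thesis by (simp add: e_def)
 qed
 obtain r where r: "0 < r" "ALL w:nearby T r. ALL i:{..degree P}. w (coeff P i-phi (coeff P i)) < e"
  using nearby_finite[of "{..degree P}" T "%i w. w (coeff P i-phi (coeff P i)) < e"]
   phi_continuous[OF T(1,2) _ e] coeffs_inD[OF P(2)] by blast
 have "EX u:S. agree K u w & u y = w0 (phi y)" if wr: "w : nearby T r" for w
 proof -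
  have w: "w : S" using wr by (simp add: nearby_def)
  note nw = S_nonarch[OF w]
  have z: "w z = d" unfolding z_def d_def by (rule acl_k_norm[OF w y(1)])
  have "phi (poly P y) = (SUM i<=degree P. phi (coeff P i*y^i))"
   unfolding poly_altdef by (rule phi_sum) (intro subring_mult[OF B_ring] subring_power[OF B_ring] PB y(1))
  also have "... = (SUM i<=degree P. phi (coeff P i)*z^i)"
   using PB y(1) by (intro sum.cong) (auto simp: phi_mult[folded B_def] phi_power z_def subring_power[OF B_ring])
  finally have "(SUM i<=degree P. phi (coeff P i)*z^i) = 0" using Pm(2) phi_0 by simp
  hence "poly P z = (SUM i<=degree P. (coeff P i-phi (coeff P i))*z^i)" by (simp add: poly_altdef left_diff_distrib sum_subtractf)
  also have "w ... < d^degree P"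
  proof (rule nan_sum_less[OF nw])
   fix i assume i: "i : {..degree P}"
   have "w (coeff P i-phi (coeff P i))*d^i < e*d^i" using r(2) wr i d by (intro mult_strict_right_mono) auto
   thus "w ((coeff P i-phi (coeff P i))*z^i) < d^degree P" using ed[of i] i by (simp add: nan_mult[OF nw] nan_power[OF nw] z)
  qed (use d in simp)
  finally obtain x where x: "poly P x = 0" "w (z-x) < d" using root_near[OF nw Pm(1) d] by blast
  have wx: "w x = d" using nan_dominant[OF nw, of "x-z" z] x(2) z by (simp add: nan_diff_commute[OF nw])
  obtain u where u: "nonarch_norm u" "!!g. coeffs_in K g ==> u (poly g y) = w (poly g x)" "ALL x:K. u x = w x"
   using norm_transport[OF K(1) Kinf P(1) x(1) nw] by blast
  have ag: "agree K u w" using u(3) by (simp add: agree_def)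
  have "u y = w0 (phi y)" using u(2)[OF coeffs_in_X[OF field_ring[OF K(1)]]] wx by (simp add: d_def z_def)
  thus ?thesis using ag S_agree[OF w u(1) ag K(2)] by blast
 qed
 thus ?thesis using r(1) unfolding K_def by blast
qed

text \<open>Each monomial x j = prod (g i)^(j^i) can be given the right value by some extension of w, and there are at most n
extensions. One of them works for more than N exponents j. The logarithm of its error is a polynomial of degree
less than N in j, which vanishes identically, so that all g i have the right value.\<close>

theorem exact_specialization:
 assumes nz: "!!y. y : Y ==> phi y~=0"
 shows "EX u:S. ALL y:Y. u y = w0 (phi y)"
proof -
 define N where "N = card Y"
 obtain g where g: "bij_betw g {..<N} Y" using ex_bij_betw_nat_finite[OF Y] by (auto simp: N_def atLeast0LessThan)
 have gY: "g i : Y" if "i < N" for i using bij_betwE[OF g] that by auto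
 obtain T where T: "finite T" "T<=B" "alg_indep T" "!!y. y : Y ==> poly_bounded T y" using noether_normalization[OF Y Y_B B_ring] by blast
 have pbB: "poly_bounded T y" if "y : B" for y using pring_least[OF poly_bounded_ring[OF T(1)], of k Y] poly_bounded_k[OF T(1)] T(4) that by (auto simp: B_def)
 define K where "K = fgen (k Un T)"
 note K = fgen_Un[where A = k and B = T, folded K_def]
 have Kinf: "infinite K" by (rule K(4)[OF k(2)])
 have YK: "Y<=acl K" using poly_bounded_algebraic[OF T(1) T(4)] by (auto simp: K_def)
 define L where "L = fgen (K Un Y)"
 note L = fgen_Un[where A = K and B = Y, folded L_def]
 have BL: "B<=L" unfolding B_def using L K(2) by (intro pring_least field_ring) auto
 obtain n where n: "!!w. nonarch_norm w ==> EX A. finite A & card A<=n & (ALL u:A. nonarch_norm u) &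
  (ALL v. nonarch_norm v & agree K v w --> (EX u:A. agree L u v))" using finite_norm_restrictions[OF K(1) Kinf Y YK] unfolding L_def by blast
 define H where "H = {..n*N}"
 define x where "x j = (PROD i<N. g i^(j^i))" for j :: nat
 have gB: "g i : B" if "i < N" for i using gY[OF that] Y_B by auto
 have x: "x j : B" "phi (x j) = (PROD i<N. phi (g i)^(j^i))" for j
  using phi_prod[of "{..<N}" "%i. g i^(j^i)"] gB by (auto simp: x_def phi_power subring_power[OF B_ring])
 have x0: "phi (x j)~=0" for j using nz gY by (auto simp: x(2))
 obtain r where r: "0 < r" "ALL w:nearby T r. ALL j:H. EX u:S. agree K u w & u (x j) = w0 (phi (x j))"
  using nearby_finite[of H T "%j w. EX u:S. agree K u w & u (x j) = w0 (phi (x j))"]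
   lift_value[OF T(1-3) x(1) pbB[OF x(1)] x0] by (auto simp: K_def H_def)
 have "!!t. t : T ==> phi t : acl k" using T(2) phi_acl by (auto simp: B_def)
 with norm_near_point[OF T(1,3), of phi r] r(1) obtain w where w: "w : S" "w : nearby T r" by (auto simp: nearby_def)
 obtain u where u: "!!j. j : H ==> u j : S & agree K (u j) w & u j (x j) = w0 (phi (x j))" using r(2) w(2) by metis
 obtain A where A: "finite A" "card A<=n" "!!v. v : A ==> nonarch_norm v"
  "!!v. nonarch_norm v ==> agree K v w ==> EX u:A. agree L u v" using n[OF S_nonarch[OF w(1)]] by blast
 have "ALL j:H. EX a:A. agree L a (u j)" using A(4) u S_nonarch by blast
 then obtain a where a: "!!j. j : H ==> a j : A & agree L (a j) (u j)" by metis
 obtain b where b: "b : A" "N < card {j:H. a j = b}" using pigeonhole_fiber[OF A(1,2), of H a N] a by (auto simp: H_def)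
 note nb = A(3)[OF b(1)]
 have bu: "agree L b (u j)" if "j : {j:H. a j = b}" for j using a[of j] that by auto
 have "{j:H. a j = b}~={}" using b(2) by force
 then obtain j0 where j0: "j0 : {j:H. a j = b}" by blast
 have bS: "b : S" using S_agree[OF _ nb bu[OF j0]] u[of j0] j0 K(2) L(2) by blast
 have pos: "0 < b (g i)" "0 < w0 (phi (g i))" if "i < N" for i using nz[OF gY[OF that]] phi_0 by (auto intro!: nan_pos[OF nb] nan_pos[OF w0])
 have "ln (b (g i))-ln (w0 (phi (g i))) = 0" if "i < N" for i
 proof (rule vanishing_exponential_sums[OF _ b(2) _ that])
  fix j assume j: "j : {j:H. a j = b}"
  have "b (x j) = w0 (phi (x j))" using bu[OF j] u[of j] j x(1)[of j] BL by (auto simp: agree_def)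
  hence "ln (PROD i<N. b (g i)^(j^i)) = ln (PROD i<N. w0 (phi (g i))^(j^i))"
   by (simp only: x(2)) (simp add: x_def nan_prod[OF nb] nan_power[OF nb] nan_prod[OF w0] nan_power[OF w0])
  hence "(SUM i<N. real (j^i)*ln (b (g i))) = (SUM i<N. real (j^i)*ln (w0 (phi (g i))))"
   using pos by (subst (asm) (1 2) ln_prod) (auto simp: ln_realpow order_less_imp_not_eq2)
  thus "(SUM i<N. (ln (b (g i))-ln (w0 (phi (g i))))*real j^i) = 0" by (simp add: algebra_simps sum_subtractf)
 qed (simp add: H_def)
 hence "b (g i) = w0 (phi (g i))" if "i < N" for i using pos[OF that] that by (metis eq_iff_diff_eq_0 ln_inj_iff)
 hence "ALL y:Y. b y = w0 (phi y)" using g by (auto simp: bij_betw_def)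
 thus ?thesis using bS by blast
qed

end

section \<open>A universal domain\<close>

lemma poly_mapping_additive_induct:
 assumes "!!m c. Q (Poly_Mapping.single m c)" "!!f g. Q f ==> Q g ==> Q (f+g)"
 shows "Q (f :: 'm \<Rightarrow>\<^sub>0 'c::comm_monoid_add)"
proof (induction f rule: Poly_Mapping.update_induct)
 case const
 show ?case using assms(1)[of _ 0] by simp
next
 case (update f a b)
 have "Poly_Mapping.update a b f = f+Poly_Mapping.single a b"
  using update(1) by (intro poly_mapping_eqI) (auto simp: lookup_update lookup_add lookup_single not_in_keys_iff_lookup_eq_zero)
 thus ?case using assms update(3) by metis
qed

definition mp_eval :: "('c::comm_ring_1 => 'b::comm_ring_1) => ('m => 'b) => ('m \<Rightarrow>\<^sub>0 'c) => 'b" where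
 "mp_eval h v f = (SUM m:Poly_Mapping.keys f. h (Poly_Mapping.lookup f m) * v m)"

definition ring_map :: "('c::comm_ring_1 => 'b::comm_ring_1) => bool" where
 "ring_map h \<longleftrightarrow> h 1 = 1 & (ALL x y. h (x+y) = h x+h y) & (ALL x y. h (x*y) = h x*h y)"

lemma ring_mapD:
 assumes "ring_map h"
 shows "h 1 = 1" "h (x+y) = h x+h y" "h (x*y) = h x*h y" "h 0 = 0" "h (- x) = - h x" "h (x-y) = h x-h y"
proof -
 have a: "!!x y. h (x+y) = h x+h y" using assms by (simp add: ring_map_def)
 show 0: "h 0 = 0" using a[of 0 0] by simp
 show m: "h (- x) = - h x" for x using a[of x "- x"] 0 by (simp add: eq_neg_iff_add_eq_0 add.commute)
 show "h (x-y) = h x-h y" using a[of x "- y"] m[of y] by simp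
qed (use assms in \<open>auto simp: ring_map_def\<close>)

lemma ring_map_poly:
 assumes "ring_map h" "!!i. coeff q i = h (coeff p i)" shows "poly q (h x) = h (poly p x)"
proof -
 have hs: "h (sum f A) = (SUM i:A. h (f i))" for f and A :: "nat set" by (induction A rule: infinite_finite_induct) (auto simp: ring_mapD[OF assms(1)])
 have hp: "h (x^n) = h x^n" for n by (induction n) (auto simp: ring_mapD[OF assms(1)])
 have "degree q<=degree p" by (intro degree_le) (simp add: assms(2) coeff_eq_0 ring_mapD(4)[OF assms(1)])
 hence "poly q (h x) = (SUM i<=degree p. coeff q i*h x^i)" unfolding poly_altdef by (intro sum.mono_neutral_left) (auto simp: coeff_eq_0)
 thus ?thesis by (simp add: poly_altdef hs ring_mapD[OF assms(1)] hp assms(2))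
qed

lemma ring_map_mp_eval:
 fixes h :: "'c::comm_ring_1 => 'b::comm_ring_1" and v :: "'m::comm_monoid_add => 'b"
 assumes h: "ring_map h" and v: "v 0 = 1" "!!m n. v (m+n) = v m * v n"
 shows "ring_map (mp_eval h v)" "mp_eval h v (Poly_Mapping.single m c) = h c * v m"
proof -
 note H = ring_mapD[OF h]
 have single: "mp_eval h v (Poly_Mapping.single m c) = h c * v m" for m c by (simp add: mp_eval_def H)
 thus "mp_eval h v (Poly_Mapping.single m c) = h c * v m" .
 have sup: "mp_eval h v f = (SUM m:S. h (Poly_Mapping.lookup f m) * v m)" if "finite S" "Poly_Mapping.keys f<=S" for f S
  unfolding mp_eval_def using that by (intro sum.mono_neutral_left) (auto simp: not_in_keys_iff_lookup_eq_zero H)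
 have add: "mp_eval h v (f+g) = mp_eval h v f+mp_eval h v g" for f g
 proof -
  define S where "S = Poly_Mapping.keys f Un Poly_Mapping.keys g"
  have "finite S" "Poly_Mapping.keys f<=S" "Poly_Mapping.keys g<=S" "Poly_Mapping.keys (f+g)<=S" using Poly_Mapping.keys_add[of f g] by (auto simp: S_def)
  thus ?thesis by (simp add: sup lookup_add H distrib_right sum.distrib)
 qed
 have 1: "mp_eval h v (Poly_Mapping.single m c*g) = mp_eval h v (Poly_Mapping.single m c)*mp_eval h v g" for m c g
  by (induction g rule: poly_mapping_additive_induct) (auto simp: mult_single single add H v distrib_left algebra_simps)
 have "mp_eval h v (f*g) = mp_eval h v f*mp_eval h v g" for f g by (induction f rule: poly_mapping_additive_induct) (auto simp: 1 add distrib_right)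
 moreover have "mp_eval h v 1 = 1" using single[of 0 1] by (simp add: H v)
 ultimately show "ring_map (mp_eval h v)" using add by (simp add: ring_map_def)
qed

type_synonym 'c universal = "((nat \<Rightarrow>\<^sub>0 nat) \<Rightarrow>\<^sub>0 'c) fract alg_closure"

definition emb :: "((nat \<Rightarrow>\<^sub>0 nat) \<Rightarrow>\<^sub>0 'c::field) => 'c universal" where "emb p = to_ac (Fract p 1)"
definition Var :: "nat => (nat \<Rightarrow>\<^sub>0 nat) \<Rightarrow>\<^sub>0 'c::field" where "Var n = Poly_Mapping.single (Poly_Mapping.single n 1) 1"

definition indeterminate :: "nat => 'c::field universal" where "indeterminate n = emb (Var n)"
definition const :: "'c::field => 'c universal" where "const c = emb (Poly_Mapping.single 0 c)"

lemma ring_map_emb: "ring_map emb" by (simp add: ring_map_def emb_def to_ac_add[symmetric] to_ac_mult[symmetric] One_fract_def[symmetric])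

lemma emb_eq_0: "emb p = 0 \<longleftrightarrow> p = 0" by (simp add: emb_def Zero_fract_def eq_fract)

lemma ring_map_const: "ring_map const" unfolding ring_map_def const_def
 by (auto simp: ring_mapD[OF ring_map_emb, symmetric] single_add mult_single single_one[symmetric] simp del: single_one)

definition monomial_value :: "(nat => 'b::comm_ring_1) => (nat \<Rightarrow>\<^sub>0 nat) => 'b" where
 "monomial_value z m = (PROD i:Poly_Mapping.keys m. z i^Poly_Mapping.lookup m i)"

lemma monomial_value_add: "monomial_value z (m+n) = monomial_value z m*monomial_value z n"
proof -
 define S where "S = Poly_Mapping.keys m Un Poly_Mapping.keys n"
 have sup: "monomial_value z l = (PROD i:S. z i^Poly_Mapping.lookup l i)" if "Poly_Mapping.keys l<=S" for l
  unfolding monomial_value_def using that by (intro prod.mono_neutral_left) (auto simp: S_def not_in_keys_iff_lookup_eq_zero)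
 have "Poly_Mapping.keys m<=S" "Poly_Mapping.keys n<=S" "Poly_Mapping.keys (m+n)<=S" using Poly_Mapping.keys_add[of m n] by (auto simp: S_def)
 thus ?thesis by (simp add: sup lookup_add power_add prod.distrib)
qed

text \<open>A relation for the n-th variable whose coefficients involve the earlier ones only is invariant under
renaming this variable, hence it would have infinitely many roots.\<close>

theorem indeterminate_transcendental:
 "indeterminate n ~: acl (fgen (range (const :: 'c::field => 'c universal) Un indeterminate ` {..<n}))"
proof
 define A where "A = range (const :: 'c => 'c universal)"
 note E = ring_mapD[OF ring_map_emb[where 'a='c]] and C = ring_mapD[OF ring_map_const[where 'a='c]]
 assume "indeterminate n : acl (fgen (range (const :: 'c => 'c universal) Un indeterminate ` {..<n}))"
 then obtain p where p: "coeffs_in (fgen (A Un indeterminate ` {..<n})) p" "p~=0" "poly p (indeterminate n) = 0" by (auto simp: acl_def alg_def A_def)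
 define sigma where "sigma m = mp_eval (%c. Poly_Mapping.single 0 c :: (nat \<Rightarrow>\<^sub>0 nat) \<Rightarrow>\<^sub>0 'c) (monomial_value (Var(n := Var m)))" for m
 have con: "ring_map (%c. Poly_Mapping.single 0 c :: (nat \<Rightarrow>\<^sub>0 nat) \<Rightarrow>\<^sub>0 'c)"
  by (simp add: ring_map_def single_add mult_single)
 have m0: "monomial_value z 0 = 1" for z :: "nat => (nat \<Rightarrow>\<^sub>0 nat) \<Rightarrow>\<^sub>0 'c" by (simp add: monomial_value_def)
 have sigma: "ring_map (sigma m)" for m unfolding sigma_def by (rule ring_map_mp_eval[OF con m0 monomial_value_add])
 have sigmas: "sigma m (Poly_Mapping.single l c) = Poly_Mapping.single 0 c*monomial_value (Var(n := Var m)) l" for m l c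
  unfolding sigma_def by (rule ring_map_mp_eval[OF con m0 monomial_value_add])
 have sigmaV: "sigma m (Var i) = (if i = n then Var m else Var i)" for m i unfolding Var_def[of i] sigmas by (auto simp: monomial_value_def Var_def)
 define D where "D = emb ` {q. ALL m. sigma m q = q}"
 have A_ring: "is_ring A" unfolding is_ring_def A_def using C(1)[symmetric] C(3,6)[symmetric] by auto
 have DI: "x : D" if "x = emb q" "ALL m. sigma m q = q" for x q using that by (auto simp: D_def)
 have "is_ring D" unfolding is_ring_def
 proof (intro conjI ballI)
  show "1 : D" by (rule DI[of _ 1]) (simp_all add: E(1) ring_mapD[OF sigma])
  fix x y assume "x : D" "y : D"
  then obtain p q where "x = emb p" "y = emb q" "ALL m. sigma m p = p" "ALL m. sigma m q = q" by (auto simp: D_def)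
  thus "x-y : D" "x*y : D" by (auto intro: DI[of _ "p-q"] DI[of _ "p*q"] simp: E ring_mapD[OF sigma])
 qed
 moreover have "A<=D" unfolding A_def D_def const_def by (auto simp: sigmas m0)
 moreover have "indeterminate ` {..<n}<=D" unfolding D_def indeterminate_def by (auto simp: sigmaV)
 ultimately have sub: "pring A (indeterminate ` {..<n})<=D" by (rule pring_least)
 obtain d where d: "d~=0" "coeffs_in (pring A (indeterminate ` {..<n})) (smult d p)"
  using coeffs_in_quotient[OF subring_pring[OF A_ring, of "indeterminate ` {..<n}"], of p] p(1) unfolding fgen_pring[OF A_ring] by blast
 have "ALL i. EX q. coeff (smult d p) i = emb q & (ALL m. sigma m q = q)" using d(2) sub unfolding coeffs_in_def D_def by blast
 then obtain q where q: "!!i. coeff (smult d p) i = emb (q i)" "!!i m. sigma m (q i) = q i" by metis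
 define Q where "Q = Abs_poly q"
 have "\<forall>\<^sub>\<infinity>i. q i = 0"
 proof (rule eventually_mono)
  show "\<forall>\<^sub>\<infinity>i. coeff (smult d p) i = 0" by (rule MOST_coeff_eq_0)
  show "coeff (smult d p) i = 0 ==> q i = 0" for i using q(1)[of i] emb_eq_0[of "q i"] by metis
 qed
 hence Qc: "coeff Q i = q i" for i unfolding Q_def by (simp add: Abs_poly_inverse)
 have "emb (poly Q (Var n)) = poly (smult d p) (indeterminate n)"
  unfolding indeterminate_def by (rule ring_map_poly[OF ring_map_emb, symmetric]) (simp only: q(1) Qc)
 hence "poly Q (Var n) = 0" by (simp add: p(3) emb_eq_0)
 have root: "poly Q (Var m) = 0" for m
 proof -
  have "poly Q (sigma m (Var n)) = sigma m (poly Q (Var n))" by (rule ring_map_poly[OF sigma]) (simp add: Qc q(2))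
  thus ?thesis using \<open>poly Q (Var n) = 0\<close> by (simp add: sigmaV ring_mapD[OF sigma])
 qed
 have inj: "inj (Var :: nat => (nat \<Rightarrow>\<^sub>0 nat) \<Rightarrow>\<^sub>0 'c)"
  unfolding Var_def by (rule injI) (metis keys_single one_neq_zero singleton_inject)
 have "Q = 0"
 proof (rule ccontr)
  assume "Q~=0"
  hence "finite {x. poly Q x = 0}" by (rule poly_roots_finite)
  moreover have "range Var<={x. poly Q x = 0}" using root by auto
  ultimately show False using inj by (meson finite_subset finite_imageD infinite_UNIV_nat)
 qed
 hence "q i = 0" for i using Qc by (metis coeff_0)
 hence "smult d p = 0" by (intro poly_eqI) (simp only: q(1) emb_eq_0 coeff_0)
 thus False using d(1) p(2) by simp
qed

definition prime_set :: "'l::comm_ring_1 set => bool" where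
 "prime_set P \<longleftrightarrow> 1 ~: P & 0 : P & (ALL x:P. ALL y:P. x-y : P) & (ALL x:P. ALL y. x*y : P) &
  (ALL x y. x*y : P --> x : P \<or> y : P)"

definition hom_with_kernel :: "'l::comm_ring_1 set => 'l set => ('l => 'b::comm_ring_1) => bool" where
 "hom_with_kernel P A h \<longleftrightarrow> h 1 = 1 & (ALL x:A. ALL y:A. h (x-y) = h x-h y & h (x*y) = h x*h y) &
  (ALL x:A. h x = 0 \<longleftrightarrow> x : P)"

section \<open>Generic points of prime ideals\<close>

lemma map_poly_hom:
 assumes A: "is_ring A" and h: "hom_with_kernel P A h" and p: "coeffs_in A p" and q: "coeffs_in A q"
 shows "map_poly h (p-q) = map_poly h p-map_poly h q" "map_poly h (p*q) = map_poly h p*map_poly h q"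
  "map_poly h p = 0 \<longleftrightarrow> (ALL i. coeff p i : P)" "coeffs_in (h ` A) (map_poly h p)" "coeff (map_poly h p) i = h (coeff p i)"
  "h 0 = 0"
proof -
 have H: "h 1 = 1" "!!x y. x : A ==> y : A ==> h (x-y) = h x-h y" "!!x y. x : A ==> y : A ==> h (x*y) = h x*h y"
  "!!x. x : A ==> h x = 0 \<longleftrightarrow> x : P" using h by (auto simp: hom_with_kernel_def)
 note R = subring_zero[OF A] subring_mult[OF A] subring_uminus[OF A]
 have h0: "h 0 = 0" using H(2)[of 0 0] R(1) by simp
 have neg: "h (- x) = - h x" if "x : A" for x using H(2)[of 0 x] R(1) h0 that by simp
 have add: "h (x+y) = h x+h y" if "x : A" "y : A" for x y using H(2)[of x "- y"] neg[of y] R(3)[of y] that by simp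
 have sum: "h (sum f I) = (SUM i:I. h (f i))" if "!!i. i : I ==> f i : A" for f and I :: "nat set"
  using that by (induction I rule: infinite_finite_induct) (auto simp: h0 add subring_sum[OF A])
 have c: "coeff (map_poly h p) i = h (coeff p i)" for p i by (simp add: coeff_map_poly h0)
 show "coeff (map_poly h p) i = h (coeff p i)" "h 0 = 0" by (fact c h0)+
 show "map_poly h (p-q) = map_poly h p-map_poly h q" using p q by (intro poly_eqI) (simp add: c H coeffs_in_def)
 show "map_poly h (p*q) = map_poly h p*map_poly h q" using p q R by (intro poly_eqI) (simp add: c coeff_mult sum coeffs_in_def H)
 show "map_poly h p = 0 \<longleftrightarrow> (ALL i. coeff p i : P)" using p by (auto simp: poly_eq_iff c H(4) coeffs_in_def)
 show "coeffs_in (h ` A) (map_poly h p)" using p by (auto simp: coeffs_in_def c)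
qed

lemma prime_setD:
 assumes "prime_set P"
 shows "1 ~: P" "0 : P" "x : P ==> y : P ==> x-y : P" "x : P ==> x*y : P" "x : P ==> y*x : P"
  "x*y : P ==> x : P \<or> y : P" "x : P ==> y : P ==> x+y : P" "x^n : P ==> x : P"
proof -
 have P: "1 ~: P" "0 : P" "!!x y. x : P ==> y : P ==> x-y : P" "!!x y. x : P ==> x*y : P"
  "!!x y. x*y : P ==> x : P \<or> y : P" using assms by (auto simp: prime_set_def)
 show "1 ~: P" "0 : P" "x : P ==> y : P ==> x-y : P" "x : P ==> x*y : P" "x*y : P ==> x : P \<or> y : P" by (fact P)+
 show "x : P ==> y*x : P" using P(4)[of x y] by (simp add: mult.commute)
 show "x : P ==> y : P ==> x+y : P" using P(3)[of x "0-y"] P(3)[of 0 y] P(2) by simp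
 show "x^n : P ==> x : P" using P(1) by (induction n) (auto dest: P(5))
qed

lemma prime_set_poly:
 assumes "prime_set P" "!!i. coeff p i : P" shows "poly p x : P"
proof -
 have "sum f I : P" if "!!i. i : I ==> f i : P" for f and I :: "nat set"
  using that by (induction I rule: infinite_finite_induct) (auto simp: prime_setD[OF assms(1)])
 thus ?thesis using prime_setD(4)[OF assms(1) assms(2)] by (simp add: poly_altdef)
qed

text \<open>If no polynomial in x with nonzero image belongs to P, any transcendental value works. Otherwise take a
root xi of one of minimal degree. Its minimal polynomial mu, multiplied by e to lift it to u over A, generates the
relations up to pseudo-division.\<close>

lemma value_of_next_generator:
 fixes h :: "'l::comm_ring_1 => 'b::alg_closed_field"
 assumes P: "prime_set P" and A: "is_ring A" and h: "hom_with_kernel P A h"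
  and tau: "tau ~: acl (fgen (h ` A))"
 shows "EX xi:insert tau (acl (fgen (h ` A))). ALL p. coeffs_in A p --> poly p x : P \<longleftrightarrow> poly (map_poly h p) xi = 0"
proof -
 define K where "K = fgen (h ` A)"
 have K: "is_field K" "h ` A<=K" unfolding K_def by (rule subfield_fgen, rule fgen_superset)
 note M = map_poly_hom[OF A h]
 have MK: "coeffs_in K (map_poly h p)" if "coeffs_in A p" for p using coeffs_in_mono[OF M(4)[OF that that] K(2)] .
 have hP: "h a = 0 \<longleftrightarrow> a : P" if "a : A" for a using h that by (simp add: hom_with_kernel_def)
 have M0: "map_poly h p = 0 ==> coeffs_in A p ==> poly p x : P" for p using M(3)[of p p] prime_set_poly[OF P] by blast
 show ?thesis
 proof (cases "ALL p. coeffs_in A p --> poly p x : P --> map_poly h p = 0")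
  case True
  have "poly p x : P \<longleftrightarrow> poly (map_poly h p) tau = 0" if p: "coeffs_in A p" for p
  proof
   assume "poly (map_poly h p) tau = 0"
   hence "map_poly h p = 0" using tau MK[OF p] unfolding K_def acl_def alg_def by blast
   thus "poly p x : P" using M0 p by blast
  qed (use True p in simp)
  thus ?thesis by blast
 next
  case False
  define Q where "Q d \<longleftrightarrow> (EX g. coeffs_in A g & poly g x : P & map_poly h g~=0 & degree (map_poly h g) = d)" for d
  define d where "d = (LEAST d. Q d)"
  have "EX d. Q d" using False by (auto simp: Q_def)
  hence "Q d" unfolding d_def by (rule LeastI_ex)
  then obtain g where g: "coeffs_in A g" "poly g x : P" "map_poly h g~=0" "degree (map_poly h g) = d" by (auto simp: Q_def)
  have minimal: "d<=degree (map_poly h f)" if "coeffs_in A f" "poly f x : P" "map_poly h f~=0" for f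
   unfolding d_def using that by (intro Least_le) (auto simp: Q_def)
  have "d~=0"
  proof
   assume "d = 0"
   hence z: "coeff g i : P" if "i~=0" for i using g(1,4) that hP[of "coeff g i"] M(5)[OF g(1) g(1), of i] by (simp add: coeffs_in_def coeff_eq_0)
   have "poly (g-[:coeff g 0:]) x : P" by (rule prime_set_poly[OF P]) (auto simp: coeff_pCons z prime_setD[OF P] split: nat.split)
   hence "poly g x-coeff g 0 : P" by simp
   hence "coeff g 0 : P" using prime_setD(3)[OF P g(2)] by fastforce
   hence "ALL i. coeff g i : P" using z by metis
   thus False using M(3)[OF g(1) g(1)] g(3) by blast
  qed
  then obtain xi where xi: "poly (map_poly h g) xi = 0" using alg_closed_imp_poly_has_root[of "map_poly h g"] g(4) by auto
  have alg: "alg K xi" unfolding alg_def using xi g(3) MK[OF g(1)] by blast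
  obtain mu where mu: "is_minpoly K xi mu" using minpoly_exists[OF K(1) alg] by blast
  have mu0: "mu~=0" "0 < degree mu" using minpoly_degree_pos[OF mu] by auto
  have hA: "is_ring (h ` A)" unfolding is_ring_def
   using h A by (auto simp: hom_with_kernel_def image_iff subring_one subring_diff subring_mult) (metis subring_one subring_diff subring_mult)+
  obtain e where e: "e~=0" "coeffs_in (h ` A) (smult e mu)" using coeffs_in_quotient[OF hA, of mu] mu by (auto simp: is_minpoly_def K_def)
  have "ALL i. EX a:A. coeff (smult e mu) i = h a & (i > degree mu --> a = 0)"
  proof
   fix i
   obtain a where a: "a : A" "coeff (smult e mu) i = h a" using e(2) by (auto simp: coeffs_in_def)
   show "EX a:A. coeff (smult e mu) i = h a & (i > degree mu --> a = 0)"
   proof (cases "i > degree mu")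
    case True
    thus ?thesis using subring_zero[OF A] M(6)[OF g(1) g(1)] by (intro bexI[of _ 0]) (auto simp: coeff_eq_0)
   qed (use a in auto)
  qed
  then obtain a where a: "!!i. a i : A" "!!i. coeff (smult e mu) i = h (a i)" "!!i. i > degree mu ==> a i = 0" by metis
  define u where "u = (SUM i<=degree mu. monom (a i) i)"
  have uc: "coeff u i = a i" for i using a(3)[of i] by (auto simp: u_def coeff_sum_monom)
  have uA: "coeffs_in A u" by (simp add: coeffs_in_def uc a(1))
  have hu: "map_poly h u = smult e mu" by (intro poly_eqI) (simp only: M(5)[OF uA uA] uc a(2))
  have lead: "a (degree mu) ~: P" using a(2)[of "degree mu"] e(1) mu0(1) hP[OF a(1), of "degree mu"] by (metis coeff_smult leading_coeff_0_iff mult_eq_0_iff)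
  hence "a (degree mu)~=0" using prime_setD(2)[OF P] by metis
  hence du: "degree u = degree mu" using a(3) by (intro antisym degree_le le_degree) (auto simp: uc)
  have lu: "lead_coeff u ~: P" using lead by (simp add: du uc)
  have u0: "u~=0" using du mu0 by auto
  have div: "EX c s r. c ~: P & h c~=0 & coeffs_in A s & coeffs_in A r & smult c p = s*u+r &
   smult (h c) (map_poly h p) = map_poly h s * smult e mu+map_poly h r &
   degree (map_poly h r) < degree mu & (poly (map_poly h p) xi = 0 \<longleftrightarrow> map_poly h r = 0)" if p: "coeffs_in A p" for p
  proof -
   obtain N s r where sr: "coeffs_in A s" "coeffs_in A r" "smult (lead_coeff u^N) p = s*u+r" "r = 0 \<or> degree r < degree u"
    using pseudo_division_over[OF A uA u0 p] by blast
   define c where "c = lead_coeff u^N"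
   have c: "c : A" unfolding c_def using uA by (intro subring_power[OF A]) (simp add: coeffs_in_def)
   have cP: "c ~: P" using lu prime_setD(8)[OF P, of "lead_coeff u" N] by (auto simp: c_def)
   hence hc: "h c~=0" using hP[OF c] by simp
   have su: "coeffs_in A (s*u)" by (rule coeffs_in_mult[OF A sr(1) uA])
   have "map_poly h r = map_poly h (smult c p-s*u)" using sr(3) by (simp add: c_def)
   also have "... = map_poly h (smult c p)-map_poly h s * smult e mu" using M(1)[OF coeffs_in_smult[OF A c p] su] M(2)[OF sr(1) uA] hu by simp
   finally have "map_poly h (smult c p) = map_poly h s * smult e mu+map_poly h r" by simp
   moreover have "smult (h c) (map_poly h p) = map_poly h (smult c p)" using M(2)[OF coeffs_in_const[OF A c] p] M(6)[OF p p] by (simp add: map_poly_pCons)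
   ultimately have eq: "smult (h c) (map_poly h p) = map_poly h s * smult e mu+map_poly h r" by simp
   have "h c*poly (map_poly h p) xi = poly (map_poly h r) xi" using arg_cong[OF eq, of "%f. poly f xi"] mu by (simp add: is_minpoly_def)
   hence z: "poly (map_poly h p) xi = 0 \<longleftrightarrow> poly (map_poly h r) xi = 0" using hc by (metis mult_eq_0_iff)
   have "degree (map_poly h r)<=degree r" by (intro degree_le) (simp add: M(5)[OF sr(2) sr(2)] coeff_eq_0 M(6)[OF p p])
   hence dr: "degree (map_poly h r) < degree mu" using sr(4) du mu0(2) by auto
   have "map_poly h r = 0" if "poly (map_poly h r) xi = 0" using mu MK[OF sr(2)] that dr unfolding is_minpoly_def by (metis not_le)
   thus ?thesis using sr z dr eq hc cP unfolding c_def by (intro exI[of _ "lead_coeff u^N"] exI[of _ s] exI[of _ r]) auto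
  qed
  have "degree mu<=d" using mu MK[OF g(1)] xi g(3,4) unfolding is_minpoly_def by blast
  have uP: "poly u x : P"
  proof -
   obtain c s r where sr: "coeffs_in A s" "coeffs_in A r" "smult c g = s*u+r" "map_poly h r = 0"
    "smult (h c) (map_poly h g) = map_poly h s * smult e mu" "h c~=0" using div[OF g(1)] xi by auto
   have "poly (s*u) x = c*poly g x-poly r x" using arg_cong[OF sr(3), of "%f. poly f x"] by simp
   also have "... : P" using prime_setD(3,5)[OF P] M0[OF sr(4,2)] g(2) by blast
   finally have or: "poly s x : P \<or> poly u x : P" using prime_setD(6)[OF P] by simp
   have s0: "map_poly h s~=0" using sr(5,6) g(3) by auto
   have "d = degree (map_poly h s)+degree mu" using arg_cong[OF sr(5), of degree] sr(6) g(4) e(1) s0 mu0(1) by (simp add: degree_mult_eq)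
   hence "poly s x ~: P" using minimal[OF sr(1) _ s0] mu0(2) by auto
   thus ?thesis using or by blast
  qed
  have "poly p x : P \<longleftrightarrow> poly (map_poly h p) xi = 0" if p: "coeffs_in A p" for p
  proof -
   obtain c s r where sr: "c ~: P" "coeffs_in A r" "smult c p = s*u+r" "degree (map_poly h r) < degree mu"
    "poly (map_poly h p) xi = 0 \<longleftrightarrow> map_poly h r = 0" using div[OF p] by blast
   have eq: "c*poly p x = poly s x*poly u x+poly r x" using arg_cong[OF sr(3), of "%f. poly f x"] by simp
   have su: "poly s x*poly u x : P" by (rule prime_setD(5)[OF P uP])
   show ?thesis
   proof
    assume "poly p x : P"
    hence "c*poly p x : P" by (rule prime_setD(5)[OF P])
    hence "poly r x : P" using prime_setD(3)[OF P _ su] eq by (metis add_diff_cancel_left')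
    thus "poly (map_poly h p) xi = 0" using minimal[OF sr(2)] sr(4,5) \<open>degree mu<=d\<close> by fastforce
   next
    assume "poly (map_poly h p) xi = 0"
    hence "poly r x : P" using M0[OF _ sr(2)] sr(5) by blast
    hence "c*poly p x : P" unfolding eq using su by (intro prime_setD(7)[OF P])
    thus "poly p x : P" using prime_setD(6)[OF P] sr(1) by blast
   qed
  qed
  moreover have "xi : acl (fgen (h ` A))" using alg by (simp add: acl_def K_def)
  ultimately show ?thesis by blast
 qed
qed

text \<open>Define the new value of p(x) as the image of p evaluated at xi; the choice of p does not matter.\<close>

lemma hom_extension:
 fixes h :: "'l::comm_ring_1 => 'b::alg_closed_field"
 assumes P: "prime_set P" and A: "is_ring A" and h: "hom_with_kernel P A h"
  and tau: "tau ~: acl (fgen (h ` A))" and inf: "infinite (h ` A)"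
 shows "EX A' h'. is_ring A' & insert x A<=A' & hom_with_kernel P A' h' & (ALL a:A. h' a = h a) &
  h' ` A'<=acl (fgen (insert tau (h ` A)))"
proof -
 obtain xi where xi: "xi : insert tau (acl (fgen (h ` A)))"
  "!!p. coeffs_in A p ==> poly p x : P \<longleftrightarrow> poly (map_poly h p) xi = 0" using value_of_next_generator[OF P A h tau] by blast
 note M = map_poly_hom[OF A h]
 define A' where "A' = {poly p x | p. coeffs_in A p}"
 note A' = subring_poly_range[OF A, of x, folded A'_def]
 define h' where "h' z = poly (map_poly h (SOME p. coeffs_in A p & z = poly p x)) xi" for z
 have h': "h' (poly p x) = poly (map_poly h p) xi" if p: "coeffs_in A p" for p
 proof -
  define q where "q = (SOME q. coeffs_in A q & poly p x = poly q x)"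
  have q: "coeffs_in A q" "poly p x = poly q x" unfolding q_def using someI[of "%q. coeffs_in A q & poly p x = poly q x" p] p by auto
  have "poly (p-q) x : P" using q(2) prime_setD(2)[OF P] by simp
  hence "poly (map_poly h (p-q)) xi = 0" using xi(2)[OF coeffs_in_diff[OF A p q(1)]] by simp
  thus ?thesis using M(1)[OF p q(1)] by (simp add: h'_def q_def[symmetric])
 qed
 have const: "h' a = h a" if "a : A" for a using h'[OF coeffs_in_const[OF A that]] M(6)[OF coeffs_in_X[OF A] coeffs_in_X[OF A]] by (simp add: map_poly_pCons)
 have "hom_with_kernel P A' h'" unfolding hom_with_kernel_def
 proof (intro conjI ballI)
  show "h' 1 = 1" using const[OF subring_one[OF A]] h by (simp add: hom_with_kernel_def)
  fix y assume "y : A'"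
  then obtain p where p: "coeffs_in A p" "y = poly p x" by (auto simp: A'_def)
  show "h' y = 0 \<longleftrightarrow> y : P" unfolding p(2) h'[OF p(1)] using xi(2)[OF p(1)] by simp
  fix z assume "z : A'"
  then obtain q where q: "coeffs_in A q" "z = poly q x" by (auto simp: A'_def)
  show "h' (y-z) = h' y-h' z" "h' (y*z) = h' y*h' z"
   using h'[OF coeffs_in_diff[OF A p(1) q(1)]] h'[OF coeffs_in_mult[OF A p(1) q(1)]] h'[OF p(1)] h'[OF q(1)] M(1,2)[OF p(1) q(1)] by (simp_all add: p(2) q(2))
 qed
 moreover have "h' ` A'<=acl (fgen (insert tau (h ` A)))"
 proof -
  note E = acl_fgen[OF inf, of "{tau}", simplified]
  note ER = aclosed_subring[OF E(1)]
  have "acl (fgen (h ` A))<=acl (fgen (insert tau (h ` A)))" by (intro acl_mono fgen_mono) auto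
  hence "xi : acl (fgen (insert tau (h ` A)))" using xi(1) E(3) by auto
  thus ?thesis unfolding A'_def using h' subring_poly[OF ER coeffs_in_mono[OF M(4) E(2)]] by auto
 qed
 ultimately show ?thesis using const A' by (intro exI[of _ A'] exI[of _ h']) auto
qed

text \<open>Each new generator uses up at most one of the elements tau n.\<close>

lemma hom_on_finitely_generated:
 fixes h :: "'l::comm_ring_1 => 'b::alg_closed_field"
 assumes P: "prime_set P" and A: "is_ring A" and h: "hom_with_kernel P A h" and inf: "infinite (h ` A)" and F: "h ` A<=F"
  and tau: "!!n::nat. tau n ~: acl (fgen (F Un tau ` {..<n}))"
 shows "finite G ==> EX n A' h'. is_ring A' & A Un G<=A' & hom_with_kernel P A' h' & (ALL a:A. h' a = h a) &
  h' ` A'<=acl (fgen (F Un tau ` {..<n}))"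
proof (induction G rule: finite_induct)
 case empty
 have "h ` A<=acl (fgen (F Un tau ` {..<0}))" using F fgen_superset[of "F"] subset_acl[OF field_ring[OF subfield_fgen], of F] by auto
 thus ?case using A h by (intro exI[of _ 0] exI[of _ A] exI[of _ h]) auto
next
 case (insert x G)
 then obtain n A' h' where IH: "is_ring A'" "A Un G<=A'" "hom_with_kernel P A' h'" "ALL a:A. h' a = h a"
  "h' ` A'<=acl (fgen (F Un tau ` {..<n}))" by metis
 have hh: "h ` A<=h' ` A'" using IH(2,4) by force
 have inf': "infinite (h' ` A')" by (rule infinite_super[OF hh inf])
 define E where "E n = acl (fgen (F Un tau ` {..<n}))" for n
 have Finf: "infinite F" by (rule infinite_super[OF F inf])
 have E: "aclosed (E n)" "F Un tau ` {..<n}<=E n" for n unfolding E_def using acl_fgen[OF Finf, of "tau ` {..<n}"] by auto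
 have le: "acl (fgen (insert z (h' ` A')))<=E m" if "z : E m" "E n<=E m" for z m
  using IH(5) that E(1)[of m] unfolding E_def[symmetric] by (intro acl_least fgen_least) (auto simp: aclosed_def)
 have "acl (fgen (h' ` A'))<=E n" using IH(5) E(1)[of n] unfolding E_def[symmetric] by (intro acl_least fgen_least) (auto simp: aclosed_def)
 hence "tau n ~: acl (fgen (h' ` A'))" using tau[of n] by (auto simp: E_def)
 from hom_extension[OF P IH(1,3) this inf', of x] obtain A'' h'' where 2: "is_ring A''" "insert x A'<=A''" "hom_with_kernel P A'' h''"
  "ALL a:A'. h'' a = h' a" "h'' ` A''<=acl (fgen (insert (tau n) (h' ` A')))" by metis
 have "E n<=E (Suc n)" unfolding E_def by (intro acl_mono fgen_mono) auto
 hence "h'' ` A''<=E (Suc n)" using order.trans[OF 2(5) le[of "tau n" "Suc n"]] E(2)[of "Suc n"] by auto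
 thus ?case unfolding E_def using 2 IH(2,4) by (intro exI[of _ "Suc n"] exI[of _ A''] exI[of _ h'']) auto
qed

abbreviation laurent_const :: "'c => ('n::finite, 'c::comm_ring_1) laurent" where
 "laurent_const == Poly_Mapping.single 0"

abbreviation coordinate :: "'n::finite => int => ('n, 'c::comm_ring_1) laurent" where
 "coordinate i z == Poly_Mapping.single (axis i z) 1"

lemma coordinate_mult: "coordinate i y*coordinate i z = coordinate i (y+z)"
proof -
 have "axis i y+axis i z = axis i (y+z)" by (simp add: vec_eq_iff axis_def)
 thus ?thesis by (simp add: mult_single)
qed

lemma laurent_subring_eq_UNIV:
 fixes A :: "('n::finite, 'c::comm_ring_1) laurent set"
 assumes A: "is_ring A" and c: "range laurent_const<=A" and x: "!!i. coordinate i 1 : A" "!!i. coordinate i (- 1) : A"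
 shows "A = UNIV"
proof -
 have axis: "coordinate i z : A" for i z
 proof (induction z rule: int_induct[of _ 0])
  case base
  have "axis i 0 = (0 :: int ^ 'n)" by (simp add: vec_eq_iff axis_def)
  thus ?case using subring_one[OF A] by (simp only: single_one)
 next
  case (step1 z)
  thus ?case using subring_mult[OF A step1(2) x(1)[of i]] by (simp add: coordinate_mult)
 next
  case (step2 z)
  thus ?case using subring_mult[OF A step2(2) x(2)[of i]] by (simp add: coordinate_mult)
 qed
 have "Poly_Mapping.single (sum g I) 1 : A" if "!!i. Poly_Mapping.single (g i) 1 : A" for g :: "'n => int ^ 'n" and I
 proof (induction I rule: infinite_finite_induct)
  case (insert i I)
  thus ?case using subring_mult[OF A that[of i] insert(3)] by (simp add: mult_single)
 qed (use subring_one[OF A] in auto)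
 from this[of "%i. axis i (m $ i)" UNIV for m] have "Poly_Mapping.single (SUM i:UNIV. axis i (m $ i)) 1 : A" for m using axis by blast
 moreover have "(SUM i:UNIV. axis i (m $ i)) = m" for m :: "int ^ 'n" by (simp add: vec_eq_iff axis_def sum.If_cases)
 ultimately have mon: "Poly_Mapping.single m 1 : A" for m by metis
 have "f : A" for f
 proof (induction f rule: poly_mapping_additive_induct)
  case (1 m c)
  have "laurent_const c*Poly_Mapping.single m 1 : A" by (rule subring_mult[OF A _ mon]) (use c in auto)
  thus ?case by (simp add: mult_single)
 qed (rule subring_add[OF A])
 thus ?thesis by blast
qed

theorem generic_point:
 fixes h :: "'c::field => 'b::alg_closed_field" and P :: "('n::finite, 'c) laurent set"
 assumes P: "prime_set P" and h: "ring_map h" "infinite (range h)" and F: "range h<=F"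
  and tau: "!!n::nat. tau n ~: acl (fgen (F Un tau ` {..<n}))"
 shows "EX psi. ring_map psi & (ALL f. psi f = 0 \<longleftrightarrow> f : P) & (ALL c. psi (laurent_const c) = h c)"
proof -
 define A where "A = range (laurent_const :: 'c => ('n, 'c) laurent)"
 define h0 where "h0 f = h (Poly_Mapping.lookup f 0)" for f :: "('n, 'c) laurent"
 note H = ring_mapD[OF h(1)]
 have A: "is_ring A" unfolding is_ring_def A_def by (auto simp: mult_single single_diff[symmetric] single_one[symmetric] simp del: single_one)
 have inj: "c = 0" if "h c = 0" for c
 proof (rule ccontr)
  assume "c~=0"
  hence "h c*h (inverse c) = 1" using H(1) by (simp add: H(3)[symmetric])
  thus False using that by simp
 qed
 have cP: "laurent_const c : P \<longleftrightarrow> c = 0" for c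
 proof
  assume "laurent_const c : P"
  from prime_setD(4)[OF P this, of "laurent_const (inverse c)"] show "c = 0" using prime_setD(1)[OF P] by (cases "c = 0") (auto simp: mult_single)
 qed (use prime_setD(2)[OF P] in simp)
 have "hom_with_kernel P A h0" unfolding hom_with_kernel_def A_def
  using inj by (auto simp: h0_def mult_single single_diff[symmetric] H cP single_one[symmetric] simp del: single_one)
 moreover have hA: "h0 ` A = range h" by (auto simp: A_def h0_def image_image)
 moreover have fin: "finite (range (%i. coordinate i 1) Un range (%i. coordinate i (- 1)) :: ('n, 'c) laurent set)" by simp
 ultimately obtain A' psi where psi: "is_ring A'" "A Un (range (%i. coordinate i 1) Un range (%i. coordinate i (- 1)))<=A'"
  "hom_with_kernel P A' psi" "ALL a:A. psi a = h0 a" using hom_on_finitely_generated[OF P A _ _ _ tau fin, of h0] h(2) F by metis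
 have U: "A' = UNIV" by (rule laurent_subring_eq_UNIV[OF psi(1)]) (use psi(2) in \<open>auto simp: A_def\<close>)
 have d: "psi 1 = 1" "!!x y. psi (x-y) = psi x-psi y" "!!x y. psi (x*y) = psi x*psi y" "!!x. psi x = 0 \<longleftrightarrow> x : P"
  using psi(3) by (auto simp: hom_with_kernel_def U)
 have m: "psi (- y) = - psi y" for y using d(2)[of 0 y] d(2)[of 0 0] by simp
 have "psi (x+y) = psi x+psi y" for x y using d(2)[of x "- y"] m[of y] by simp
 hence "ring_map psi" using d by (simp add: ring_map_def)
 moreover have "psi (laurent_const c) = h c" for c using psi(4) by (auto simp: A_def h0_def)
 ultimately show ?thesis using d(4) by (intro exI[of _ psi]) simp
qed

section \<open>Valuations on the coordinate ring\<close>

lemma rta_simps: "carrier ring_of_type_algebra = UNIV" "x \<otimes>\<^bsub>ring_of_type_algebra\<^esub> y = x*y" "x \<oplus>\<^bsub>ring_of_type_algebra\<^esub> y = x+y"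
 "\<one>\<^bsub>ring_of_type_algebra\<^esub> = 1" "\<zero>\<^bsub>ring_of_type_algebra\<^esub> = 0" by (simp_all add: ring_of_type_algebra_def)

locale laurent_ideal =
 fixes I :: "('n::finite, 'k::field) laurent set"
 assumes ideal: "ideal I ring_of_type_algebra"
begin

lemma I_mem: "0 : I" "x : I ==> y : I ==> x+y : I" "x : I ==> x*f : I" "x : I ==> - x : I"
proof -
 interpret ideal I ring_of_type_algebra by (rule ideal)
 show "0 : I" "x : I ==> y : I ==> x+y : I" "x : I ==> x*f : I"
  using additive_subgroup.zero_closed[OF ideal.axioms(1)[OF ideal]] additive_subgroup.a_closed[OF ideal.axioms(1)[OF ideal], of x y]
   I_r_closed[of x f] by (simp_all add: rta_simps)
 show "x : I ==> - x : I" using I_r_closed[of x "- 1"] by (simp add: rta_simps)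
qed

lemma coord_class_eq_iff: "coord_class I f = coord_class I g \<longleftrightarrow> f-g : I"
proof -
 have c: "coord_class I f = (%h. h+f) ` I" for f by (auto simp: coord_class_def a_r_coset_def r_coset_def ring_of_type_algebra_def)
 show ?thesis
 proof
  assume "coord_class I f = coord_class I g"
  moreover have "f : coord_class I f" unfolding c using I_mem(1) by (auto intro: image_eqI[of _ _ 0])
  ultimately obtain h where "h : I" "f = h+g" unfolding c by auto
  thus "f-g : I" by simp
 next
  have sub: "coord_class I f<=coord_class I g" if "f-g : I" for f g
  proof
   fix z assume "z : coord_class I f"
   then obtain h where "h : I" "z = h+f" by (auto simp: c)
   hence "z = (h+(f-g))+g" "h+(f-g) : I" using I_mem(2) that by auto
   thus "z : coord_class I g" unfolding c by blast
  qed
  assume "f-g : I"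
  thus "coord_class I f = coord_class I g" using sub[of f g] sub[of g f] I_mem(4)[of "f-g"] by simp
 qed
qed

lemma coord_ring_simps:
 "carrier (coord_ring I) = range (coord_class I)"
 "coord_class I f \<otimes>\<^bsub>coord_ring I\<^esub> coord_class I g = coord_class I (f*g)"
 "coord_class I f \<oplus>\<^bsub>coord_ring I\<^esub> coord_class I g = coord_class I (f+g)"
 "\<one>\<^bsub>coord_ring I\<^esub> = coord_class I 1" "\<zero>\<^bsub>coord_ring I\<^esub> = coord_class I 0"
proof -
 have cc: "coord_class I = (+>\<^bsub>ring_of_type_algebra\<^esub>) I" by (rule ext) (simp add: coord_class_def)
 have hom: "coord_class I : ring_hom ring_of_type_algebra (coord_ring I)" unfolding cc coord_ring_def by (rule ideal.rcos_ring_hom[OF ideal])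
 show "coord_class I f \<otimes>\<^bsub>coord_ring I\<^esub> coord_class I g = coord_class I (f*g)"
  "coord_class I f \<oplus>\<^bsub>coord_ring I\<^esub> coord_class I g = coord_class I (f+g)" "\<one>\<^bsub>coord_ring I\<^esub> = coord_class I 1"
  using ring_hom_mult[OF hom, of f g] ring_hom_add[OF hom, of f g] ring_hom_one[OF hom] by (simp_all add: rta_simps)
 show "carrier (coord_ring I) = range (coord_class I)"
  by (auto simp: coord_ring_def FactRing_simps A_RCOSETS_def RCOSETS_def coord_class_def a_r_coset_def ring_of_type_algebra_def)
 have "coord_class I 0 = I" by (auto simp: coord_class_def a_r_coset_def r_coset_def ring_of_type_algebra_def)
 thus "\<zero>\<^bsub>coord_ring I\<^esub> = coord_class I 0" by (simp add: coord_ring_def FactRing_def)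
qed

lemma cring_coord_ring: "cring (coord_ring I)" unfolding coord_ring_def by (rule ideal.quotient_is_cring[OF ideal cring_from_type_algebra])

lemma prime_set_of_primeideal:
 assumes "primeideal Q (coord_ring I)" shows "prime_set {f. coord_class I f : Q}"
proof -
 interpret Q: primeideal Q "coord_ring I" by (rule assms)
 note simps = coord_ring_simps
 have add: "coord_class I (f+g) : Q" if "coord_class I f : Q" "coord_class I g : Q" for f g
  using additive_subgroup.a_closed[OF ideal.axioms(1)[OF Q.is_ideal] that] by (simp add: simps)
 have mult: "coord_class I (f*g) : Q" if "coord_class I f : Q" for f g using Q.I_r_closed[OF that, of "coord_class I g"] by (simp add: simps)
 have "coord_class I 1 ~: Q" using Q.one_imp_carrier Q.I_notcarr by (auto simp: simps)
 moreover have "coord_class I 0 : Q" using additive_subgroup.zero_closed[OF ideal.axioms(1)[OF Q.is_ideal]] by (simp add: simps)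
 moreover have "coord_class I (f-g) : Q" if "coord_class I f : Q" "coord_class I g : Q" for f g using add[OF that(1) mult[OF that(2), of "- 1"]] by simp
 moreover have "coord_class I f : Q \<or> coord_class I g : Q" if "coord_class I (f*g) : Q" for f g
  using Q.I_prime[of "coord_class I f" "coord_class I g"] that by (simp add: simps)
 ultimately show ?thesis using mult by (auto simp: prime_set_def)
qed

lemma primeideal_of_prime_set:
 assumes P: "prime_set P" "I<=P"
 shows "EX Q. primeideal Q (coord_ring I) & (ALL f. coord_class I f : Q \<longleftrightarrow> f : P)"
proof -
 define Q where "Q = coord_class I ` P"
 note simps = coord_ring_simps and p = prime_setD[OF P(1)]
 have Q: "coord_class I f : Q \<longleftrightarrow> f : P" for f
 proof
  assume "coord_class I f : Q"
  then obtain g where "g : P" "f-g : I" by (auto simp: Q_def coord_class_eq_iff)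
  hence "(f-g)+g : P" using P(2) by (intro p(7)) auto
  thus "f : P" by simp
 qed (simp add: Q_def)
 interpret C: cring "coord_ring I" by (rule cring_coord_ring)
 have "primeideal Q (coord_ring I)"
 proof (rule primeidealI2[OF _ cring_coord_ring])
  show "additive_subgroup Q (coord_ring I)"
  proof (rule additive_subgroup.intro, rule C.add.subgroupI)
   show "Q<=carrier (coord_ring I)" "Q~={}" using p(2) by (auto simp: Q_def simps)
   fix x assume "x : Q"
   then obtain f where f: "f : P" "x = coord_class I f" by (auto simp: Q_def)
   have "coord_class I (- f) \<oplus>\<^bsub>coord_ring I\<^esub> x = \<zero>\<^bsub>coord_ring I\<^esub>" by (simp add: simps f(2))
   hence "\<ominus>\<^bsub>coord_ring I\<^esub> x = coord_class I (- f)" using f(2) by (intro C.minus_equality) (auto simp: simps)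
   moreover have "- f : P" using p(3)[OF p(2) f(1)] by simp
   ultimately show "\<ominus>\<^bsub>coord_ring I\<^esub> x : Q" by (simp add: Q)
   fix y assume "y : Q"
   then obtain g where "g : P" "y = coord_class I g" by (auto simp: Q_def)
   thus "x \<oplus>\<^bsub>coord_ring I\<^esub> y : Q" using f by (simp add: simps Q p(7))
  qed
  show "carrier (coord_ring I)~=Q" using Q[of 1] p(1) by (auto simp: simps)
  fix x y assume y: "y : carrier (coord_ring I)"
  obtain g where g: "y = coord_class I g" using y by (auto simp: simps)
  show "y \<otimes>\<^bsub>coord_ring I\<^esub> x : Q" "x \<otimes>\<^bsub>coord_ring I\<^esub> y : Q" if x: "x : Q"
  proof -
   obtain f where "f : P" "x = coord_class I f" using x unfolding Q_def by blast
   thus "y \<otimes>\<^bsub>coord_ring I\<^esub> x : Q" "x \<otimes>\<^bsub>coord_ring I\<^esub> y : Q"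
    using p(4)[of f g] p(5)[of f g] by (simp_all add: g simps Q)
  qed
  show "x : Q \<or> y : Q" if xc: "x : carrier (coord_ring I)" and xy: "x \<otimes>\<^bsub>coord_ring I\<^esub> y : Q"
  proof -
   obtain f where f: "x = coord_class I f" using xc unfolding simps(1) by blast
   hence "f*g : P" using xy by (simp only: g f simps(2) Q)
   thus ?thesis using p(6) by (auto simp: f g Q)
  qed
 qed
 thus ?thesis using Q by blast
qed

text \<open>The intersection of all primes of the coordinate ring, pulled back to Laurent polynomials; it describes the reduced variety.\<close>

definition "common_kernel = {f. ALL Q:prime_spectrum (coord_ring I). coord_class I f : Q}"

text \<open>If f g lies in every prime, the spectrum is the union of the closed sets of f and g, and one of them is everything.\<close>

lemma prime_common_kernel:
 assumes irr: "irreducible_space (zariski_topology (coord_ring I))"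
 shows "prime_set common_kernel" "I<=common_kernel" "!!P. prime_set P ==> I<=P ==> common_kernel<=P"
proof -
 define Sp where "Sp = prime_spectrum (coord_ring I)"
 have pr: "prime_set {f. coord_class I f : Q}" if "Q : Sp" for Q using prime_set_of_primeideal that by (simp add: Sp_def prime_spectrum_def)
 have irr': "Sp~={}" "!!C D. closedin (zariski_topology (coord_ring I)) C ==> closedin (zariski_topology (coord_ring I)) D ==> C Un D = Sp ==> C = Sp \<or> D = Sp"
  using irr by (auto simp: irreducible_space_def topspace_zariski_topology Sp_def)
 define V where "V f = {Q:Sp. coord_class I f : Q}" for f
 have cl: "closedin (zariski_topology (coord_ring I)) (V f)" for f
 proof -
  have "Sp-V f = prime_spectrum (coord_ring I)-vanishing_locus (coord_ring I) {coord_class I f}" by (auto simp: V_def Sp_def vanishing_locus_def)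
  thus ?thesis unfolding closedin_def openin_zariski_topology topspace_zariski_topology Sp_def[symmetric]
   using coord_ring_simps(1) by (auto simp: V_def intro!: exI[of _ "{coord_class I f}"])
 qed
 have "f : common_kernel \<or> g : common_kernel" if "f*g : common_kernel" for f g
 proof -
  have "V f Un V g = Sp" using that prime_setD(6)[OF pr] by (auto simp: V_def common_kernel_def Sp_def)
  hence "V f = Sp \<or> V g = Sp" by (rule irr'(2)[OF cl cl])
  thus ?thesis by (auto simp: V_def common_kernel_def Sp_def)
 qed
 moreover have "x*y : common_kernel" if "x : common_kernel" for x y using that prime_setD(4)[OF pr] by (simp add: common_kernel_def Sp_def[symmetric])
 moreover have "x-y : common_kernel" if "x : common_kernel" "y : common_kernel" for x y
  using that prime_setD(3)[OF pr] by (simp add: common_kernel_def Sp_def[symmetric])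
 moreover have "0 : common_kernel" using prime_setD(2)[OF pr] by (simp add: common_kernel_def Sp_def[symmetric])
 moreover have "1 ~: common_kernel" using irr'(1) prime_setD(1)[OF pr] by (auto simp: common_kernel_def Sp_def[symmetric])
 ultimately show "prime_set common_kernel" unfolding prime_set_def by blast
 show "I<=common_kernel"
 proof
  fix f assume "f : I"
  hence "coord_class I f = coord_class I 0" by (simp add: coord_class_eq_iff)
  thus "f : common_kernel" using prime_setD(2)[OF pr] by (simp add: common_kernel_def Sp_def[symmetric])
 qed
 fix P assume "prime_set P" "I<=P"
 from primeideal_of_prime_set[OF this] show "common_kernel<=P" by (auto simp: common_kernel_def prime_spectrum_def)
qed

definition laurent_valuation :: "(('n, 'k) laurent => ereal) => bool" where
 "laurent_valuation v \<longleftrightarrow> (ALL f. v f ~= -\<infinity>) & (ALL f g. v (f*g) = v f+v g) & (ALL f g. min (v f) (v g)<=v (f+g)) &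
  v 0 = \<infinity> & v 1 = 0 & (ALL f:I. v f = \<infinity>)"

lemma laurent_valuation_cong:
 assumes v: "laurent_valuation v" and fg: "v (f-g) = \<infinity>" shows "v f = v g"
proof -
 have a: "v y<=v x" if "v (x-y) = \<infinity>" for x y
 proof -
  have "min (v (x-y)) (v y)<=v ((x-y)+y)" using v unfolding laurent_valuation_def by blast
  thus ?thesis using that by simp
 qed
 have "v (g-f) = v (- 1)+v (f-g)" using v unfolding laurent_valuation_def by (metis minus_diff_eq mult_minus1)
 moreover have "v (- 1) ~= -\<infinity>" using v by (simp add: laurent_valuation_def)
 ultimately have "v (g-f) = \<infinity>" using fg by simp
 thus ?thesis using a[OF fg] a[of g f] by simp
qed

lemma bieri_groves_iff:
 "p : bieri_groves N I \<longleftrightarrow> (EX v. laurent_valuation v & (ALL c. v (laurent_const c) = norm_val N c) & (ALL i. v (coordinate i 1) = ereal (p $ i)))"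
proof
 note simps = coord_ring_simps
 assume "p : bieri_groves N I"
 then obtain w where w: "ring_valuation (coord_ring I) w" "ALL c. w (coord_class I (laurent_const c)) = norm_val N c"
  "ALL i. w (coord_class I (coordinate i 1)) = ereal (p $ i)" by (auto simp: bieri_groves_def)
 have "w (coord_class I f) = \<infinity>" if "f : I" for f
 proof -
  have "coord_class I f = coord_class I 0" using that by (simp add: coord_class_eq_iff)
  thus ?thesis using w(1) by (simp add: ring_valuation_def simps)
 qed
 hence "laurent_valuation (%f. w (coord_class I f))" using w(1) by (simp add: ring_valuation_def laurent_valuation_def simps)
 thus "EX v. laurent_valuation v & (ALL c. v (laurent_const c) = norm_val N c) & (ALL i. v (coordinate i 1) = ereal (p $ i))" using w(2,3) by blast
next
 note simps = coord_ring_simps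
 assume "EX v. laurent_valuation v & (ALL c. v (laurent_const c) = norm_val N c) & (ALL i. v (coordinate i 1) = ereal (p $ i))"
 then obtain v where v: "laurent_valuation v" "ALL c. v (laurent_const c) = norm_val N c" "ALL i. v (coordinate i 1) = ereal (p $ i)" by blast
 define w where "w x = v (SOME f. x = coord_class I f)" for x
 have w: "w (coord_class I f) = v f" for f
 proof -
  have "coord_class I f = coord_class I (SOME g. coord_class I f = coord_class I g)" by (rule someI) simp
  hence "f-(SOME g. coord_class I f = coord_class I g) : I" by (simp only: coord_class_eq_iff)
  thus ?thesis unfolding w_def using v(1) by (intro laurent_valuation_cong[symmetric]) (auto simp: laurent_valuation_def)
 qed
 have "ring_valuation (coord_ring I) w" using v(1) by (auto simp: ring_valuation_def laurent_valuation_def simps w)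
 thus "p : bieri_groves N I" unfolding bieri_groves_def using v(2,3) w by auto
qed

lemma norm_val_valuation:
 assumes w: "nonarch_norm w" and h: "ring_map h" "!!f. f : I ==> h f = 0"
 shows "laurent_valuation (%f. norm_val w (h f))"
proof -
 have "min (norm_val w x) (norm_val w y)<=norm_val w (x+y)" for x y
 proof (cases "x = 0 \<or> y = 0 \<or> x+y = 0")
  case False
  hence "ln (w (x+y))<=ln (max (w x) (w y))" using nan_add[OF w, of x y] nan_pos[OF w] by (intro ln_mono) auto
  hence "ln (w (x+y))<=ln (w x) \<or> ln (w (x+y))<=ln (w y)" by (auto simp: max_def split: if_splits)
  thus ?thesis using False by (auto simp: norm_val_def min_le_iff_disj)
 qed (auto simp: norm_val_def)
 moreover have "norm_val w (x*y) = norm_val w x+norm_val w y" for x y by (auto simp: norm_val_def nan_mult[OF w] ln_mult nan_eq_0[OF w])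
 moreover have "norm_val w 0 = \<infinity>" "norm_val w 1 = 0" "!!x. norm_val w x ~= -\<infinity>" by (auto simp: norm_val_def nan_one[OF w])
 ultimately show ?thesis using h(2) by (simp add: laurent_valuation_def ring_mapD[OF h(1)])
qed

lemma prime_set_valuation:
 assumes v: "laurent_valuation v" shows "prime_set {f. v f = \<infinity>}"
proof -
 note V = v[unfolded laurent_valuation_def]
 have mult: "v (x*y) = \<infinity> \<longleftrightarrow> v x = \<infinity> \<or> v y = \<infinity>" for x y using V by simp
 have "v (x-y) = \<infinity>" if "v x = \<infinity>" "v y = \<infinity>" for x y
 proof -
  have "v (- 1*y) = \<infinity>" using mult that(2) by blast
  moreover have "min (v x) (v (- 1*y))<=v (x + - 1*y)" using V by blast
  ultimately show ?thesis using that(1) by simp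
 qed
 thus ?thesis using mult V by (auto simp: prime_set_def)
qed

text \<open>The quotient by the elements of infinite value is a domain, on which exp(-v) is multiplicative.\<close>

lemma norm_of_valuation:
 fixes psi :: "('n, 'k) laurent => 'b::alg_closed_field"
 assumes v: "laurent_valuation v" and psi: "ring_map psi" "!!f. psi f = 0 \<longleftrightarrow> v f = \<infinity>" and inf: "infinite (range psi)"
 shows "EX w. nonarch_norm w & (ALL f. norm_val w (psi f) = v f)"
proof -
 note V = v[unfolded laurent_valuation_def] and P = ring_mapD[OF psi(1)]
 define E where "E f = (if v f = \<infinity> then 0 else exp (- real_of_ereal (v f)))" for f
 have real: "EX r. v f = ereal r" if "v f~=\<infinity>" for f using V that by (cases "v f") auto
 have E0: "0<=E f" "E f = 0 \<longleftrightarrow> psi f = 0" for f using psi(2) by (auto simp: E_def)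
 have Emult: "E (f*g) = E f*E g" for f g
 proof (cases "v f = \<infinity> \<or> v g = \<infinity>")
  case False
  then obtain r s where "v f = ereal r" "v g = ereal s" using real by metis
  thus ?thesis using V by (simp add: E_def flip: exp_add)
 qed (use V in \<open>auto simp: E_def\<close>)
 have Eadd: "E (f+g)<=max (E f) (E g)" for f g
 proof (cases "v (f+g) = \<infinity>")
  case True
  thus ?thesis using E0(1)[of f] by (simp add: E_def[of "f+g"])
 next
  case False
  then obtain t where t: "v (f+g) = ereal t" using real by blast
  have "min (v f) (v g)<=ereal t" using V t by metis
  hence "v f<=ereal t \<or> v g<=ereal t" by (simp add: min_le_iff_disj)
  moreover have "E (f+g)<=E x" if "v x<=ereal t" for x
  proof -
   have "v x~=\<infinity>" using that by auto
   then obtain s where "v x = ereal s" using real by blast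
   thus ?thesis using that t by (simp add: E_def)
  qed
  ultimately show ?thesis by (auto simp: le_max_iff_disj)
 qed
 have Eneg: "E (- g) = E g" for g
 proof -
  have "E (- 1)^2 = 1" using Emult[of "- 1" "- 1"] V by (simp add: power2_eq_square E_def zero_ereal_def one_ereal_def)
  hence "E (- 1) = 1" using E0(1)[of "- 1"] by (simp add: power2_eq_1_iff)
  thus ?thesis using Emult[of "- 1" g] by simp
 qed
 have "EX w. norm_on (fgen (psi ` UNIV)) w & (ALL f:UNIV. w (psi f) = E f)"
  by (rule norm_extend_image) (use Eadd[of _ "- _"] in \<open>auto simp: is_ring_def P E0 Emult Eneg\<close>)
 then obtain w0 where w0: "norm_on (fgen (range psi)) w0" "!!f. w0 (psi f) = E f" by auto
 obtain w where w: "nonarch_norm w" "ALL x:fgen (range psi). w x = w0 x" using norm_extend[OF subfield_fgen infinite_super[OF fgen_superset inf] w0(1)] by blast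
 have "norm_val w (psi f) = v f" for f
 proof -
  have "psi f : fgen (range psi)" by (rule subsetD[OF fgen_superset rangeI])
  hence "w (psi f) = E f" using w(2) w0(2) by simp
  show ?thesis
  proof (cases "v f = \<infinity>")
   case True
   hence "psi f = 0" using psi(2) by blast
   thus ?thesis by (simp add: norm_val_def True)
  next
   case False
   then obtain r where r: "v f = ereal r" using real by blast
   have "psi f~=0" using psi(2) False by blast
   thus ?thesis by (simp add: norm_val_def \<open>w (psi f) = E f\<close> E_def r)
  qed
 qed
 thus ?thesis using w(1) by blast
qed

end

section \<open>Tropical varieties\<close>

lemma tendsto_of_inverse_bound:
 assumes "!!n. \<bar>f n-l\<bar> < inverse (real (Suc n))" shows "f \<longlonglongrightarrow> (l :: real)"
proof -
 have "(%n. f n-l) \<longlonglongrightarrow> 0"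
  by (rule Lim_null_comparison[OF _ LIMSEQ_inverse_real_of_nat]) (use assms in \<open>simp add: always_eventually less_imp_le del: of_nat_Suc\<close>)
 thus ?thesis by (simp add: LIM_zero_cancel)
qed

lemma ring_map_inverse:
 assumes h: "ring_map h" shows "h (inverse (x::'a::field)) = inverse (h x :: 'b::field)"
proof (cases "x = 0")
 case False
 hence "h x*h (inverse x) = 1" using ring_mapD(1)[OF h] by (simp flip: ring_mapD(3)[OF h])
 thus ?thesis by (simp add: inverse_unique)
qed (simp add: ring_mapD(4)[OF h])

lemma ring_map_eq_0:
 assumes h: "ring_map h" shows "h (x::'a::field) = (0::'b::field) \<longleftrightarrow> x = 0"
proof
 assume z: "h x = 0"
 show "x = 0"
 proof (rule ccontr)
  assume "x~=0"
  hence "h 1 = h x*h (inverse x)" using ring_mapD(3)[OF h, of x "inverse x"] by simp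
  thus False using z ring_mapD(1)[OF h] by simp
 qed
qed (simp add: ring_mapD(4)[OF h])

lemma subfield_range: "ring_map (h :: 'a::field => 'b::field) ==> is_field (range h)" unfolding is_field_def is_ring_def
 by (auto simp: ring_map_inverse[symmetric] simp flip: ring_mapD(3,6)) (metis ring_mapD(1) rangeI)

lemma prime_set_kernel:
 fixes h :: "'l::comm_ring_1 => 'b::idom" shows "ring_map h ==> prime_set {f. h f = 0}" by (auto simp: prime_set_def ring_mapD)

text \<open>An algebraically closed field has no proper algebraic extensions, inside any larger field.\<close>

lemma aclosed_range:
 fixes j :: "'c::alg_closed_field => 'b::field"
 assumes j: "ring_map j" shows "aclosed (range j)" unfolding aclosed_def
proof (intro conjI allI impI)
 show K: "is_field (range j)" by (rule subfield_range[OF j])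
 fix y assume "alg (range j) y"
 then obtain q where q: "is_minpoly (range j) y q" using minpoly_exists[OF K] by blast
 hence "ALL i. EX c. coeff q i = j c" by (auto simp: is_minpoly_def coeffs_in_def image_iff)
 then obtain c where c: "!!i. coeff q i = j (c i)" by metis
 define p where "p = (SUM i<=degree q. monom (c i) i)"
 have pc: "coeff q i = j (coeff p i)" for i using c[of i] ring_mapD(4)[OF j] by (auto simp: p_def coeff_sum_monom coeff_eq_0)
 have "coeff p (degree q)~=0" using pc[of "degree q"] q ring_mapD(4)[OF j] by (auto simp: is_minpoly_def)
 hence "0 < degree p" using le_degree[of p "degree q"] minpoly_degree_pos[OF q] by linarith
 then obtain r where r: "poly p r = 0" using alg_closed_imp_poly_has_root by blast
 have "poly q (j r) = 0" using ring_map_poly[OF j pc, of r] r ring_mapD(4)[OF j] by simp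
 hence "is_minpoly (range j) (j r) q" by (rule minpoly_conj[OF K q])
 moreover have lin: "coeffs_in (range j) [:- j r, 1:]" by (rule coeffs_in_linear[OF field_ring[OF K]]) simp
 moreover have "[:- j r, 1:]~=0" "poly [:- j r, 1:] (j r) = 0" by simp_all
 ultimately have "degree q<=degree [:- j r, 1:]" unfolding is_minpoly_def by blast
 have "[:- j r, 1:] dvd q" using \<open>poly q (j r) = 0\<close> by (simp add: poly_eq_0_iff_dvd)
 then obtain s where s: "q = [:- j r, 1:] * s" by (elim dvdE)
 have "s~=0" using s minpoly_degree_pos[OF q] by auto
 hence "degree q = degree [:- j r, 1:]+degree s" unfolding s by (intro degree_mult_eq) auto
 hence "degree s = 0" using \<open>degree q<=degree [:- j r, 1:]\<close> by simp
 then obtain c0 where "s = [:c0:]" by (rule degree_eq_zeroE)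
 moreover have "poly q y = 0" "q~=0" using q by (auto simp: is_minpoly_def)
 ultimately have "y = j r" using s by (auto simp: algebra_simps)
 thus "y : range j" by simp
qed

lemma ring_map_to_ac: "ring_map to_ac" by (simp add: ring_map_def)

lemma acl_range_to_ac:
 fixes j :: "'k::field alg_closure => 'b::alg_closed_field"
 assumes j: "ring_map j" shows "acl (range (%c. j (to_ac c))) = range j"
proof
 show "acl (range (%c. j (to_ac c)))<=range j" by (rule acl_least[OF _ aclosed_range[OF j]]) auto
 show "range j<=acl (range (%c. j (to_ac c)))"
 proof
  fix y assume "y : range j"
  then obtain x where x: "y = j x" by blast
  obtain p :: "'k poly" where p: "p~=0" "poly (map_poly to_ac p) x = 0" using alg_closure_algebraic by blast
  define q where "q = map_poly (%c. j (to_ac c)) p"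
  have qc: "coeff q i = j (coeff (map_poly to_ac p) i)" for i by (simp add: q_def coeff_map_poly ring_mapD(4)[OF j])
  have "poly q y = 0" unfolding x using ring_map_poly[OF j qc] p(2) ring_mapD(4)[OF j] by simp
  moreover have "coeff q (degree p)~=0" using p(1) by (simp add: qc coeff_map_poly ring_map_eq_0[OF j])
  hence "q~=0" by auto
  moreover have "coeffs_in (range (%c. j (to_ac c))) q" by (auto simp: coeffs_in_def qc coeff_map_poly)
  ultimately show "y : acl (range (%c. j (to_ac c)))" by (auto simp: acl_def alg_def)
 qed
qed

lemma laurent_eval_hom:
 fixes a :: "'k::field alg_closure ^ 'n::finite"
 assumes a: "!!i. a $ i~=0"
 shows "ring_map (laurent_eval a)" "laurent_eval a (laurent_const c) = to_ac c" "laurent_eval a (coordinate i z) = (a $ i) powi z"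
proof -
 define m where "m = (%e :: int ^ 'n. PROD i:UNIV. (a $ i) powi (e $ i))"
 have eq: "laurent_eval a = mp_eval to_ac m" by (rule ext) (simp add: laurent_eval_def mp_eval_def m_def)
 have m: "m 0 = 1" "m (x+y) = m x*m y" for x y using a by (simp_all add: m_def power_int_add prod.distrib)
 note E = ring_map_mp_eval[OF ring_map_to_ac m]
 show "ring_map (laurent_eval a)" "laurent_eval a (laurent_const c) = to_ac c" unfolding eq by (rule E) (simp add: E m)
 have "m (axis i z) = (a $ i) powi z"
 proof -
  have "m (axis i z) = (PROD l:UNIV. if l = i then (a $ i) powi z else 1)" unfolding m_def by (intro prod.cong) (auto simp: axis_def)
  thus ?thesis by simp
 qed
 thus "laurent_eval a (coordinate i z) = (a $ i) powi z" unfolding eq by (simp add: E)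
qed

locale valued_laurent = norm_family k w0 + laurent_ideal I for k :: "'b::alg_closed_field set" and w0 and I :: "('n::finite, 'k::field) laurent set" +
 fixes j :: "'k alg_closure => 'b" and N :: "'k => real" and Nbar :: "'k alg_closure => real" and tau :: "nat => 'b"
 assumes j: "ring_map j" and k_range: "k = range (%c. j (to_ac c))"
  and w0_j: "w0 (j x) = Nbar x" and Nbar: "nonarch_norm Nbar" "Nbar (to_ac c) = N c"
  and tau: "tau n ~: acl (fgen (range j Un tau ` {..<n}))"
begin

abbreviation "F0 == range j"

lemma acl_k: "acl k = F0" unfolding k_range by (rule acl_range_to_ac[OF j])
lemma F0: "aclosed F0" "infinite F0" "k<=F0" using aclosed_range[OF j] infinite_super[OF _ k(2), of F0] by (auto simp: k_range)
lemma S_F0: "S = ext_norms F0 w0"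
proof
 show "S<=ext_norms F0 w0" using S_acl S_nonarch acl_k by (auto simp: ext_norms_def agree_def)
 show "ext_norms F0 w0<=S" using F0(3) by (auto simp: S_def ext_norms_def agree_def)
qed
lemma S_j: "w : S ==> w (j x) = Nbar x" using S_acl[of w "j x"] acl_k w0_j by simp
lemma S_const: "w : S ==> norm_val w (j (to_ac c)) = norm_val N c" by (simp add: norm_val_def S_j Nbar(2) ring_map_eq_0[OF j])

definition "point psi \<longleftrightarrow> ring_map psi & (ALL f:I. psi f = 0) & (ALL c. psi (laurent_const c) = j (to_ac c))" for psi :: "('n, 'k) laurent => 'b"
definition vals :: "(('n, 'k) laurent => 'b) => ('b => real) => real ^ 'n" where
 "vals psi w = (\<chi> i. - ln (w (psi (coordinate i 1))))"
definition Y :: "(('n, 'k) laurent => 'b) => 'b set" where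
 "Y psi = range (%i. psi (coordinate i 1)) Un range (%i. psi (coordinate i (- 1)))"

lemma finite_Y: "finite (Y psi)" by (simp add: Y_def)

lemma point_inverse:
 assumes "point psi" shows "psi (coordinate i 1)*psi (coordinate i (- 1)) = 1" "psi (coordinate i 1)~=0"
proof -
 have r: "ring_map psi" using assms by (simp add: point_def)
 have "axis i 0 = (0 :: int ^ 'n)" for i by (simp add: vec_eq_iff axis_def)
 thus c: "psi (coordinate i 1)*psi (coordinate i (- 1)) = 1" using ring_mapD(1,3)[OF r] coordinate_mult[of i 1 "- 1"] by (metis add.right_inverse single_one)
 thus "psi (coordinate i 1)~=0" by auto
qed

lemma tendsto_vals:
 assumes p: "point psi" and w: "nonarch_norm w" and u: "!!i. (%n. u n $ i) \<longlonglongrightarrow> w (psi (coordinate i 1))"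
 shows "(%n. \<chi> i. - ln (u n $ i)) \<longlonglongrightarrow> vals psi w"
 unfolding vals_def by (intro vec_tendstoI) (simp add: tendsto_minus tendsto_ln u nan_eq_0[OF w] point_inverse[OF p])

theorem connected_vals:
 assumes p: "point psi" shows "connected (vals psi ` S)"
proof (rule connectedI)
 define K where "K = acl (fgen (F0 Un Y psi))"
 have YK: "Y psi<=K" unfolding K_def by (rule acl_fgen(3)[OF F0(2)])
 have op: "kopen S K {w:S. vals psi w : A}" if A: "open A" for A
 proof (rule kopenI)
  fix w assume "w : {w:S. vals psi w : A}"
  hence w: "w : S" "vals psi w : A" by auto
  show "~ near K (S-{w:S. vals psi w : A}) w"
  proof
   assume "near K (S-{w:S. vals psi w : A}) w"
   from near_sequence[OF this finite_Y YK] obtain u where u: "!!n::nat. u n : S-{w:S. vals psi w : A}"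
    "!!z. z : Y psi ==> (%n. u n z) \<longlonglongrightarrow> w z" by blast
   have "(%n. \<chi> i. - ln ((\<chi> i. u n (psi (coordinate i 1))) $ i)) \<longlonglongrightarrow> vals psi w"
    by (rule tendsto_vals[OF p S_nonarch[OF w(1)]]) (simp add: u(2) Y_def)
   hence "(%n. vals psi (u n)) \<longlonglongrightarrow> vals psi w" by (simp add: vals_def)
   hence "eventually (%n. vals psi (u n) : A) sequentially" using A w(2) by (rule topological_tendstoD)
   thus False using u(1) by (auto simp: eventually_sequentially)
  qed
 qed auto
 fix A B assume AB: "open A" "open B" "A Int vals psi ` S~={}" "B Int vals psi ` S~={}" "A Int B Int vals psi ` S = {}" "vals psi ` S<=A Un B"
 have "S-{w:S. vals psi w : A} = {w:S. vals psi w : B}" using AB(5,6) by blast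
 hence "{w:S. vals psi w : A} = S" using finitely_generated_connected[OF F0(1,2) S_F0 finite_Y[of psi], folded K_def] op[OF AB(1)] op[OF AB(2)] AB(3) by force
 thus False using AB(4,5) by blast
qed

lemma vals_in_bieri_groves:
 assumes p: "point psi" and w: "w : S" shows "vals psi w : bieri_groves N I" unfolding bieri_groves_iff
proof (intro exI[of _ "%f. norm_val w (psi f)"] conjI allI)
 show "laurent_valuation (%f. norm_val w (psi f))" using p by (intro norm_val_valuation S_nonarch[OF w]) (auto simp: point_def)
 show "norm_val w (psi (laurent_const c)) = norm_val N c" for c using p S_const[OF w] by (simp add: point_def)
 show "norm_val w (psi (coordinate i 1)) = ereal (vals psi w $ i)" for i using point_inverse(2)[OF p] by (simp add: norm_val_def vals_def)
qed

lemma bieri_groves_vals: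
 assumes "p : bieri_groves N I" shows "EX psi w. point psi & w : S & p = vals psi w"
proof -
 obtain v where v: "laurent_valuation v" "!!c. v (laurent_const c) = norm_val N c" "!!i. v (coordinate i 1) = ereal (p $ i)"
  using assms by (auto simp: bieri_groves_iff)
 have h: "ring_map (%c. j (to_ac c))" using j by (simp add: ring_map_def)
 obtain psi where psi: "ring_map psi" "!!f. psi f = 0 \<longleftrightarrow> f : {f. v f = \<infinity>}" "!!c. psi (laurent_const c) = j (to_ac c)"
  using generic_point[OF prime_set_valuation[OF v(1)] h k(2)[unfolded k_range] F0(3)[unfolded k_range] tau] by blast
 have pt: "point psi" unfolding point_def using psi v(1) by (auto simp: laurent_valuation_def)
 have inf: "infinite (range psi)" by (rule infinite_super[OF _ k(2)]) (use psi(3)[symmetric] in \<open>auto simp: k_range\<close>)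
 obtain w where w: "nonarch_norm w" "!!f. norm_val w (psi f) = v f" using norm_of_valuation[OF v(1) psi(1) _ inf] psi(2) by auto
 have "w (j (to_ac c)) = w0 (j (to_ac c))" for c
 proof (cases "c = 0")
  case True
  thus ?thesis by (simp add: ring_mapD(4)[OF j] nan_zero[OF w(1)] nan_zero[OF w0])
 next
  case False
  hence 0: "j (to_ac c)~=0" "to_ac c~=0" by (simp_all add: ring_map_eq_0[OF j])
  have "norm_val w (j (to_ac c)) = norm_val N c" using w(2)[of "laurent_const c"] v(2) psi(3) by simp
  hence "ln (w (j (to_ac c))) = ln (Nbar (to_ac c))" using 0 False by (simp add: norm_val_def Nbar(2))
  thus ?thesis using nan_pos[OF w(1) 0(1)] nan_pos[OF Nbar(1) 0(2)] by (simp add: w0_j)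
 qed
 hence "agree k w w0" by (auto simp: agree_def k_range)
 hence "w : S" using w(1) by (simp add: S_def ext_norms_def)
 moreover have "p = vals psi w" using w(2)[of "coordinate _ 1"] v(3) point_inverse(2)[OF pt] by (auto simp: vec_eq_iff vals_def norm_val_def)
 ultimately show ?thesis using pt by blast
qed

lemma val_map_geometric:
 fixes a :: "'k alg_closure ^ 'n"
 assumes "!!i. a $ i~=0" shows "val_map Nbar a = (\<chi> i. - ln (Nbar (a $ i)))" using assms by (simp add: val_map_def norm_val_def)

text \<open>The coordinates and their inverses satisfy the relations of I, and so does a specialisation of them to F0. The
set G consists of the f whose value at the new point is obtained by specialising their value at psi.\<close>

theorem vals_in_closure_of_points:
 assumes p: "point psi" and w: "w : S" shows "vals psi w : closure (val_map Nbar ` geometric_points I)"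
proof -
 have r: "ring_map psi" using p by (simp add: point_def)
 note F = S_nonarch[OF w]
 obtain x where x: "x : k" "1 < w0 x" using nontrivial by blast
 have x': "x : F0" "x~=0" "w x~=1" using x F0(3) nan_zero[OF w0] S_k[OF w x(1)] by auto
 have Yacl: "Y psi<=acl (fgen (F0 Un Y psi))" by (rule acl_fgen(3)[OF F0(2)])
 have "EX a:geometric_points I. ALL i. \<bar>Nbar (a $ i)-w (psi (coordinate i 1))\<bar> < e" if e: "0 < e" for e
 proof -
  obtain b where b: "specializes w F0 (Y psi) e b" using specialize_to_algebraic_point[OF F0(1,2) F x' finite_Y finite_Y Yacl e] by blast
  note D = specializesD[OF b]
  define a where "a = (\<chi> i. inv_into UNIV j (b (psi (coordinate i 1))))"
  have y: "psi (coordinate i 1) : Y psi" "psi (coordinate i (- 1)) : Y psi" for i by (auto simp: Y_def)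
  have ja: "j (a $ i) = b (psi (coordinate i 1))" for i using D(1)[OF y(1)] by (simp add: a_def f_inv_into_f)
  note FR = aclosed_subring[OF F0(1)]
  have inv: "b (psi (coordinate i 1))*b (psi (coordinate i (- 1))) = 1" for i
  proof -
   have "(%b. b (psi (coordinate i 1))*b (psi (coordinate i (- 1)))+(- 1)) : polyfun F0 (Y psi)" by (intro polyfun.intros y subring_uminus FR subring_one)
   from D(3)[OF this] show ?thesis using point_inverse(1)[OF p, of i] by simp
  qed
  have a0: "a $ i~=0" for i using inv[of i] ja[of i] ring_mapD(4)[OF j] by auto
  note L = laurent_eval_hom[of a, OF a0]
  define G where "G = {f. EX f':polyfun F0 (Y psi). f' (%y. y) = psi f & f' b = j (laurent_eval a f)}"
  have GI: "f : G" if "f' : polyfun F0 (Y psi)" "f' (%y. y) = psi f" "f' b = j (laurent_eval a f)" for f f' unfolding G_def using that by blast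
  have con: "laurent_const c : G" for c by (rule GI[of "%_. j (to_ac c)"]) (use p in \<open>auto simp: point_def L intro: polyfun.const\<close>)
  have co: "coordinate i 1 : G" "coordinate i (- 1) : G" for i
  proof -
   show "coordinate i 1 : G" by (rule GI[OF polyfun.proj[OF y(1)]]) (simp_all add: L ja)
   have "b (psi (coordinate i (- 1))) = inverse (j (a $ i))" using inv[of i] by (simp add: ja inverse_unique)
   thus "coordinate i (- 1) : G" by (intro GI[OF polyfun.proj[OF y(2)]]) (simp_all add: L ring_map_inverse[OF j])
  qed
  have "is_ring G" unfolding is_ring_def
  proof (intro conjI ballI)
   show "1 : G" using con[of 1] by simp
   fix f g assume "f : G" "g : G"
   then obtain f' g' where f: "f' : polyfun F0 (Y psi)" "f' (%y. y) = psi f" "f' b = j (laurent_eval a f)"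
    and g: "g' : polyfun F0 (Y psi)" "g' (%y. y) = psi g" "g' b = j (laurent_eval a g)" unfolding G_def by blast
   show "f*g : G" by (rule GI[OF polyfun.mult[OF f(1) g(1)]]) (simp_all add: f g ring_mapD[OF r] ring_mapD[OF j] ring_mapD[OF L(1)])
   have "(%b. f' b + - 1*g' b) : polyfun F0 (Y psi)" by (intro polyfun.intros f g subring_uminus FR subring_one)
   thus "f-g : G" by (rule GI) (simp_all add: f g ring_mapD[OF r] ring_mapD[OF j] ring_mapD[OF L(1)])
  qed
  hence G: "G = UNIV" by (rule laurent_subring_eq_UNIV) (use con co in auto)
  have "laurent_eval a f = 0" if f: "f : I" for f
  proof -
   have "f : G" using G by simp
   then obtain f' where f': "f' : polyfun F0 (Y psi)" "f' (%y. y) = psi f" "f' b = j (laurent_eval a f)" unfolding G_def by blast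
   hence "j (laurent_eval a f) = 0" using D(3)[OF f'(1)] p f by (simp add: point_def)
   thus ?thesis by (simp add: ring_map_eq_0[OF j])
  qed
  hence "a : geometric_points I" using a0 by (simp add: geometric_points_def)
  moreover have "\<bar>Nbar (a $ i)-w (psi (coordinate i 1))\<bar> < e" for i using D(2)[OF y(1), of i] ja[of i] S_j[OF w, of "a $ i"] by simp
  ultimately show ?thesis by blast
 qed
 hence "EX a:geometric_points I. ALL i. \<bar>Nbar (a $ i)-w (psi (coordinate i 1))\<bar> < inverse (real (Suc n))" for n by simp
 then obtain a where a: "!!n. a n : geometric_points I" "!!n i. \<bar>Nbar (a n $ i)-w (psi (coordinate i 1))\<bar> < inverse (real (Suc n))" by metis
 have "(%n. \<chi> i. - ln ((\<chi> i. Nbar (a n $ i)) $ i)) \<longlonglongrightarrow> vals psi w"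
 proof (rule tendsto_vals[OF p F])
  fix i
  show "(%n. (\<chi> i. Nbar (a n $ i)) $ i) \<longlonglongrightarrow> w (psi (coordinate i 1))" using a(2) by (intro tendsto_of_inverse_bound) simp
 qed
 moreover have "val_map Nbar (a n) = (\<chi> i. - ln (Nbar (a n $ i)))" for n using a(1)[of n] by (intro val_map_geometric) (auto simp: geometric_points_def)
 ultimately have "(%n. val_map Nbar (a n)) \<longlonglongrightarrow> vals psi w" by simp
 thus ?thesis unfolding closure_sequential using a(1) by (intro exI[of _ "%n. val_map Nbar (a n)"]) auto
qed

lemma pring_Y:
 assumes p: "point psi" shows "pring k (Y psi) = range psi"
proof
 have r: "ring_map psi" and c: "!!c. psi (laurent_const c) = j (to_ac c)" using p by (auto simp: point_def)
 note R = ring_mapD[OF r]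
 have "is_ring (range psi)" unfolding is_ring_def by (auto simp flip: R(3,6)) (metis R(1) rangeI)
 thus "pring k (Y psi)<=range psi" by (rule pring_least) (auto simp: k_range Y_def c[symmetric])
 have P: "is_ring (pring k (Y psi))" by (rule subring_pring[OF k_ring])
 have "is_ring {f. psi f : pring k (Y psi)}" unfolding is_ring_def using P by (auto simp: R subring_one subring_diff subring_mult)
 moreover have "range laurent_const<={f. psi f : pring k (Y psi)}" using pring_base[of k "Y psi"] c by (auto simp: k_range)
 ultimately have "{f. psi f : pring k (Y psi)} = UNIV" by (rule laurent_subring_eq_UNIV) (use pring_gens[of "Y psi" k] in \<open>auto simp: Y_def\<close>)
 thus "range psi<=pring k (Y psi)" by auto
qed

text \<open>The kernel of the evaluation at a is a prime over I and contains the kernel of psi, so that the evaluation factors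
through psi.\<close>

theorem points_in_vals:
 assumes p: "point psi" and ker: "!!f. psi f = 0 ==> f : common_kernel" and a: "a : geometric_points I"
 shows "val_map Nbar a : vals psi ` S"
proof -
 have r: "ring_map psi" and c: "!!c. psi (laurent_const c) = j (to_ac c)" using p by (auto simp: point_def)
 have a0: "a $ i~=0" for i using a by (simp add: geometric_points_def)
 note L = laurent_eval_hom[of a, OF a0] and R = ring_mapD[OF r]
 have sub: "common_kernel<={f. laurent_eval a f = 0}"
  using primeideal_of_prime_set[OF prime_set_kernel[OF L(1)]] a by (auto simp: common_kernel_def prime_spectrum_def geometric_points_def)
 define phi where "phi z = j (laurent_eval a (SOME f. z = psi f))" for z
 have phi: "phi (psi f) = j (laurent_eval a f)" for f
 proof -
  have "psi f = psi (SOME g. psi f = psi g)" by (rule someI) simp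
  hence "psi (f-(SOME g. psi f = psi g)) = 0" by (simp add: R)
  hence "laurent_eval a (f-(SOME g. psi f = psi g)) = 0" using ker sub by blast
  thus ?thesis by (simp add: phi_def ring_mapD[OF L(1)])
 qed
 note rng = pring_Y[OF p]
 interpret sp: point_specialization k w0 "Y psi" phi
 proof unfold_locales
  show "phi (x+y) = phi x+phi y" "phi (x*y) = phi x*phi y" if xy: "x : pring k (Y psi)" "y : pring k (Y psi)" for x y
  proof -
   obtain f g where "x = psi f" "y = psi g" using xy rng by auto
   thus "phi (x+y) = phi x+phi y" "phi (x*y) = phi x*phi y"
    using phi[of "f+g"] phi[of "f*g"] phi[of f] phi[of g] by (simp_all add: R ring_mapD[OF j] ring_mapD[OF L(1)])
  qed
  show "phi x = x" if xk: "x : k" for x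
  proof -
   obtain d where d: "x = psi (laurent_const d)" using xk c by (auto simp: k_range)
   show ?thesis unfolding d phi by (simp add: L c)
  qed
  show "phi x : acl k" if "x : pring k (Y psi)" for x using that phi unfolding rng acl_k by auto
 qed (rule finite_Y)
 have "phi y~=0" if "y : Y psi" for y using that phi a0 by (auto simp: Y_def L ring_map_eq_0[OF j])
 then obtain u where u: "u : S" "!!y. y : Y psi ==> u y = w0 (phi y)" using sp.exact_specialization by blast
 have "u (psi (coordinate i 1)) = Nbar (a $ i)" for i using u(2)[of "psi (coordinate i 1)"] by (simp add: Y_def phi L w0_j)
 hence "val_map Nbar a = vals psi u" by (simp add: vals_def val_map_geometric[of a, OF a0])
 thus ?thesis using u(1) by blast
qed

theorem tropical_connected:
 assumes irr: "irreducible_space (zariski_topology (coord_ring I))"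
 shows "connected (tropical_variety Nbar I) & connected (bieri_groves N I) & connected (amoeba Nbar I)"
proof -
 note P = prime_common_kernel[OF irr]
 have h: "ring_map (%c. j (to_ac c))" using j by (simp add: ring_map_def)
 obtain psi where psi: "ring_map psi" "!!f. psi f = 0 \<longleftrightarrow> f : common_kernel" "!!c. psi (laurent_const c) = j (to_ac c)"
  using generic_point[OF P(1) h k(2)[unfolded k_range] F0(3)[unfolded k_range] tau] by blast
 have pt: "point psi" unfolding point_def using psi P(2) by auto
 define B where "B = vals psi ` S"
 define V where "V = val_map Nbar ` geometric_points I"
 have con: "connected B" unfolding B_def by (rule connected_vals[OF pt])
 have B_BG: "B<=bieri_groves N I" unfolding B_def using vals_in_bieri_groves[OF pt] by blast
 have BG_V: "bieri_groves N I<=closure V" unfolding V_def using bieri_groves_vals vals_in_closure_of_points by blast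
 have V_B: "closure V<=closure B" unfolding V_def B_def using points_in_vals[OF pt] psi(2) by (intro closure_mono) blast
 have T: "connected (closure V)" by (rule connected_intermediate_closure[OF con]) (use B_BG BG_V V_B in auto)
 have BG: "connected (bieri_groves N I)" by (rule connected_intermediate_closure[OF con B_BG]) (use BG_V V_B in auto)
 have "Log_map Nbar ` geometric_points I = (%x. - 1 *\<^sub>R x) ` V" by (auto simp: V_def Log_map_def image_image)
 hence "amoeba Nbar I = (%x. - 1 *\<^sub>R x) ` closure V" unfolding amoeba_def using closure_scaleR[of "- 1" V] by simp
 hence "connected (amoeba Nbar I)" using connected_continuous_image[OF _ T, of "%x. - 1 *\<^sub>R x"] by (simp add: continuous_on_minus)
 thus ?thesis using T BG by (simp add: tropical_variety_def V_def)
qed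

end

theorem theorem2p2p7:
  fixes N :: "'k::field \<Rightarrow> real"
    and Nbar :: "'k alg_closure \<Rightarrow> real"
    and I :: "('n::finite, 'k) laurent set"
  assumes "nonarch_norm N"
    and "\<exists>x. x \<noteq> 0 \<and> N x \<noteq> 1"
    and "Metric_space.mcomplete UNIV (\<lambda>x y. N (x - y))"
    and "nonarch_norm Nbar"
    and "\<forall>x. Nbar (to_ac x) = N x"
    and "ideal I ring_of_type_algebra"
    and "irreducible_space (zariski_topology (coord_ring I))"
  shows "connected (tropical_variety Nbar I) \<and>
         connected (bieri_groves N I) \<and>
         connected (amoeba Nbar I)"
proof -
 define j :: "'k alg_closure => 'k alg_closure universal" where "j = const"
 define k where "k = range (%c. j (to_ac c))"
 have j: "ring_map j" unfolding j_def by (rule ring_map_const)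
 have h: "ring_map (%c. j (to_ac c))" using j by (simp add: ring_map_def)
 have inj: "inj j"
 proof (rule injI)
  fix x y assume "j x = j y"
  hence "j (x-y) = 0" by (simp add: ring_mapD(6)[OF j])
  thus "x = y" by (simp add: ring_map_eq_0[OF j])
 qed
 have k: "is_field k" unfolding k_def by (rule subfield_range[OF h])
 note nN = assms(1) and nNbar = assms(4)
 obtain x where x: "1 < N x"
 proof -
  obtain y where y: "y~=0" "N y~=1" using assms(2) by blast
  hence "1 < N y \<or> 1 < N (inverse y)" using nan_pos[OF nN y(1)] by (auto simp: nan_inverse[OF nN] one_less_inverse_iff)
  thus thesis using that by blast
 qed
 have inf: "infinite k"
 proof -
  have "inj (%n. x^n)"
  proof (rule injI)
   fix m n assume "x^m = x^n"
   hence "N x^m = N x^n" by (metis nan_power[OF nN])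
   thus "m = n" using x by (simp add: power_inject_exp)
  qed
  hence "infinite (UNIV :: 'k set)" by (meson infinite_UNIV_nat finite_imageD finite_subset subset_UNIV)
  moreover have "inj (%c. j (to_ac c))" by (rule injI) (metis injD[OF inj] injD[OF inj_to_ac])
  ultimately show ?thesis unfolding k_def by (simp add: finite_image_iff)
 qed
 have F0: "is_field (range j)" "infinite (range j)" using subfield_range[OF j] infinite_super[OF _ inf, of "range j"] by (auto simp: k_def)
 have "norm_on (range j) (%z. Nbar (inv_into UNIV j z))"
  by (rule norm_onI) (auto simp: inv_f_f[OF inj] nan_nonneg[OF nNbar] nan_eq_0[OF nNbar] ring_map_eq_0[OF j] nan_mult[OF nNbar]
   nan_add[OF nNbar] simp flip: ring_mapD(2,3)[OF j])
 then obtain w0 where w0: "nonarch_norm w0" "ALL x:range j. w0 x = Nbar (inv_into UNIV j x)" using norm_extend[OF F0] by blast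
 have w0j: "w0 (j x) = Nbar x" for x using w0(2) inv_f_f[OF inj] by simp
 have w0k: "w0 (j (to_ac c)) = N c" for c using w0j assms(5) by simp
 have complete: "EX l:k. (%n. w0 (s n-l)) \<longlonglongrightarrow> 0"
  if s: "!!n. s n : k" "!!e. 0 < e ==> EX M. ALL m>=M. ALL n>=M. w0 (s m-s n) < e" for s :: "nat => _"
 proof -
  have tri: "N (x-z)<=N (x-y)+N (y-z)" for x y z using nan_add[OF nN, of "x-y" "y-z"] nan_nonneg[OF nN, of "x-y"] nan_nonneg[OF nN, of "y-z"] by simp
  interpret M: Metric_space UNIV "%x y. N (x-y)" by unfold_locales (auto simp: nan_nonneg[OF nN] nan_diff_commute[OF nN] nan_eq_0[OF nN] tri)
  have "ALL n. EX c. s n = j (to_ac c)" using s(1) by (auto simp: k_def)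
  then obtain c where c: "!!n. s n = j (to_ac (c n))" by metis
  have d: "w0 (s n-j (to_ac b)) = N (c n-b)" for n b using w0k[of "c n-b"] by (simp add: c ring_mapD(6)[OF j])
  have "M.MCauchy c" unfolding M.MCauchy_def using s(2) d c by (metis subset_UNIV)
  then obtain b where "limitin M.mtopology c b sequentially" using assms(3) by (auto simp: M.mcomplete_def)
  hence "(%n. N (c n-b)) \<longlonglongrightarrow> 0" by (simp add: M.limitin_metric_dist_null)
  thus ?thesis using d by (intro bexI[of _ "j (to_ac b)"]) (auto simp: k_def)
 qed
 interpret valued_laurent k w0 I j N Nbar indeterminate
 proof (intro valued_laurent.intro valued_laurent_axioms.intro norm_family.intro laurent_ideal.intro)
  show "w x = w0 x" if "nonarch_norm w" "agree k w w0" "x : acl k" for w x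
   using complete_unique_extension[OF k w0(1) that(1,2) complete] that(3) by (auto simp: acl_def)
  show "EX x:k. 1 < w0 x" using x w0k by (auto simp: k_def)
  show "indeterminate n ~: acl (fgen (range j Un indeterminate ` {..<n}))" for n unfolding j_def by (rule indeterminate_transcendental)
 qed (use k inf w0(1) assms(4,5,6) j w0j in \<open>auto simp: k_def\<close>)
 show ?thesis by (rule tropical_connected[OF assms(7)])
qed

end
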